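(* Let $G$ be a finite directed graph. For every $s\in\mathcal{S}(0)$, $$C^*(\overline{\{s\}})\simeq M_{n_s}(\mathbb{C}),$$ and for every $C\in\mathcal{Z}(0)$, $$C^*(\overline{C})\simeq M_{n_C}(C(\mathbb{T})).$$ For every trace state $\omega$ on $C^*(G)$ there are unique numbers $\alpha_s\in[0,1]$ and $\alpha_C\in[0,1]$, and trace states $\omega_s$ on $C^*(\overline{\{s\}})$ and $\omega_C$ on $C^*(\overline{C})$, $s\in\mathcal{S}(0)$, $C\in\mathcal{Z}(0)$, such that $$\sum_{s\in\mathcal{S}(0)}\alpha_s+\sum_{C\in\mathcal{Z}(0)}\alpha_C=1$$ and $$\omega=\sum_{s\in\mathcal{S}(0)}\alpha_s\,\omega_s\circ\pi_s+\sum_{C\in\mathcal{Z}(0)}\alpha_C\,\omega_C\circ\pi_C.$$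
   Context: $G$ is a finite directed graph with vertex set $V$, edge set $E$ and maps $r,s:E\to V$ (range and source). A sink is a vertex $v$ with $s^{-1}(v)=\emptyset$. $C^*(G)$ is the universal $C^*$-algebra generated by partial isometries $S_e$, $e\in E$, and mutually orthogonal projections $P_v$, $v\in V$, such that $S_e^*S_e=P_{r(e)}$ for all $e\in E$ and $P_v=\sum_{e\in s^{-1}(v)}S_eS_e^*$ for every vertex $v$ that is not a sink. A finite path of length $n\ge1$ is $\mu=\mu_1\cdots\mu_n\in E^n$ with $r(\mu_i)=s(\mu_{i+1})$; $|\mu|=n$, $s(\mu)=s(\mu_1)$, $r(\mu)=r(\mu_n)$. Vertices are finite paths of length $0$ with $r(v)=s(v)=v$. $P_f(G)$ is the set of finite paths. Write $v\leadsto w$ if there is a finite path (possibly of length $0$) from $v$ to $w$, and $v\sim w$ if $v\leadsto w$ and $w\leadsto v$. A component is a $\sim$-equivalence class $C\subseteq V$ such that there is an edge with both endpoints in $C$. For $X\subseteq V$, $\overline{X}=\{v\in V:v\leadsto w\text{ for some }w\in X\}$. A loop is a finite path of positive length starting and ending at the same vertex; a component is circular if it contains only a single loop (up to cyclic rotation and repetition). $\mathcal{Z}(0)$ is the set of circular components $C$ such that $\overline{C}\setminus C$ does not contain any components. $\mathcal{S}(0)$ is the set of sinks $s$ such that $\overline{\{s\}}\setminus\{s\}$ does not contain a component. For $X=\overline{C}$ with $C\in\mathcal{Z}(0)$, or $X=\overline{\{s\}}$ with $s\in\mathcal{S}(0)$, regard $X$ as a directed graph with vertex set $X$ and edge set $\{e\in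 E:s(e),r(e)\in X\}$, and let $C^*(X)$ be its graph $C^*$-algebra. $V\setminus X$ is hereditary and saturated, and $\pi_C:C^*(G)\to C^*(\overline{C})$, resp. $\pi_s:C^*(G)\to C^*(\overline{\{s\}})$, is the corresponding canonical surjective $*$-homomorphism: it sends $P_v\mapsto P_v$ for $v\in X$, $P_v\mapsto0$ for $v\notin X$, $S_e\mapsto S_e$ if $r(e)\in X$ and $S_e\mapsto0$ otherwise; its kernel is the ideal generated by $\{P_v:v\notin X\}$. For $s\in\mathcal{S}(0)$, $n_s$ is the number of finite paths in $G$ terminating at $s$ (including the path $s$ of length $0$). For $C\in\mathcal{Z}(0)$ choose a vertex $v_C\in C$ and set $$n_C=\#\{\mu\in P_f(G): r(\mu)=v_C,\ s(\mu_i)\ne v_C\text{ for }i\le|\mu|\},$$ where the condition $s(\mu_i)\ne v_C$ is void when $|\mu|=0$. *)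

theory Defs
  imports
    "HOL-Analysis.Analysis"
    "HOL-Library.Poly_Mapping"
    "HOL-Algebra.Module"
    "Jordan_Normal_Form.Matrix"
    "Graph_Theory.Graph_Theory"
begin

section \<open>Complex *-algebras\<close>

text \<open>
  A *-algebra over the complex numbers is recorded as a module over \<^typ>\<open>complex\<close> (in the sense of
  HOL-Algebra) with an involution. No norm is recorded: the norm of a C*-algebra is determined by
  its *-algebra structure, and isomorphism of C*-algebras means *-isomorphism.
\<close>

record 'a star_algebra = "(complex, 'a) module" +
  star :: "'a \<Rightarrow> 'a"

definition star_hom :: "'a star_algebra \<Rightarrow> 'b star_algebra \<Rightarrow> ('a \<Rightarrow> 'b) set" where
  "star_hom A B = {h. h \<in> carrier A \<rightarrow> carrier B \<and>
     (\<forall>a\<in>carrier A. \<forall>b\<in>carrier A. h (a \<oplus>\<^bsub>A\<^esub> b) = h a \<oplus>\<^bsub>B\<^esub> h b) \<and>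
     (\<forall>a\<in>carrier A. \<forall>b\<in>carrier A. h (a \<otimes>\<^bsub>A\<^esub> b) = h a \<otimes>\<^bsub>B\<^esub> h b) \<and>
     (\<forall>c. \<forall>a\<in>carrier A. h (c \<odot>\<^bsub>A\<^esub> a) = c \<odot>\<^bsub>B\<^esub> h a) \<and>
     (\<forall>a\<in>carrier A. h (star A a) = star B (h a))}"

definition star_isomorphic :: "'a star_algebra \<Rightarrow> 'b star_algebra \<Rightarrow> bool" where
  "star_isomorphic A B \<longleftrightarrow> (\<exists>h \<in> star_hom A B. bij_betw h (carrier A) (carrier B))"

text \<open>
  A state on a unital C*-algebra is a linear functional that is positive (nonnegative on the
  elements \<open>a\<^sup>* a\<close>) and takes the value 1 at the unit. Functionals are only relevant on the carrier.
\<close>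

definition trace_state :: "'a star_algebra \<Rightarrow> ('a \<Rightarrow> complex) \<Rightarrow> bool" where
  "trace_state A \<omega> \<longleftrightarrow>
     (\<forall>a\<in>carrier A. \<forall>b\<in>carrier A. \<omega> (a \<oplus>\<^bsub>A\<^esub> b) = \<omega> a + \<omega> b) \<and>
     (\<forall>c. \<forall>a\<in>carrier A. \<omega> (c \<odot>\<^bsub>A\<^esub> a) = c * \<omega> a) \<and>
     (\<forall>a\<in>carrier A. \<omega> (star A a \<otimes>\<^bsub>A\<^esub> a) \<in> \<real>\<^sub>\<ge>\<^sub>0) \<and>
     \<omega> \<one>\<^bsub>A\<^esub> = 1 \<and>
     (\<forall>a\<in>carrier A. \<forall>b\<in>carrier A. \<omega> (a \<otimes>\<^bsub>A\<^esub> b) = \<omega> (b \<otimes>\<^bsub>A\<^esub> a))"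

definition complex_algebra :: "complex star_algebra" where
  "complex_algebra = \<lparr>carrier = UNIV, mult = (*), one = 1, zero = 0, add = (+),
     smult = (*), star = cnj\<rparr>"

text \<open>Continuous functions on the unit circle; off the circle they are \<^const>\<open>undefined\<close>.\<close>

definition circle_algebra :: "(complex \<Rightarrow> complex) star_algebra" where
  "circle_algebra = (let T = sphere 0 1 in
     \<lparr>carrier = {f. continuous_on T f \<and> f \<in> extensional T},
      mult = (\<lambda>f g. \<lambda>z\<in>T. f z * g z),
      one = (\<lambda>z\<in>T. 1),
      zero = (\<lambda>z\<in>T. 0),
      add = (\<lambda>f g. \<lambda>z\<in>T. f z + g z),
      smult = (\<lambda>c f. \<lambda>z\<in>T. c * f z),
      star = (\<lambda>f. \<lambda>z\<in>T. cnj (f z))\<rparr>)"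

definition matrix_algebra :: "nat \<Rightarrow> 'a star_algebra \<Rightarrow> 'a mat star_algebra" where
  "matrix_algebra n A =
     \<lparr>carrier = {M \<in> carrier_mat n n. \<forall>i<n. \<forall>j<n. M $$ (i, j) \<in> carrier A},
      mult = (\<lambda>M N. mat n n (\<lambda>(i, j). \<Oplus>\<^bsub>A\<^esub>k\<in>{..<n}. M $$ (i, k) \<otimes>\<^bsub>A\<^esub> N $$ (k, j))),
      one = mat n n (\<lambda>(i, j). if i = j then \<one>\<^bsub>A\<^esub> else \<zero>\<^bsub>A\<^esub>),
      zero = mat n n (\<lambda>(i, j). \<zero>\<^bsub>A\<^esub>),
      add = (\<lambda>M N. mat n n (\<lambda>(i, j). M $$ (i, j) \<oplus>\<^bsub>A\<^esub> N $$ (i, j))),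
      smult = (\<lambda>c M. mat n n (\<lambda>(i, j). c \<odot>\<^bsub>A\<^esub> M $$ (i, j))),
      star = (\<lambda>M. mat n n (\<lambda>(i, j). star A (M $$ (j, i))))\<rparr>"


section \<open>Universal C*-algebras\<close>

text \<open>
  The free (non-unital) *-algebra on a set of generators consists of the finite complex linear
  combinations of nonempty words in the letters \<open>g\<close>, encoded \<open>(g, False)\<close>, and \<open>g\<^sup>*\<close>, encoded
  \<open>(g, True)\<close>. It sits inside the monoid algebra of the free monoid on these letters, whose product
  is that of \<^type>\<open>poly_mapping\<close>.
\<close>

datatype 'g star_word = Word (letters: "('g \<times> bool) list")

instantiation star_word :: (type) monoid_add
begin

definition zero_star_word :: "'a star_word" where
  "0 = Word []"

definition plus_star_word :: "'a star_word \<Rightarrow> 'a star_word \<Rightarrow> 'a star_word" where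
  "v + w = Word (letters v @ letters w)"

instance
  by standard (simp_all add: zero_star_word_def plus_star_word_def)

end

type_synonym 'g star_poly = "'g star_word \<Rightarrow>\<^sub>0 complex"

definition gen :: "'g \<Rightarrow> 'g star_poly" where
  "gen g = Poly_Mapping.single (Word [(g, False)]) 1"

definition poly_scale :: "complex \<Rightarrow> 'g star_poly \<Rightarrow> 'g star_poly" where
  "poly_scale c x = Poly_Mapping.map ((*) c) x"

definition adj_word :: "'g star_word \<Rightarrow> 'g star_word" where
  "adj_word w = Word (rev (map (\<lambda>(g, b). (g, \<not> b)) (letters w)))"

definition poly_star :: "'g star_poly \<Rightarrow> 'g star_poly" where
  "poly_star x =
     (\<Sum>w\<in>Poly_Mapping.keys x. Poly_Mapping.single (adj_word w) (cnj (Poly_Mapping.lookup x w)))"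

definition free_star_algebra :: "'g set \<Rightarrow> 'g star_poly set" where
  "free_star_algebra X =
     {x. \<forall>w\<in>Poly_Mapping.keys x. letters w \<noteq> [] \<and> fst ` set (letters w) \<subseteq> X}"

definition cstar_seminorms :: "'g set \<Rightarrow> ('g star_poly \<Rightarrow> real) set" where
  "cstar_seminorms X = (let F = free_star_algebra X in
     {p. (\<forall>x\<in>F. 0 \<le> p x) \<and>
         (\<forall>x\<in>F. \<forall>y\<in>F. p (x + y) \<le> p x + p y) \<and>
         (\<forall>c. \<forall>x\<in>F. p (poly_scale c x) = cmod c * p x) \<and>
         (\<forall>x\<in>F. \<forall>y\<in>F. p (x * y) \<le> p x * p y) \<and>
         (\<forall>x\<in>F. p (poly_star x * x) = (p x)\<^sup>2)})"

text \<open>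
  The universal C*-algebra generated by \<open>X\<close> subject to relations \<open>R\<close> (a set of elements of the free
  *-algebra, each to be equated with 0) is the Hausdorff completion of the free *-algebra in the
  largest C*-seminorm that vanishes on \<open>R\<close>. This presupposes that the relations bound every such
  seminorm on each generator; otherwise the supremum over the reals is meaningless.
\<close>

definition universal_seminorm :: "'g set \<Rightarrow> 'g star_poly set \<Rightarrow> 'g star_poly \<Rightarrow> real" where
  "universal_seminorm X R x = (SUP p \<in> {p \<in> cstar_seminorms X. \<forall>r\<in>R. p r = 0}. p x)"

definition cauchy_seqs :: "'g set \<Rightarrow> 'g star_poly set \<Rightarrow> (nat \<Rightarrow> 'g star_poly) set" where
  "cauchy_seqs X R = {x. (\<forall>n. x n \<in> free_star_algebra X) \<and>
     (\<forall>\<epsilon>>0. \<exists>N. \<forall>m\<ge>N. \<forall>n\<ge>N. universal_seminorm X R (x m - x n) < \<epsilon>)}"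

definition cauchy_rel ::
  "'g set \<Rightarrow> 'g star_poly set \<Rightarrow> ((nat \<Rightarrow> 'g star_poly) \<times> (nat \<Rightarrow> 'g star_poly)) set" where
  "cauchy_rel X R = {(x, y). x \<in> cauchy_seqs X R \<and> y \<in> cauchy_seqs X R \<and>
     (\<lambda>n. universal_seminorm X R (x n - y n)) \<longlonglongrightarrow> 0}"

definition cauchy_class ::
  "'g set \<Rightarrow> 'g star_poly set \<Rightarrow> (nat \<Rightarrow> 'g star_poly) \<Rightarrow> (nat \<Rightarrow> 'g star_poly) set" where
  "cauchy_class X R x = cauchy_rel X R `` {x}"

definition universal_mult ::
  "'g set \<Rightarrow> 'g star_poly set \<Rightarrow> (nat \<Rightarrow> 'g star_poly) set \<Rightarrow> (nat \<Rightarrow> 'g star_poly) set \<Rightarrow>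
   (nat \<Rightarrow> 'g star_poly) set" where
  "universal_mult X R a b = (\<Union>x\<in>a. \<Union>y\<in>b. cauchy_class X R (\<lambda>n. x n * y n))"

text \<open>
  The \<^const>\<open>one\<close> of the record is the unit of the algebra and is unspecified if there is none.
\<close>

definition universal_cstar ::
  "'g set \<Rightarrow> 'g star_poly set \<Rightarrow> (nat \<Rightarrow> 'g star_poly) set star_algebra" where
  "universal_cstar X R = (let A = cauchy_seqs X R // cauchy_rel X R in
     \<lparr>carrier = A,
      mult = universal_mult X R,
      one = (THE u. u \<in> A \<and> (\<forall>a\<in>A. universal_mult X R u a = a \<and> universal_mult X R a u = a)),
      zero = cauchy_class X R (\<lambda>n. 0),
      add = (\<lambda>a b. \<Union>x\<in>a. \<Union>y\<in>b. cauchy_class X R (\<lambda>n. x n + y n)),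
      smult = (\<lambda>c a. \<Union>x\<in>a. cauchy_class X R (\<lambda>n. poly_scale c (x n))),
      star = (\<lambda>a. \<Union>x\<in>a. cauchy_class X R (\<lambda>n. poly_star (x n)))\<rparr>)"


section \<open>Graph C*-algebras\<close>

text \<open>
  Directed graphs are those of \<^theory>\<open>Graph_Theory.Digraph\<close>, which allow loops and parallel arcs;
  the source and range maps are \<^const>\<open>tail\<close> and \<^const>\<open>head\<close>. A finite path from \<open>v\<close> to \<open>w\<close> is a
  \<^const>\<open>pre_digraph.awalk\<close>, where the empty list of arcs is the path \<open>v\<close> of length 0.
\<close>

definition is_sink :: "('v, 'e) pre_digraph \<Rightarrow> 'v \<Rightarrow> bool" where
  "is_sink G v \<longleftrightarrow> v \<in> verts G \<and> {e \<in> arcs G. tail G e = v} = {}"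

datatype ('v, 'e) graph_gen = VertexGen 'v | EdgeGen 'e

type_synonym ('v, 'e) graph_poly = "('v, 'e) graph_gen star_poly"
type_synonym ('v, 'e) graph_elem = "(nat \<Rightarrow> ('v, 'e) graph_poly) set"

abbreviation P_gen :: "'v \<Rightarrow> ('v, 'e) graph_poly" where
  "P_gen v \<equiv> gen (VertexGen v)"

abbreviation S_gen :: "'e \<Rightarrow> ('v, 'e) graph_poly" where
  "S_gen e \<equiv> gen (EdgeGen e)"

definition graph_gens :: "('v, 'e) pre_digraph \<Rightarrow> ('v, 'e) graph_gen set" where
  "graph_gens G = VertexGen ` verts G \<union> EdgeGen ` arcs G"

definition graph_rels :: "('v, 'e) pre_digraph \<Rightarrow> ('v, 'e) graph_poly set" where
  "graph_rels G =
     {poly_star (P_gen v) - P_gen v | v. v \<in> verts G} \<union>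
     {P_gen v * P_gen v - P_gen v | v. v \<in> verts G} \<union>
     {P_gen v * P_gen w | v w. v \<in> verts G \<and> w \<in> verts G \<and> v \<noteq> w} \<union>
     {S_gen e * poly_star (S_gen e) * S_gen e - S_gen e | e. e \<in> arcs G} \<union>
     {poly_star (S_gen e) * S_gen e - P_gen (head G e) | e. e \<in> arcs G} \<union>
     {P_gen v - (\<Sum>e\<in>{e \<in> arcs G. tail G e = v}. S_gen e * poly_star (S_gen e)) | v.
        v \<in> verts G \<and> \<not> is_sink G v}"

definition graph_cstar :: "('v, 'e) pre_digraph \<Rightarrow> ('v, 'e) graph_elem star_algebra" where
  "graph_cstar G = universal_cstar (graph_gens G) (graph_rels G)"

definition P_elem :: "('v, 'e) pre_digraph \<Rightarrow> 'v \<Rightarrow> ('v, 'e) graph_elem" where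
  "P_elem G v = cauchy_class (graph_gens G) (graph_rels G) (\<lambda>n. P_gen v)"

definition S_elem :: "('v, 'e) pre_digraph \<Rightarrow> 'e \<Rightarrow> ('v, 'e) graph_elem" where
  "S_elem G e = cauchy_class (graph_gens G) (graph_rels G) (\<lambda>n. S_gen e)"

text \<open>
  For \<open>X\<close> with hereditary and saturated complement, this is the canonical *-homomorphism from the
  C*-algebra of \<open>G\<close> to that of the subgraph induced by \<open>X\<close>; it is unique because a *-homomorphism is
  determined by its values on the generators.
\<close>

definition canonical_hom ::
  "('v, 'e) pre_digraph \<Rightarrow> 'v set \<Rightarrow> ('v, 'e) graph_elem \<Rightarrow> ('v, 'e) graph_elem" where
  "canonical_hom G X = (let H = G \<restriction> X in
     (THE \<pi>. \<pi> \<in> star_hom (graph_cstar G) (graph_cstar H) \<inter> extensional (carrier (graph_cstar G)) \<and>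
        (\<forall>v\<in>verts G. \<pi> (P_elem G v) = (if v \<in> X then P_elem H v else \<zero>\<^bsub>graph_cstar H\<^esub>)) \<and>
        (\<forall>e\<in>arcs G. \<pi> (S_elem G e) = (if head G e \<in> X then S_elem H e else \<zero>\<^bsub>graph_cstar H\<^esub>))))"


section \<open>Components and sinks\<close>

definition leads_to :: "('v, 'e) pre_digraph \<Rightarrow> 'v \<Rightarrow> 'v \<Rightarrow> bool" where
  "leads_to G v w \<longleftrightarrow> (\<exists>\<mu>. pre_digraph.awalk G v \<mu> w)"

definition mutual_rel :: "('v, 'e) pre_digraph \<Rightarrow> ('v \<times> 'v) set" where
  "mutual_rel G = {(v, w). leads_to G v w \<and> leads_to G w v}"

definition back_closure :: "('v, 'e) pre_digraph \<Rightarrow> 'v set \<Rightarrow> 'v set" where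
  "back_closure G X = {v \<in> verts G. \<exists>w\<in>X. leads_to G v w}"

definition is_component :: "('v, 'e) pre_digraph \<Rightarrow> 'v set \<Rightarrow> bool" where
  "is_component G C \<longleftrightarrow>
     C \<in> verts G // mutual_rel G \<and> (\<exists>e\<in>arcs G. tail G e \<in> C \<and> head G e \<in> C)"

definition loops_in :: "('v, 'e) pre_digraph \<Rightarrow> 'v set \<Rightarrow> 'e list set" where
  "loops_in G C =
     {\<mu>. \<mu> \<noteq> [] \<and> (\<exists>v. pre_digraph.awalk G v \<mu> v) \<and> tail G ` set \<mu> \<subseteq> C}"

definition circular :: "('v, 'e) pre_digraph \<Rightarrow> 'v set \<Rightarrow> bool" where
  "circular G C \<longleftrightarrow> (\<exists>\<mu> \<in> loops_in G C. \<forall>\<nu> \<in> loops_in G C.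
     \<exists>k m. \<nu> = rotate k (concat (replicate m \<mu>)))"

definition Z0 :: "('v, 'e) pre_digraph \<Rightarrow> 'v set set" where
  "Z0 G = {C. is_component G C \<and> circular G C \<and>
     \<not> (\<exists>D. is_component G D \<and> D \<subseteq> back_closure G C - C)}"

definition S0 :: "('v, 'e) pre_digraph \<Rightarrow> 'v set" where
  "S0 G = {s. is_sink G s \<and> \<not> (\<exists>D. is_component G D \<and> D \<subseteq> back_closure G {s} - {s})}"

text \<open>In the next two definitions a finite path is the pair of its source and its list of arcs.\<close>

definition n_sink :: "('v, 'e) pre_digraph \<Rightarrow> 'v \<Rightarrow> nat" where
  "n_sink G s = card {(v, \<mu>). pre_digraph.awalk G v \<mu> s}"

definition n_component :: "('v, 'e) pre_digraph \<Rightarrow> 'v \<Rightarrow> nat" where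
  "n_component G vC =
     card {(v, \<mu>). pre_digraph.awalk G v \<mu> vC \<and> (\<forall>e\<in>set \<mu>. tail G e \<noteq> vC)}"

abbreviation closure_graph :: "('v, 'e) pre_digraph \<Rightarrow> 'v set \<Rightarrow> ('v, 'e) pre_digraph" where
  "closure_graph G X \<equiv> G \<restriction> back_closure G X"

abbreviation pi_hom ::
  "('v, 'e) pre_digraph \<Rightarrow> 'v set \<Rightarrow> ('v, 'e) graph_elem \<Rightarrow> ('v, 'e) graph_elem" where
  "pi_hom G X \<equiv> canonical_hom G (back_closure G X)"

definition trace_decomposition ::
  "('v, 'e) pre_digraph \<Rightarrow> (('v, 'e) graph_elem \<Rightarrow> complex) \<Rightarrow>
   ('v \<Rightarrow> real) \<Rightarrow> ('v set \<Rightarrow> real) \<Rightarrow>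
   ('v \<Rightarrow> ('v, 'e) graph_elem \<Rightarrow> complex) \<Rightarrow> ('v set \<Rightarrow> ('v, 'e) graph_elem \<Rightarrow> complex) \<Rightarrow> bool" where
  "trace_decomposition G \<omega> \<alpha>S \<alpha>C \<omega>S \<omega>C \<longleftrightarrow>
     (\<forall>s\<in>S0 G. \<alpha>S s \<in> {0..1} \<and> trace_state (graph_cstar (closure_graph G {s})) (\<omega>S s)) \<and>
     (\<forall>C\<in>Z0 G. \<alpha>C C \<in> {0..1} \<and> trace_state (graph_cstar (closure_graph G C)) (\<omega>C C)) \<and>
     (\<Sum>s\<in>S0 G. \<alpha>S s) + (\<Sum>C\<in>Z0 G. \<alpha>C C) = 1 \<and>
     (\<forall>a\<in>carrier (graph_cstar G).
        \<omega> a = (\<Sum>s\<in>S0 G. of_real (\<alpha>S s) * \<omega>S s (pi_hom G {s} a)) +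
              (\<Sum>C\<in>Z0 G. of_real (\<alpha>C C) * \<omega>C C (pi_hom G C a)))"

end

theory Submission imports Defs begin

text \<open>
  Call a vertex \<open>r\<close> terminal if it is a sink in \<open>\<S>(0)\<close> or lies in a component in \<open>\<Z>(0)\<close>, and let \<open>X\<close> be
  the set of vertices leading to \<open>r\<close>. Only finitely many paths end at \<open>r\<close> without having visited it
  before, and the span of the elements \<open>S\<^sub>\<xi> f(u) S\<^sub>\<nu>\<^sup>*\<close> with such paths \<open>\<xi>, \<nu>\<close> is dense in \<open>C\<^sup>*(X)\<close>, where \<open>u\<close> is the unitary
  \<open>S\<^sub>\<lambda>\<close> of the only simple loop \<open>\<lambda>\<close> at \<open>r\<close>, or \<open>P\<^sub>r\<close> if \<open>r\<close> is a sink. This identifies \<open>C\<^sup>*(X)\<close> with matrices.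

  For a trace \<open>\<tau>\<close> the function \<open>v \<mapsto> \<tau>(P\<^sub>v)\<close> is nonnegative, and its value at a \<open>v\<close> that is no sink is the sum of the values
  at the ranges of the edges leaving \<open>v\<close>. Hence it vanishes at every vertex to which a loop has an
  exit and at every vertex with two different simple loops, so at all sinks and loop vertices that are
  not terminal, and \<open>\<tau>\<close> is determined by its values on the loops at terminal vertices. Conversely the moments
  \<open>\<omega>(S\<^sub>\<lambda>\<^sup>k) / \<omega>(P\<^sub>r)\<close> define a state on the continuous functions on the circle, since \<open>S\<^sub>\<lambda>\<close> is isometric, and
  this yields \<open>\<omega>\<^sub>r\<close>. The weight of \<open>\<omega>\<^sub>r\<close> is \<open>n\<^sub>r \<omega>(P\<^sub>r)\<close>, as every trace state of \<open>C\<^sup>*(X)\<close> is \<open>1 / n\<^sub>r\<close> at \<open>P\<^sub>r\<close>.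
\<close>

section \<open>The free *-algebra\<close>

text \<open>The relations do not say that the range projections of arcs with a common source are
  orthogonal, nor that such an arc is absorbed by its source projection, without which there would
  be no unit. For operators on a Hilbert space both follow from the sum being a projection. Here
  only C*-seminorms on a free *-algebra are at hand, with neither an order nor vectors, so a norm
  argument has to supply them before the completion is formed.

  Spectral theory is replaced by two estimates. A square root of 1 - h, found by iteration, bounds
  positive functionals and *-homomorphisms. A count of coefficients bounds a Laurent polynomial in a
  unitary by its supremum on the circle.

  In the matrix description the norm on the dense span is compared with the entries from both sides:
  from above term by term, from below by finite-dimensional representations, one for each point z of
  the spectrum, in which the loop arc carries the factor z. The two bounds differ by the square of
  the matrix size, which is harmless for limits.

  In \<open>C*(G)\<close> itself a terminal loop may have exits. There its path element is only an
  isometry, and this is why moments are used instead of a functional calculus.\<close>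

abbreviation "single \<equiv> Poly_Mapping.single"
abbreviation "lookup \<equiv> Poly_Mapping.lookup"
abbreviation "keys \<equiv> Poly_Mapping.keys"

text \<open>The index 0 is neutral, so constants are central even when the indices, such as words,
  do not commute. Scaling is multiplication by a constant, and its laws become ring laws.\<close>

lemma single_0_central: "single 0 c * x = x * single (0::'w::monoid_add) (c::'r::comm_ring_1)"
proof -
  have *: "x = (\<Sum>w\<in>keys x. single w (lookup x w))"
    by (rule poly_mapping_eqI) (auto simp: lookup_sum lookup_single when_def in_keys_iff)
  show ?thesis
    by (subst (1 2) *) (simp add: sum_distrib_left sum_distrib_right mult_single mult.commute)
qed

lemma poly_mapping_single_induct:
  fixes x :: "'w \<Rightarrow>\<^sub>0 'r::comm_monoid_add"
  assumes s: "!!w c. P (single w c)" and a: "!!x y. P x ==> P y ==> P (x + y)"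
  shows "P x"
proof -
  have *: "x = (\<Sum>w\<in>keys x. single w (lookup x w))"
    by (rule poly_mapping_eqI) (auto simp: lookup_sum lookup_single when_def in_keys_iff)
  have "P (\<Sum>w\<in>S. single w (lookup x w))" if "finite S" for S
    using that
  proof induct
    case empty
    \<comment> \<open>A monomial with coefficient 0 is 0, which is why the rule has no separate case
      for 0.\<close>
    show ?case using s[of undefined 0] by simp
  next
    case (insert w S)
    then show ?case using s a by simp
  qed
  then show ?thesis using * by (metis finite_keys)
qed

lemma poly_scale_eq: "poly_scale c x = single 0 c * x"
  by (simp add: poly_scale_def mult_map_scale_conv_mult)

lemma lookup_poly_scale: "lookup (poly_scale c x) w = c * lookup x w"
  unfolding poly_scale_def by (simp add: Poly_Mapping.map.rep_eq when_def)

lemma poly_scale_simps: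
  "poly_scale c x * y = poly_scale c (x * y)"
  "x * poly_scale c y = poly_scale c (x * y)"
  "poly_scale c (poly_scale d x) = poly_scale (c * d) x"
  "poly_scale 1 x = x" "poly_scale 0 x = 0" "poly_scale c 0 = 0"
  "poly_scale c (- x) = - poly_scale c x"
proof -
  show "x * poly_scale c y = poly_scale c (x * y)"
    unfolding poly_scale_eq by (metis mult.assoc single_0_central)
qed (simp_all add: poly_scale_eq mult.assoc mult_single flip: mult.assoc)

lemma poly_scale_distrib:
  "poly_scale c (x + y) = poly_scale c x + poly_scale c y"
  "poly_scale c (x - y) = poly_scale c x - poly_scale c y"
  "poly_scale (c + d) x = poly_scale c x + poly_scale d x"
  "poly_scale (c - d) x = poly_scale c x - poly_scale d x"
  "poly_scale (- c) x = - poly_scale c x"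
  by (simp_all add: poly_scale_eq algebra_simps single_add single_diff single_uminus)

lemma poly_scale_sum: "poly_scale c (sum f A) = (\<Sum>a\<in>A. poly_scale c (f a))"
  by (simp add: poly_scale_eq sum_distrib_left)

lemma poly_scale_sum_left: "poly_scale (sum f A) x = (\<Sum>a\<in>A. poly_scale (f a) x)"
  by (induct A rule: infinite_finite_induct) (auto simp: poly_scale_distrib poly_scale_simps)

lemma poly_scale_single: "poly_scale c (single w d) = single w (c * d)"
  by (simp add: poly_scale_eq mult_single)

lemma adj_adj_word [simp]: "adj_word (adj_word w) = w"
  by (cases w) (simp add: adj_word_def rev_map comp_def split_def)

lemma adj_word_plus: "adj_word (v + w) = adj_word w + adj_word v"
  by (simp add: adj_word_def plus_star_word_def)

lemma lookup_poly_star: "lookup (poly_star x) w = cnj (lookup x (adj_word w))"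
proof -
  have "lookup (poly_star x) w =
    (\<Sum>v\<in>keys x. if v = adj_word w then cnj (lookup x v) else 0)"
    unfolding poly_star_def lookup_sum lookup_single when_def
    by (rule sum.cong) (auto split: if_splits)
  then show ?thesis by (auto simp: in_keys_iff)
qed

lemma poly_star_add: "poly_star (x + y) = poly_star x + poly_star y"
  by (rule poly_mapping_eqI) (simp add: lookup_poly_star lookup_add)

lemma poly_star_diff: "poly_star (x - y) = poly_star x - poly_star y"
  by (rule poly_mapping_eqI) (simp add: lookup_poly_star lookup_minus)

lemma poly_star_zero [simp]: "poly_star 0 = 0"
  by (rule poly_mapping_eqI) (simp add: lookup_poly_star)

lemma poly_star_sum: "poly_star (sum f A) = (\<Sum>a\<in>A. poly_star (f a))"
  by (induct A rule: infinite_finite_induct) (auto simp: poly_star_add)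

lemma poly_star_scale: "poly_star (poly_scale c x) = poly_scale (cnj c) (poly_star x)"
  by (rule poly_mapping_eqI) (simp add: lookup_poly_star lookup_poly_scale)

lemma poly_star_star [simp]: "poly_star (poly_star x) = x"
  by (rule poly_mapping_eqI) (simp add: lookup_poly_star)

lemma poly_star_single: "poly_star (single w c) = single (adj_word w) (cnj c)"
  by (rule poly_mapping_eqI) (auto simp: lookup_poly_star lookup_single when_def)

lemma poly_star_mult: "poly_star (x * y) = poly_star y * poly_star x"
proof (induct x rule: poly_mapping_single_induct)
  case (1 w c)
  show ?case
    by (induct y rule: poly_mapping_single_induct)
      (simp_all add: poly_star_single mult_single adj_word_plus mult.commute poly_star_add algebra_simps)
next
  case (2 x x')
  then show ?case by (simp add: poly_star_add algebra_simps)
qed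

lemma poly_star_one [simp]: "poly_star 1 = 1"
proof -
  have "(1 :: 'a star_poly) = single 0 1" by simp
  moreover have "adj_word 0 = (0 :: 'a star_word)" by (simp add: adj_word_def zero_star_word_def)
  ultimately show ?thesis by (metis poly_star_single complex_cnj_one)
qed

lemma star_word_plus_letters: "letters (v + w) = letters v @ letters w"
  by (simp add: plus_star_word_def)

section \<open>Closure properties and induction for the non-unital free algebra\<close>

lemma free_zero [simp]: "0 \<in> free_star_algebra X"
  by (simp add: free_star_algebra_def)

lemma free_add: "x \<in> free_star_algebra X ==> y \<in> free_star_algebra X ==> x + y \<in> free_star_algebra X"
  using Poly_Mapping.keys_add[of x y] by (fastforce simp: free_star_algebra_def)

lemma free_uminus: "x \<in> free_star_algebra X ==> - x \<in> free_star_algebra X"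
  by (auto simp: free_star_algebra_def in_keys_iff)

lemma free_diff: "x \<in> free_star_algebra X ==> y \<in> free_star_algebra X ==> x - y \<in> free_star_algebra X"
  using free_add[of x X "- y"] free_uminus by auto

lemma free_scale: "x \<in> free_star_algebra X ==> poly_scale c x \<in> free_star_algebra X"
  by (auto simp: free_star_algebra_def in_keys_iff lookup_poly_scale)

lemma free_mult: "x \<in> free_star_algebra X ==> y \<in> free_star_algebra X ==> x * y \<in> free_star_algebra X"
  using keys_mult[of x y] by (fastforce simp: free_star_algebra_def star_word_plus_letters)

lemma free_star: "x \<in> free_star_algebra X ==> poly_star x \<in> free_star_algebra X"
  unfolding free_star_algebra_def
proof (intro CollectI ballI)
  fix w assume x: "x \<in> {x. \<forall>w\<in>keys x. letters w \<noteq> [] \<and> fst ` set (letters w) \<subseteq> X}"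
    and w: "w \<in> keys (poly_star x)"
  then have "adj_word w \<in> keys x" by (simp add: in_keys_iff lookup_poly_star)
  with x have "letters (adj_word w) \<noteq> [] \<and> fst ` set (letters (adj_word w)) \<subseteq> X" by blast
  moreover have "fst ` set (letters (adj_word w)) = fst ` set (letters w)"
    by (force simp: adj_word_def image_image split_def)
  ultimately show "letters w \<noteq> [] \<and> fst ` set (letters w) \<subseteq> X" by (auto simp: adj_word_def)
qed

lemma free_gen: "g \<in> X ==> gen g \<in> free_star_algebra X"
  by (simp add: free_star_algebra_def gen_def)

lemma free_sum: "(!!a. a \<in> A ==> f a \<in> free_star_algebra X) ==> sum f A \<in> free_star_algebra X"
  by (induct A rule: infinite_finite_induct) (auto simp: free_add)

lemmas free_intros = free_zero free_add free_uminus free_diff free_scale free_mult free_star free_sum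

text \<open>Words are nonempty, so the induction starts from single letters and prepends further
  ones. Arguments about left multiplication by generators fit these cases directly.\<close>

lemma free_induct [consumes 1, case_names gen gen_star mult_gen mult_gen_star add scale zero]:
  assumes "x \<in> free_star_algebra X"
    and g: "!!g. g \<in> X ==> P (gen g)" and gs: "!!g. g \<in> X ==> P (poly_star (gen g))"
    and m: "!!g y. g \<in> X ==> y \<in> free_star_algebra X ==> P y ==> P (gen g * y)"
    and ms: "!!g y. g \<in> X ==> y \<in> free_star_algebra X ==> P y ==> P (poly_star (gen g) * y)"
    and add: "!!x y. x \<in> free_star_algebra X ==> y \<in> free_star_algebra X ==> P x ==> P y ==> P (x + y)"
    and scale: "!!c x. x \<in> free_star_algebra X ==> P x ==> P (poly_scale c x)"
    and zero: "P 0"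
  shows "P x"
proof -
  have words: "single (Word l) 1 \<in> free_star_algebra X \<and> P (single (Word l) 1)"
    if "l \<noteq> []" "fst ` set l \<subseteq> X" for l
    using that
  proof (induct l)
    case Nil
    then show ?case by simp
  next
    case (Cons a l)
    obtain h b where a: "a = (h, b)" by force
    define y where "y = (if b then poly_star (gen h) else gen h)"
    have y: "y = single (Word [a]) 1"
      by (simp add: y_def a gen_def poly_star_single adj_word_def)
    have h: "h \<in> X" using Cons a by auto
    have Py: "P y" "y \<in> free_star_algebra X" using h g gs by (auto simp: y_def intro: free_gen free_star)
    show ?case
    proof (cases "l = []")
      case True
      then show ?thesis using Py y by simp
    next
      case False
      then have IH: "single (Word l) 1 \<in> free_star_algebra X" "P (single (Word l) 1)"
        using Cons by auto
      have *: "single (Word (a # l)) 1 = y * single (Word l) 1"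
        by (simp add: y mult_single plus_star_word_def)
      show ?thesis unfolding * using IH h m ms Py by (auto simp: y_def intro: free_mult)
    qed
  qed
  have *: "x = (\<Sum>w\<in>keys x. poly_scale (lookup x w) (single w 1))"
    by (rule poly_mapping_eqI) (auto simp: lookup_sum poly_scale_single lookup_single when_def in_keys_iff)
  have "(\<Sum>w\<in>S. poly_scale (lookup x w) (single w 1)) \<in> free_star_algebra X \<and>
     P (\<Sum>w\<in>S. poly_scale (lookup x w) (single w 1))"
    if "finite S" "S \<subseteq> keys x" for S
    using that
  proof induct
    case empty
    then show ?case using zero by simp
  next
    case (insert w S)
    have "letters w \<noteq> []" "fst ` set (letters w) \<subseteq> X"
      using assms(1) insert unfolding free_star_algebra_def by auto
    then have "single w 1 \<in> free_star_algebra X \<and> P (single w 1)"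
      using words[of "letters w"] by simp
    then show ?case using insert by (simp add: add scale free_add free_scale)
  qed
  then show ?thesis using * by (metis finite_keys order_refl)
qed

section \<open>Averages over roots of unity\<close>

text \<open>A geometric sum whose ratio is an M-th root of unity. The bound on d leaves 0 as the
  only multiple of M, so the ratio is 1 only for d = 0.\<close>

lemma sum_roots_of_unity_powi:
  fixes d :: int
  assumes "M > 0" "\<bar>d\<bar> < int M"
  shows "(\<Sum>k<M. cis (2 * pi * real k / real M) powi d) = (if d = 0 then of_nat M else 0)"
proof (cases "d = 0")
  case True
  then show ?thesis by simp
next
  case False
  define x where "x = cis (2 * pi * real_of_int d / real M)"
  have "cis (2 * pi * real k / real M) powi d = x ^ k" for k
    unfolding x_def Complex.DeMoivre cis_power_int by (rule arg_cong[of _ _ cis]) simp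
  moreover have "x \<noteq> 1"
  proof
    assume "x = 1"
    then have "cos (2 * pi * real_of_int d / real M) = 1" by (simp add: x_def complex_eq_iff)
    then obtain n :: int where "2 * pi * real_of_int d / real M = of_int n * (2 * pi)"
      unfolding cos_one_2pi_int by (auto simp: mult.assoc)
    then have "real_of_int d = of_int n * real M"
      using assms by (simp add: field_simps)
    then have "d = n * int M" by (metis of_int_eq_iff of_int_mult of_int_of_nat_eq)
    then show False using assms False
      by (metis dvd_imp_le_int dvd_triv_right abs_of_nat leD)
  qed
  moreover have "x ^ M = 1"
    using assms by (simp add: x_def Complex.DeMoivre cis_multiple_2pi)
  ultimately show ?thesis using False by (simp add: sum_gp_strict)
qed

section \<open>C*-seminorms\<close>

locale cstar_seminorm =
  fixes X :: "'g set" and N :: "'g star_poly => real"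
  assumes seminorm: "N \<in> cstar_seminorms X"
begin

abbreviation "F \<equiv> free_star_algebra X"

lemma N_nonneg: "x \<in> F ==> 0 \<le> N x"
  and N_add: "x \<in> F ==> y \<in> F ==> N (x + y) \<le> N x + N y"
  and N_scale: "x \<in> F ==> N (poly_scale c x) = cmod c * N x"
  and N_mult: "x \<in> F ==> y \<in> F ==> N (x * y) \<le> N x * N y"
  and N_cstar: "x \<in> F ==> N (poly_star x * x) = (N x)\<^sup>2"
  using seminorm unfolding cstar_seminorms_def Let_def by auto

lemma N_zero [simp]: "N 0 = 0"
  using N_scale[of 0 0] by (simp add: poly_scale_simps)

lemma N_uminus: "x \<in> F ==> N (- x) = N x"
  using N_scale[of x "-1"] by (simp add: poly_scale_simps poly_scale_distrib)

lemma N_diff: "x \<in> F ==> y \<in> F ==> N (x - y) \<le> N x + N y"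
  using N_add[of x "- y"] by (simp add: N_uminus free_intros)

lemma N_diff_commute: "x \<in> F ==> y \<in> F ==> N (x - y) = N (y - x)"
  using N_uminus[of "x - y"] by (simp add: free_intros)

text \<open>The C*-identity and submultiplicativity bound the square of \<open>N x\<close> by
  \<open>N (poly_star x) * N x\<close>; one factor cancels.\<close>

lemma N_le_star: "x \<in> F ==> N x \<le> N (poly_star x)"
proof -
  assume x: "x \<in> F"
  have "(N x)\<^sup>2 \<le> N (poly_star x) * N x" using N_mult[of "poly_star x" x] x by (simp add: N_cstar free_intros)
  then show ?thesis using N_nonneg[OF x] N_nonneg[OF free_star[OF x]]
    by (cases "N x = 0") (auto simp: power2_eq_square)
qed

lemma N_star: "x \<in> F ==> N (poly_star x) = N x"
  using N_le_star[of x] N_le_star[of "poly_star x"] by (simp add: free_intros)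

lemma N_sum: "(!!a. a \<in> A ==> f a \<in> F) ==> N (sum f A) \<le> (\<Sum>a\<in>A. N (f a))"
proof (induct A rule: infinite_finite_induct)
  case (insert a A)
  then show ?case using N_add[of "f a" "sum f A"] by (force simp: free_intros)
qed auto

lemma N_eq: "x \<in> F ==> y \<in> F ==> N (x - y) = 0 ==> N x = N y"
  using N_add[of "x - y" y] N_add[of "y - x" x] N_diff_commute[of x y] by (simp add: free_intros)

lemma N_null_mult:
  "x \<in> F ==> y \<in> F ==> N x = 0 ==> N (x * y) = 0"
  "x \<in> F ==> y \<in> F ==> N y = 0 ==> N (x * y) = 0"
  using N_mult[of x y] N_nonneg[of "x * y"] by (auto simp: free_intros)

lemma N_null_add: "x \<in> F ==> y \<in> F ==> N x = 0 ==> N y = 0 ==> N (x + y) = 0"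
  using N_add[of x y] N_nonneg[of "x + y"] by (auto simp: free_intros)

lemma N_null_diff: "x \<in> F ==> y \<in> F ==> N x = 0 ==> N y = 0 ==> N (x - y) = 0"
  using N_diff[of x y] N_nonneg[of "x - y"] by (auto simp: free_intros)

lemma N_null_sum: "(!!a. a \<in> A ==> f a \<in> F) ==> (!!a. a \<in> A ==> N (f a) = 0) ==> N (sum f A) = 0"
  using N_sum[of A f] N_nonneg[of "sum f A"] by (auto simp: free_intros)

text \<open>
  The argument of Bohnenblust and Karlin that 1 is an extreme point of the unit ball of a Banach
  algebra: \<open>1 + \<lambda>w\<close> is a contraction for all small \<open>\<lambda>\<close>, and the coefficient \<open>K w\<close> of its \<open>K\<close>-th
  power is an average of contractions over roots of unity.
\<close>

lemma bohnenblust_karlin: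
  assumes V: "V \<subseteq> F" and w: "w \<in> F"
    and Vadd: "!!c d. c \<in> V ==> d \<in> V ==> c + d \<in> V"
    and Vscale: "!!c a. c \<in> V ==> poly_scale a c \<in> V"
    and Vw: "!!c. c \<in> V ==> w * c \<in> V"
    and contr: "!!c a. c \<in> V ==> a \<in> {1, -1, \<i>, -\<i>} ==> N (c + poly_scale a (w * c)) \<le> N c"
    and c: "c \<in> V"
  shows "N (w * c) = 0"
proof -
  define T where "T a d = d + poly_scale a (w * d)" for a d
  have TV: "T a d \<in> V" if "d \<in> V" for a d
    using that by (simp add: T_def Vadd Vscale Vw)
  \<comment> \<open>Such an a is a convex combination of 0, one of 1 and -1, and one of \<i> and
    -\<i>, because |Re a| + |Im a| is at most 1. At the nonzero points contractivity is
    assumed.\<close>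
  have half: "N (T a d) \<le> N d" if d: "d \<in> V" and a: "cmod a \<le> 1/2" for a d
  proof -
    have dF: "d \<in> F" "w * d \<in> F" using d V w by (auto simp: free_intros)
    \<comment> \<open>A sign with value 1 at 0, so that it is always one of the multipliers for
      which \<open>contr\<close> is assumed.\<close>
    define s where "s t = (if t \<ge> 0 then 1 else -1 :: real)" for t :: real
    have st: "s t * \<bar>t\<bar> = t" for t by (simp add: s_def)
    have re: "\<bar>Re a\<bar> \<le> 1/2" "\<bar>Im a\<bar> \<le> 1/2" using a abs_Re_le_cmod abs_Im_le_cmod order_trans by blast+
    define A B where "A = d + poly_scale (of_real (s (Re a))) (w * d)"
      and "B = d + poly_scale (of_real (s (Im a)) * \<i>) (w * d)"
    have AB: "A \<in> F" "B \<in> F" by (simp_all add: A_def B_def dF free_intros)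
    have nA: "N A \<le> N d" and nB: "N B \<le> N d"
      unfolding A_def B_def using d by (auto simp: s_def intro!: contr)
    have lin: "poly_scale (of_real u) (d + poly_scale x (w * d)) = poly_scale (of_real u) d + poly_scale (of_real u * x) (w * d)"
      for u x by (simp add: poly_scale_distrib poly_scale_simps)
    have "a = of_real \<bar>Re a\<bar> * of_real (s (Re a)) + of_real \<bar>Im a\<bar> * (of_real (s (Im a)) * \<i>)"
      using st[of "Re a"] st[of "Im a"] by (simp add: complex_eq_iff mult.commute)
    then have e1: "poly_scale a (w * d) = poly_scale (of_real \<bar>Re a\<bar> * of_real (s (Re a))) (w * d) +
      poly_scale (of_real \<bar>Im a\<bar> * (of_real (s (Im a)) * \<i>)) (w * d)"
      by (metis poly_scale_distrib(3))
    have e2: "poly_scale (of_real (1 - \<bar>Re a\<bar> - \<bar>Im a\<bar>)) d + poly_scale (of_real \<bar>Re a\<bar>) d + poly_scale (of_real \<bar>Im a\<bar>) d = d"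
      by (simp add: poly_scale_distrib poly_scale_simps)
    have "T a d = poly_scale (of_real (1 - \<bar>Re a\<bar> - \<bar>Im a\<bar>)) d + poly_scale (of_real \<bar>Re a\<bar>) A
       + poly_scale (of_real \<bar>Im a\<bar>) B"
      unfolding T_def A_def B_def lin e1 by (subst e2[symmetric]) (simp only: add_ac)
    also have "N \<dots> \<le> N (poly_scale (of_real (1 - \<bar>Re a\<bar> - \<bar>Im a\<bar>)) d) + N (poly_scale (of_real \<bar>Re a\<bar>) A)
       + N (poly_scale (of_real \<bar>Im a\<bar>) B)"
      by (meson AB N_add add_right_mono dF(1) free_add free_scale order_trans)
    also have "\<dots> = (1 - \<bar>Re a\<bar> - \<bar>Im a\<bar>) * N d + \<bar>Re a\<bar> * N A + \<bar>Im a\<bar> * N B"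
    proof -
      have "cmod (of_real (1 - \<bar>Re a\<bar> - \<bar>Im a\<bar>)) = 1 - \<bar>Re a\<bar> - \<bar>Im a\<bar>"
        unfolding norm_of_real using re by linarith
      then show ?thesis by (simp only: N_scale AB dF norm_of_real abs_abs)
    qed
    also have "\<dots> \<le> (1 - \<bar>Re a\<bar> - \<bar>Im a\<bar>) * N d + \<bar>Re a\<bar> * N d + \<bar>Im a\<bar> * N d"
      using re by (intro add_mono mult_left_mono nA nB) linarith+
    finally show ?thesis by (simp add: algebra_simps)
  qed
  have iter: "(T a ^^ K) c \<in> V" for a K by (induct K) (auto simp: c TV)
  have iterN: "N ((T a ^^ K) c) \<le> N c" if "cmod a \<le> 1/2" for a K
  proof (induct K)
    case (Suc K)
    then show ?case using half[OF iter[of K a] that] by simp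
  qed simp
  \<comment> \<open>Binomial expansion of the K-th power of 1 + a w, applied to c, as a polynomial
    in a. What counts is its linear coefficient K w c.\<close>
  have poly: "\<exists>b. range b \<subseteq> F \<and> b 0 = c \<and> b 1 = poly_scale (of_nat K) (w * c) \<and> (\<forall>j>K. b j = 0) \<and>
    (\<forall>a. (T a ^^ K) c = (\<Sum>j\<le>K. poly_scale (a ^ j) (b j)))" for K
  proof (induct K)
    case 0
    show ?case by (rule exI[of _ "\<lambda>j. if j = 0 then c else 0"]) (use c V in \<open>auto simp: poly_scale_simps\<close>)
  next
    case (Suc K)
    then obtain b where b: "range b \<subseteq> F" "b 0 = c" "b 1 = poly_scale (of_nat K) (w * c)" "\<forall>j>K. b j = 0"
      "!!a. (T a ^^ K) c = (\<Sum>j\<le>K. poly_scale (a ^ j) (b j))" by auto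
    define b' where "b' j = (case j of 0 => c | Suc i => b (Suc i) + w * b i)" for j
    have "(T a ^^ Suc K) c = (\<Sum>j\<le>Suc K. poly_scale (a ^ j) (b' j))" for a
    proof -
      have "(\<Sum>j\<le>Suc K. poly_scale (a ^ j) (b' j)) =
        c + (\<Sum>j\<le>K. poly_scale (a ^ Suc j) (b (Suc j))) + (\<Sum>j\<le>K. poly_scale (a * a ^ j) (w * b j))"
        by (subst sum.atMost_Suc_shift)
          (simp add: b'_def poly_scale_simps poly_scale_distrib sum.distrib add.assoc)
      also have "c + (\<Sum>j\<le>K. poly_scale (a ^ Suc j) (b (Suc j))) = (\<Sum>j\<le>Suc K. poly_scale (a ^ j) (b j))"
        by (subst sum.atMost_Suc_shift) (simp add: b poly_scale_simps)
      also have "\<dots> = (T a ^^ K) c" using b by (simp add: poly_scale_simps)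
      also have "(\<Sum>j\<le>K. poly_scale (a * a ^ j) (w * b j)) = poly_scale a (w * (T a ^^ K) c)"
        by (simp add: b poly_scale_sum sum_distrib_left poly_scale_simps)
      finally show ?thesis using T_def[of a "(T a ^^ K) c"] by simp
    qed
    moreover have "range b' \<subseteq> F"
    proof -
      have "b' j \<in> F" for j using b(1) c V w
        by (cases j) (auto simp: b'_def intro!: free_add free_mult)
      then show ?thesis by auto
    qed
    moreover have "b' 1 = poly_scale (of_nat (Suc K)) (w * c)"
      using b by (simp add: b'_def poly_scale_distrib poly_scale_simps add.commute)
    moreover have "b' 0 = c" "\<forall>j>Suc K. b' j = 0"
      using b by (auto simp: b'_def split: nat.split)
    ultimately show ?case by blast
  qed
  have wc: "w * c \<in> F" using w c V by (auto simp: free_intros)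
  have main: "real K * N (w * c) \<le> 2 * N c" for K
  proof -
    obtain b where b: "range b \<subseteq> F" "b 1 = poly_scale (of_nat K) (w * c)" "!!j. j > K ==> b j = 0"
      "!!a. (T a ^^ K) c = (\<Sum>j\<le>K. poly_scale (a ^ j) (b j))" using poly[of K] by auto
    \<comment> \<open>The exponents j - 1 run from -1 to K - 1. Their absolute values must be less
      than M also for K = 0, where -1 occurs.\<close>
    define M where "M = K + 2"
    define z where "z k = cis (2 * pi * real k / real M)" for k
    have z: "cmod (z k) = 1" "z k \<noteq> 0" for k by (auto simp: z_def)
    have bF: "b j \<in> F" for j using b(1) by auto
    \<comment> \<open>The weights \<open>inverse (z k)\<close> isolate the coefficient of the first
      power of a. The radius 1/2 is the one permitted by \<open>half\<close>; it costs the factor 2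
      in the final bound.\<close>
    have "(\<Sum>k<M. poly_scale (inverse (z k)) ((T (z k / 2) ^^ K) c)) =
      (\<Sum>k<M. \<Sum>j\<le>K. poly_scale (inverse (z k) * (z k / 2) ^ j) (b j))"
      by (simp add: b poly_scale_sum poly_scale_simps)
    also have "\<dots> = (\<Sum>j\<le>K. poly_scale (\<Sum>k<M. inverse (z k) * (z k / 2) ^ j) (b j))"
      by (subst sum.swap) (simp add: poly_scale_sum_left)
    also have "\<dots> = (\<Sum>j\<le>K. if j = 1 then poly_scale (of_nat M / 2) (b 1) else 0)"
    proof (rule sum.cong)
      fix j assume j: "j \<in> {..K}"
      have "inverse (z k) * (z k / 2) ^ j = (1 / 2 ^ j) * (z k powi (int j - 1))" for k
        using z by (simp add: power_int_diff field_simps)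
      then have "(\<Sum>k<M. inverse (z k) * (z k / 2) ^ j) = (1 / 2 ^ j) * (\<Sum>k<M. z k powi (int j - 1))"
        by (simp only: sum_distrib_left)
      also have "(\<Sum>k<M. z k powi (int j - 1)) = (if int j - 1 = 0 then of_nat M else 0)"
        unfolding z_def by (rule sum_roots_of_unity_powi) (use j in \<open>auto simp: M_def\<close>)
      finally show "poly_scale (\<Sum>k<M. inverse (z k) * (z k / 2) ^ j) (b j) =
        (if j = 1 then poly_scale (of_nat M / 2) (b 1) else 0)"
        by (auto simp: poly_scale_simps)
    qed auto
    also have "\<dots> = poly_scale (of_nat M / 2) (b 1)"
      using b(3)[of 1] by (auto simp: poly_scale_simps)
    also have "\<dots> = poly_scale (of_nat M / 2 * of_nat K) (w * c)"
      by (simp only: b poly_scale_simps)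
    finally have eq: "poly_scale (of_nat M / 2 * of_nat K) (w * c) =
      (\<Sum>k<M. poly_scale (inverse (z k)) ((T (z k / 2) ^^ K) c))" by simp
    have "real M / 2 * real K * N (w * c) = N (poly_scale (of_nat M / 2 * of_nat K) (w * c))"
      by (simp add: N_scale wc norm_mult norm_divide)
    also have "\<dots> \<le> (\<Sum>k<M. N (poly_scale (inverse (z k)) ((T (z k / 2) ^^ K) c)))"
      unfolding eq by (rule N_sum) (use iter V in \<open>auto intro!: free_scale\<close>)
    also have "\<dots> \<le> (\<Sum>k<M. N c)"
    proof (rule sum_mono)
      fix k assume "k \<in> {..<M}"
      have "(T (z k / 2) ^^ K) c \<in> F" using iter V by auto
      then show "N (poly_scale (inverse (z k)) ((T (z k / 2) ^^ K) c)) \<le> N c"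
        using iterN[of "z k / 2" K] by (simp add: N_scale norm_inverse norm_divide z)
    qed
    finally have "real M * (real K * N (w * c)) \<le> real M * (2 * N c)" by simp
    then show ?thesis by (subst (asm) mult_le_cancel_left_pos) (auto simp: M_def)
  qed
  show ?thesis
  proof (rule ccontr)
    assume "N (w * c) \<noteq> 0"
    then have p: "N (w * c) > 0" using N_nonneg[OF wc] by simp
    obtain K where "real K > 2 * N c / N (w * c)" using reals_Archimedean2 by blast
    then have "real K * N (w * c) > 2 * N c" using p by (simp add: field_simps)
    then show False using main[of K] by simp
  qed
qed

text \<open>
  If \<open>\<Sum>\<^sub>j x q\<^sub>j x = 0\<close> then \<open>x q\<^sub>i x\<close> is positive and negative. On the range of \<open>x\<close> this is expressed by
  norms: \<open>c - x q\<^sub>i x c\<close> has norm at most that of \<open>c\<close>, and so does \<open>c + x q\<^sub>i x c / M\<close>.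
\<close>

lemma compressions_sum_null:
  fixes q :: "'j => 'g star_poly"
  assumes J: "finite J" and i: "i \<in> J"
    and q: "!!j. j \<in> J ==> q j \<in> F" "!!j. j \<in> J ==> poly_star (q j) = q j"
      "!!j. j \<in> J ==> N (q j * q j - q j) = 0"
    and x: "!!c. c \<in> F ==> x * c \<in> F" "!!c. c \<in> F ==> c * x \<in> F" "poly_star x = x"
      "!!c. c \<in> F ==> N (x * c) \<le> N c" "!!c. c \<in> F ==> N (x * (x * c) - x * c) = 0"
    and null: "N (\<Sum>j\<in>J. x * q j * x) = 0"
  shows "N (q i * x) = 0"
proof -
  define y where "y j = x * q j * x" for j
  have y: "y j \<in> F" "poly_star (y j) = y j" if "j \<in> J" for j
    using q[OF that] x(1-3) by (auto simp: y_def poly_star_mult mult.assoc)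
  \<comment> \<open>Up to null elements V is the range of x. In the first application x is 1 minus
    an element of \<open>F\<close>; this is not in the non-unital algebra, so x is only assumed to
    multiply \<open>F\<close> into itself.\<close>
  define V where "V = {c \<in> F. N (x * c - c) = 0}"
  have VF: "V \<subseteq> F" by (auto simp: V_def)
  have Vadd: "c + d \<in> V" if "c \<in> V" "d \<in> V" for c d
  proof -
    have "x * (c + d) - (c + d) = (x * c - c) + (x * d - d)" by (simp add: algebra_simps)
    moreover have "N ((x * c - c) + (x * d - d)) = 0" "c + d \<in> F"
      using that x(1) by (auto simp: V_def intro!: N_null_add free_add free_diff)
    ultimately have "N (x * (c + d) - (c + d)) = 0" "c + d \<in> F" by (simp_all only:)
    then show ?thesis unfolding V_def by blast
  qed
  have Vscale: "poly_scale a c \<in> V" if "c \<in> V" for a c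
  proof -
    have "x * poly_scale a c - poly_scale a c = poly_scale a (x * c - c)"
      by (simp add: poly_scale_simps poly_scale_distrib)
    then show ?thesis using that x by (simp add: V_def N_scale free_intros)
  qed
  have Vy: "y j * c \<in> V" if "j \<in> J" "c \<in> V" for j c
  proof -
    have "c \<in> F" using that VF by auto
    then have "q j * (x * c) \<in> F" using q(1)[OF that(1)] x(1)[of c] free_mult by blast
    then have "N (x * (x * (q j * (x * c))) - x * (q j * (x * c))) = 0" by (rule x(5))
    moreover have "y j * c \<in> F" using y(1)[OF that(1)] \<open>c \<in> F\<close> by (rule free_mult)
    ultimately show ?thesis by (simp add: V_def y_def mult.assoc)
  qed
  \<comment> \<open>For a projection q j the C*-square of c - q j c is
    \<open>poly_star c * (c - q j * c)\<close> up to a null element; one factor of the norm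
    cancels.\<close>
  have qn: "N (c - q j * c) \<le> N c" if j: "j \<in> J" and c: "c \<in> F" for j c
  proof -
    note qj = q[OF j]
    have d: "c - q j * c \<in> F" using c qj by (simp add: free_intros)
    have "poly_star (c - q j * c) * (c - q j * c) =
       poly_star c * (c - q j * c) + poly_star c * ((q j * q j - q j) * c)"
      using qj by (simp add: poly_star_diff poly_star_mult algebra_simps)
    moreover have "N (poly_star c * ((q j * q j - q j) * c)) = 0"
      using c qj by (intro N_null_mult(2) N_null_mult(1)) (auto simp: free_intros)
    ultimately have "(N (c - q j * c))\<^sup>2 \<le> N (poly_star c * (c - q j * c))"
      using N_add[of "poly_star c * (c - q j * c)" "poly_star c * ((q j * q j - q j) * c)"] c qj d
      by (simp add: N_cstar[symmetric] free_intros)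
    also have "\<dots> \<le> N c * N (c - q j * c)"
      using N_mult[of "poly_star c" "c - q j * c"] c d by (simp add: N_star free_intros)
    finally show ?thesis using N_nonneg[OF d] N_nonneg[OF c]
      by (cases "N (c - q j * c) = 0") (auto simp: power2_eq_square)
  qed
  have yn: "N (c - y j * c) \<le> N c" if j: "j \<in> J" and c: "c \<in> V" for j c
  proof -
    note qj = q[OF j]
    have cF: "c \<in> F" and cx: "N (c - x * c) = 0"
      using c x by (auto simp: V_def N_diff_commute)
    have F': "c - q j * c \<in> F" "c - x * c \<in> F" "q j * (c - x * c) \<in> F" using cF qj(1) x(1) by (simp_all add: free_intros)
    have e: "c - y j * c = x * (c - q j * c) + ((c - x * c) + x * (q j * (c - x * c)))"
      by (simp add: y_def algebra_simps)
    have "N (x * (q j * (c - x * c))) = 0"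
      using x(4)[OF F'(3)] N_nonneg[OF x(1)[OF F'(3)]] N_null_mult(2)[of "q j" "c - x * c"] F' qj cx by simp
    then have "N ((c - x * c) + x * (q j * (c - x * c))) = 0"
      using F' x(1) cx by (intro N_null_add) auto
    then have "N (c - y j * c) \<le> N (x * (c - q j * c))"
      unfolding e using N_add[of "x * (c - q j * c)" "(c - x * c) + x * (q j * (c - x * c))"] F' x(1) by (simp add: free_intros)
    also have "\<dots> \<le> N (c - q j * c)" using x(4) F' by auto
    also have "\<dots> \<le> N c" using qn j cF by auto
    finally show ?thesis .
  qed
  \<comment> \<open>The y j add up to a null element, so y i c is minus the sum of the other y j c.
    Hence M c + y i c is c plus the contractions c - y j c over the other indices, up to a null
    element: M summands of norm at most \<open>N c\<close>.\<close>
  define M where "M = card (J - {i}) + 1"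
  have M: "real M \<ge> 1" by (simp add: M_def)
  have yp: "N (poly_scale (of_nat M) c + y i * c) \<le> real M * N c" if c: "c \<in> V" for c
  proof -
    have cF: "c \<in> F" using c VF by auto
    have F': "c - y j * c \<in> F" if "j \<in> J" for j using y[OF that] cF by (simp add: free_intros)
    have sF: "(\<Sum>j\<in>J. y j) * c \<in> F" using y(1) cF by (intro free_mult free_sum) auto
    have s0: "N ((\<Sum>j\<in>J. y j) * c) = 0"
      by (rule N_null_mult(1)) (use y(1) cF null in \<open>auto simp: y_def[symmetric] intro!: free_sum\<close>)
    have "(\<Sum>j\<in>J - {i}. c - y j * c) = poly_scale (of_nat (card (J - {i}))) c - (\<Sum>j\<in>J - {i}. y j * c)"
    proof -
      have "of_nat n * c = poly_scale (of_nat n) c" for n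
        by (induct n) (auto simp: poly_scale_simps poly_scale_distrib algebra_simps)
      then show ?thesis by (simp only: sum_subtractf sum_constant)
    qed
    also have "(\<Sum>j\<in>J - {i}. y j * c) = (\<Sum>j\<in>J. y j) * c - y i * c"
      using J i by (simp add: sum.remove[of J i] sum_distrib_right algebra_simps)
    finally have "poly_scale (of_nat M) c + y i * c = ((\<Sum>j\<in>J - {i}. c - y j * c) + (\<Sum>j\<in>J. y j) * c) + c"
      unfolding M_def by (simp add: poly_scale_distrib poly_scale_simps)
    also have "N \<dots> \<le> (N (\<Sum>j\<in>J - {i}. c - y j * c) + N ((\<Sum>j\<in>J. y j) * c)) + N c"
      using F' sF cF by (intro order_trans[OF N_add] add_mono N_add order_refl free_add free_sum) auto
    also have "N (\<Sum>j\<in>J - {i}. c - y j * c) \<le> (\<Sum>j\<in>J - {i}. N (c - y j * c))"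
      using F' by (intro N_sum) auto
    also have "\<dots> \<le> (\<Sum>j\<in>J - {i}. N c)" using yn c by (intro sum_mono) auto
    finally show ?thesis by (simp add: s0 M_def algebra_simps)
  qed
  \<comment> \<open>Division by M makes c + w c a contraction of c. Then c - w c is one too, being a
    convex combination of c and c - y i c.\<close>
  define w where "w = poly_scale (1 / of_nat M) (y i)"
  have wF: "w \<in> F" using y i by (simp add: w_def free_intros)
  have ws: "poly_star w = w" using y i by (simp add: w_def poly_star_scale)
  have Vw: "w * c \<in> V" if "c \<in> V" for c using Vscale[OF Vy[OF i that]] by (simp add: w_def poly_scale_simps)
  have p1: "N (c + w * c) \<le> N c" if c: "c \<in> V" for c
  proof -
    have cF: "c \<in> F" "y i * c \<in> F" using c VF y i by (auto intro!: free_intros)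
    have "c + w * c = poly_scale (1 / of_nat M) (poly_scale (of_nat M) c + y i * c)"
      using M by (simp add: w_def poly_scale_simps poly_scale_distrib)
    then have "N (c + w * c) = 1 / real M * N (poly_scale (of_nat M) c + y i * c)"
      using cF by (simp add: N_scale free_intros norm_divide)
    also have "\<dots> \<le> 1 / real M * (real M * N c)" by (intro mult_left_mono yp c) auto
    finally show ?thesis using M by simp
  qed
  have m1: "N (c - w * c) \<le> N c" if c: "c \<in> V" for c
  proof -
    have cF: "c \<in> F" "y i * c \<in> F" using c VF y i by (auto intro!: free_intros)
    have "c - w * c = poly_scale (of_real (1 - 1 / real M)) c + poly_scale (of_real (1 / real M)) (c - y i * c)"
      using M by (simp add: w_def poly_scale_simps poly_scale_distrib)
    then have "N (c - w * c) \<le> cmod (of_real (1 - 1 / real M)) * N c + cmod (of_real (1 / real M)) * N (c - y i * c)"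
      using N_add[of "poly_scale (of_real (1 - 1 / real M)) c" "poly_scale (of_real (1 / real M)) (c - y i * c)"] cF
      by (simp add: N_scale free_intros del: of_real_diff of_real_divide)
    also have "\<dots> = (1 - 1 / real M) * N c + (1 / real M) * N (c - y i * c)"
      using M by (simp add: norm_of_real del: of_real_diff of_real_divide)
    also have "\<dots> \<le> (1 - 1 / real M) * N c + (1 / real M) * N c"
      using yn[OF i c] M by (intro add_mono mult_left_mono) auto
    finally show ?thesis by (simp add: algebra_simps)
  qed
  \<comment> \<open>c + w w c is the mean of (1 + w)(1 + w) c and (1 - w)(1 - w) c.\<close>
  have sq: "N (c + w * (w * c)) \<le> N c" if c: "c \<in> V" for c
  proof -
    have cF: "c \<in> F" "w * c \<in> F" "w * (w * c) \<in> F" using c VF wF by (auto intro!: free_intros)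
    define A B where "A = (c + w * c) + w * (c + w * c)" and "B = (c - w * c) - w * (c - w * c)"
    have mV: "c - w * c \<in> V" using Vadd[OF c Vscale[OF Vw[OF c], of "-1"]] by (simp add: poly_scale_simps poly_scale_distrib)
    have AB: "A \<in> F" "B \<in> F" using cF wF by (auto simp: A_def B_def intro!: free_intros)
    have "N A \<le> N c" unfolding A_def using p1[OF Vadd[OF c Vw[OF c]]] p1[OF c] by simp
    moreover have "N B \<le> N c" unfolding B_def using m1[OF mV] m1[OF c] by simp
    moreover have "poly_scale 2 (c + w * (w * c)) = A + B"
    proof -
      have "poly_scale 2 z = z + z" for z :: "'g star_poly"
        using poly_scale_distrib(3)[of 1 1 z] by (simp add: poly_scale_simps)
      then show ?thesis by (simp add: A_def B_def algebra_simps)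
    qed
    then have "2 * N (c + w * (w * c)) \<le> N A + N B"
      using N_add[OF AB] N_scale[of "c + w * (w * c)" 2] cF by (simp add: free_intros)
    ultimately show ?thesis by simp
  qed
  \<comment> \<open>For imaginary a the terms linear in w cancel in \<open>poly_star d * d\<close>,
    because w is self-adjoint; what remains is controlled by \<open>sq\<close>.\<close>
  have im: "N (c + poly_scale a (w * c)) \<le> N c" if c: "c \<in> V" and a: "a = \<i> \<or> a = -\<i>" for c a
  proof -
    have cF: "c \<in> F" "w * c \<in> F" "w * (w * c) \<in> F" using c VF wF by (auto intro!: free_intros)
    define d where "d = c + poly_scale a (w * c)"
    have dF: "d \<in> F" using cF by (simp add: d_def free_intros)
    have "poly_star d = poly_star c + poly_scale (cnj a) (poly_star c * w)"
      using ws by (simp add: d_def poly_star_add poly_star_scale poly_star_mult)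
    then have "poly_star d * d = poly_star c * c + (poly_scale a (poly_star c * (w * c)) +
        poly_scale (cnj a) (poly_star c * (w * c))) + poly_scale (a * cnj a) (poly_star c * (w * (w * c)))"
      by (simp add: d_def distrib_left distrib_right poly_scale_simps poly_scale_distrib(1) mult.assoc add.assoc)
    also have "\<dots> = poly_star c * (c + w * (w * c))"
      using a by (auto simp: poly_scale_simps distrib_left simp flip: poly_scale_distrib(3))
    finally have "(N d)\<^sup>2 = N (poly_star c * (c + w * (w * c)))" using N_cstar[OF dF] by simp
    also have "\<dots> \<le> N c * N (c + w * (w * c))"
      using N_mult[of "poly_star c" "c + w * (w * c)"] cF N_star[OF cF(1)] by (simp add: free_star free_add)
    also have "\<dots> \<le> N c * N c" using sq[OF c] N_nonneg[OF cF(1)] by (rule mult_left_mono)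
    finally have "(N d)\<^sup>2 \<le> (N c)\<^sup>2" by (simp add: power2_eq_square)
    then have "N d \<le> N c" using N_nonneg[OF cF(1)] by (rule power2_le_imp_le)
    then show ?thesis by (simp add: d_def)
  qed
  have wV: "N (w * c) = 0" if "c \<in> V" for c
    by (rule bohnenblust_karlin[OF VF wF Vadd Vscale Vw _ that])
      (use p1 m1 im in \<open>auto simp: poly_scale_simps poly_scale_distrib\<close>)
  \<comment> \<open>With c = y i itself, w y i is null. So y i is self-adjoint with null square, and
    the C*-identity makes it null.\<close>
  have yV: "y i \<in> V"
  proof -
    have "q i * x \<in> F" using q i x by auto
    then have "N (x * (x * (q i * x)) - x * (q i * x)) = 0" by (rule x(5))
    then show ?thesis using y i by (simp add: V_def y_def mult.assoc)
  qed
  have yF: "y i \<in> F" using y i by auto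
  have "N (poly_scale (of_nat M) (w * y i)) = 0" using wV[OF yV] wF yF by (simp add: N_scale free_intros)
  then have "N (poly_star (y i) * y i) = 0" using M y i by (simp add: w_def poly_scale_simps)
  then have "N (y i) = 0" using N_cstar[OF yF] by simp
  \<comment> \<open>The C*-square of q i x is x q i x up to a null element, which carries the result
    from y i to q i x.\<close>
  moreover have "N (poly_star (q i * x) * (q i * x)) = N (y i)"
  proof (rule N_eq)
    have "poly_star (q i * x) * (q i * x) - y i = x * ((q i * q i - q i) * x)"
      using q i x by (simp add: poly_star_mult y_def algebra_simps)
    moreover have dF: "(q i * q i - q i) * x \<in> F" using q i by (intro x(2) free_diff free_mult) auto
    have "N (q i * q i - q i) = 0" using q i by auto
    then have "N ((q i * q i - q i) * x) = 0"
    proof -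
      assume 0: "N (q i * q i - q i) = 0"
      have d: "q i * q i - q i \<in> F" using q i by (auto intro!: free_intros)
      have "N (poly_star ((q i * q i - q i) * x)) \<le> N (poly_star (q i * q i - q i))"
        using x(4)[OF free_star[OF d]] x(3) by (simp add: poly_star_mult)
      then show ?thesis using N_star[OF d] N_star[OF dF] 0 N_nonneg[OF dF] by simp
    qed
    then have "N (x * ((q i * q i - q i) * x)) = 0"
      using x(4)[OF dF] N_nonneg[OF x(1)[OF dF]] by simp
    ultimately show "N (poly_star (q i * x) * (q i * x) - y i) = 0" by simp
  next
    have "q i * x \<in> F" using q i x(2) by auto
    then show "poly_star (q i * x) * (q i * x) \<in> F" by (intro free_mult[of "poly_star (q i * x)"] free_star)
  qed (rule yF)
  moreover have "q i * x \<in> F" using q i x by auto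
  ultimately show ?thesis using N_cstar[of "q i * x"] by simp
qed

text \<open>Let s be the sum of the q j. Their compressions by 1 - s add up to a null element, so
  each q i lies below s. Then the compressions of the other q j by q i add up to q i s q i - q i,
  which is null again.\<close>

lemma projections_with_projection_sum:
  fixes q :: "'j => 'g star_poly"
  assumes J: "finite J"
    and q: "!!j. j \<in> J ==> q j \<in> F" "!!j. j \<in> J ==> poly_star (q j) = q j"
      "!!j. j \<in> J ==> N (q j * q j - q j) = 0"
    and p: "N ((\<Sum>j\<in>J. q j) * (\<Sum>j\<in>J. q j) - (\<Sum>j\<in>J. q j)) = 0"
  shows "i \<in> J ==> N ((\<Sum>j\<in>J. q j) * q i - q i) = 0"
    and "i \<in> J ==> k \<in> J ==> i \<noteq> k ==> N (q k * q i) = 0"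
proof -
  define s where "s = (\<Sum>j\<in>J. q j)"
  have s: "s \<in> F" "poly_star s = s" "N (s * s - s) = 0"
    using q p by (auto simp: s_def poly_star_sum intro!: free_sum)
  have qn: "N (t * c) \<le> N c" "N (c - t * c) \<le> N c"
    if t: "t \<in> F" "poly_star t = t" "N (t * t - t) = 0" and c: "c \<in> F" for t c
  proof -
    have 0: "N (poly_star c * ((t * t - t) * c)) = 0"
      using c t by (intro N_null_mult(2) N_null_mult(1)) (auto simp: free_intros)
    { fix d assume dF: "d \<in> F" and eq: "poly_star d * d = poly_star c * d + poly_star c * ((t * t - t) * c)"
      have "(N d)\<^sup>2 \<le> N (poly_star c * d)"
        using N_add[of "poly_star c * d" "poly_star c * ((t * t - t) * c)"] c t dF eq 0
        by (simp add: N_cstar[symmetric] free_intros)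
      also have "\<dots> \<le> N c * N d"
        using N_mult[of "poly_star c" d] c dF by (simp add: N_star free_intros)
      finally have "N d \<le> N c" using N_nonneg[OF dF] N_nonneg[OF c]
        by (cases "N d = 0") (auto simp: power2_eq_square) }
    note * = this
    show "N (t * c) \<le> N c" "N (c - t * c) \<le> N c"
      by (rule *; use t c in \<open>simp add: free_intros poly_star_diff poly_star_mult algebra_simps\<close>)+
  qed
  have one: "N (q i * (1 - s)) = 0" if i: "i \<in> J" for i
  proof (rule compressions_sum_null[OF J i q])
    show "(1 - s) * c \<in> F" "c * (1 - s) \<in> F" if "c \<in> F" for c
      using s that by (auto simp: algebra_simps intro!: free_intros)
    show "poly_star (1 - s) = 1 - s" using s by (simp add: poly_star_diff)
    show "N ((1 - s) * c) \<le> N c" if "c \<in> F" for c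
      using qn(2)[OF s that] by (simp add: algebra_simps)
    show "N ((1 - s) * ((1 - s) * c) - (1 - s) * c) = 0" if "c \<in> F" for c
    proof -
      have "(1 - s) * ((1 - s) * c) - (1 - s) * c = (s * s - s) * c" by (simp add: algebra_simps)
      then show ?thesis using N_null_mult(1)[of "s * s - s" c] s that by (simp add: free_intros)
    qed
    have "(\<Sum>j\<in>J. (1 - s) * q j * (1 - s)) = (1 - s) * s * (1 - s)"
      by (simp add: s_def sum_distrib_left sum_distrib_right)
    also have "\<dots> = (s * s - s) * s - (s * s - s)" by (simp add: algebra_simps)
    finally have e: "(\<Sum>j\<in>J. (1 - s) * q j * (1 - s)) = (s * s - s) * s - (s * s - s)" .
    have "s * s - s \<in> F" "(s * s - s) * s \<in> F" using s by (auto intro!: free_intros)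
    then show "N (\<Sum>j\<in>J. (1 - s) * q j * (1 - s)) = 0"
      unfolding e using N_null_mult(1)[of "s * s - s" s] s by (metis N_null_diff)
  qed auto
  have sq: "N (s * q i - q i) = 0" if i: "i \<in> J" for i
  proof -
    have e: "poly_star (q i * (1 - s)) = - (s * q i - q i)"
      using q i s by (simp add: poly_star_mult poly_star_diff algebra_simps)
    have F': "q i * (1 - s) \<in> F" "s * q i - q i \<in> F" using q i s by (auto simp: algebra_simps intro!: free_intros)
    show ?thesis using N_star[OF F'(1)] N_uminus[OF F'(2)] one[OF i] by (simp add: e)
  qed
  then show "i \<in> J ==> N ((\<Sum>j\<in>J. q j) * q i - q i) = 0" by (simp add: s_def)
  show "N (q k * q i) = 0" if i: "i \<in> J" and k: "k \<in> J" and ik: "i \<noteq> k"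
  proof (rule compressions_sum_null[where J = "J - {i}"])
    show "finite (J - {i})" "k \<in> J - {i}" using J k ik by auto
    show "q i * c \<in> F" "c * q i \<in> F" if "c \<in> F" for c using q i that by (auto intro!: free_intros)
    show "poly_star (q i) = q i" using q i by auto
    show "N (q i * c) \<le> N c" if "c \<in> F" for c using qn(1)[of "q i" c] q i that by auto
    show "N (q i * (q i * c) - q i * c) = 0" if "c \<in> F" for c
    proof -
      have "q i * (q i * c) - q i * c = (q i * q i - q i) * c" by (simp add: algebra_simps)
      then show ?thesis using N_null_mult(1)[of "q i * q i - q i" c] q i that by (simp add: free_intros)
    qed
    have "(\<Sum>j\<in>J - {i}. q i * q j * q i) = q i * s * q i - q i * q i * q i"
      using J i by (simp add: s_def sum_distrib_left sum_distrib_right sum.remove[of J i] algebra_simps)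
    also have "\<dots> = q i * (s * q i - q i) - q i * (q i * q i - q i)" by (simp add: algebra_simps)
    finally show "N (\<Sum>j\<in>J - {i}. q i * q j * q i) = 0"
      using q[OF i] s sq[OF i] by (auto intro!: N_null_diff N_null_mult(2) free_intros)
  qed (use q in auto)
qed

end

no_notation vwalk_join (infixr "\<oplus>" 65)

section \<open>Unital C*-algebras\<close>

text \<open>The norm is a parameter because \<open>star_algebra\<close> carries none. The square
  roots constructed below stand in for continuous functional calculus.\<close>

locale cstar_algebra = ring A for A :: "'a star_algebra" (structure) +
  fixes nrm :: "'a => real"
  assumes smult_closed [simp]: "a \<in> carrier A ==> c \<odot> a \<in> carrier A"
    and smult_l_distr: "a \<in> carrier A ==> (c + d) \<odot> a = c \<odot> a \<oplus> d \<odot> a"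
    and smult_r_distr: "a \<in> carrier A ==> b \<in> carrier A ==> c \<odot> (a \<oplus> b) = c \<odot> a \<oplus> c \<odot> b"
    and smult_smult: "a \<in> carrier A ==> c \<odot> (d \<odot> a) = (c * d) \<odot> a"
    and smult_one [simp]: "a \<in> carrier A ==> 1 \<odot> a = a"
    and smult_mult_l: "a \<in> carrier A ==> b \<in> carrier A ==> (c \<odot> a) \<otimes> b = c \<odot> (a \<otimes> b)"
    and smult_mult_r: "a \<in> carrier A ==> b \<in> carrier A ==> a \<otimes> (c \<odot> b) = c \<odot> (a \<otimes> b)"
    and star_closed [simp]: "a \<in> carrier A ==> star A a \<in> carrier A"
    and star_add: "a \<in> carrier A ==> b \<in> carrier A ==> star A (a \<oplus> b) = star A a \<oplus> star A b"
    and star_mult: "a \<in> carrier A ==> b \<in> carrier A ==> star A (a \<otimes> b) = star A b \<otimes> star A a"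
    and star_smult: "a \<in> carrier A ==> star A (c \<odot> a) = cnj c \<odot> star A a"
    and star_star [simp]: "a \<in> carrier A ==> star A (star A a) = a"
    and nrm_nonneg: "a \<in> carrier A ==> 0 \<le> nrm a"
    and nrm_eq_zero: "a \<in> carrier A ==> nrm a = 0 ==> a = \<zero>"
    and nrm_add: "a \<in> carrier A ==> b \<in> carrier A ==> nrm (a \<oplus> b) \<le> nrm a + nrm b"
    and nrm_smult: "a \<in> carrier A ==> nrm (c \<odot> a) = cmod c * nrm a"
    and nrm_mult: "a \<in> carrier A ==> b \<in> carrier A ==> nrm (a \<otimes> b) \<le> nrm a * nrm b"
    and nrm_cstar: "a \<in> carrier A ==> nrm (star A a \<otimes> a) = (nrm a)\<^sup>2"
    and complete: "(!!n::nat. x n \<in> carrier A) ==>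
      (!!e. e > 0 ==> \<exists>M. \<forall>m\<ge>M. \<forall>n\<ge>M. nrm (x m \<ominus> x n) < e) ==>
      \<exists>a\<in>carrier A. (\<lambda>n. nrm (x n \<ominus> a)) \<longlonglongrightarrow> 0"
begin

lemma smult_zero_l [simp]: "a \<in> carrier A ==> 0 \<odot> a = \<zero>"
  using smult_l_distr[of a 0 0] by (metis add.l_cancel_one' add_0 smult_closed)

lemma smult_zero_r [simp]: "c \<odot> \<zero> = \<zero>"
  using smult_r_distr[of \<zero> \<zero> c] by (metis add.l_cancel_one' zero_closed l_zero smult_closed)

lemma smult_minus1: "a \<in> carrier A ==> (-1) \<odot> a = \<ominus> a"
  using smult_l_distr[of a "-1" 1] by (intro minus_equality[symmetric]) auto

lemma smult_minus_r: "a \<in> carrier A ==> c \<odot> (\<ominus> a) = \<ominus> (c \<odot> a)"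
  by (metis mult.commute smult_closed smult_minus1 smult_smult)

lemma smult_diff_r: "a \<in> carrier A ==> b \<in> carrier A ==> c \<odot> (a \<ominus> b) = c \<odot> a \<ominus> c \<odot> b"
  by (simp add: minus_eq smult_r_distr smult_minus_r)

lemma star_zero [simp]: "star A \<zero> = \<zero>"
  using star_smult[of \<zero> 0] by simp

lemma star_minus: "a \<in> carrier A ==> star A (\<ominus> a) = \<ominus> star A a"
  using star_smult[of a "-1"] by (simp add: smult_minus1)

lemma star_diff: "a \<in> carrier A ==> b \<in> carrier A ==> star A (a \<ominus> b) = star A a \<ominus> star A b"
  by (simp add: minus_eq star_add star_minus)

lemma star_one [simp]: "star A \<one> = \<one>"
  by (metis l_one one_closed r_one star_closed star_mult star_star)

lemma nrm_zero [simp]: "nrm \<zero> = 0"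
  using nrm_smult[of \<zero> 0] by simp

lemma nrm_minus: "a \<in> carrier A ==> nrm (\<ominus> a) = nrm a"
  using nrm_smult[of a "-1"] by (simp add: smult_minus1)

lemma nrm_diff_commute: "a \<in> carrier A ==> b \<in> carrier A ==> nrm (a \<ominus> b) = nrm (b \<ominus> a)"
  using nrm_minus[of "a \<ominus> b"] by (simp add: minus_eq minus_add a_comm)

lemma diff_telescope: "a \<in> carrier A ==> b \<in> carrier A ==> c \<in> carrier A ==> a \<ominus> c = (a \<ominus> b) \<oplus> (b \<ominus> c)"
  by algebra

lemma nrm_triangle: "a \<in> carrier A ==> b \<in> carrier A ==> c \<in> carrier A ==>
    nrm (a \<ominus> c) \<le> nrm (a \<ominus> b) + nrm (b \<ominus> c)"
  using nrm_add[of "a \<ominus> b" "b \<ominus> c"] diff_telescope[of a b c] by simp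

lemma nrm_triangle2: "a \<in> carrier A ==> b \<in> carrier A ==> nrm a \<le> nrm (a \<ominus> b) + nrm b"
proof -
  assume ab: "a \<in> carrier A" "b \<in> carrier A"
  then have "a = (a \<ominus> b) \<oplus> b" by algebra
  then show ?thesis using nrm_add[of "a \<ominus> b" b] ab by simp
qed

lemma diff_eq_zero: "a \<in> carrier A ==> b \<in> carrier A ==> nrm (a \<ominus> b) = 0 ==> a = b"
proof -
  assume ab: "a \<in> carrier A" "b \<in> carrier A" and 0: "nrm (a \<ominus> b) = 0"
  have "a = (a \<ominus> b) \<oplus> b" using ab by algebra
  moreover have "a \<ominus> b = \<zero>" using ab 0 by (intro nrm_eq_zero) auto
  ultimately show "a = b" using ab by simp
qed

lemma nrm_star: "a \<in> carrier A ==> nrm (star A a) = nrm a"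
proof -
  have *: "nrm a \<le> nrm (star A a)" if a: "a \<in> carrier A" for a
  proof -
    have "(nrm a)\<^sup>2 \<le> nrm (star A a) * nrm a" using nrm_mult[of "star A a" a] a by (simp add: nrm_cstar)
    then show ?thesis using nrm_nonneg[OF a] nrm_nonneg[OF star_closed[OF a]]
      by (cases "nrm a = 0") (auto simp: power2_eq_square)
  qed
  show "a \<in> carrier A ==> ?thesis" using *[of a] *[of "star A a"] by simp
qed

lemma nrm_projection: "p \<in> carrier A ==> star A p \<otimes> p = p ==> nrm p \<le> 1"
  using nrm_cstar[of p] nrm_nonneg[of p] by (cases "nrm p = 0") (auto simp: power2_eq_square)

lemma nrm_finsum: "finite I ==> (!!i. i \<in> I ==> f i \<in> carrier A) ==> nrm (finsum A f I) \<le> (\<Sum>i\<in>I. nrm (f i))"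
proof (induct I rule: finite_induct)
  case (insert i I)
  then have "f \<in> I \<rightarrow> carrier A" by auto
  then show ?case using insert nrm_add[of "f i" "finsum A f I"] by (force simp: finsum_closed)
qed auto

lemma smult_finsum: "finite I ==> (!!i. i \<in> I ==> f i \<in> carrier A) ==>
   c \<odot> finsum A f I = finsum A (\<lambda>i. c \<odot> f i) I"
proof (induct I rule: finite_induct)
  case (insert i I)
  then have "f \<in> I \<rightarrow> carrier A" by auto
  then show ?case using insert by (simp add: smult_r_distr Pi_def)
qed simp

lemma star_finsum: "finite I ==> (!!i. i \<in> I ==> f i \<in> carrier A) ==>
   star A (finsum A f I) = finsum A (\<lambda>i. star A (f i)) I"
proof (induct I rule: finite_induct)
  case (insert i I)
  then have "f \<in> I \<rightarrow> carrier A" by auto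
  then show ?case using insert by (simp add: star_add Pi_def)
qed simp

section \<open>Convergence in norm\<close>

definition conv :: "(nat => 'a) => 'a => bool" where
  "conv x a \<longleftrightarrow> range x \<subseteq> carrier A \<and> a \<in> carrier A \<and> (\<lambda>n. nrm (x n \<ominus> a)) \<longlonglongrightarrow> 0"

lemma convD: "conv x a ==> x n \<in> carrier A" "conv x a ==> a \<in> carrier A"
  "conv x a ==> (\<lambda>n. nrm (x n \<ominus> a)) \<longlonglongrightarrow> 0"
  by (auto simp: conv_def)

lemma convI:
  assumes "!!n. x n \<in> carrier A" "a \<in> carrier A" "!!n. nrm (x n \<ominus> a) \<le> g n" "g \<longlonglongrightarrow> 0"
  shows "conv x a"
  unfolding conv_def
proof (intro conjI)
  show "(\<lambda>n. nrm (x n \<ominus> a)) \<longlonglongrightarrow> 0"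
    by (rule tendsto_sandwich[OF _ _ tendsto_const assms(4)]) (use assms in \<open>auto simp: nrm_nonneg\<close>)
qed (use assms in auto)

lemma conv_const: "a \<in> carrier A ==> conv (\<lambda>n. a) a"
  by (rule convI[where g = "\<lambda>n. 0"]) (auto simp: r_neg minus_eq)

lemma conv_unique: "conv x a ==> conv x b ==> a = b"
proof -
  assume a: "conv x a" and b: "conv x b"
  have "(\<lambda>n. nrm (x n \<ominus> a) + nrm (x n \<ominus> b)) \<longlonglongrightarrow> 0" using tendsto_add[OF convD(3)[OF a] convD(3)[OF b]] by simp
  moreover have "nrm (a \<ominus> b) \<le> nrm (x n \<ominus> a) + nrm (x n \<ominus> b)" for n
    using nrm_triangle[of a "x n" b] nrm_diff_commute[of a "x n"] convD[OF a] convD[OF b] by simp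
  ultimately have "nrm (a \<ominus> b) \<le> 0" by (intro LIMSEQ_le_const) auto
  then show ?thesis using nrm_nonneg[of "a \<ominus> b"] convD[OF a] convD[OF b] by (auto intro: diff_eq_zero)
qed

lemma conv_add: "conv x a ==> conv y b ==> conv (\<lambda>n. x n \<oplus> y n) (a \<oplus> b)"
proof -
  assume a: "conv x a" and b: "conv y b"
  show ?thesis
  proof (rule convI)
    show "(\<lambda>n. nrm (x n \<ominus> a) + nrm (y n \<ominus> b)) \<longlonglongrightarrow> 0"
      using tendsto_add[OF convD(3)[OF a] convD(3)[OF b]] by simp
    fix n
    have "x n \<oplus> y n \<ominus> (a \<oplus> b) = (x n \<ominus> a) \<oplus> (y n \<ominus> b)"
      using convD(1,2)[OF a] convD(1,2)[OF b] by (auto simp: minus_eq minus_add a_ac)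
    then show "nrm (x n \<oplus> y n \<ominus> (a \<oplus> b)) \<le> nrm (x n \<ominus> a) + nrm (y n \<ominus> b)"
      using nrm_add convD(1,2)[OF a] convD(1,2)[OF b] by simp
  qed (use convD[OF a] convD[OF b] in auto)
qed

lemma conv_smult: "conv x a ==> conv (\<lambda>n. c \<odot> x n) (c \<odot> a)"
proof -
  assume a: "conv x a"
  show ?thesis
  proof (rule convI)
    show "(\<lambda>n. cmod c * nrm (x n \<ominus> a)) \<longlonglongrightarrow> 0"
      using tendsto_mult_right_zero[OF convD(3)[OF a]] by simp
  qed (use convD[OF a] in \<open>auto simp: nrm_smult simp flip: smult_diff_r\<close>)
qed

lemma conv_star: "conv x a ==> conv (\<lambda>n. star A (x n)) (star A a)"
  unfolding conv_def by (auto simp: nrm_star image_subset_iff simp flip: star_diff)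

lemma conv_bounded: "conv x a ==> \<exists>K. \<forall>n. nrm (x n) \<le> K"
proof -
  assume a: "conv x a"
  then have "Bseq (\<lambda>n. nrm (x n \<ominus> a))" by (auto dest!: convD(3) intro: convergent_imp_Bseq convergentI)
  then obtain K where "\<forall>n. norm (nrm (x n \<ominus> a)) \<le> K" by (auto simp: Bseq_def)
  then have "\<forall>n. nrm (x n) \<le> K + nrm a" using nrm_triangle2[of "x n" a for n] convD[OF a]
    by (smt (verit) real_norm_def)
  then show ?thesis by blast
qed

lemma conv_mult: "conv x a ==> conv y b ==> conv (\<lambda>n. x n \<otimes> y n) (a \<otimes> b)"
proof -
  assume a: "conv x a" and b: "conv y b"
  obtain K where K: "!!n. nrm (x n) \<le> K" using conv_bounded[OF a] by auto
  note c = convD(1,2)[OF a] convD(1,2)[OF b]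
  show ?thesis
  proof (rule convI)
    show "(\<lambda>n. K * nrm (y n \<ominus> b) + nrm (x n \<ominus> a) * nrm b) \<longlonglongrightarrow> 0"
      using tendsto_add[OF tendsto_mult_right_zero[OF convD(3)[OF b]] tendsto_mult_left_zero[OF convD(3)[OF a]]] by simp
    fix n
    have "x n \<otimes> y n \<ominus> a \<otimes> b = x n \<otimes> (y n \<ominus> b) \<oplus> (x n \<ominus> a) \<otimes> b"
      using c(1)[of n] c(2) c(3)[of n] c(4) by algebra
    then have "nrm (x n \<otimes> y n \<ominus> a \<otimes> b) \<le> nrm (x n) * nrm (y n \<ominus> b) + nrm (x n \<ominus> a) * nrm b"
      using c nrm_add[of "x n \<otimes> (y n \<ominus> b)" "(x n \<ominus> a) \<otimes> b"] nrm_mult[of "x n" "y n \<ominus> b"] nrm_mult[of "x n \<ominus> a" b]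
      by simp
    also have "nrm (x n) * nrm (y n \<ominus> b) \<le> K * nrm (y n \<ominus> b)"
      using c K by (intro mult_right_mono) (auto simp: nrm_nonneg)
    finally show "nrm (x n \<otimes> y n \<ominus> a \<otimes> b) \<le> K * nrm (y n \<ominus> b) + nrm (x n \<ominus> a) * nrm b" by simp
  qed (use c in auto)
qed

lemma conv_Suc: "conv x a ==> conv (\<lambda>n. x (Suc n)) a"
  unfolding conv_def using LIMSEQ_Suc by fastforce

text \<open>The iteration \<open>c \<mapsto> (h + c\<^sup>2) / 2\<close> converges to \<open>1 - (1 - h)\<^sup>1\<^sup>/\<^sup>2\<close>.\<close>

lemma square_root_of_one_minus:
  assumes h: "h \<in> carrier A" "star A h = h" "nrm h < 1"
  obtains b where "b \<in> carrier A" "star A b = b" "b \<otimes> b = \<one> \<ominus> h"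
    "!!k. k \<in> carrier A ==> k \<otimes> h = h \<otimes> k ==> k \<otimes> b = b \<otimes> k"
proof -
  define g where "g x = (1/2) \<odot> (h \<oplus> x \<otimes> x)" for x
  define c where "c n = (g ^^ n) \<zero>" for n
  have cs: "c 0 = \<zero>" "c (Suc n) = g (c n)" for n by (auto simp: c_def)
  \<comment> \<open>r is the smaller fixed point of t \<mapsto> (nrm h + t^2) / 2. The ball of
    radius r is mapped to itself, and on it the map is a contraction with the same constant
    r.\<close>
  define r where "r = 1 - sqrt (1 - nrm h)"
  have r: "0 \<le> r" "r < 1" "(nrm h + r\<^sup>2) / 2 = r"
    using h nrm_nonneg[OF h(1)] by (auto simp: r_def power2_diff)
  have g: "g x \<in> carrier A" if "x \<in> carrier A" for x using h that by (simp add: g_def)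
  have cc [simp]: "c n \<in> carrier A" for n by (induct n) (auto simp: cs g)
  have gr: "nrm (g x) \<le> r" if "x \<in> carrier A" "nrm x \<le> r" for x
  proof -
    have "nrm (g x) = (1/2) * nrm (h \<oplus> x \<otimes> x)" using that h by (simp add: g_def nrm_smult)
    also have "nrm (h \<oplus> x \<otimes> x) \<le> nrm h + nrm x * nrm x"
      using nrm_add[of h "x \<otimes> x"] nrm_mult[of x x] that h by simp
    also have "nrm x * nrm x \<le> r\<^sup>2" using that nrm_nonneg by (auto simp: power2_eq_square intro!: mult_mono r)
    finally show ?thesis using r(3) by simp
  qed
  have cr: "nrm (c n) \<le> r" for n by (induct n) (auto simp: cs gr r)
  have contr: "nrm (g x \<ominus> g y) \<le> r * nrm (x \<ominus> y)"
    if x: "x \<in> carrier A" "nrm x \<le> r" and y: "y \<in> carrier A" "nrm y \<le> r" for x y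
  proof -
    have "g x \<ominus> g y = (1/2) \<odot> (x \<otimes> (x \<ominus> y) \<oplus> (x \<ominus> y) \<otimes> y)"
    proof -
      have "(h \<oplus> x \<otimes> x) \<ominus> (h \<oplus> y \<otimes> y) = x \<otimes> (x \<ominus> y) \<oplus> (x \<ominus> y) \<otimes> y"
        using x(1) y(1) h(1) by algebra
      then show ?thesis unfolding g_def using x y h by (simp flip: smult_diff_r)
    qed
    then have "nrm (g x \<ominus> g y) = (1/2) * nrm (x \<otimes> (x \<ominus> y) \<oplus> (x \<ominus> y) \<otimes> y)"
      using x y by (simp add: nrm_smult)
    also have "\<dots> \<le> (1/2) * (nrm x * nrm (x \<ominus> y) + nrm (x \<ominus> y) * nrm y)"
      using nrm_add[of "x \<otimes> (x \<ominus> y)" "(x \<ominus> y) \<otimes> y"] nrm_mult[of x "x \<ominus> y"] nrm_mult[of "x \<ominus> y" y] x y by simp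
    also have "\<dots> \<le> (1/2) * (r * nrm (x \<ominus> y) + nrm (x \<ominus> y) * r)"
      using x y by (intro mult_left_mono add_mono mult_right_mono) (auto simp: nrm_nonneg)
    finally show ?thesis by simp
  qed
  have step: "nrm (c (k + n) \<ominus> c n) \<le> r ^ n" for k n
  proof (induct n)
    case 0
    then show ?case using cr[of k] r by (simp add: cs minus_eq)
  next
    case (Suc n)
    have "nrm (c (k + Suc n) \<ominus> c (Suc n)) \<le> r * nrm (c (k + n) \<ominus> c n)"
      using contr[of "c (k + n)" "c n"] cr by (simp add: cs)
    also have "\<dots> \<le> r * r ^ n" using Suc r by (intro mult_left_mono)
    finally show ?case by simp
  qed
  have "\<exists>a\<in>carrier A. (\<lambda>n. nrm (c n \<ominus> a)) \<longlonglongrightarrow> 0"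
  proof (rule complete)
    fix e :: real assume e: "e > 0"
    have "(\<lambda>n. r ^ n) \<longlonglongrightarrow> 0" using r by (intro LIMSEQ_power_zero) auto
    then have "\<forall>\<^sub>F n in sequentially. r ^ n < e / 2" using e by (intro order_tendstoD) auto
    then obtain M where M: "r ^ M < e / 2" using eventually_happens' sequentially_bot by blast
    have "nrm (c m \<ominus> c n) < e" if "m \<ge> M" "n \<ge> M" for m n
    proof -
      have "nrm (c m \<ominus> c n) \<le> nrm (c m \<ominus> c M) + nrm (c n \<ominus> c M)"
        using nrm_triangle[of "c m" "c M" "c n"] nrm_diff_commute[of "c n" "c M"] by simp
      also have "\<dots> \<le> r ^ M + r ^ M"
        using step[of "m - M" M] step[of "n - M" M] that by simp
      finally show ?thesis using M by simp
    qed
    then show "\<exists>M. \<forall>m\<ge>M. \<forall>n\<ge>M. nrm (c m \<ominus> c n) < e" by blast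
  qed auto
  then obtain d where "d \<in> carrier A" "(\<lambda>n. nrm (c n \<ominus> d)) \<longlonglongrightarrow> 0" by blast
  then have d: "conv c d" by (auto simp: conv_def)
  have dc [simp]: "d \<in> carrier A" using d by (rule convD)
  have "conv (\<lambda>n. g (c n)) (g d)"
    unfolding g_def using h by (intro conv_smult conv_add conv_mult d conv_const)
  then have gd: "g d = d" using conv_Suc[OF d] by (auto simp: cs intro: conv_unique)
  \<comment> \<open>The fixed point equation 2 d = h + d^2, that is, 1 - d is a square root of 1 -
    h.\<close>
  have dd: "d \<oplus> d = h \<oplus> d \<otimes> d"
  proof -
    have "d \<oplus> d = 2 \<odot> g d" using smult_l_distr[of d 1 1] gd by simp
    also have "\<dots> = h \<oplus> d \<otimes> d" using h by (simp add: g_def smult_smult)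
    finally show ?thesis .
  qed
  have ds: "star A d = d"
  proof -
    have "star A (c n) = c n" for n
      by (induct n) (use h in \<open>auto simp: cs g_def star_smult star_add star_mult\<close>)
    then have "conv c (star A d)" using conv_star[OF d] by simp
    then show ?thesis using d conv_unique by blast
  qed
  show ?thesis
  proof (rule that[of "\<one> \<ominus> d"])
    have "(\<one> \<ominus> d) \<otimes> (\<one> \<ominus> d) = \<one> \<ominus> (d \<oplus> d \<ominus> d \<otimes> d)" using dc
      by (simp add: minus_eq l_distr r_distr l_minus r_minus minus_add minus_minus a_ac)
    also have "d \<oplus> d \<ominus> d \<otimes> d = h" using dd h(1) dc by algebra
    finally show "(\<one> \<ominus> d) \<otimes> (\<one> \<ominus> d) = \<one> \<ominus> h" .
    \<comment> \<open>The iterates are polynomials in h, so whatever commutes with h commutes with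
      them and with their limit.\<close>
    fix k assume k: "k \<in> carrier A" "k \<otimes> h = h \<otimes> k"
    have kc: "k \<otimes> c n = c n \<otimes> k" for n
    proof (induct n)
      case (Suc n)
      have "k \<otimes> (c n \<otimes> c n) = (c n \<otimes> c n) \<otimes> k" using Suc k by (metis cc m_assoc)
      then show ?case using k h by (simp add: cs g_def smult_mult_l smult_mult_r l_distr r_distr)
    qed (use k in \<open>simp add: cs\<close>)
    have "conv (\<lambda>n. k \<otimes> c n) (k \<otimes> d)" "conv (\<lambda>n. c n \<otimes> k) (d \<otimes> k)"
      using k by (auto intro!: conv_mult conv_const d)
    then have "k \<otimes> d = d \<otimes> k" using kc conv_unique by auto
    then show "k \<otimes> (\<one> \<ominus> d) = (\<one> \<ominus> d) \<otimes> k" using k(1) dc by (simp add: minus_eq l_distr r_distr l_minus r_minus)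
  qed (auto simp: star_diff ds)
qed

section \<open>Positive functionals and their automatic continuity\<close>

definition positive_functional :: "('a => complex) => bool" where
  "positive_functional \<omega> \<longleftrightarrow>
     (\<forall>a\<in>carrier A. \<forall>b\<in>carrier A. \<omega> (a \<oplus> b) = \<omega> a + \<omega> b) \<and>
     (\<forall>c. \<forall>a\<in>carrier A. \<omega> (c \<odot> a) = c * \<omega> a) \<and>
     (\<forall>a\<in>carrier A. \<omega> (star A a \<otimes> a) \<in> \<real>\<^sub>\<ge>\<^sub>0)"

context
  fixes \<omega> assumes \<omega>: "positive_functional \<omega>"
begin

lemma pf_add: "a \<in> carrier A ==> b \<in> carrier A ==> \<omega> (a \<oplus> b) = \<omega> a + \<omega> b"
  and pf_smult: "a \<in> carrier A ==> \<omega> (c \<odot> a) = c * \<omega> a"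
  and pf_pos: "a \<in> carrier A ==> \<omega> (star A a \<otimes> a) \<in> \<real>\<^sub>\<ge>\<^sub>0"
  using \<omega> by (auto simp: positive_functional_def)

lemma pf_minus: "a \<in> carrier A ==> \<omega> (\<ominus> a) = - \<omega> a"
  using pf_smult[of a "-1"] by (simp add: smult_minus1)

lemma pf_diff: "a \<in> carrier A ==> b \<in> carrier A ==> \<omega> (a \<ominus> b) = \<omega> a - \<omega> b"
  by (simp add: minus_eq pf_add pf_minus)

lemma pf_zero: "\<omega> \<zero> = 0"
  using pf_smult[of \<zero> 0] by simp

lemma pf_expand:
  assumes "a \<in> carrier A" "b \<in> carrier A"
  shows "\<omega> (star A (a \<oplus> l \<odot> b) \<otimes> (a \<oplus> l \<odot> b)) =
    \<omega> (star A a \<otimes> a) + l * \<omega> (star A a \<otimes> b) + cnj l * \<omega> (star A b \<otimes> a) + (cmod l)\<^sup>2 * \<omega> (star A b \<otimes> b)"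
  using assms
  by (simp add: star_add star_smult l_distr r_distr smult_mult_l smult_mult_r smult_smult pf_add pf_smult
    smult_r_distr complex_norm_square[symmetric] mult.commute add_ac del: of_real_power)

text \<open>Polarization: the value at the square of a + l b is real. Taking l = 1 compares the
  imaginary parts and l = \<i> the real parts.\<close>

lemma pf_hermitian2:
  assumes ab: "a \<in> carrier A" "b \<in> carrier A"
  shows "\<omega> (star A b \<otimes> a) = cnj (\<omega> (star A a \<otimes> b))"
proof -
  have im: "Im (\<omega> (star A c \<otimes> c)) = 0" if "c \<in> carrier A" for c
    using pf_pos[OF that] by (auto simp: complex_nonneg_Reals_iff)
  have "Im (\<omega> (star A (a \<oplus> 1 \<odot> b) \<otimes> (a \<oplus> 1 \<odot> b))) = 0" "Im (\<omega> (star A (a \<oplus> \<i> \<odot> b) \<otimes> (a \<oplus> \<i> \<odot> b))) = 0"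
    using ab by (intro im; simp)+
  then show ?thesis
    unfolding pf_expand[OF ab] using im[OF ab(1)] im[OF ab(2)] by (simp add: complex_eq_iff)
qed

lemma pf_hermitian: "a \<in> carrier A ==> \<omega> (star A a) = cnj (\<omega> a)"
  using pf_hermitian2[of \<one> a] by simp

lemma pf_Cauchy_Schwarz:
  assumes ab: "a \<in> carrier A" "b \<in> carrier A"
  shows "(cmod (\<omega> (star A a \<otimes> b)))\<^sup>2 \<le> Re (\<omega> (star A a \<otimes> a)) * Re (\<omega> (star A b \<otimes> b))"
proof -
  define p q z where "p = Re (\<omega> (star A a \<otimes> a))" and "q = Re (\<omega> (star A b \<otimes> b))" and "z = \<omega> (star A a \<otimes> b)"
  have p0: "p \<ge> 0" and q0: "q \<ge> 0"
    using pf_pos[OF ab(1)] pf_pos[OF ab(2)] by (auto simp: p_def q_def complex_nonneg_Reals_iff)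
  \<comment> \<open>Positivity at a + l b, with l a real multiple of the conjugate of z so that the
    mixed terms are real.\<close>
  have main: "p - 2 * t * (cmod z)\<^sup>2 + t\<^sup>2 * (cmod z)\<^sup>2 * q \<ge> 0" for t :: real
  proof -
    define l where "l = - of_real t * cnj z"
    have "0 \<le> Re (\<omega> (star A (a \<oplus> l \<odot> b) \<otimes> (a \<oplus> l \<odot> b)))"
      using pf_pos[of "a \<oplus> l \<odot> b"] ab by (auto simp: complex_nonneg_Reals_iff)
    also have "\<dots> = p + 2 * Re (l * z) + (cmod l)\<^sup>2 * q"
      unfolding pf_expand[OF ab] pf_hermitian2[OF ab] p_def q_def z_def by simp
    also have "Re (l * z) = - t * (cmod z)\<^sup>2"
      by (simp add: l_def cmod_power2) (simp add: power2_eq_square algebra_simps)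
    also have "(cmod l)\<^sup>2 = t\<^sup>2 * (cmod z)\<^sup>2" by (simp add: l_def norm_mult power_mult_distrib)
    finally show ?thesis by simp
  qed
  show ?thesis unfolding p_def[symmetric] q_def[symmetric] z_def[symmetric]
  proof (cases "q = 0")
    case True
    have "(cmod z)\<^sup>2 = 0"
    proof (rule ccontr)
      assume "(cmod z)\<^sup>2 \<noteq> 0"
      then have zp: "(cmod z)\<^sup>2 > 0" by (simp add: less_le)
      \<comment> \<open>For q = 0 the expression is affine in t, and this t makes it equal to
        -1.\<close>
      have "2 * ((p + 1) / (2 * (cmod z)\<^sup>2)) * (cmod z)\<^sup>2 = p + 1" using zp by simp
      then show False using main[of "(p + 1) / (2 * (cmod z)\<^sup>2)"] True by simp
    qed
    then show "(cmod z)\<^sup>2 \<le> p * q" using True by simp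
  next
    case False
    then have q: "q > 0" using q0 by simp
    have "p - 2 * (1 / q) * (cmod z)\<^sup>2 + (1 / q)\<^sup>2 * (cmod z)\<^sup>2 * q = p - (cmod z)\<^sup>2 / q"
      using q by (simp add: power2_eq_square field_simps)
    then have "(cmod z)\<^sup>2 / q \<le> p" using main[of "1 / q"] by simp
    then show "(cmod z)\<^sup>2 \<le> p * q" using q by (simp add: field_simps)
  qed
qed

lemma pf_one: "\<omega> \<one> = of_real (Re (\<omega> \<one>))" "0 \<le> Re (\<omega> \<one>)"
  using pf_pos[of \<one>] by (auto simp: complex_nonneg_Reals_iff complex_eq_iff)

text \<open>\<open>\<one> \<ominus> h\<close> is the square of a self-adjoint element, hence of the
  form on which a positive functional is nonnegative.\<close>

lemma pf_selfadjoint_le: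
  assumes h: "h \<in> carrier A" "star A h = h" "nrm h < 1"
  shows "Re (\<omega> h) \<le> Re (\<omega> \<one>)"
proof -
  obtain b where b: "b \<in> carrier A" "star A b = b" "b \<otimes> b = \<one> \<ominus> h"
    using square_root_of_one_minus[OF h] by metis
  have "0 \<le> Re (\<omega> (star A b \<otimes> b))" using pf_pos[OF b(1)] by (auto simp: complex_nonneg_Reals_iff)
  then show ?thesis using b h by (simp add: pf_diff)
qed

text \<open>Cauchy-Schwarz against the unit reduces the claim to
  \<open>star A a \<otimes> a\<close>. This is scaled to norm less than 1, where square roots are
  available; therefore t stays above the norm until a limit is taken at the end.\<close>

lemma pf_bound:
  assumes a: "a \<in> carrier A" shows "cmod (\<omega> a) \<le> Re (\<omega> \<one>) * nrm a"
proof -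
  have sq: "Re (\<omega> (star A a \<otimes> a)) \<le> Re (\<omega> \<one>) * t\<^sup>2" if t: "t > nrm a" for t
  proof -
    have t0: "t > 0" using t nrm_nonneg[OF a] by simp
    define h where "h = of_real (1 / t\<^sup>2) \<odot> (star A a \<otimes> a)"
    have "nrm h = (nrm a)\<^sup>2 / t\<^sup>2" using a by (simp add: h_def nrm_smult nrm_cstar norm_divide norm_power)
    also have "\<dots> < 1" using t t0 nrm_nonneg[OF a] by (simp add: power_strict_mono)
    finally have "Re (\<omega> h) \<le> Re (\<omega> \<one>)"
      using a by (intro pf_selfadjoint_le) (auto simp: h_def star_smult star_mult)
    moreover have "Re (\<omega> h) = Re (\<omega> (star A a \<otimes> a)) / t\<^sup>2"
      unfolding h_def using a by (simp only: pf_smult m_closed star_closed Re_complex_of_real times_complex.sel) simp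
    ultimately show ?thesis using t0 by (simp add: field_simps)
  qed
  have "(cmod (\<omega> a))\<^sup>2 \<le> Re (\<omega> \<one>) * Re (\<omega> (star A a \<otimes> a))"
    using pf_Cauchy_Schwarz[of \<one> a] a by simp
  then have le0: "(cmod (\<omega> a))\<^sup>2 \<le> Re (\<omega> \<one>) * (Re (\<omega> \<one>) * t\<^sup>2)" if t: "t > nrm a" for t
    using mult_left_mono[OF sq[OF t] pf_one(2)] by (rule order_trans)
  have le: "(cmod (\<omega> a))\<^sup>2 \<le> (Re (\<omega> \<one>) * t)\<^sup>2" if t: "t > nrm a" for t
  proof -
    have "(Re (\<omega> \<one>) * t)\<^sup>2 = Re (\<omega> \<one>) * (Re (\<omega> \<one>) * t\<^sup>2)" by (simp add: power2_eq_square)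
    then show ?thesis using le0[OF t] by (simp only:)
  qed
  have le: "cmod (\<omega> a) \<le> Re (\<omega> \<one>) * t" if t: "t > nrm a" for t
  proof (rule power2_le_imp_le[OF le[OF t]])
    have "0 \<le> t" using t nrm_nonneg[OF a] by linarith
    then show "0 \<le> Re (\<omega> \<one>) * t" by (rule mult_nonneg_nonneg[OF pf_one(2)])
  qed
  show ?thesis
  proof (rule field_le_epsilon)
    fix e :: real assume e: "e > 0"
    define d where "d = e / (Re (\<omega> \<one>) + 1)"
    have d: "d > 0" "Re (\<omega> \<one>) * d \<le> e" using e pf_one(2) by (auto simp: d_def field_simps)
    have "cmod (\<omega> a) \<le> Re (\<omega> \<one>) * (nrm a + d)" using d by (intro le) auto
    then show "cmod (\<omega> a) \<le> Re (\<omega> \<one>) * nrm a + e" using d by (simp add: algebra_simps)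
  qed
qed

text \<open>Cauchy-Schwarz with a factor 0. In this way vertices of mass 0 drop out of a
  trace.\<close>

lemma pf_null:
  assumes "p \<in> carrier A" "star A p \<otimes> p = p" "\<omega> p = 0" "a \<in> carrier A"
  shows "\<omega> (star A p \<otimes> a) = 0" "\<omega> (star A a \<otimes> p) = 0"
proof -
  show "\<omega> (star A p \<otimes> a) = 0"
    using pf_Cauchy_Schwarz[OF assms(1,4)] assms by simp
  show "\<omega> (star A a \<otimes> p) = 0"
    using pf_Cauchy_Schwarz[OF assms(4,1)] assms by simp
qed

end

end

section \<open>Contractivity of *-homomorphisms\<close>

locale cstar_algebra_pair = A: cstar_algebra A nA + B: cstar_algebra B nB
  for A :: "'a star_algebra" and nA and B :: "'b star_algebra" and nB
begin

context
  fixes \<phi> assumes \<phi>: "\<phi> \<in> star_hom A B"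
begin

lemma hom_closed [simp]: "a \<in> carrier A ==> \<phi> a \<in> carrier B"
  and hom_add: "a \<in> carrier A ==> b \<in> carrier A ==> \<phi> (a \<oplus>\<^bsub>A\<^esub> b) = \<phi> a \<oplus>\<^bsub>B\<^esub> \<phi> b"
  and hom_mult: "a \<in> carrier A ==> b \<in> carrier A ==> \<phi> (a \<otimes>\<^bsub>A\<^esub> b) = \<phi> a \<otimes>\<^bsub>B\<^esub> \<phi> b"
  and hom_smult: "a \<in> carrier A ==> \<phi> (c \<odot>\<^bsub>A\<^esub> a) = c \<odot>\<^bsub>B\<^esub> \<phi> a"
  and hom_star: "a \<in> carrier A ==> \<phi> (star A a) = star B (\<phi> a)"
  using \<phi> by (auto simp: star_hom_def)

lemma hom_zero: "\<phi> \<zero>\<^bsub>A\<^esub> = \<zero>\<^bsub>B\<^esub>"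
  using hom_smult[of "\<zero>\<^bsub>A\<^esub>" 0] by simp

lemma hom_minus: "a \<in> carrier A ==> \<phi> (\<ominus>\<^bsub>A\<^esub> a) = \<ominus>\<^bsub>B\<^esub> \<phi> a"
  using hom_smult[of a "-1"] by (simp add: A.smult_minus1 B.smult_minus1)

lemma hom_diff: "a \<in> carrier A ==> b \<in> carrier A ==> \<phi> (a \<ominus>\<^bsub>A\<^esub> b) = \<phi> a \<ominus>\<^bsub>B\<^esub> \<phi> b"
  by (simp add: A.minus_eq B.minus_eq hom_add hom_minus)

lemma hom_finsum: "finite I ==> (!!i. i \<in> I ==> f i \<in> carrier A) ==>
   \<phi> (finsum A f I) = finsum B (\<lambda>i. \<phi> (f i)) I"
proof (induct I rule: finite_induct)
  case (insert i I)
  then have "f \<in> I \<rightarrow> carrier A" by auto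
  then show ?case using insert by (simp add: hom_add Pi_def A.finsum_closed)
qed (simp add: hom_zero)

text \<open>A self-adjoint \<open>h\<close> with \<open>\<parallel>h\<parallel> < 1\<close> is the real part of a unitary \<open>h + i(1 - h\<^sup>2)\<^sup>1\<^sup>/\<^sup>2\<close>.\<close>

lemma hom_selfadjoint_le:
  assumes h: "h \<in> carrier A" "star A h = h" "nA h < 1"
  shows "nB (\<phi> h) \<le> 1"
proof -
  let ?h2 = "h \<otimes>\<^bsub>A\<^esub> h"
  have h2: "?h2 \<in> carrier A" "star A ?h2 = ?h2" using h by (auto simp: A.star_mult)
  have "nA ?h2 \<le> nA h * nA h" using h A.nrm_mult by auto
  also have "\<dots> < 1 * 1" using h A.nrm_nonneg[OF h(1)] by (intro mult_strict_mono') auto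
  finally obtain b where b: "b \<in> carrier A" "star A b = b" "b \<otimes>\<^bsub>A\<^esub> b = \<one>\<^bsub>A\<^esub> \<ominus>\<^bsub>A\<^esub> ?h2"
    "h \<otimes>\<^bsub>A\<^esub> b = b \<otimes>\<^bsub>A\<^esub> h"
    using A.square_root_of_one_minus[OF h2] h by (metis A.m_assoc mult_1)
  define u where "u = h \<oplus>\<^bsub>A\<^esub> \<i> \<odot>\<^bsub>A\<^esub> b"
  have u: "u \<in> carrier A" using h b by (simp add: u_def)
  have su: "star A u = h \<oplus>\<^bsub>A\<^esub> (-\<i>) \<odot>\<^bsub>A\<^esub> b" using h b by (simp add: u_def A.star_add A.star_smult)
  \<comment> \<open>The two squares add up to the unit, and the mixed terms cancel because b
    commutes with h.\<close>
  have "star A u \<otimes>\<^bsub>A\<^esub> u = (?h2 \<oplus>\<^bsub>A\<^esub> b \<otimes>\<^bsub>A\<^esub> b) \<oplus>\<^bsub>A\<^esub> (\<i> \<odot>\<^bsub>A\<^esub> (b \<otimes>\<^bsub>A\<^esub> h) \<oplus>\<^bsub>A\<^esub> (-\<i>) \<odot>\<^bsub>A\<^esub> (b \<otimes>\<^bsub>A\<^esub> h))"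
    unfolding su unfolding u_def using h b(1,2)
    by (simp add: A.l_distr A.r_distr A.smult_mult_l A.smult_mult_r A.smult_smult A.smult_r_distr A.a_ac b(4))
  also have "\<i> \<odot>\<^bsub>A\<^esub> (b \<otimes>\<^bsub>A\<^esub> h) \<oplus>\<^bsub>A\<^esub> (-\<i>) \<odot>\<^bsub>A\<^esub> (b \<otimes>\<^bsub>A\<^esub> h) = \<zero>\<^bsub>A\<^esub>"
    using h b(1) A.smult_l_distr[of "b \<otimes>\<^bsub>A\<^esub> h" \<i> "-\<i>"] by simp
  also have "?h2 \<oplus>\<^bsub>A\<^esub> b \<otimes>\<^bsub>A\<^esub> b = \<one>\<^bsub>A\<^esub>" unfolding b(3) using h(1) by algebra
  finally have uu: "star A u \<otimes>\<^bsub>A\<^esub> u = \<one>\<^bsub>A\<^esub>" by simp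
  \<comment> \<open>\<phi> is not assumed to be unital, but it maps the unit to a projection, which
    has norm at most 1.\<close>
  have "nB (\<phi> \<one>\<^bsub>A\<^esub>) \<le> 1"
    by (rule B.nrm_projection) (simp_all flip: hom_star hom_mult)
  then have "(nB (\<phi> u))\<^sup>2 \<le> 1"
    using uu u by (simp flip: B.nrm_cstar hom_star hom_mult)
  then have nu: "nB (\<phi> u) \<le> 1" using abs_square_le_1[of "nB (\<phi> u)"] by linarith
  have "2 \<odot>\<^bsub>A\<^esub> h = u \<oplus>\<^bsub>A\<^esub> star A u"
  proof -
    have "\<i> \<odot>\<^bsub>A\<^esub> b \<oplus>\<^bsub>A\<^esub> (-\<i>) \<odot>\<^bsub>A\<^esub> b = \<zero>\<^bsub>A\<^esub>" using b A.smult_l_distr[of b \<i> "-\<i>"] by simp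
    moreover have "2 \<odot>\<^bsub>A\<^esub> h = h \<oplus>\<^bsub>A\<^esub> h" using h A.smult_l_distr[of h 1 1] by simp
    moreover have "u \<oplus>\<^bsub>A\<^esub> star A u = (h \<oplus>\<^bsub>A\<^esub> h) \<oplus>\<^bsub>A\<^esub> (\<i> \<odot>\<^bsub>A\<^esub> b \<oplus>\<^bsub>A\<^esub> (-\<i>) \<odot>\<^bsub>A\<^esub> b)"
      unfolding su unfolding u_def using h b by (simp add: A.a_ac)
    ultimately show ?thesis using h by simp
  qed
  then have "\<phi> (2 \<odot>\<^bsub>A\<^esub> h) = \<phi> u \<oplus>\<^bsub>B\<^esub> star B (\<phi> u)"
    using u by (simp add: hom_star hom_add)
  then have "2 * nB (\<phi> h) = nB (\<phi> u \<oplus>\<^bsub>B\<^esub> star B (\<phi> u))"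
    using h(1) B.nrm_smult[of "\<phi> h" 2] by (simp add: hom_smult)
  also have "\<dots> \<le> nB (\<phi> u) + nB (\<phi> u)" using B.nrm_add[of "\<phi> u" "star B (\<phi> u)"] u by (simp add: B.nrm_star)
  finally show ?thesis using nu by simp
qed

text \<open>By the C*-identity in both algebras the claim passes to
  \<open>star A a \<otimes> a\<close>, scaled into the open unit ball where
  \<open>hom_selfadjoint_le\<close> applies.\<close>

lemma hom_contractive: "a \<in> carrier A ==> nB (\<phi> a) \<le> nA a"
proof (rule dense_ge)
  fix t assume a: "a \<in> carrier A" and t: "nA a < t"
  have t0: "t > 0" using t A.nrm_nonneg[OF a] by simp
  define h where "h = of_real (1 / t\<^sup>2) \<odot>\<^bsub>A\<^esub> (star A a \<otimes>\<^bsub>A\<^esub> a)"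
  have "nA h = (nA a)\<^sup>2 / t\<^sup>2" using a by (simp add: h_def A.nrm_smult A.nrm_cstar norm_divide norm_power)
  also have "\<dots> < 1" using t t0 A.nrm_nonneg[OF a] by (simp add: power_strict_mono)
  finally have "nB (\<phi> h) \<le> 1"
    using a by (intro hom_selfadjoint_le) (auto simp: h_def A.star_smult A.star_mult)
  moreover have "nB (\<phi> h) = (nB (\<phi> a))\<^sup>2 / t\<^sup>2"
    using a by (simp add: h_def hom_smult hom_mult hom_star B.nrm_smult B.nrm_cstar norm_divide norm_power)
  ultimately have "(nB (\<phi> a))\<^sup>2 \<le> t\<^sup>2" using t0 by (simp add: field_simps)
  then show "nB (\<phi> a) \<le> t" by (rule power2_le_imp_le) (use t0 in simp)
qed

lemma hom_conv: "A.conv x a ==> B.conv (\<lambda>n. \<phi> (x n)) (\<phi> a)"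
proof -
  assume a: "A.conv x a"
  note c = A.convD[OF a]
  show ?thesis
  proof (rule B.convI[OF _ _ _ c(3)])
    show "nB (\<phi> (x n) \<ominus>\<^bsub>B\<^esub> \<phi> a) \<le> nA (x n \<ominus>\<^bsub>A\<^esub> a)" for n
      using hom_contractive[of "x n \<ominus>\<^bsub>A\<^esub> a"] c by (simp add: hom_diff)
  qed (use c in auto)
qed

end

end

section \<open>Universal C*-algebras\<close>

lemma squeeze_to_0:
  fixes f g :: "nat => real"
  assumes "g \<longlonglongrightarrow> 0" "!!n. 0 \<le> f n" "!!n. f n \<le> g n"
  shows "f \<longlonglongrightarrow> 0"
  by (rule tendsto_sandwich[OF _ _ tendsto_const assms(1)]) (use assms in auto)

text \<open>A bound on each generator that is uniform over the admissible seminorms turns the real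
  supremum in \<open>universal_seminorm\<close> into a genuine one.\<close>

locale bounded_relations =
  fixes X :: "'g set" and R :: "'g star_poly set"
  assumes rels_free: "R \<subseteq> free_star_algebra X"
    and gens_bounded: "g \<in> X ==> \<exists>K. \<forall>p\<in>cstar_seminorms X. (\<forall>r\<in>R. p r = 0) --> p (gen g) \<le> K"
begin

abbreviation "SN \<equiv> {p \<in> cstar_seminorms X. \<forall>r\<in>R. p r = 0}"
abbreviation "N \<equiv> universal_seminorm X R"

lemma SN_ne: "SN \<noteq> {}"
proof -
  have "(\<lambda>x. 0) \<in> SN" by (simp add: cstar_seminorms_def Let_def)
  then show ?thesis by blast
qed

lemma SN_cstar: "p \<in> SN ==> cstar_seminorm X p"
  by unfold_locales auto

lemma gens_bounded_SN: assumes "g \<in> X" obtains K where "!!p. p \<in> SN ==> p (gen g) \<le> K"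
  using gens_bounded[OF assms] by blast

lemma SN_bounded:
  assumes "x \<in> free_star_algebra X"
  shows "\<exists>K. \<forall>p\<in>SN. p x \<le> K"
  using assms
proof (induct rule: free_induct)
  case (gen g)
  then show ?case using gens_bounded by blast
next
  case (gen_star g)
  then obtain K where "!!p. p\<in>SN ==> p (gen g) \<le> K" using gens_bounded_SN by blast
  then have "\<forall>p\<in>SN. p (poly_star (gen g)) \<le> K"
    by (simp add: cstar_seminorm.N_star[OF SN_cstar] free_gen[OF gen_star])
  then show ?case by blast
next
  case (mult_gen g y)
  obtain K where K: "!!p. p\<in>SN ==> p (gen g) \<le> K" using gens_bounded_SN[OF \<open>g \<in> X\<close>] by blast
  obtain L where L: "!!p. p\<in>SN ==> p y \<le> L" using \<open>\<exists>K. \<forall>p\<in>SN. p y \<le> K\<close> by blast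
  note KL = K L
  have "p (gen g * y) \<le> K * L" if p: "p \<in> SN" for p
  proof -
    interpret cstar_seminorm X p using p by (rule SN_cstar)
    have "p (gen g * y) \<le> p (gen g) * p y" using mult_gen by (intro N_mult free_gen)
    also have "\<dots> \<le> K * L" using mult_gen KL[OF p] N_nonneg[of "gen g"] N_nonneg[of y]
      by (intro mult_mono) (auto simp: free_gen)
    finally show ?thesis .
  qed
  then show ?case by blast
next
  case (mult_gen_star g y)
  obtain K where K: "!!p. p\<in>SN ==> p (gen g) \<le> K" using gens_bounded_SN[OF \<open>g \<in> X\<close>] by blast
  obtain L where L: "!!p. p\<in>SN ==> p y \<le> L" using \<open>\<exists>K. \<forall>p\<in>SN. p y \<le> K\<close> by blast
  note KL = K L
  have "p (poly_star (gen g) * y) \<le> K * L" if p: "p \<in> SN" for p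
  proof -
    interpret cstar_seminorm X p using p by (rule SN_cstar)
    have "p (poly_star (gen g) * y) \<le> p (gen g) * p y"
      using mult_gen_star N_mult[of "poly_star (gen g)" y] by (simp add: N_star free_gen free_star)
    also have "\<dots> \<le> K * L" using mult_gen_star KL[OF p] N_nonneg[of "gen g"] N_nonneg[of y]
      by (intro mult_mono) (auto simp: free_gen)
    finally show ?thesis .
  qed
  then show ?case by blast
next
  case (add x y)
  obtain K where K: "!!p. p\<in>SN ==> p x \<le> K" using \<open>\<exists>K. \<forall>p\<in>SN. p x \<le> K\<close> by blast
  obtain L where L: "!!p. p\<in>SN ==> p y \<le> L" using \<open>\<exists>K. \<forall>p\<in>SN. p y \<le> K\<close> by blast
  have "p (x + y) \<le> K + L" if p: "p \<in> SN" for p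
    using cstar_seminorm.N_add[OF SN_cstar[OF p] add(1,2)] K[OF p] L[OF p] by linarith
  then show ?case by blast
next
  case (scale c x)
  obtain K where K: "!!p. p\<in>SN ==> p x \<le> K" using \<open>\<exists>K. \<forall>p\<in>SN. p x \<le> K\<close> by blast
  have "p (poly_scale c x) \<le> cmod c * K" if p: "p \<in> SN" for p
    using cstar_seminorm.N_scale[OF SN_cstar[OF p] scale(1), of c] K[OF p] by (simp add: mult_left_mono)
  then show ?case by blast
next
  case zero
  have "p 0 \<le> 0" if p: "p \<in> SN" for p using cstar_seminorm.N_zero[OF SN_cstar[OF p]] by simp
  then show ?case by blast
qed

lemma SN_le_N: "p \<in> SN ==> x \<in> free_star_algebra X ==> p x \<le> N x"
  unfolding universal_seminorm_def using SN_bounded[of x]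
  by (intro cSUP_upper) (auto simp: bdd_above_def)

lemma N_least: "(!!p. p \<in> SN ==> p x \<le> K) ==> N x \<le> K"
  unfolding universal_seminorm_def using SN_ne by (intro cSUP_least) auto

lemma N_seminorm: "N \<in> cstar_seminorms X"
  unfolding cstar_seminorms_def Let_def
proof (intro CollectI conjI ballI allI)
  fix x y :: "'g star_poly" and c assume x: "x \<in> free_star_algebra X"
  obtain p0 where p0: "p0 \<in> SN" using SN_ne by blast
  show Nx: "0 \<le> N x" using SN_le_N[OF p0 x] cstar_seminorm.N_nonneg[OF SN_cstar[OF p0] x] by simp
  show "N (poly_scale c x) = cmod c * N x"
  proof (rule antisym)
    show "N (poly_scale c x) \<le> cmod c * N x"
    proof (rule N_least)
      fix p assume p: "p \<in> SN"
      show "p (poly_scale c x) \<le> cmod c * N x"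
        using cstar_seminorm.N_scale[OF SN_cstar[OF p] x] SN_le_N[OF p x] by (simp add: mult_left_mono)
    qed
    show "cmod c * N x \<le> N (poly_scale c x)"
    proof (cases "c = 0")
      case True
      then show ?thesis using SN_le_N[OF p0 free_zero] cstar_seminorm.N_zero[OF SN_cstar[OF p0]]
        by (simp add: poly_scale_simps)
    next
      case False
      have "N x \<le> N (poly_scale c x) / cmod c"
      proof (rule N_least)
        fix p assume p: "p \<in> SN"
        have "cmod c * p x \<le> N (poly_scale c x)"
          using cstar_seminorm.N_scale[OF SN_cstar[OF p] x, of c] SN_le_N[OF p free_scale[OF x], of c] by simp
        then show "p x \<le> N (poly_scale c x) / cmod c" using False by (simp add: field_simps)
      qed
      then show ?thesis using False by (simp add: field_simps)
    qed
  qed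
  show "N (poly_star x * x) = (N x)\<^sup>2"
  proof (rule antisym)
    show "N (poly_star x * x) \<le> (N x)\<^sup>2"
    proof (rule N_least)
      fix p assume p: "p \<in> SN"
      show "p (poly_star x * x) \<le> (N x)\<^sup>2"
        using cstar_seminorm.N_cstar[OF SN_cstar[OF p] x] SN_le_N[OF p x]
          cstar_seminorm.N_nonneg[OF SN_cstar[OF p] x] by (simp add: power_mono)
    qed
    \<comment> \<open>The supremum is taken over p x and not over its square, so the bound is
      written with a root before \<open>N_least\<close> is applied.\<close>
    have "N x \<le> sqrt (N (poly_star x * x))"
    proof (rule N_least)
      fix p assume p: "p \<in> SN"
      have "(p x)\<^sup>2 \<le> N (poly_star x * x)"
        using cstar_seminorm.N_cstar[OF SN_cstar[OF p] x] SN_le_N[OF p, of "poly_star x * x"] x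
        by (simp add: free_mult free_star)
      then show "p x \<le> sqrt (N (poly_star x * x))" by (rule real_le_rsqrt)
    qed
    then show "(N x)\<^sup>2 \<le> N (poly_star x * x)"
      using Nx power_mono[of "N x" "sqrt (N (poly_star x * x))" 2] real_sqrt_ge_0_iff[of "N (poly_star x * x)"]
      by (metis order_trans real_sqrt_pow2)
  qed
  assume y: "y \<in> free_star_algebra X"
  show "N (x + y) \<le> N x + N y"
  proof (rule N_least)
    fix p assume p: "p \<in> SN"
    show "p (x + y) \<le> N x + N y"
      using cstar_seminorm.N_add[OF SN_cstar[OF p] x y] SN_le_N[OF p x] SN_le_N[OF p y] by simp
  qed
  show "N (x * y) \<le> N x * N y"
  proof (rule N_least)
    fix p assume p: "p \<in> SN"
    interpret cstar_seminorm X p using p by (rule SN_cstar)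
    have "p (x * y) \<le> p x * p y" using x y by (rule N_mult)
    also have "\<dots> \<le> N x * N y" using SN_le_N[OF p x] SN_le_N[OF p y] N_nonneg[OF x] N_nonneg[OF y] Nx
      by (intro mult_mono) auto
    finally show "p (x * y) \<le> N x * N y" .
  qed
qed

sublocale cstar_seminorm X N
  by unfold_locales (rule N_seminorm)

lemma N_rel: "r \<in> R ==> N r = 0"
proof (rule antisym)
  assume r: "r \<in> R"
  show "N r \<le> 0" by (rule N_least) (use r in auto)
  show "0 \<le> N r" using r rels_free by (intro N_nonneg) auto
qed

section \<open>Cauchy sequences and operations on their classes\<close>

abbreviation "CS \<equiv> cauchy_seqs X R"
abbreviation "cls \<equiv> cauchy_class X R"
abbreviation "U \<equiv> universal_cstar X R"

lemma CS_F: "x \<in> CS ==> x n \<in> F"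
  by (auto simp: cauchy_seqs_def)

lemma CS_cauchy: "x \<in> CS ==> e > 0 ==> \<exists>M. \<forall>m\<ge>M. \<forall>n\<ge>M. N (x m - x n) < e"
  by (auto simp: cauchy_seqs_def)

lemma CS_cauchyE:
  assumes "x \<in> CS" "e > 0" obtains M where "!!m n. m \<ge> M ==> n \<ge> M ==> N (x m - x n) < e"
  using CS_cauchy[OF assms] by blast

lemma CS_I: "(!!n. x n \<in> F) ==> (!!e. e > 0 ==> \<exists>M. \<forall>m\<ge>M. \<forall>n\<ge>M. N (x m - x n) < e) ==> x \<in> CS"
  by (auto simp: cauchy_seqs_def)

lemma CS_const: "x \<in> F ==> (\<lambda>n. x) \<in> CS"
  by (rule CS_I) auto

lemma N_diff_triangle: "x \<in> F ==> y \<in> F ==> z \<in> F ==> N (x - z) \<le> N (x - y) + N (y - z)"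
  using N_add[of "x - y" "y - z"] by (simp add: free_diff)

lemma N_diff_abs: "x \<in> F ==> y \<in> F ==> \<bar>N x - N y\<bar> \<le> N (x - y)"
  using N_add[of "x - y" y] N_add[of "y - x" x] N_diff_commute[of x y] by (simp add: free_diff)

lemma CS_lim: "x \<in> CS ==> (\<lambda>n. N (x n)) \<longlonglongrightarrow> lim (\<lambda>n. N (x n))"
proof -
  assume x: "x \<in> CS"
  have "Cauchy (\<lambda>n. N (x n))"
  proof (rule metric_CauchyI)
    fix e :: real assume "e > 0"
    then obtain M where "\<forall>m\<ge>M. \<forall>n\<ge>M. N (x m - x n) < e" using CS_cauchy[OF x] by blast
    then show "\<exists>M. \<forall>m\<ge>M. \<forall>n\<ge>M. dist (N (x m)) (N (x n)) < e"
      using N_diff_abs[OF CS_F[OF x] CS_F[OF x]] unfolding dist_real_def by (meson le_less_trans)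
  qed
  then show ?thesis using Cauchy_convergent convergent_LIMSEQ_iff by blast
qed

lemma CS_bounded: "x \<in> CS ==> \<exists>K. K > 0 \<and> (\<forall>n. N (x n) \<le> K)"
proof -
  assume x: "x \<in> CS"
  obtain K where "K > 0" "!!n. \<bar>N (x n)\<bar> \<le> K"
    using convergent_imp_Bseq[OF convergentI[OF CS_lim[OF x]]] by (auto simp: Bseq_def)
  then show ?thesis by (intro exI[of _ K]) (auto intro: abs_le_D1)
qed

lemma CS_add: "x \<in> CS ==> y \<in> CS ==> (\<lambda>n. x n + y n) \<in> CS"
proof (rule CS_I)
  fix e :: real assume x: "x \<in> CS" and y: "y \<in> CS" and e: "e > 0"
  have e2: "e/2 > 0" using e by simp
  obtain M1 where M1: "!!m n. m \<ge> M1 ==> n \<ge> M1 ==> N (x m - x n) < e/2"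
    using CS_cauchyE[OF x e2] by blast
  obtain M2 where M2: "!!m n. m \<ge> M2 ==> n \<ge> M2 ==> N (y m - y n) < e/2"
    using CS_cauchyE[OF y e2] by blast
  note M = M1 M2
  have "N (x m + y m - (x n + y n)) < e" if "m \<ge> max M1 M2" "n \<ge> max M1 M2" for m n
    using M(1)[of m n] M(2)[of m n] that N_add[of "x m - x n" "y m - y n"] CS_F[OF x] CS_F[OF y]
    by (simp add: add_diff_add free_diff)
  then show "\<exists>M. \<forall>m\<ge>M. \<forall>n\<ge>M. N (x m + y m - (x n + y n)) < e" by blast
qed (auto simp: CS_F free_add)

lemma CS_scale: "x \<in> CS ==> (\<lambda>n. poly_scale c (x n)) \<in> CS"
proof (rule CS_I)
  fix e :: real assume x: "x \<in> CS" and e: "e > 0"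
  \<comment> \<open>The summand 1 allows c = 0 in the quotient below.\<close>
  have c: "cmod c + 1 > 0" by (simp add: add_nonneg_pos)
  obtain M where M: "!!m n. m \<ge> M ==> n \<ge> M ==> N (x m - x n) < e / (cmod c + 1)"
    using CS_cauchy[OF x, of "e / (cmod c + 1)"] e c by auto
  have "N (poly_scale c (x m) - poly_scale c (x n)) < e" if "m \<ge> M" "n \<ge> M" for m n
  proof -
    have d: "x m - x n \<in> F" using CS_F[OF x] by (simp add: free_diff)
    have "N (poly_scale c (x m) - poly_scale c (x n)) = cmod c * N (x m - x n)"
      using N_scale[OF d] by (simp add: poly_scale_distrib)
    also have "\<dots> \<le> (cmod c + 1) * N (x m - x n)" using N_nonneg[OF d] by (simp add: algebra_simps)
    also have "\<dots> < (cmod c + 1) * (e / (cmod c + 1))" using M[OF that] c by (intro mult_strict_left_mono)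
    finally show ?thesis using c by simp
  qed
  then show "\<exists>M. \<forall>m\<ge>M. \<forall>n\<ge>M. N (poly_scale c (x m) - poly_scale c (x n)) < e" by blast
qed (auto simp: CS_F free_scale)

lemma CS_star: "x \<in> CS ==> (\<lambda>n. poly_star (x n)) \<in> CS"
  by (rule CS_I) (auto simp: CS_F free_star free_diff N_star CS_cauchy simp flip: poly_star_diff)

lemma CS_mult: "x \<in> CS ==> y \<in> CS ==> (\<lambda>n. x n * y n) \<in> CS"
proof (rule CS_I)
  fix e :: real assume x: "x \<in> CS" and y: "y \<in> CS" and e: "e > 0"
  obtain K L where K: "K > 0" "!!n. N (x n) \<le> K" and L: "L > 0" "!!n. N (y n) \<le> L"
    using CS_bounded[OF x] CS_bounded[OF y] by auto
  have e2: "e/2/L > 0" "e/2/K > 0" using e K L by auto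
  obtain M1 where M1: "!!m n. m \<ge> M1 ==> n \<ge> M1 ==> N (x m - x n) < e/2/L"
    using CS_cauchyE[OF x e2(1)] by blast
  obtain M2 where M2: "!!m n. m \<ge> M2 ==> n \<ge> M2 ==> N (y m - y n) < e/2/K"
    using CS_cauchyE[OF y e2(2)] by blast
  note M = M1 M2
  have "N (x m * y m - x n * y n) < e" if "m \<ge> max M1 M2" "n \<ge> max M1 M2" for m n
  proof -
    have F': "x m \<in> F" "y n \<in> F" "x m - x n \<in> F" "y m - y n \<in> F" using CS_F[OF x] CS_F[OF y] by (auto simp: free_diff)
    have "x m * y m - x n * y n = x m * (y m - y n) + (x m - x n) * y n" by (simp add: algebra_simps)
    then have "N (x m * y m - x n * y n) \<le> N (x m * (y m - y n)) + N ((x m - x n) * y n)"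
      using N_add[of "x m * (y m - y n)" "(x m - x n) * y n"] F' by (simp add: free_mult)
    also have "\<dots> \<le> N (x m) * N (y m - y n) + N (x m - x n) * N (y n)"
      by (intro add_mono N_mult F')
    also have "\<dots> \<le> K * N (y m - y n) + N (x m - x n) * L"
      by (intro add_mono mult_right_mono mult_left_mono K L N_nonneg F')
    also have "\<dots> < K * (e/2/K) + (e/2/L) * L"
      using M(1)[of m n] M(2)[of m n] that K L by (intro add_strict_mono mult_strict_left_mono mult_strict_right_mono) auto
    also have "\<dots> = e" using K L by simp
    finally show ?thesis .
  qed
  then show "\<exists>M. \<forall>m\<ge>M. \<forall>n\<ge>M. N (x m * y m - x n * y n) < e" by blast
qed (auto simp: CS_F free_mult)

lemma CS_uminus: "x \<in> CS ==> (\<lambda>n. - x n) \<in> CS"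
  using CS_scale[of x "-1"] by (simp add: poly_scale_distrib poly_scale_simps)

lemma CS_diff: "x \<in> CS ==> y \<in> CS ==> (\<lambda>n. x n - y n) \<in> CS"
  using CS_add[OF _ CS_uminus, of x y] by simp

lemma rel_iff: "(x, y) \<in> cauchy_rel X R \<longleftrightarrow> x \<in> CS \<and> y \<in> CS \<and> (\<lambda>n. N (x n - y n)) \<longlonglongrightarrow> 0"
  by (auto simp: cauchy_rel_def)

lemma rel_equiv: "equiv CS (cauchy_rel X R)"
proof (rule equivI)
  show "refl_on CS (cauchy_rel X R)" by (auto simp: refl_on_def rel_iff)
  show "cauchy_rel X R \<subseteq> CS \<times> CS" by (auto simp: rel_iff)
  show "sym (cauchy_rel X R)"
  proof (rule symI)
    fix x y assume xy: "(x, y) \<in> cauchy_rel X R"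
    then have "N (x n - y n) = N (y n - x n)" for n using CS_F by (intro N_diff_commute) (auto simp: rel_iff)
    then show "(y, x) \<in> cauchy_rel X R" using xy by (simp add: rel_iff)
  qed
  show "trans (cauchy_rel X R)"
  proof (rule transI)
    fix x y z assume xy: "(x, y) \<in> cauchy_rel X R" and yz: "(y, z) \<in> cauchy_rel X R"
    then have C: "x \<in> CS" "y \<in> CS" "z \<in> CS" by (auto simp: rel_iff)
    have "(\<lambda>n. N (x n - y n) + N (y n - z n)) \<longlonglongrightarrow> 0"
      using tendsto_add[of "\<lambda>n. N (x n - y n)" 0 _ "\<lambda>n. N (y n - z n)" 0] xy yz by (simp add: rel_iff)
    then have "(\<lambda>n. N (x n - z n)) \<longlonglongrightarrow> 0"
      by (rule squeeze_to_0) (use C CS_F in \<open>auto intro!: N_nonneg free_diff N_diff_triangle\<close>)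
    then show "(x, z) \<in> cauchy_rel X R" using C by (simp add: rel_iff)
  qed
qed

lemma cls_eq_iff: "x \<in> CS ==> y \<in> CS ==> cls x = cls y \<longleftrightarrow> (\<lambda>n. N (x n - y n)) \<longlonglongrightarrow> 0"
  unfolding cauchy_class_def using eq_equiv_class_iff[OF rel_equiv] by (simp add: rel_iff)

lemma cls_eqI: "x \<in> CS ==> y \<in> CS ==> (!!n. N (x n - y n) = 0) ==> cls x = cls y"
  by (simp add: cls_eq_iff)

lemma in_cls: "y \<in> cls x ==> x \<in> CS \<and> y \<in> CS \<and> cls y = cls x"
proof -
  assume "y \<in> cls x"
  then have r: "(x, y) \<in> cauchy_rel X R" by (simp add: cauchy_class_def)
  then show ?thesis using equiv_class_eq[OF rel_equiv r] by (simp add: cauchy_class_def rel_iff)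
qed

lemma self_in_cls: "x \<in> CS ==> x \<in> cls x"
  by (simp add: cauchy_class_def rel_iff)

lemma carrier_U: "carrier U = CS // cauchy_rel X R"
  by (simp add: universal_cstar_def Let_def)

lemma cls_carrier [simp]: "x \<in> CS ==> cls x \<in> carrier U"
  by (simp add: carrier_U cauchy_class_def quotientI)

lemma carrierE: assumes "a \<in> carrier U" obtains x where "x \<in> CS" "a = cls x"
  using assms unfolding carrier_U cauchy_class_def by (rule quotientE)

text \<open>The operations of \<open>universal_cstar\<close> are unions over all representatives.
  When all of them yield the same class, the nonempty union collapses to it.\<close>

lemma lift1:
  assumes "x \<in> CS" "!!x'. x' \<in> CS ==> cls x' = cls x ==> cls (f x') = cls (f x)"
  shows "(\<Union>x'\<in>cls x. cls (f x')) = cls (f x)"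
proof -
  have "(\<Union>x'\<in>cls x. cls (f x')) = (\<Union>x'\<in>cls x. cls (f x))"
    by (intro SUP_cong refl assms(2)) (simp_all add: in_cls)
  moreover have "cls x \<noteq> {}" using self_in_cls assms by blast
  ultimately show ?thesis by simp
qed

lemma lift2:
  assumes "x \<in> CS" "y \<in> CS"
    "!!x' y'. x' \<in> CS ==> y' \<in> CS ==> cls x' = cls x ==> cls y' = cls y ==> cls (f x' y') = cls (f x y)"
  shows "(\<Union>x'\<in>cls x. \<Union>y'\<in>cls y. cls (f x' y')) = cls (f x y)"
proof -
  have "(\<Union>x'\<in>cls x. \<Union>y'\<in>cls y. cls (f x' y')) = (\<Union>x'\<in>cls x. \<Union>y'\<in>cls y. cls (f x y))"
    by (intro SUP_cong refl assms(3)) (simp_all add: in_cls)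
  moreover have "cls x \<noteq> {}" "cls y \<noteq> {}" using self_in_cls assms by blast+
  ultimately show ?thesis by simp
qed

lemma U_add: "x \<in> CS ==> y \<in> CS ==> cls x \<oplus>\<^bsub>U\<^esub> cls y = cls (\<lambda>n. x n + y n)"
proof -
  assume x: "x \<in> CS" and y: "y \<in> CS"
  have "(\<Union>x'\<in>cls x. \<Union>y'\<in>cls y. cls (\<lambda>n. x' n + y' n)) = cls (\<lambda>n. x n + y n)"
  proof (rule lift2[OF x y])
    fix x' y' assume x': "x' \<in> CS" "cls x' = cls x" and y': "y' \<in> CS" "cls y' = cls y"
    have "(\<lambda>n. N (x' n - x n) + N (y' n - y n)) \<longlonglongrightarrow> 0"
      using tendsto_add[of "\<lambda>n. N (x' n - x n)" 0 _ "\<lambda>n. N (y' n - y n)" 0] x' y' x y by (simp add: cls_eq_iff)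
    then have "(\<lambda>n. N ((x' n + y' n) - (x n + y n))) \<longlonglongrightarrow> 0"
      by (rule squeeze_to_0)
        (use x y x' y' CS_F in \<open>auto simp: add_diff_add intro!: N_nonneg free_diff free_add N_add\<close>)
    then show "cls (\<lambda>n. x' n + y' n) = cls (\<lambda>n. x n + y n)" using x y x' y' by (simp add: cls_eq_iff CS_add)
  qed
  then show ?thesis by (simp add: universal_cstar_def Let_def)
qed

lemma U_mult0: "x \<in> CS ==> y \<in> CS ==> universal_mult X R (cls x) (cls y) = cls (\<lambda>n. x n * y n)"
  unfolding universal_mult_def
proof (rule lift2)
  fix x' y' assume x: "x \<in> CS" and y: "y \<in> CS" and x': "x' \<in> CS" "cls x' = cls x" and y': "y' \<in> CS" "cls y' = cls y"
  obtain K L where K: "!!n. N (x' n) \<le> K" and L: "!!n. N (y n) \<le> L"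
    using CS_bounded[OF x'(1)] CS_bounded[OF y] by auto
  have "(\<lambda>n. K * N (y' n - y n)) \<longlonglongrightarrow> 0" "(\<lambda>n. N (x' n - x n) * L) \<longlonglongrightarrow> 0"
    using x x' y y' by (auto simp: cls_eq_iff intro: tendsto_mult_right_zero tendsto_mult_left_zero)
  from tendsto_add[OF this] have l: "(\<lambda>n. K * N (y' n - y n) + N (x' n - x n) * L) \<longlonglongrightarrow> 0" by simp
  have le: "N (x' n * y' n - x n * y n) \<le> K * N (y' n - y n) + N (x' n - x n) * L" for n
  proof -
    have F': "x' n \<in> F" "y n \<in> F" "x' n - x n \<in> F" "y' n - y n \<in> F"
      using CS_F[OF x] CS_F[OF y] CS_F[OF x'(1)] CS_F[OF y'(1)] by (auto simp: free_diff)
    have "x' n * y' n - x n * y n = x' n * (y' n - y n) + (x' n - x n) * y n" by (simp add: algebra_simps)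
    then have "N (x' n * y' n - x n * y n) \<le> N (x' n * (y' n - y n)) + N ((x' n - x n) * y n)"
      using N_add[of "x' n * (y' n - y n)" "(x' n - x n) * y n"] F' by (simp add: free_mult)
    also have "\<dots> \<le> N (x' n) * N (y' n - y n) + N (x' n - x n) * N (y n)"
      by (intro add_mono N_mult F')
    also have "\<dots> \<le> K * N (y' n - y n) + N (x' n - x n) * L"
      by (intro add_mono mult_right_mono mult_left_mono K L N_nonneg F')
    finally show ?thesis .
  qed
  have "0 \<le> N (x' n * y' n - x n * y n)" for n
    using x y x' y' CS_F by (intro N_nonneg free_diff free_mult) auto
  then have "(\<lambda>n. N (x' n * y' n - x n * y n)) \<longlonglongrightarrow> 0"
    using le by (rule squeeze_to_0[OF l])
  then show "cls (\<lambda>n. x' n * y' n) = cls (\<lambda>n. x n * y n)" using x y x' y' by (simp add: cls_eq_iff CS_mult)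
qed auto

lemma U_mult: "x \<in> CS ==> y \<in> CS ==> cls x \<otimes>\<^bsub>U\<^esub> cls y = cls (\<lambda>n. x n * y n)"
  using U_mult0 by (simp add: universal_cstar_def Let_def)

lemma U_smult: "x \<in> CS ==> c \<odot>\<^bsub>U\<^esub> cls x = cls (\<lambda>n. poly_scale c (x n))"
proof -
  assume x: "x \<in> CS"
  have "(\<Union>x'\<in>cls x. cls (\<lambda>n. poly_scale c (x' n))) = cls (\<lambda>n. poly_scale c (x n))"
  proof (rule lift1[OF x])
    fix x' assume x': "x' \<in> CS" "cls x' = cls x"
    have "N (poly_scale c (x' n) - poly_scale c (x n)) = cmod c * N (x' n - x n)" for n
      using x x' CS_F by (simp add: N_scale free_diff flip: poly_scale_distrib)
    moreover have "(\<lambda>n. cmod c * N (x' n - x n)) \<longlonglongrightarrow> 0"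
      using x' x by (intro tendsto_mult_right_zero) (simp add: cls_eq_iff)
    ultimately show "cls (\<lambda>n. poly_scale c (x' n)) = cls (\<lambda>n. poly_scale c (x n))"
      using x x' by (simp add: cls_eq_iff CS_scale)
  qed
  then show ?thesis by (simp add: universal_cstar_def Let_def)
qed

lemma U_star: "x \<in> CS ==> star U (cls x) = cls (\<lambda>n. poly_star (x n))"
proof -
  assume x: "x \<in> CS"
  have "(\<Union>x'\<in>cls x. cls (\<lambda>n. poly_star (x' n))) = cls (\<lambda>n. poly_star (x n))"
  proof (rule lift1[OF x])
    fix x' assume x': "x' \<in> CS" "cls x' = cls x"
    have "N (poly_star (x' n) - poly_star (x n)) = N (x' n - x n)" for n
      using x x' CS_F by (simp add: N_star free_diff flip: poly_star_diff)
    then show "cls (\<lambda>n. poly_star (x' n)) = cls (\<lambda>n. poly_star (x n))"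
      using x x' by (simp add: cls_eq_iff CS_star)
  qed
  then show ?thesis by (simp add: universal_cstar_def Let_def)
qed

lemma U_zero: "\<zero>\<^bsub>U\<^esub> = cls (\<lambda>n. 0)"
  by (simp add: universal_cstar_def Let_def)

text \<open>The norm that the record leaves out. The representative is chosen arbitrarily;
  \<open>unorm_cls\<close> shows that each one gives the same limit.\<close>

definition unorm :: "(nat => 'g star_poly) set => real" where
  "unorm a = lim (\<lambda>n. N ((SOME x. x \<in> a) n))"

lemma unorm_cls: "x \<in> CS ==> (\<lambda>n. N (x n)) \<longlonglongrightarrow> unorm (cls x)"
proof -
  assume x: "x \<in> CS"
  define y where "y = (SOME y. y \<in> cls x)"
  have "y \<in> cls x" unfolding y_def by (rule someI[of "\<lambda>y. y \<in> cls x", OF self_in_cls[OF x]])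
  then have y: "y \<in> CS" "cls x = cls y" using in_cls by auto
  have l: "(\<lambda>n. N (y n)) \<longlonglongrightarrow> unorm (cls x)"
    unfolding unorm_def y_def[symmetric] by (rule CS_lim[OF y(1)])
  have "(\<lambda>n. N (x n - y n)) \<longlonglongrightarrow> 0" using x y by (simp add: cls_eq_iff)
  then have "(\<lambda>n. N (x n) - N (y n)) \<longlonglongrightarrow> 0"
    by (rule Lim_null_comparison[rotated]) (use N_diff_abs[OF CS_F[OF x] CS_F[OF y(1)]] in auto)
  from tendsto_add[OF this l] show ?thesis by simp
qed

lemma unorm_const: "x \<in> F ==> unorm (cls (\<lambda>n. x)) = N x"
  using unorm_cls[OF CS_const, of x] LIMSEQ_unique tendsto_const by metis

end

text \<open>The free algebra has no unit, and e acts as one only up to null elements. This is what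
  the definite description in the field \<open>one\<close> of the record needs.\<close>

locale unital_relations = bounded_relations +
  fixes e :: "'a star_poly"
  assumes e_free: "e \<in> free_star_algebra X"
    and e_unit: "x \<in> free_star_algebra X ==> universal_seminorm X R (e * x - x) = 0"
      "x \<in> free_star_algebra X ==> universal_seminorm X R (x * e - x) = 0"
begin

lemma cls_e: "x \<in> CS ==> cls (\<lambda>n. e * x n) = cls x" "x \<in> CS ==> cls (\<lambda>n. x n * e) = cls x"
  by (rule cls_eqI; simp add: CS_mult CS_const e_free e_unit CS_F)+

lemma U_one: "\<one>\<^bsub>U\<^esub> = cls (\<lambda>n. e)"
proof -
  have "(THE u. u \<in> carrier U \<and> (\<forall>a\<in>carrier U. universal_mult X R u a = a \<and> universal_mult X R a u = a)) = cls (\<lambda>n. e)"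
  proof (rule the_equality)
    show 1: "cls (\<lambda>n. e) \<in> carrier U \<and> (\<forall>a\<in>carrier U. universal_mult X R (cls (\<lambda>n. e)) a = a \<and> universal_mult X R a (cls (\<lambda>n. e)) = a)"
    proof (intro conjI ballI)
      fix a assume "a \<in> carrier U"
      then obtain x where x: "x \<in> CS" "a = cls x" by (rule carrierE)
      show "universal_mult X R (cls (\<lambda>n. e)) a = a" "universal_mult X R a (cls (\<lambda>n. e)) = a"
        unfolding x(2) using x(1) CS_const[OF e_free] cls_e by (simp_all add: U_mult0)
    qed (simp add: CS_const e_free)
    fix u assume "u \<in> carrier U \<and> (\<forall>a\<in>carrier U. universal_mult X R u a = a \<and> universal_mult X R a u = a)"
    then show "u = cls (\<lambda>n. e)" using 1 by metis
  qed
  then show ?thesis unfolding carrier_U by (simp add: universal_cstar_def Let_def)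
qed

lemma U_ring: "ring U"
proof (rule ringI)
  note c = CS_add CS_mult CS_const CS_uminus
  show "abelian_group U"
  proof (rule abelian_groupI)
    fix x assume "x \<in> carrier U"
    then obtain f where f: "f \<in> CS" "x = cls f" by (rule carrierE)
    have "cls (\<lambda>n. - f n) \<oplus>\<^bsub>U\<^esub> x = \<zero>\<^bsub>U\<^esub>"
      using f by (simp add: U_add U_zero c)
    then show "\<exists>y\<in>carrier U. y \<oplus>\<^bsub>U\<^esub> x = \<zero>\<^bsub>U\<^esub>" using f by (auto intro!: bexI[of _ "cls (\<lambda>n. - f n)"] simp: c)
  qed (auto elim!: carrierE simp: U_add U_zero c add_ac)
  show "monoid U"
  proof (rule monoidI)
    fix x assume "x \<in> carrier U"
    then obtain f where f: "f \<in> CS" "x = cls f" by (rule carrierE)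
    show "\<one>\<^bsub>U\<^esub> \<otimes>\<^bsub>U\<^esub> x = x" "x \<otimes>\<^bsub>U\<^esub> \<one>\<^bsub>U\<^esub> = x"
      using f by (simp_all add: U_mult U_one c e_free cls_e)
  qed (auto elim!: carrierE simp: U_mult U_one c e_free mult.assoc)
qed (auto elim!: carrierE simp: U_mult U_add CS_add CS_mult algebra_simps)

interpretation U: ring U by (rule U_ring)

lemma U_minus: "x \<in> CS ==> \<ominus>\<^bsub>U\<^esub> cls x = cls (\<lambda>n. - x n)"
  by (rule U.minus_equality) (simp_all add: U_add U_zero CS_uminus)

lemma U_diff: "x \<in> CS ==> y \<in> CS ==> cls x \<ominus>\<^bsub>U\<^esub> cls y = cls (\<lambda>n. x n - y n)"
  by (simp add: U.minus_eq U_minus U_add CS_uminus)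

lemma unorm_triangle:
  assumes "a \<in> carrier U" "b \<in> carrier U" "c \<in> carrier U"
  shows "unorm (a \<ominus>\<^bsub>U\<^esub> c) \<le> unorm (a \<ominus>\<^bsub>U\<^esub> b) + unorm (b \<ominus>\<^bsub>U\<^esub> c)"
proof -
  obtain x y z where x: "x \<in> CS" "a = cls x" "y \<in> CS" "b = cls y" "z \<in> CS" "c = cls z"
    using assms by (metis carrierE)
  have "(\<lambda>n. N (x n - y n) + N (y n - z n)) \<longlonglongrightarrow> unorm (a \<ominus>\<^bsub>U\<^esub> b) + unorm (b \<ominus>\<^bsub>U\<^esub> c)"
    using x by (intro tendsto_add) (simp_all add: U_diff unorm_cls CS_diff)
  moreover have "(\<lambda>n. N (x n - z n)) \<longlonglongrightarrow> unorm (a \<ominus>\<^bsub>U\<^esub> c)"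
    using x by (simp add: U_diff unorm_cls CS_diff)
  moreover have "N (x n - z n) \<le> N (x n - y n) + N (y n - z n)" for n
    using x CS_F by (intro N_diff_triangle) auto
  ultimately show ?thesis by (intro LIMSEQ_le) auto
qed

text \<open>Replace the k-th element by a constant sequence within distance 1 / (k + 1). The chosen
  polynomials form a Cauchy sequence themselves, and its class is the limit.\<close>

lemma U_complete:
  fixes a :: "nat => (nat => 'a star_poly) set"
  assumes a: "!!n. a n \<in> carrier U"
    and cauchy: "!!e. e > 0 ==> \<exists>M. \<forall>m\<ge>M. \<forall>n\<ge>M. unorm (a m \<ominus>\<^bsub>U\<^esub> a n) < e"
  shows "\<exists>b\<in>carrier U. (\<lambda>n. unorm (a n \<ominus>\<^bsub>U\<^esub> b)) \<longlonglongrightarrow> 0"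
proof -
  have "\<exists>f. f \<in> F \<and> unorm (a k \<ominus>\<^bsub>U\<^esub> cls (\<lambda>n. f)) \<le> 1 / Suc k" for k
  proof -
    obtain x where x: "x \<in> CS" "a k = cls x" using a by (rule carrierE)
    obtain M where M: "\<forall>m\<ge>M. \<forall>n\<ge>M. N (x m - x n) < 1 / Suc k"
      using CS_cauchy[OF x(1), of "1 / Suc k"] by auto
    have "(\<lambda>n. N (x n - x M)) \<longlonglongrightarrow> unorm (a k \<ominus>\<^bsub>U\<^esub> cls (\<lambda>n. x M))"
      using x by (simp add: U_diff unorm_cls CS_diff CS_const CS_F)
    then have "unorm (a k \<ominus>\<^bsub>U\<^esub> cls (\<lambda>n. x M)) \<le> 1 / Suc k"
      by (rule LIMSEQ_le_const2) (use M in \<open>auto intro!: exI[of _ M] less_imp_le\<close>)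
    then show ?thesis using CS_F[OF x(1)] by blast
  qed
  then obtain y where y: "!!k. y k \<in> F" "!!k. unorm (a k \<ominus>\<^bsub>U\<^esub> cls (\<lambda>n. y k)) \<le> 1 / Suc k" by metis
  define i where "i k = cls (\<lambda>n. y k)" for k
  have i: "i k \<in> carrier U" for k using y by (simp add: i_def CS_const)
  have sym: "unorm (u \<ominus>\<^bsub>U\<^esub> v) = unorm (v \<ominus>\<^bsub>U\<^esub> u)" if "u \<in> carrier U" "v \<in> carrier U" for u v
  proof -
    obtain x z where x: "x \<in> CS" "u = cls x" "z \<in> CS" "v = cls z" using \<open>u \<in> carrier U\<close> \<open>v \<in> carrier U\<close> by (metis carrierE)
    have "(\<lambda>n. N (x n - z n)) \<longlonglongrightarrow> unorm (u \<ominus>\<^bsub>U\<^esub> v)" "(\<lambda>n. N (z n - x n)) \<longlonglongrightarrow> unorm (v \<ominus>\<^bsub>U\<^esub> u)"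
      using x by (simp_all add: U_diff unorm_cls CS_diff)
    moreover have "N (x n - z n) = N (z n - x n)" for n using x CS_F by (simp add: N_diff_commute)
    ultimately show ?thesis using LIMSEQ_unique by simp
  qed
  have yC: "y \<in> CS"
  proof (rule CS_I)
    fix e :: real assume e: "e > 0"
    obtain M where M: "\<forall>m\<ge>M. \<forall>n\<ge>M. unorm (a m \<ominus>\<^bsub>U\<^esub> a n) < e / 3" using cauchy[of "e/3"] e by auto
    obtain L :: nat where "real L > 3 / e" using reals_Archimedean2 by blast
    then have L: "1 / real (Suc n) < e / 3" if "n \<ge> L" for n
    proof -
      have "real (Suc n) > 3 / e" using that \<open>real L > 3 / e\<close> by linarith
      then show ?thesis using e by (simp add: field_simps)
    qed
    have "N (y m - y n) < e" if m: "m \<ge> max M L" and n: "n \<ge> max M L" for m n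
    proof -
      have "N (y m - y n) = unorm (i m \<ominus>\<^bsub>U\<^esub> i n)"
        using y by (simp add: i_def U_diff CS_const unorm_const free_diff)
      also have "\<dots> \<le> unorm (i m \<ominus>\<^bsub>U\<^esub> a m) + (unorm (a m \<ominus>\<^bsub>U\<^esub> a n) + unorm (a n \<ominus>\<^bsub>U\<^esub> i n))"
        using unorm_triangle[OF i[of m] a[of m] i[of n]] unorm_triangle[OF a[of m] a[of n] i[of n]] by simp
      also have "\<dots> < e / 3 + (e / 3 + e / 3)"
        using y(2)[of m] y(2)[of n] L[of m] L[of n] M m n sym[OF i[of m] a[of m]] by (fold i_def) (intro add_strict_mono; simp)
      finally show ?thesis by simp
    qed
    then show "\<exists>M. \<forall>m\<ge>M. \<forall>n\<ge>M. N (y m - y n) < e" by blast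
  qed (rule y)
  have "(\<lambda>k. unorm (a k \<ominus>\<^bsub>U\<^esub> cls y)) \<longlonglongrightarrow> 0"
  proof (rule LIMSEQ_I)
    fix e :: real assume e: "e > 0"
    obtain M where M: "\<forall>m\<ge>M. \<forall>n\<ge>M. N (y m - y n) < e / 2 / 2" using CS_cauchy[OF yC, of "e/2/2"] e by auto
    obtain L :: nat where L0: "real L > 2 / e" using reals_Archimedean2 by blast
    have "norm (unorm (a k \<ominus>\<^bsub>U\<^esub> cls y) - 0) < e" if k: "k \<ge> max M L" for k
    proof -
      have "(\<lambda>n. N (y k - y n)) \<longlonglongrightarrow> unorm (i k \<ominus>\<^bsub>U\<^esub> cls y)"
        using y yC by (simp add: i_def U_diff unorm_cls CS_diff CS_const)
      then have 1: "unorm (i k \<ominus>\<^bsub>U\<^esub> cls y) \<le> e / 2 / 2"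
        by (rule LIMSEQ_le_const2) (use M k in \<open>auto intro!: exI[of _ M] less_imp_le\<close>)
      have "real (Suc k) > 2 / e" using k L0 by linarith
      then have "1 / real (Suc k) < e / 2" using e by (simp add: field_simps)
      then have "unorm (a k \<ominus>\<^bsub>U\<^esub> cls y) < e"
        using unorm_triangle[OF a[of k] i[of k], of "cls y"] yC 1 y(2)[of k] e by (fold i_def) simp
      moreover have "unorm (a k \<ominus>\<^bsub>U\<^esub> cls y) \<ge> 0"
      proof -
        obtain x where x: "x \<in> CS" "a k = cls x" using a by (rule carrierE)
        have "(\<lambda>n. N (x n - y n)) \<longlonglongrightarrow> unorm (a k \<ominus>\<^bsub>U\<^esub> cls y)"
          using x yC by (simp add: U_diff unorm_cls CS_diff)
        then show ?thesis by (rule LIMSEQ_le_const) (use x yC CS_F in \<open>auto intro!: N_nonneg free_diff\<close>)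
      qed
      ultimately show ?thesis by simp
    qed
    then show "\<exists>M. \<forall>k\<ge>M. norm (unorm (a k \<ominus>\<^bsub>U\<^esub> cls y) - 0) < e" by blast
  qed
  then show ?thesis using yC by (intro bexI[of _ "cls y"]) auto
qed

lemma U_cstar: "cstar_algebra U unorm"
proof -
  note c = CS_add CS_mult CS_const CS_uminus CS_scale CS_star
  note o = U_add U_mult U_smult U_star
  show ?thesis
  proof (unfold_locales; (elim carrierE)?; hypsubst?)
    fix a b and x y :: "nat => 'a star_poly" and k l
    assume x: "x \<in> CS"
    note Fx = CS_F[OF x]
    show "k \<odot>\<^bsub>U\<^esub> cls x \<in> carrier U" using x by (simp add: o c)
    show "(k + l) \<odot>\<^bsub>U\<^esub> cls x = k \<odot>\<^bsub>U\<^esub> cls x \<oplus>\<^bsub>U\<^esub> l \<odot>\<^bsub>U\<^esub> cls x" using x by (simp add: o c poly_scale_distrib)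
    show "k \<odot>\<^bsub>U\<^esub> (l \<odot>\<^bsub>U\<^esub> cls x) = (k * l) \<odot>\<^bsub>U\<^esub> cls x" using x by (simp add: o c poly_scale_simps)
    show "1 \<odot>\<^bsub>U\<^esub> cls x = cls x" using x by (simp add: o c poly_scale_simps)
    show "star U (cls x) \<in> carrier U" using x by (simp add: o c)
    show "star U (k \<odot>\<^bsub>U\<^esub> cls x) = cnj k \<odot>\<^bsub>U\<^esub> star U (cls x)" using x by (simp add: o c poly_star_scale)
    show "star U (star U (cls x)) = cls x" using x by (simp add: o c)
    show "0 \<le> unorm (cls x)"
      by (rule LIMSEQ_le_const[OF unorm_cls[OF x]]) (auto simp: Fx N_nonneg)
    show "cls x = \<zero>\<^bsub>U\<^esub>" if "unorm (cls x) = 0"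
      unfolding U_zero using x unorm_cls[OF x] that by (simp add: cls_eq_iff CS_const)
    show "unorm (k \<odot>\<^bsub>U\<^esub> cls x) = cmod k * unorm (cls x)"
    proof (rule LIMSEQ_unique)
      show "(\<lambda>n. N (poly_scale k (x n))) \<longlonglongrightarrow> unorm (k \<odot>\<^bsub>U\<^esub> cls x)"
        using x by (simp add: o unorm_cls c)
      show "(\<lambda>n. N (poly_scale k (x n))) \<longlonglongrightarrow> cmod k * unorm (cls x)"
        using x by (simp add: N_scale Fx tendsto_mult_left unorm_cls)
    qed
    show "unorm (star U (cls x) \<otimes>\<^bsub>U\<^esub> cls x) = (unorm (cls x))\<^sup>2"
    proof (rule LIMSEQ_unique)
      show "(\<lambda>n. N (poly_star (x n) * x n)) \<longlonglongrightarrow> unorm (star U (cls x) \<otimes>\<^bsub>U\<^esub> cls x)"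
        using x by (simp add: o unorm_cls c)
      show "(\<lambda>n. N (poly_star (x n) * x n)) \<longlonglongrightarrow> (unorm (cls x))\<^sup>2"
        using x by (simp add: N_cstar Fx tendsto_power unorm_cls)
    qed
    assume y: "y \<in> CS"
    note Fy = CS_F[OF y]
    show "k \<odot>\<^bsub>U\<^esub> (cls x \<oplus>\<^bsub>U\<^esub> cls y) = k \<odot>\<^bsub>U\<^esub> cls x \<oplus>\<^bsub>U\<^esub> k \<odot>\<^bsub>U\<^esub> cls y"
      using x y by (simp add: o c poly_scale_distrib)
    show "k \<odot>\<^bsub>U\<^esub> cls x \<otimes>\<^bsub>U\<^esub> cls y = k \<odot>\<^bsub>U\<^esub> (cls x \<otimes>\<^bsub>U\<^esub> cls y)"
      "cls x \<otimes>\<^bsub>U\<^esub> (k \<odot>\<^bsub>U\<^esub> cls y) = k \<odot>\<^bsub>U\<^esub> (cls x \<otimes>\<^bsub>U\<^esub> cls y)"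
      using x y by (simp_all add: o c poly_scale_simps)
    show "star U (cls x \<oplus>\<^bsub>U\<^esub> cls y) = star U (cls x) \<oplus>\<^bsub>U\<^esub> star U (cls y)"
      using x y by (simp add: o c poly_star_add)
    show "star U (cls x \<otimes>\<^bsub>U\<^esub> cls y) = star U (cls y) \<otimes>\<^bsub>U\<^esub> star U (cls x)"
      using x y by (simp add: o c poly_star_mult)
    show "unorm (cls x \<oplus>\<^bsub>U\<^esub> cls y) \<le> unorm (cls x) + unorm (cls y)"
    proof (rule LIMSEQ_le)
      show "(\<lambda>n. N (x n + y n)) \<longlonglongrightarrow> unorm (cls x \<oplus>\<^bsub>U\<^esub> cls y)" using x y by (simp add: o unorm_cls c)
      show "(\<lambda>n. N (x n) + N (y n)) \<longlonglongrightarrow> unorm (cls x) + unorm (cls y)"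
        using x y by (intro tendsto_add unorm_cls)
    qed (use Fx Fy N_add in auto)
    show "unorm (cls x \<otimes>\<^bsub>U\<^esub> cls y) \<le> unorm (cls x) * unorm (cls y)"
    proof (rule LIMSEQ_le)
      show "(\<lambda>n. N (x n * y n)) \<longlonglongrightarrow> unorm (cls x \<otimes>\<^bsub>U\<^esub> cls y)" using x y by (simp add: o unorm_cls c)
      show "(\<lambda>n. N (x n) * N (y n)) \<longlonglongrightarrow> unorm (cls x) * unorm (cls y)"
        using x y by (intro tendsto_mult unorm_cls)
    qed (use Fx Fy N_mult in auto)
  next
    fix x :: "nat => (nat => 'a star_poly) set"
    assume "!!n. x n \<in> carrier U" "!!e. e > 0 ==> \<exists>M. \<forall>m\<ge>M. \<forall>n\<ge>M. unorm (x m \<ominus>\<^bsub>U\<^esub> x n) < e"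
    then show "\<exists>a\<in>carrier U. (\<lambda>n. unorm (x n \<ominus>\<^bsub>U\<^esub> a)) \<longlonglongrightarrow> 0" by (rule U_complete)
  qed
qed

end

section \<open>Evaluation of *-polynomials in a C*-algebra\<close>

context cstar_algebra
begin

text \<open>The empty word is sent to the unit, so that evaluation is multiplicative on the whole
  monoid algebra and not only on the free algebra inside it.\<close>

definition eval_letters :: "('g => 'a) => ('g \<times> bool) list => 'a" where
  "eval_letters g l = foldr (\<lambda>(h, b) a. (if b then star A (g h) else g h) \<otimes> a) l \<one>"

definition eval_poly :: "('g => 'a) => 'g star_poly => 'a" where
  "eval_poly g x = finsum A (\<lambda>w. lookup x w \<odot> eval_letters g (letters w)) (keys x)"

context
  fixes g :: "'g => 'a" assumes g [simp]: "!!h. g h \<in> carrier A"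
begin

lemma eval_letters_closed [simp]: "eval_letters g l \<in> carrier A"
  by (induct l) (auto simp: eval_letters_def)

lemma eval_letters_simps:
  "eval_letters g [] = \<one>"
  "eval_letters g ((h, b) # l) = (if b then star A (g h) else g h) \<otimes> eval_letters g l"
  by (auto simp: eval_letters_def)

lemma eval_letters_append: "eval_letters g (l @ m) = eval_letters g l \<otimes> eval_letters g m"
proof (induct l)
  case (Cons a l)
  then show ?case by (cases a) (simp add: eval_letters_simps m_assoc)
qed (simp add: eval_letters_simps)

lemma eval_letters_adj: "eval_letters g (letters (adj_word w)) = star A (eval_letters g (letters w))"
proof -
  have "eval_letters g (rev (map (\<lambda>(g, b). (g, \<not> b)) l)) = star A (eval_letters g l)" for l
  proof (induct l)
    case (Cons a l)
    then show ?case by (cases a) (simp add: eval_letters_simps eval_letters_append star_mult)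
  qed (simp add: eval_letters_simps)
  then show ?thesis by (simp add: adj_word_def)
qed

lemma eval_poly_superset:
  assumes "finite K" "keys x \<subseteq> K"
  shows "eval_poly g x = finsum A (\<lambda>w. lookup x w \<odot> eval_letters g (letters w)) K"
  unfolding eval_poly_def
  by (rule add.finprod_mono_neutral_cong_left) (use assms in \<open>auto simp: in_keys_iff\<close>)

lemma eval_poly_closed [simp]: "eval_poly g x \<in> carrier A"
  unfolding eval_poly_def by (rule finsum_closed) auto

lemma eval_poly_zero: "eval_poly g 0 = \<zero>"
  by (simp add: eval_poly_def)

lemma eval_poly_add: "eval_poly g (x + y) = eval_poly g x \<oplus> eval_poly g y"
proof -
  let ?K = "keys x \<union> keys y"
  have "eval_poly g (x + y) = finsum A (\<lambda>w. lookup (x + y) w \<odot> eval_letters g (letters w)) ?K"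
    by (rule eval_poly_superset) (use Poly_Mapping.keys_add[of x y] in auto)
  also have "\<dots> = finsum A (\<lambda>w. lookup x w \<odot> eval_letters g (letters w) \<oplus>
      lookup y w \<odot> eval_letters g (letters w)) ?K"
    by (rule finsum_cong') (auto simp: lookup_add smult_l_distr)
  also have "\<dots> = finsum A (\<lambda>w. lookup x w \<odot> eval_letters g (letters w)) ?K \<oplus>
      finsum A (\<lambda>w. lookup y w \<odot> eval_letters g (letters w)) ?K"
    by (rule finsum_addf) auto
  also have "\<dots> = eval_poly g x \<oplus> eval_poly g y"
    by (subst (1 2) eval_poly_superset[of ?K]) auto
  finally show ?thesis .
qed

lemma eval_poly_single: "eval_poly g (single w c) = c \<odot> eval_letters g (letters w)"
proof -
  have "eval_poly g (single w c) = finsum A (\<lambda>v. lookup (single w c) v \<odot> eval_letters g (letters v)) {w}"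
    by (rule eval_poly_superset) auto
  then show ?thesis by simp
qed

lemma eval_poly_scale: "eval_poly g (poly_scale c x) = c \<odot> eval_poly g x"
  by (induct x rule: poly_mapping_single_induct)
    (auto simp: poly_scale_single eval_poly_single poly_scale_distrib eval_poly_add smult_smult smult_r_distr)

lemma eval_poly_uminus: "eval_poly g (- x) = \<ominus> eval_poly g x"
  using eval_poly_scale[of "-1" x] by (simp add: poly_scale_distrib poly_scale_simps smult_minus1)

lemma eval_poly_diff: "eval_poly g (x - y) = eval_poly g x \<ominus> eval_poly g y"
  using eval_poly_add[of x "- y"] by (simp add: eval_poly_uminus minus_eq)

lemma eval_poly_mult: "eval_poly g (x * y) = eval_poly g x \<otimes> eval_poly g y"
proof (induct x rule: poly_mapping_single_induct)
  case (1 w c)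
  show ?case
  proof (induct y rule: poly_mapping_single_induct)
    case (1 v d)
    show ?case
      by (simp add: mult_single eval_poly_single plus_star_word_def eval_letters_append
          smult_mult_l smult_mult_r smult_smult mult.commute)
  qed (simp add: distrib_left eval_poly_add r_distr)
qed (simp add: distrib_right eval_poly_add l_distr)

lemma eval_poly_star: "eval_poly g (poly_star x) = star A (eval_poly g x)"
  by (induct x rule: poly_mapping_single_induct)
    (auto simp: poly_star_single eval_poly_single eval_letters_adj star_smult poly_star_add eval_poly_add star_add)

lemma eval_poly_gen: "eval_poly g (gen h) = g h"
  by (simp add: gen_def eval_poly_single eval_letters_simps)

lemma eval_poly_sum: "finite I ==> eval_poly g (sum f I) = finsum A (\<lambda>i. eval_poly g (f i)) I"
  by (induct I rule: finite_induct) (auto simp: eval_poly_zero eval_poly_add)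

text \<open>The norm pulled back along a *-homomorphism is a C*-seminorm. When the relations
  evaluate to 0 it competes in the supremum, so evaluation is bounded by the universal
  seminorm.\<close>

lemma eval_poly_seminorm: "(\<lambda>x. nrm (eval_poly g x)) \<in> cstar_seminorms X"
  by (auto simp: cstar_seminorms_def Let_def nrm_nonneg eval_poly_add nrm_add eval_poly_scale nrm_smult
      eval_poly_mult nrm_mult eval_poly_star nrm_cstar)

end

end

section \<open>The universal property\<close>

context unital_relations
begin

sublocale U: cstar_algebra U unorm by (rule U_cstar)

abbreviation "emb x \<equiv> cls (\<lambda>n. x)"

lemma emb_closed [simp]: "x \<in> F ==> emb x \<in> carrier U"
  by (simp add: CS_const)

lemma emb_ops:
  "x \<in> F ==> y \<in> F ==> emb (x + y) = emb x \<oplus>\<^bsub>U\<^esub> emb y"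
  "x \<in> F ==> y \<in> F ==> emb (x - y) = emb x \<ominus>\<^bsub>U\<^esub> emb y"
  "x \<in> F ==> y \<in> F ==> emb (x * y) = emb x \<otimes>\<^bsub>U\<^esub> emb y"
  "x \<in> F ==> emb (poly_scale c x) = c \<odot>\<^bsub>U\<^esub> emb x"
  "x \<in> F ==> emb (poly_star x) = star U (emb x)"
  by (simp_all add: U_add U_diff U_mult U_smult U_star CS_const)

lemma emb_sum: "finite I ==> (!!i. i \<in> I ==> f i \<in> F) ==> emb (sum f I) = finsum U (\<lambda>i. emb (f i)) I"
proof (induct I rule: finite_induct)
  case empty
  then show ?case by (simp add: U_zero)
next
  case (insert i I)
  then show ?case by (simp add: emb_ops(1) free_sum Pi_def)
qed

lemma emb_null: "x \<in> F ==> N x = 0 ==> emb x = \<zero>\<^bsub>U\<^esub>"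
  unfolding U_zero by (rule cls_eqI) (auto simp: CS_const)

lemma emb_eq: "x \<in> F ==> y \<in> F ==> N (x - y) = 0 ==> emb x = emb y"
  by (rule cls_eqI) (auto simp: CS_const)

lemma emb_dense:
  assumes "a \<in> carrier U"
  obtains y where "!!n. y n \<in> F" "U.conv (\<lambda>k. emb (y k)) a"
proof -
  obtain x where x: "x \<in> CS" "a = cls x" using assms by (rule carrierE)
  have "(\<lambda>k. unorm (emb (x k) \<ominus>\<^bsub>U\<^esub> a)) \<longlonglongrightarrow> 0"
  proof (rule LIMSEQ_I)
    fix r :: real assume r: "r > 0"
    obtain M where M: "!!m n. m \<ge> M ==> n \<ge> M ==> N (x m - x n) < r / 2"
      using CS_cauchyE[OF x(1), of "r / 2"] r by auto
    have "norm (unorm (emb (x k) \<ominus>\<^bsub>U\<^esub> a) - 0) < r" if k: "k \<ge> M" for k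
    proof -
      have "(\<lambda>n. N (x k - x n)) \<longlonglongrightarrow> unorm (emb (x k) \<ominus>\<^bsub>U\<^esub> a)"
        using x by (simp add: U_diff CS_const CS_F unorm_cls CS_diff)
      then have "unorm (emb (x k) \<ominus>\<^bsub>U\<^esub> a) \<le> r / 2"
        by (rule LIMSEQ_le_const2) (use M k in \<open>auto intro!: exI[of _ M] less_imp_le\<close>)
      moreover have "unorm (emb (x k) \<ominus>\<^bsub>U\<^esub> a) \<ge> 0" using x assms by (intro U.nrm_nonneg) (simp add: CS_F)
      ultimately show ?thesis using r by simp
    qed
    then show "\<exists>M. \<forall>k\<ge>M. norm (unorm (emb (x k) \<ominus>\<^bsub>U\<^esub> a) - 0) < r" by blast
  qed
  then have "U.conv (\<lambda>k. emb (x k)) a" unfolding U.conv_def using x assms by (auto simp: CS_F)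
  then show ?thesis using that[of x] x by (auto simp: CS_F)
qed

text \<open>Evaluation is dominated by the universal seminorm, so it turns Cauchy sequences of
  polynomials into Cauchy sequences of B; the homomorphism takes their limits.\<close>

theorem universal_hom:
  fixes B :: "'b star_algebra"
  assumes B: "cstar_algebra B nB" and g: "!!h. g h \<in> carrier B"
    and rels: "!!r. r \<in> R ==> cstar_algebra.eval_poly B g r = \<zero>\<^bsub>B\<^esub>"
  obtains \<phi> where "\<phi> \<in> star_hom U B" "!!h. h \<in> X ==> \<phi> (emb (gen h)) = g h"
proof -
  interpret B: cstar_algebra B nB by (rule B)
  let ?ev = "B.eval_poly g"
  have ev: "?ev x \<in> carrier B" for x by (rule B.eval_poly_closed) (rule g)
  have "(\<lambda>x. nB (?ev x)) \<in> SN" using rels B.eval_poly_seminorm[OF g] by auto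
  then have le: "nB (?ev x) \<le> N x" if "x \<in> F" for x
    using SN_le_N that by blast
  have ex: "\<exists>b. B.conv (\<lambda>n. ?ev (x n)) b" if x: "x \<in> CS" for x
  proof -
    have "\<exists>b\<in>carrier B. (\<lambda>n. nB (?ev (x n) \<ominus>\<^bsub>B\<^esub> b)) \<longlonglongrightarrow> 0"
    proof (rule B.complete)
      fix r :: real assume "r > 0"
      then obtain M where M: "!!m n. m \<ge> M ==> n \<ge> M ==> N (x m - x n) < r" using CS_cauchyE[OF x] by blast
      have "nB (?ev (x m) \<ominus>\<^bsub>B\<^esub> ?ev (x n)) < r" if "m \<ge> M" "n \<ge> M" for m n
        using le[of "x m - x n"] M[OF that] CS_F[OF x] by (simp add: B.eval_poly_diff[OF g] free_diff)
      then show "\<exists>M. \<forall>m\<ge>M. \<forall>n\<ge>M. nB (?ev (x m) \<ominus>\<^bsub>B\<^esub> ?ev (x n)) < r" by blast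
    qed (rule ev)
    then obtain b where "b \<in> carrier B" "(\<lambda>n. nB (?ev (x n) \<ominus>\<^bsub>B\<^esub> b)) \<longlonglongrightarrow> 0" by blast
    then show ?thesis unfolding B.conv_def using ev by (auto intro!: exI[of _ b])
  qed
  \<comment> \<open>The limit is taken along some representative of the class; \<open>conv\<close>
    shows that every representative has this limit.\<close>
  define \<phi> where "\<phi> a = (SOME b. \<exists>x\<in>a. B.conv (\<lambda>n. ?ev (x n)) b)" for a
  have conv: "B.conv (\<lambda>n. ?ev (x n)) (\<phi> (cls x))" if x: "x \<in> CS" for x
  proof -
    have "\<exists>b. \<exists>y\<in>cls x. B.conv (\<lambda>n. ?ev (y n)) b" using ex[OF x] self_in_cls[OF x] by blast
    then have "\<exists>y\<in>cls x. B.conv (\<lambda>n. ?ev (y n)) (\<phi> (cls x))"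
      unfolding \<phi>_def by (rule someI_ex)
    then obtain y where y: "y \<in> cls x" "B.conv (\<lambda>n. ?ev (y n)) (\<phi> (cls x))" by blast
    have yC: "y \<in> CS" "cls y = cls x" using in_cls[OF y(1)] by auto
    show ?thesis
    proof (rule B.convI)
      show "nB (?ev (x n) \<ominus>\<^bsub>B\<^esub> \<phi> (cls x)) \<le> N (x n - y n) + nB (?ev (y n) \<ominus>\<^bsub>B\<^esub> \<phi> (cls x))" for n
        using le[of "x n - y n"] B.nrm_triangle[OF ev[of "x n"] ev[of "y n"] B.convD(2)[OF y(2)]] CS_F[OF x] CS_F[OF yC(1)]
        by (simp add: B.eval_poly_diff[OF g] free_diff)
      have "(\<lambda>n. N (x n - y n)) \<longlonglongrightarrow> 0" using cls_eq_iff[OF x yC(1)] yC(2) by simp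
      from tendsto_add[OF this B.convD(3)[OF y(2)]]
      show "(\<lambda>n. N (x n - y n) + nB (?ev (y n) \<ominus>\<^bsub>B\<^esub> \<phi> (cls x))) \<longlonglongrightarrow> 0" by simp
    qed (use ev B.convD(2)[OF y(2)] in auto)
  qed
  note cl = B.convD(2)[OF conv]
  note ops = U_add U_mult U_smult U_star CS_add CS_mult CS_scale CS_star
  have "\<phi> \<in> star_hom U B"
    unfolding star_hom_def
  proof (intro CollectI conjI ballI allI Pi_I; (elim carrierE)?; hypsubst?)
    fix x c assume x: "x \<in> CS"
    show "\<phi> (cls x) \<in> carrier B" using cl[OF x] .
    show "\<phi> (c \<odot>\<^bsub>U\<^esub> cls x) = c \<odot>\<^bsub>B\<^esub> \<phi> (cls x)"
      using B.conv_unique[OF conv[OF CS_scale[OF x, of c]]] B.conv_smult[OF conv[OF x], of c] x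
      by (simp add: ops B.eval_poly_scale[OF g])
    show "\<phi> (star U (cls x)) = star B (\<phi> (cls x))"
      using B.conv_unique[OF conv[OF CS_star[OF x]]] B.conv_star[OF conv[OF x]] x
      by (simp add: ops B.eval_poly_star[OF g])
    fix y assume y: "y \<in> CS"
    show "\<phi> (cls x \<oplus>\<^bsub>U\<^esub> cls y) = \<phi> (cls x) \<oplus>\<^bsub>B\<^esub> \<phi> (cls y)"
      using B.conv_unique[OF conv[OF CS_add[OF x y]]] B.conv_add[OF conv[OF x] conv[OF y]] x y
      by (simp add: ops B.eval_poly_add[OF g])
    show "\<phi> (cls x \<otimes>\<^bsub>U\<^esub> cls y) = \<phi> (cls x) \<otimes>\<^bsub>B\<^esub> \<phi> (cls y)"
      using B.conv_unique[OF conv[OF CS_mult[OF x y]]] B.conv_mult[OF conv[OF x] conv[OF y]] x y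
      by (simp add: ops B.eval_poly_mult[OF g])
  qed
  moreover have "\<phi> (emb (gen h)) = g h" if h: "h \<in> X" for h
    using B.conv_unique[OF conv[OF CS_const[OF free_gen[OF h]]] B.conv_const[OF ev]]
    by (simp add: B.eval_poly_gen[OF g])
  ultimately show ?thesis by (rule that)
qed

text \<open>*-Homomorphisms are automatically contractive, so agreement on the dense image of the
  free algebra is enough.\<close>

lemma hom_unique:
  fixes B :: "'b star_algebra"
  assumes B: "cstar_algebra B nB" and \<phi>: "\<phi> \<in> star_hom U B" and \<psi>: "\<psi> \<in> star_hom U B"
    and eq: "!!h. h \<in> X ==> \<phi> (emb (gen h)) = \<psi> (emb (gen h))" and a: "a \<in> carrier U"
  shows "\<phi> a = \<psi> a"
proof -
  interpret B: cstar_algebra B nB by (rule B)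
  interpret cstar_algebra_pair U unorm B nB ..
  have F: "\<phi> (emb x) = \<psi> (emb x)" if "x \<in> F" for x
    using that
  proof (induct rule: free_induct)
    case (scale c x)
    then show ?case by (simp add: emb_ops hom_smult[OF \<phi>] hom_smult[OF \<psi>])
  next
    case zero
    then show ?case by (simp add: U_zero[symmetric] hom_zero[OF \<phi>] hom_zero[OF \<psi>])
  qed (simp_all add: eq emb_ops free_gen free_star hom_star[OF \<phi>] hom_star[OF \<psi>] hom_mult[OF \<phi>] hom_mult[OF \<psi>]
      hom_add[OF \<phi>] hom_add[OF \<psi>])
  obtain y where y: "!!n. y n \<in> F" "U.conv (\<lambda>k. emb (y k)) a" using emb_dense[OF a] by blast
  show ?thesis
    using B.conv_unique[OF hom_conv[OF \<phi> y(2)]] hom_conv[OF \<psi> y(2)] F y(1) by simp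
qed

end

section \<open>Graph C*-algebras\<close>

text \<open>The interface to the C*-algebra of a graph. Besides the defining relations it records
  the consequences \<open>P_S\<close>, \<open>S_orth\<close> and \<open>one_sum\<close>. That the
  generators generate is expressed by \<open>dense\<close>: every subspace with the unit that is
  invariant under left multiplication by the letters is dense.\<close>

locale graph_algebra = fin_digraph G + cstar_algebra A nrm
  for G :: "('v, 'e) pre_digraph" and A :: "'a star_algebra" (structure) and nrm +
  fixes P :: "'v => 'a" and S :: "'e => 'a"
  assumes P_closed [simp]: "v \<in> verts G ==> P v \<in> carrier A"
    and S_closed [simp]: "e \<in> arcs G ==> S e \<in> carrier A"
    and P_star: "v \<in> verts G ==> star A (P v) = P v"
    and P_idem: "v \<in> verts G ==> P v \<otimes> P v = P v"
    and P_orth: "v \<in> verts G ==> w \<in> verts G ==> v \<noteq> w ==> P v \<otimes> P w = \<zero>"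
    and S_star_S: "e \<in> arcs G ==> star A (S e) \<otimes> S e = P (head G e)"
    and P_sum: "v \<in> verts G ==> \<not> is_sink G v ==>
      P v = finsum A (\<lambda>e. S e \<otimes> star A (S e)) {e \<in> arcs G. tail G e = v}"
    and P_S: "e \<in> arcs G ==> P (tail G e) \<otimes> S e = S e"
    and S_orth: "e \<in> arcs G ==> f \<in> arcs G ==> e \<noteq> f ==> star A (S e) \<otimes> S f = \<zero>"
    and one_sum: "\<one> = finsum A P (verts G)"
    and dense: "a \<in> carrier A ==> W \<subseteq> carrier A ==> \<one> \<in> W ==>
      (!!x y. x \<in> W ==> y \<in> W ==> x \<oplus> y \<in> W) ==> (!!c x. x \<in> W ==> c \<odot> x \<in> W) ==>
      (!!v x. v \<in> verts G ==> x \<in> W ==> P v \<otimes> x \<in> W) ==>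
      (!!e x. e \<in> arcs G ==> x \<in> W ==> S e \<otimes> x \<in> W) ==>
      (!!e x. e \<in> arcs G ==> x \<in> W ==> star A (S e) \<otimes> x \<in> W) ==>
      \<exists>x. (\<forall>n. x n \<in> W) \<and> cstar_algebra.conv A nrm x a"

lemma (in cstar_seminorm) N_ideal_cong:
  assumes "x \<in> F" "y \<in> F" "z \<in> F" "N (x - y) = 0"
  shows "N (z * x - z * y) = 0" "N (x * z - y * z) = 0"
  using N_null_mult[of z "x - y"] N_null_mult[of "x - y" z] assms by (simp_all add: algebra_simps free_diff)

lemma (in cstar_seminorm) N_null_trans:
  assumes "x \<in> F" "y \<in> F" "z \<in> F" "N (x - y) = 0" "N (y - z) = 0"
  shows "N (x - z) = 0"
  using N_null_add[of "x - y" "y - z"] assms by (simp add: free_diff)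

section \<open>Consequences of the graph relations in the universal seminorm\<close>

context fin_digraph
begin

abbreviation "GX \<equiv> graph_gens G"
abbreviation "GR \<equiv> graph_rels G"

lemma out_finite [simp]: "finite {e \<in> arcs G. tail G e = v}"
  by simp

lemma gens [simp]:
  "v \<in> verts G ==> P_gen v \<in> free_star_algebra GX"
  "e \<in> arcs G ==> S_gen e \<in> free_star_algebra GX"
  by (rule free_gen; simp add: graph_gens_def)+

lemma graph_rels_free: "GR \<subseteq> free_star_algebra GX"
  unfolding graph_rels_def by (auto intro!: free_intros)

lemma graph_relsI:
  "v \<in> verts G ==> poly_star (P_gen v) - P_gen v \<in> GR"
  "v \<in> verts G ==> P_gen v * P_gen v - P_gen v \<in> GR"
  "v \<in> verts G ==> w \<in> verts G ==> v \<noteq> w ==> P_gen v * P_gen w \<in> GR"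
  "e \<in> arcs G ==> S_gen e * poly_star (S_gen e) * S_gen e - S_gen e \<in> GR"
  "e \<in> arcs G ==> poly_star (S_gen e) * S_gen e - P_gen (head G e) \<in> GR"
  "v \<in> verts G ==> \<not> is_sink G v ==>
     P_gen v - (\<Sum>e\<in>{e \<in> arcs G. tail G e = v}. S_gen e * poly_star (S_gen e)) \<in> GR"
  unfolding graph_rels_def by blast+

text \<open>A projection satisfies p(P)^2 = p(P), so its seminorm is 0 or 1. The C*-square of an
  edge generator is a vertex projection up to a null element.\<close>

lemma graph_gens_bounded:
  assumes g: "g \<in> GX" and p: "p \<in> cstar_seminorms GX" and pR: "\<forall>r\<in>GR. p r = 0"
  shows "p (gen g) \<le> 1"
proof -
  interpret cstar_seminorm GX p using p by unfold_locales
  have P: "p (P_gen v) \<le> 1" if v: "v \<in> verts G" for v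
  proof -
    let ?P = "P_gen v :: ('a, 'b) graph_poly"
    have 1: "p (poly_star ?P * ?P - ?P * ?P) = 0"
      by (rule N_ideal_cong(2)) (use v pR graph_relsI in \<open>auto intro: free_star\<close>)
    have 2: "p (poly_star ?P * ?P - ?P) = 0"
      by (rule N_null_trans[OF _ _ _ 1]) (use v pR graph_relsI in \<open>auto intro!: free_star free_mult\<close>)
    have "(p ?P)\<^sup>2 = p ?P"
      unfolding N_cstar[OF gens(1)[OF v], symmetric] by (rule N_eq[OF _ _ 2]) (use v in \<open>auto intro!: free_star free_mult\<close>)
    then show ?thesis by (metis mult_cancel_right2 order_refl power2_eq_square zero_le_one)
  qed
  show ?thesis
  proof (cases g)
    case (VertexGen v)
    then show ?thesis using P g by (auto simp: graph_gens_def)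
  next
    case (EdgeGen e)
    then have e: "e \<in> arcs G" using g by (auto simp: graph_gens_def)
    let ?S = "S_gen e :: ('a, 'b) graph_poly"
    have "(p ?S)\<^sup>2 = p (P_gen (head G e))"
      unfolding N_cstar[OF gens(2)[OF e], symmetric]
      by (rule N_eq) (use e pR graph_relsI in \<open>auto intro!: free_star free_mult\<close>)
    then have "(p ?S)\<^sup>2 \<le> 1" using P[of "head G e"] e by simp
    then show ?thesis using EdgeGen abs_square_le_1[of "p ?S"] by simp
  qed
qed

sublocale graph: bounded_relations GX GR
  by unfold_locales (use graph_rels_free graph_gens_bounded in blast)+

abbreviation "GN \<equiv> universal_seminorm GX GR"
abbreviation "GF \<equiv> free_star_algebra GX"

lemmas N_graph = graph_relsI[THEN graph.N_rel]

text \<open>The range projections of the arcs leaving v add up to the vertex projection, itself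
  idempotent up to null elements. So \<open>projections_with_projection_sum\<close> supplies what
  the relations do not state.\<close>

lemma edge_projections:
  assumes v: "v \<in> verts G" "\<not> is_sink G v"
  defines "q \<equiv> \<lambda>e. S_gen e * poly_star (S_gen e) :: ('a, 'b) graph_poly"
    and "J \<equiv> {e \<in> arcs G. tail G e = v}"
  shows "e \<in> J ==> GN ((\<Sum>j\<in>J. q j) * q e - q e) = 0"
    and "e \<in> J ==> f \<in> J ==> e \<noteq> f ==> GN (q f * q e) = 0"
proof -
  have q: "q j \<in> GF" "poly_star (q j) = q j" "GN (q j * q j - q j) = 0" if "j \<in> J" for j
  proof -
    have S: "S_gen j \<in> GF" using that by (simp add: J_def)
    show "q j \<in> GF" "poly_star (q j) = q j" using S by (simp_all add: q_def poly_star_mult free_mult free_star)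
    have "q j * q j - q j = (S_gen j * poly_star (S_gen j) * S_gen j - S_gen j) * poly_star (S_gen j)"
      by (simp add: q_def algebra_simps)
    moreover have "GN (\<dots>) = 0"
      using S that by (intro graph.N_null_mult(1)) (auto simp: N_graph J_def intro!: free_intros)
    ultimately show "GN (q j * q j - q j) = 0" by simp
  qed
  let ?P = "P_gen v :: ('a, 'b) graph_poly" and ?s = "\<Sum>j\<in>J. q j"
  have F: "?P \<in> GF" "?s \<in> GF" using v q by (auto intro!: free_sum)
  have Ps: "GN (?s - ?P) = 0" "GN (?P - ?s) = 0"
    using N_graph(6)[OF v] graph.N_diff_commute[OF F] by (simp_all add: q_def J_def)
  have "GN (?s * ?s - ?P * ?s) = 0" "GN (?P * ?s - ?P * ?P) = 0"
    using F Ps by (auto intro!: graph.N_ideal_cong)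
  note n = graph.N_null_trans[OF free_mult[OF F(2) F(2)] free_mult[OF F(1) F(2)] free_mult[OF F(1) F(1)] this]
  note n = graph.N_null_trans[OF free_mult[OF F(2) F(2)] free_mult[OF F(1) F(1)] F(1) n N_graph(2)[OF v(1)]]
  have s: "GN (?s * ?s - ?s) = 0"
    by (rule graph.N_null_trans[OF free_mult[OF F(2) F(2)] F(1) F(2) n Ps(2)])
  have J: "finite J" by (simp add: J_def)
  show "e \<in> J ==> GN (?s * q e - q e) = 0"
    by (rule graph.projections_with_projection_sum(1)[OF J q s])
  show "e \<in> J ==> f \<in> J ==> e \<noteq> f ==> GN (q f * q e) = 0"
    by (rule graph.projections_with_projection_sum(2)[OF J q s])
qed

lemma not_sink: "e \<in> arcs G ==> \<not> is_sink G (tail G e)"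
  by (auto simp: is_sink_def)

text \<open>The range projection of e lies below the sum at its tail, hence below the vertex
  projection; multiplying by the partial isometry on the right recovers the edge itself.\<close>

lemma tail_absorbs:
  assumes e: "e \<in> arcs G"
  shows "GN (P_gen (tail G e) * S_gen e - S_gen e) = 0"
proof -
  let ?J = "{f \<in> arcs G. tail G f = tail G e}" and ?S = "S_gen e :: ('a, 'b) graph_poly"
  let ?s = "\<Sum>f\<in>?J. S_gen f * poly_star (S_gen f) :: ('a, 'b) graph_poly"
  let ?q = "?S * poly_star ?S" and ?P = "P_gen (tail G e)"
  have v: "tail G e \<in> verts G" using e by simp
  have F: "?S \<in> GF" "?s \<in> GF" "?q \<in> GF" "?P \<in> GF" using e v by (auto intro!: free_sum free_mult free_star)
  have 1: "GN (?P * ?q - ?s * ?q) = 0"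
    using F N_graph(6)[OF v not_sink[OF e]] by (intro graph.N_ideal_cong(2)) auto
  have "GN (?s * ?q - ?q) = 0" by (rule edge_projections(1)[OF v not_sink[OF e]]) (use e in simp)
  then have "GN (?P * ?q - ?q) = 0" by (rule graph.N_null_trans[OF _ _ _ 1, rotated 3]) (use F in \<open>auto intro!: free_mult free_star\<close>)
  then have 2: "GN ((?P * ?q) * ?S - ?q * ?S) = 0" by (rule graph.N_ideal_cong(2)[rotated 3]) (use F in \<open>auto intro!: free_mult free_star\<close>)
  have 3: "GN (?q * ?S - ?S) = 0" using N_graph(4)[OF e] by simp
  have 4: "GN (?P * ?S - ?P * (?q * ?S)) = 0"
    using F 3 graph.N_diff_commute[of "?q * ?S" ?S] by (intro graph.N_ideal_cong(1)) (auto intro!: free_mult free_star)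
  have "GN (?P * ?S - ?q * ?S) = 0"
    by (rule graph.N_null_trans[OF _ _ _ 4]) (use F 2 in \<open>auto simp: mult.assoc intro!: free_mult free_star\<close>)
  then show ?thesis
    by (rule graph.N_null_trans[rotated 3]) (use F 3 in \<open>auto intro!: free_mult free_star\<close>)
qed

section \<open>The unit as the sum of the vertex projections\<close>

definition vertex_sum :: "('a, 'b) graph_poly" where
  "vertex_sum = (\<Sum>v\<in>verts G. P_gen v)"

lemma vertex_sum_free: "vertex_sum \<in> GF"
  unfolding vertex_sum_def by (rule free_sum) simp

text \<open>If \<open>P_gen v\<close> fixes x up to a null element, every other vertex annihilates x
  by orthogonality to v. Each letter has such a vertex on its left.\<close>

lemma vertex_sum_absorb:
  assumes v: "v \<in> verts G" and x: "x \<in> GF" and Px: "GN (P_gen v * x - x) = 0"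
  shows "GN (vertex_sum * x - x) = 0"
proof -
  have e: "vertex_sum * x - x = (P_gen v * x - x) + (\<Sum>w\<in>verts G - {v}. P_gen w * x)"
    using v by (simp add: vertex_sum_def sum_distrib_right sum.remove[of "verts G" v] algebra_simps)
  have "GN (P_gen w * x) = 0" if w: "w \<in> verts G - {v}" for w
  proof -
    have "P_gen v * x \<in> GF" using v x by (intro free_mult) auto
    then have 1: "GN (P_gen w * x - P_gen w * (P_gen v * x)) = 0"
      using v x w Px graph.N_diff_commute[of x "P_gen v * x"] by (intro graph.N_ideal_cong(1)) (auto intro!: free_mult)
    have 2: "GN (P_gen w * P_gen v * x) = 0"
      by (rule graph.N_null_mult(1)) (use v w x N_graph(3)[of w v] in \<open>auto intro!: free_mult\<close>)
    have "GN (P_gen w * x) = GN (P_gen w * (P_gen v * x))"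
      by (rule graph.N_eq[OF _ _ 1]) (use v w x in \<open>auto intro!: free_mult\<close>)
    then show ?thesis using 2 by (simp add: mult.assoc)
  qed
  then have "GN (\<Sum>w\<in>verts G - {v}. P_gen w * x) = 0"
    using x by (intro graph.N_null_sum) (auto intro!: free_mult)
  then show ?thesis unfolding e
    using Px by (intro graph.N_null_add) (use v x in \<open>auto intro!: free_mult free_diff free_sum\<close>)
qed

lemma vertex_sum_gen:
  assumes "g \<in> GX"
  shows "GN (vertex_sum * gen g - gen g) = 0"
proof -
  consider (V) v where "v \<in> verts G" "g = VertexGen v" | (E) e where "e \<in> arcs G" "g = EdgeGen e"
    using assms by (auto simp: graph_gens_def)
  then show ?thesis
  proof cases
    case V
    then show ?thesis by (auto simp: N_graph intro!: vertex_sum_absorb)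
  next
    case E
    then show ?thesis using vertex_sum_absorb[OF _ _ tail_absorbs[OF E(1)]] by simp
  qed
qed

lemma vertex_sum_gen_star:
  assumes "g \<in> GX"
  shows "GN (vertex_sum * poly_star (gen g) - poly_star (gen g)) = 0"
proof -
  consider (V) v where "v \<in> verts G" "g = VertexGen v" | (E) e where "e \<in> arcs G" "g = EdgeGen e"
    using assms by (auto simp: graph_gens_def)
  then show ?thesis
  proof cases
    case V
    let ?P = "P_gen v :: ('a, 'b) graph_poly"
    have F: "?P \<in> GF" "poly_star ?P \<in> GF" using V by (auto intro: free_star)
    have n: "GN (poly_star ?P - ?P) = 0" "GN (?P - poly_star ?P) = 0"
      using N_graph(1)[OF V(1)] graph.N_diff_commute[OF F] by simp_all
    have "GN (?P * poly_star ?P - ?P * ?P) = 0" using F n by (intro graph.N_ideal_cong) auto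
    then have "GN (?P * poly_star ?P - ?P) = 0"
      by (rule graph.N_null_trans[rotated 3]) (use F V N_graph(2) in \<open>auto intro!: free_mult\<close>)
    then have "GN (?P * poly_star ?P - poly_star ?P) = 0"
      by (rule graph.N_null_trans[rotated 3]) (use F n in \<open>auto intro!: free_mult\<close>)
    then show ?thesis using V F by (auto intro!: vertex_sum_absorb)
  next
    case E
    let ?S = "S_gen e :: ('a, 'b) graph_poly" and ?P = "P_gen (head G e) :: ('a, 'b) graph_poly"
    have F: "?S \<in> GF" "poly_star ?S \<in> GF" "?P \<in> GF" using E by (auto intro: free_star)
    have "GN (poly_star (?S * poly_star ?S * ?S - ?S)) = 0"
      using F N_graph(4)[OF E(1)] by (subst graph.N_star) (auto intro!: free_mult free_diff)
    then have 1: "GN (poly_star ?S * ?S * poly_star ?S - poly_star ?S) = 0"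
      by (simp add: poly_star_diff poly_star_mult mult.assoc)
    have d: "GN (?P - poly_star ?S * ?S) = 0"
      using N_graph(5)[OF E(1)] graph.N_diff_commute[of ?P "poly_star ?S * ?S"] F by (simp add: free_mult)
    have "GN (?P * poly_star ?S - poly_star ?S * ?S * poly_star ?S) = 0"
      using F d by (intro graph.N_ideal_cong(2)) (auto intro!: free_mult)
    then have "GN (?P * poly_star ?S - poly_star ?S) = 0"
      by (rule graph.N_null_trans[OF _ _ _ _ 1, rotated 3]) (use F in \<open>auto intro!: free_mult\<close>)
    then show ?thesis using E F by (auto intro!: vertex_sum_absorb)
  qed
qed

lemma vertex_sum_left_unit:
  assumes "x \<in> GF"
  shows "GN (vertex_sum * x - x) = 0"
  using assms
proof (induct rule: free_induct)
  case (gen g)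
  then show ?case by (rule vertex_sum_gen)
next
  case (gen_star g)
  then show ?case by (rule vertex_sum_gen_star)
next
  case (mult_gen g y)
  have "vertex_sum * (gen g * y) - gen g * y = (vertex_sum * gen g - gen g) * y" by (simp add: algebra_simps)
  moreover have "GN (vertex_sum * gen g - gen g) = 0"
    using mult_gen(1) by (rule vertex_sum_gen)
  ultimately show ?case
    using mult_gen by (auto intro!: graph.N_null_mult(1) free_mult free_diff vertex_sum_free free_gen)
next
  case (mult_gen_star g y)
  have e: "vertex_sum * (poly_star (gen g) * y) - poly_star (gen g) * y =
    (vertex_sum * poly_star (gen g) - poly_star (gen g)) * y" by (simp add: algebra_simps)
  have "GN (vertex_sum * poly_star (gen g) - poly_star (gen g)) = 0"
    using mult_gen_star(1) by (rule vertex_sum_gen_star)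
  then show ?case unfolding e
    using mult_gen_star by (auto intro!: graph.N_null_mult(1) free_mult free_diff free_star vertex_sum_free free_gen)
next
  case (add x y)
  have e: "vertex_sum * (x + y) - (x + y) = (vertex_sum * x - x) + (vertex_sum * y - y)" by (simp add: algebra_simps)
  show ?case unfolding e using add by (intro graph.N_null_add) (auto intro!: free_diff free_mult vertex_sum_free)
next
  case (scale c x)
  have e: "vertex_sum * poly_scale c x - poly_scale c x = poly_scale c (vertex_sum * x - x)"
    by (simp add: poly_scale_simps poly_scale_distrib)
  show ?case unfolding e using scale by (subst graph.N_scale) (auto intro!: free_diff free_mult vertex_sum_free)
qed simp

text \<open>The adjoint of the left unit law; the vertex sum is self-adjoint only up to null
  elements.\<close>

lemma vertex_sum_right_unit:
  assumes x: "x \<in> GF"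
  shows "GN (x * vertex_sum - x) = 0"
proof -
  have F: "poly_star x \<in> GF" "poly_star vertex_sum \<in> GF" "vertex_sum \<in> GF" "x * vertex_sum - x \<in> GF"
    using x vertex_sum_free by (auto intro!: free_star free_mult free_diff)
  have "poly_star vertex_sum - vertex_sum = (\<Sum>v\<in>verts G. poly_star (P_gen v) - P_gen v)"
    by (simp add: vertex_sum_def poly_star_sum sum_subtractf)
  then have "GN (poly_star vertex_sum - vertex_sum) = 0"
    by (simp add: graph.N_null_sum N_graph free_diff free_star)
  then have "GN (poly_star vertex_sum * poly_star x - vertex_sum * poly_star x) = 0"
    using F by (intro graph.N_ideal_cong) auto
  then have "GN (poly_star vertex_sum * poly_star x - poly_star x) = 0"
    by (rule graph.N_null_trans[rotated 3]) (use F vertex_sum_left_unit in \<open>auto intro!: free_mult\<close>)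
  moreover have "poly_star (x * vertex_sum - x) = poly_star vertex_sum * poly_star x - poly_star x"
    by (simp add: poly_star_diff poly_star_mult)
  ultimately show ?thesis using graph.N_star[OF F(4)] by simp
qed

sublocale graph: unital_relations GX GR vertex_sum
  by unfold_locales (rule vertex_sum_free vertex_sum_left_unit vertex_sum_right_unit, assumption?)+

abbreviation "Cstar \<equiv> graph_cstar G"

lemma elem_emb: "P_elem G v = graph.emb (P_gen v)" "S_elem G e = graph.emb (S_gen e)"
  by (simp_all add: P_elem_def S_elem_def)

lemma emb_eq: "x - y \<in> GR ==> x \<in> GF ==> y \<in> GF ==> graph.emb x = graph.emb y"
  by (rule graph.emb_eq) (auto simp: graph.N_rel)

lemma graph_cstar_algebra: "cstar_algebra Cstar graph.unorm"
  unfolding graph_cstar_def by (rule graph.U_cstar)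

text \<open>Arcs with the same tail have orthogonal range projections, which are inserted by writing
  each edge as its range projection times itself. Arcs with different tails are separated by their
  source projections.\<close>

lemma edge_final_orth:
  assumes e: "e \<in> arcs G" and f: "f \<in> arcs G" and ef: "e \<noteq> f"
  shows "star Cstar (S_elem G e) \<otimes>\<^bsub>Cstar\<^esub> S_elem G f = \<zero>\<^bsub>Cstar\<^esub>"
proof -
  interpret C: cstar_algebra "Cstar" graph.unorm by (rule graph_cstar_algebra)
  let ?A = "Cstar"
  let ?star = "star ?A"
  note F = gens free_star[OF gens(1)] free_star[OF gens(2)]
  note ops = graph.emb_ops[folded graph_cstar_def]
  have closed: "v \<in> verts G ==> P_elem G v \<in> carrier ?A" "g \<in> arcs G ==> S_elem G g \<in> carrier ?A" for v g
    by (simp_all add: elem_emb graph_cstar_def)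
  note c = closed(2)[OF e] closed(2)[OF f]
  show ?thesis
  proof (cases "tail G e = tail G f")
    case True
    have SSS: "S_elem G g \<otimes>\<^bsub>?A\<^esub> ?star (S_elem G g) \<otimes>\<^bsub>?A\<^esub> S_elem G g = S_elem G g" if g: "g \<in> arcs G" for g
      using emb_eq[OF graph_relsI(4)[OF g]] g F by (simp add: elem_emb ops free_mult)
    have "graph.emb ((S_gen e * poly_star (S_gen e)) * (S_gen f * poly_star (S_gen f))) = \<zero>\<^bsub>?A\<^esub>"
      unfolding graph_cstar_def using edge_projections(2)[of "tail G e" f e] e f ef True not_sink[OF e] F
      by (intro graph.emb_null) (auto intro!: free_mult)
    then have 0: "(S_elem G e \<otimes>\<^bsub>?A\<^esub> ?star (S_elem G e)) \<otimes>\<^bsub>?A\<^esub> (S_elem G f \<otimes>\<^bsub>?A\<^esub> ?star (S_elem G f)) = \<zero>\<^bsub>?A\<^esub>"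
      using e f F by (simp add: elem_emb ops free_mult)
    have "?star (S_elem G e) \<otimes>\<^bsub>?A\<^esub> S_elem G f =
        ?star (S_elem G e \<otimes>\<^bsub>?A\<^esub> ?star (S_elem G e) \<otimes>\<^bsub>?A\<^esub> S_elem G e) \<otimes>\<^bsub>?A\<^esub> (S_elem G f \<otimes>\<^bsub>?A\<^esub> ?star (S_elem G f) \<otimes>\<^bsub>?A\<^esub> S_elem G f)"
      by (simp only: SSS[OF e] SSS[OF f])
    also have "\<dots> = ?star (S_elem G e) \<otimes>\<^bsub>?A\<^esub>
        (((S_elem G e \<otimes>\<^bsub>?A\<^esub> ?star (S_elem G e)) \<otimes>\<^bsub>?A\<^esub> (S_elem G f \<otimes>\<^bsub>?A\<^esub> ?star (S_elem G f))) \<otimes>\<^bsub>?A\<^esub> S_elem G f)"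
      using c by (simp add: C.star_mult C.m_assoc)
    finally show ?thesis unfolding 0 using c by simp
  next
    case False
    have PS: "P_elem G (tail G g) \<otimes>\<^bsub>?A\<^esub> S_elem G g = S_elem G g" if g: "g \<in> arcs G" for g
      using g F graph.emb_eq[OF _ _ tail_absorbs[OF g]] by (simp add: elem_emb ops free_mult)
    have Ps: "?star (P_elem G (tail G e)) = P_elem G (tail G e)"
      using e F emb_eq[OF graph_relsI(1)[of "tail G e"]] by (simp add: elem_emb ops)
    have "graph.emb (P_gen (tail G e) * P_gen (tail G f)) = \<zero>\<^bsub>?A\<^esub>"
      unfolding graph_cstar_def using e f F False by (intro graph.emb_null) (auto simp: N_graph intro!: free_mult)
    then have 0: "P_elem G (tail G e) \<otimes>\<^bsub>?A\<^esub> P_elem G (tail G f) = \<zero>\<^bsub>?A\<^esub>" using e f F by (simp add: elem_emb ops)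
    have "?star (S_elem G e) \<otimes>\<^bsub>?A\<^esub> S_elem G f =
        ?star (P_elem G (tail G e) \<otimes>\<^bsub>?A\<^esub> S_elem G e) \<otimes>\<^bsub>?A\<^esub> (P_elem G (tail G f) \<otimes>\<^bsub>?A\<^esub> S_elem G f)"
      by (simp only: PS[OF e] PS[OF f])
    also have "\<dots> = ?star (S_elem G e) \<otimes>\<^bsub>?A\<^esub> ((P_elem G (tail G e) \<otimes>\<^bsub>?A\<^esub> P_elem G (tail G f)) \<otimes>\<^bsub>?A\<^esub> S_elem G f)"
      using c e f closed(1) by (simp add: C.star_mult C.m_assoc Ps)
    finally show ?thesis unfolding 0 using c by simp
  qed
qed

lemma graph_algebra_graph_cstar:
  "graph_algebra G Cstar graph.unorm (P_elem G) (S_elem G)"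
proof -
  interpret C: cstar_algebra "Cstar" graph.unorm by (rule graph_cstar_algebra)
  note F = gens free_star[OF gens(1)] free_star[OF gens(2)]
  note ops = graph.emb_ops[folded graph_cstar_def]
  show ?thesis
  proof (unfold_locales, unfold elem_emb)
    fix v assume v: "v \<in> verts G"
    show "graph.emb (P_gen v) \<in> carrier Cstar"
      unfolding graph_cstar_def using v by simp
    show "star Cstar (graph.emb (P_gen v)) = graph.emb (P_gen v)"
      using v F emb_eq[OF graph_relsI(1)[OF v]] by (simp add: ops)
    show "graph.emb (P_gen v) \<otimes>\<^bsub>Cstar\<^esub> graph.emb (P_gen v) = graph.emb (P_gen v)"
      using v F emb_eq[OF graph_relsI(2)[OF v]] by (simp add: ops free_mult)
    show "graph.emb (P_gen v) = (\<Oplus>\<^bsub>Cstar\<^esub>e\<in>{e \<in> arcs G. tail G e = v}.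
       graph.emb (S_gen e) \<otimes>\<^bsub>Cstar\<^esub> star Cstar (graph.emb (S_gen e)))" if "\<not> is_sink G v"
    proof -
      have "graph.emb (P_gen v) = graph.emb (\<Sum>e\<in>{e \<in> arcs G. tail G e = v}. S_gen e * poly_star (S_gen e))"
        using F v by (intro emb_eq graph_relsI that) (auto intro!: free_sum free_mult)
      also have "\<dots> = (\<Oplus>\<^bsub>Cstar\<^esub>e\<in>{e \<in> arcs G. tail G e = v}. graph.emb (S_gen e * poly_star (S_gen e)))"
        unfolding graph_cstar_def using F by (intro graph.emb_sum) (auto intro!: free_mult)
      also have "\<dots> = (\<Oplus>\<^bsub>Cstar\<^esub>e\<in>{e \<in> arcs G. tail G e = v}.
       graph.emb (S_gen e) \<otimes>\<^bsub>Cstar\<^esub> star Cstar (graph.emb (S_gen e)))"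
        using F by (intro C.finsum_cong') (auto simp: ops graph_cstar_def[symmetric] intro!: C.m_closed C.star_closed graph.emb_closed[folded graph_cstar_def])
      finally show ?thesis .
    qed
    fix w assume w: "w \<in> verts G" "v \<noteq> w"
    then have "graph.emb (P_gen v * P_gen w) = \<zero>\<^bsub>Cstar\<^esub>"
      unfolding graph_cstar_def using v F by (intro graph.emb_null) (auto simp: N_graph intro!: free_mult)
    then show "graph.emb (P_gen v) \<otimes>\<^bsub>Cstar\<^esub> graph.emb (P_gen w) = \<zero>\<^bsub>Cstar\<^esub>"
      using v w F by (simp add: ops)
  next
    fix e assume e: "e \<in> arcs G"
    show "graph.emb (S_gen e) \<in> carrier Cstar"
      unfolding graph_cstar_def using e by simp
    show "star Cstar (graph.emb (S_gen e)) \<otimes>\<^bsub>Cstar\<^esub> graph.emb (S_gen e) = graph.emb (P_gen (head G e))"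
      using e F emb_eq[OF graph_relsI(5)[OF e]] by (simp add: ops free_mult)
    show "graph.emb (P_gen (tail G e)) \<otimes>\<^bsub>Cstar\<^esub> graph.emb (S_gen e) = graph.emb (S_gen e)"
      using e F graph.emb_eq[OF _ _ tail_absorbs[OF e]] by (simp add: ops free_mult)
    fix f assume f: "f \<in> arcs G" "e \<noteq> f"
    show "star Cstar (graph.emb (S_gen e)) \<otimes>\<^bsub>Cstar\<^esub> graph.emb (S_gen f) = \<zero>\<^bsub>Cstar\<^esub>"
      using edge_final_orth[OF e f] by (simp add: elem_emb)
  next
    have "\<one>\<^bsub>Cstar\<^esub> = graph.emb vertex_sum" unfolding graph_cstar_def by (rule graph.U_one)
    also have "\<dots> = finsum Cstar (\<lambda>v. graph.emb (P_gen v)) (verts G)"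
      unfolding vertex_sum_def graph_cstar_def by (rule graph.emb_sum) auto
    finally show "\<one>\<^bsub>Cstar\<^esub> = finsum Cstar (\<lambda>v. graph.emb (P_gen v)) (verts G)" .
  next
    fix a W assume a: "a \<in> carrier Cstar" and W: "W \<subseteq> carrier Cstar" "\<one>\<^bsub>Cstar\<^esub> \<in> W"
      and add: "!!x y. x \<in> W ==> y \<in> W ==> x \<oplus>\<^bsub>Cstar\<^esub> y \<in> W"
      and sm: "!!c x. x \<in> W ==> c \<odot>\<^bsub>Cstar\<^esub> x \<in> W"
      and P: "!!v x. v \<in> verts G ==> x \<in> W ==> graph.emb (P_gen v) \<otimes>\<^bsub>Cstar\<^esub> x \<in> W"
      and S: "!!e x. e \<in> arcs G ==> x \<in> W ==> graph.emb (S_gen e) \<otimes>\<^bsub>Cstar\<^esub> x \<in> W"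
      and S': "!!e x. e \<in> arcs G ==> x \<in> W ==> star Cstar (graph.emb (S_gen e)) \<otimes>\<^bsub>Cstar\<^esub> x \<in> W"
    have P': "star Cstar (graph.emb (P_gen v)) = graph.emb (P_gen v)" if v: "v \<in> verts G" for v
      using v F emb_eq[OF graph_relsI(1)[OF v]] by (simp add: ops)
    have g: "graph.emb (gen h) \<otimes>\<^bsub>Cstar\<^esub> x \<in> W" "star Cstar (graph.emb (gen h)) \<otimes>\<^bsub>Cstar\<^esub> x \<in> W"
      if "h \<in> GX" "x \<in> W" for h x
      using that P S S' P' by (auto simp: graph_gens_def)
    have c: "graph.emb x \<in> carrier Cstar" if "x \<in> GF" for x
      unfolding graph_cstar_def using that by simp
    \<comment> \<open>W is stable under prepending letters and contains the unit, so it contains all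
      words, and these span a dense subspace.\<close>
    have FW: "graph.emb x \<in> W" if "x \<in> GF" for x
      using that
    proof (induct rule: free_induct)
      case (gen h)
      then show ?case using g(1)[OF gen W(2)] c[OF free_gen] by simp
    next
      case (gen_star h)
      then show ?case using g(2)[OF gen_star W(2)] c[OF free_gen] by (simp add: ops free_gen)
    next
      case zero
      have "\<zero>\<^bsub>Cstar\<^esub> = 0 \<odot>\<^bsub>Cstar\<^esub> \<one>\<^bsub>Cstar\<^esub>" by simp
      then show ?case using sm[OF W(2)] graph.U_zero[folded graph_cstar_def] by metis
    qed (simp_all add: ops free_gen free_star add sm g)
    obtain y where "!!n. y n \<in> GF" "graph.U.conv (\<lambda>k. graph.emb (y k)) a"
      using graph.emb_dense[OF a[unfolded graph_cstar_def]] by blast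
    then show "\<exists>x. (\<forall>n. x n \<in> W) \<and> C.conv x a"
      using FW by (intro exI[of _ "\<lambda>k. graph.emb (y k)"]) (simp add: graph_cstar_def)
  qed
qed

lemma graph_hom_exists:
  fixes B :: "'c star_algebra"
  assumes B: "cstar_algebra B nB"
    and p: "!!v. v \<in> verts G ==> p v \<in> carrier B" "!!v. v \<in> verts G ==> star B (p v) = p v"
      "!!v. v \<in> verts G ==> p v \<otimes>\<^bsub>B\<^esub> p v = p v"
      "!!v w. v \<in> verts G ==> w \<in> verts G ==> v \<noteq> w ==> p v \<otimes>\<^bsub>B\<^esub> p w = \<zero>\<^bsub>B\<^esub>"
    and t: "!!e. e \<in> arcs G ==> t e \<in> carrier B"
      "!!e. e \<in> arcs G ==> star B (t e) \<otimes>\<^bsub>B\<^esub> t e = p (head G e)"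
      "!!e. e \<in> arcs G ==> t e \<otimes>\<^bsub>B\<^esub> p (head G e) = t e"
    and pt: "!!v. v \<in> verts G ==> \<not> is_sink G v ==>
      p v = finsum B (\<lambda>e. t e \<otimes>\<^bsub>B\<^esub> star B (t e)) {e \<in> arcs G. tail G e = v}"
  obtains \<phi> where "\<phi> \<in> star_hom Cstar B" "!!v. v \<in> verts G ==> \<phi> (P_elem G v) = p v"
    "!!e. e \<in> arcs G ==> \<phi> (S_elem G e) = t e"
proof -
  interpret B: cstar_algebra B nB by (rule B)
  \<comment> \<open>Evaluation wants a function with all values in the carrier; off the generators
    it is 0.\<close>
  define g where "g h = (if h \<in> GX then (case h of VertexGen v => p v | EdgeGen e => t e) else \<zero>\<^bsub>B\<^esub>)" for h
  have g: "g h \<in> carrier B" for h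
    by (cases h) (auto simp: g_def graph_gens_def p t)
  have gv: "v \<in> verts G ==> g (VertexGen v) = p v" and ge: "e \<in> arcs G ==> g (EdgeGen e) = t e" for v e
    by (simp_all add: g_def graph_gens_def)
  note ev = B.eval_poly_diff[OF g] B.eval_poly_mult[OF g] B.eval_poly_star[OF g] B.eval_poly_gen[OF g] B.eval_poly_sum[OF g]
  have sub: "a \<ominus>\<^bsub>B\<^esub> b = \<zero>\<^bsub>B\<^esub>" if "a = b" "b \<in> carrier B" for a b
    using that by (simp add: B.minus_eq B.r_neg)
  have rels: "B.eval_poly g x = \<zero>\<^bsub>B\<^esub>" if "x \<in> GR" for x
    using that unfolding graph_rels_def
  proof (elim UnE CollectE exE conjE; hypsubst)
    fix v assume v: "v \<in> verts G"
    show "B.eval_poly g (poly_star (P_gen v) - P_gen v) = \<zero>\<^bsub>B\<^esub>"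
      unfolding ev gv[OF v] by (rule sub) (use p v in auto)
    show "B.eval_poly g (P_gen v * P_gen v - P_gen v) = \<zero>\<^bsub>B\<^esub>"
      unfolding ev gv[OF v] by (rule sub) (use p v in auto)
    show "B.eval_poly g (P_gen v - (\<Sum>e\<in>{e \<in> arcs G. tail G e = v}. S_gen e * poly_star (S_gen e))) = \<zero>\<^bsub>B\<^esub>"
      if "\<not> is_sink G v"
    proof -
      have "finsum B (\<lambda>e. g (EdgeGen e) \<otimes>\<^bsub>B\<^esub> star B (g (EdgeGen e))) {e \<in> arcs G. tail G e = v} = p v"
        unfolding pt[OF v that] by (rule B.finsum_cong') (auto simp: ge t)
      then show ?thesis unfolding ev(1,4) ev(5)[OF out_finite] ev(2-4) gv[OF v] by (intro sub) (use p v in auto)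
    qed
    fix w assume w: "w \<in> verts G" "v \<noteq> w"
    show "B.eval_poly g (P_gen v * P_gen w) = \<zero>\<^bsub>B\<^esub>"
      unfolding ev gv[OF v] gv[OF w(1)] by (rule p(4)[OF v w])
  next
    fix e assume e: "e \<in> arcs G"
    show "B.eval_poly g (S_gen e * poly_star (S_gen e) * S_gen e - S_gen e) = \<zero>\<^bsub>B\<^esub>"
      unfolding ev ge[OF e] by (rule sub) (use t e in \<open>simp_all add: B.m_assoc\<close>)
    show "B.eval_poly g (poly_star (S_gen e) * S_gen e - P_gen (head G e)) = \<zero>\<^bsub>B\<^esub>"
      unfolding ev ge[OF e] gv[OF head_in_verts[OF e]] by (rule sub) (use t p e in auto)
  qed
  obtain \<phi> where \<phi>: "\<phi> \<in> star_hom (universal_cstar GX GR) B" "!!h. h \<in> GX ==> \<phi> (graph.emb (gen h)) = g h"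
    by (rule graph.universal_hom[OF B g rels]) blast+
  have "v \<in> verts G ==> VertexGen v \<in> GX" "e \<in> arcs G ==> EdgeGen e \<in> GX" for v e
    by (simp_all add: graph_gens_def)
  then show ?thesis using that[of \<phi>] \<phi> gv ge by (simp add: elem_emb graph_cstar_def)
qed

end

section \<open>Complex matrices with the operator norm\<close>

lemma complex_algebra_simps:
  "carrier complex_algebra = UNIV" "mult complex_algebra = (*)" "one complex_algebra = 1"
  "zero complex_algebra = 0" "add complex_algebra = (+)" "smult complex_algebra = (*)" "star complex_algebra = cnj"
  by (simp_all add: complex_algebra_def)

lemma finsum_complex_algebra: "finite I ==> finsum complex_algebra f I = sum f I"
proof -
  interpret abelian_group complex_algebra
    by (rule abelian_groupI) (auto simp: complex_algebra_simps intro: exI[of _ "- x" for x] ab_left_minus)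
  show "finite I ==> finsum complex_algebra f I = sum f I"
    by (induct I rule: finite_induct) (simp_all add: complex_algebra_simps)
qed

abbreviation (input) cmatrix :: "nat => complex mat star_algebra" where
  "cmatrix n \<equiv> matrix_algebra n complex_algebra"

definition adj_mat :: "complex mat => complex mat" where
  "adj_mat M = mat (dim_col M) (dim_row M) (\<lambda>(i, j). cnj (M $$ (j, i)))"

lemma cmatrix_carrier: "carrier (cmatrix n) = carrier_mat n n"
  by (simp add: matrix_algebra_def complex_algebra_simps)

lemma adj_mat_carrier [simp]: "M \<in> carrier_mat n n ==> adj_mat M \<in> carrier_mat n n"
  by (simp add: adj_mat_def)

text \<open>On square matrices the entrywise operations of the record are the usual ones, so the
  known matrix laws apply.\<close>

lemma cmatrix_ops:
  assumes "M \<in> carrier_mat n n" "N \<in> carrier_mat n n"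
  shows "M \<otimes>\<^bsub>cmatrix n\<^esub> N = M * N" "M \<oplus>\<^bsub>cmatrix n\<^esub> N = M + N" "c \<odot>\<^bsub>cmatrix n\<^esub> M = c \<cdot>\<^sub>m M"
    "star (cmatrix n) M = adj_mat M"
  using assms
  by (auto intro!: eq_matI simp: matrix_algebra_def complex_algebra_simps finsum_complex_algebra scalar_prod_def
      adj_mat_def lessThan_atLeast0)

lemma cmatrix_consts: "\<one>\<^bsub>cmatrix n\<^esub> = 1\<^sub>m n" "\<zero>\<^bsub>cmatrix n\<^esub> = 0\<^sub>m n n"
  by (auto intro!: eq_matI simp: matrix_algebra_def complex_algebra_simps)

lemma cmatrix_ring: "ring (cmatrix n)"
proof (rule ringI)
  show "abelian_group (cmatrix n)"
  proof (rule abelian_groupI; unfold cmatrix_carrier cmatrix_consts)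
    fix M :: "complex mat" assume M: "M \<in> carrier_mat n n"
    show "\<exists>y\<in>carrier_mat n n. y \<oplus>\<^bsub>cmatrix n\<^esub> M = 0\<^sub>m n n"
      using M by (intro bexI[of _ "- M"]) (auto simp: cmatrix_ops)
  qed (auto simp: cmatrix_ops assoc_add_mat[where nr = n and nc = n] comm_add_mat[where nr = n and nc = n])
  show "monoid (cmatrix n)"
    by (rule monoidI; unfold cmatrix_carrier cmatrix_consts)
      (auto simp: cmatrix_ops assoc_mult_mat[where n\<^sub>1 = n and n\<^sub>2 = n and n\<^sub>3 = n and n\<^sub>4 = n])
qed (auto simp: cmatrix_ops cmatrix_carrier add_mult_distrib_mat[where nr = n and n = n and nc = n]
    mult_add_distrib_mat[where nr = n and n = n and nc = n])

section \<open>The operator norm on finitely many coordinates\<close>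

definition l2 :: "nat => (nat => complex) => real" where
  "l2 n v = L2_set (\<lambda>i. cmod (v i)) {..<n}"

definition app_mat :: "nat => complex mat => (nat => complex) => nat => complex" where
  "app_mat n M v i = (\<Sum>j<n. M $$ (i, j) * v j)"

definition op_norm :: "nat => complex mat => real" where
  "op_norm n M = (SUP v\<in>{v. l2 n v \<le> 1}. l2 n (app_mat n M v))"

lemma l2_nonneg [simp]: "0 \<le> l2 n v"
  by (simp add: l2_def L2_set_nonneg)

lemma l2_scale: "l2 n (\<lambda>i. c * v i) = cmod c * l2 n v"
  unfolding l2_def by (simp add: norm_mult L2_set_right_distrib)

lemma l2_add: "l2 n (\<lambda>i. u i + v i) \<le> l2 n u + l2 n v"
proof -
  have "l2 n (\<lambda>i. u i + v i) \<le> L2_set (\<lambda>i. cmod (u i) + cmod (v i)) {..<n}"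
    unfolding l2_def by (rule L2_set_mono) (auto intro: norm_triangle_ineq)
  also have "\<dots> \<le> l2 n u + l2 n v" unfolding l2_def by (rule L2_set_triangle_ineq)
  finally show ?thesis .
qed

lemma l2_component: "i < n ==> cmod (v i) \<le> l2 n v"
  unfolding l2_def by (rule member_le_L2_set) auto

lemma l2_le_sum: "l2 n v \<le> (\<Sum>i<n. cmod (v i))"
  unfolding l2_def by (rule L2_set_le_sum) auto

lemma l2_cong: "(!!i. i < n ==> u i = v i) ==> l2 n u = l2 n v"
  unfolding l2_def by (rule L2_set_cong) auto

lemma l2_Cauchy_Schwarz: "cmod (\<Sum>i<n. cnj (u i) * v i) \<le> l2 n u * l2 n v"
proof -
  have "cmod (\<Sum>i<n. cnj (u i) * v i) \<le> (\<Sum>i<n. \<bar>cmod (u i)\<bar> * \<bar>cmod (v i)\<bar>)"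
    by (rule order_trans[OF norm_sum]) (simp add: norm_mult)
  also have "\<dots> \<le> l2 n u * l2 n v" unfolding l2_def by (rule L2_set_mult_ineq)
  finally show ?thesis .
qed

lemma l2_square: "of_real ((l2 n v)\<^sup>2) = (\<Sum>i<n. cnj (v i) * v i)"
proof -
  have "(l2 n v)\<^sup>2 = (\<Sum>i<n. (cmod (v i))\<^sup>2)"
    unfolding l2_def L2_set_def by (simp add: sum_nonneg)
  then show ?thesis by (simp add: complex_norm_square mult.commute del: of_real_power)
qed

text \<open>Crude, but it makes the supremum in \<open>op_norm\<close> finite and turns entrywise
  convergence into convergence in norm.\<close>

lemma app_mat_entry_bound: "l2 n (app_mat n M v) \<le> (\<Sum>i<n. \<Sum>j<n. cmod (M $$ (i, j))) * l2 n v"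
proof -
  have "l2 n (app_mat n M v) \<le> (\<Sum>i<n. cmod (app_mat n M v i))" by (rule l2_le_sum)
  also have "\<dots> \<le> (\<Sum>i<n. \<Sum>j<n. cmod (M $$ (i, j)) * l2 n v)"
  proof (rule sum_mono)
    fix i assume "i \<in> {..<n}"
    have "cmod (app_mat n M v i) \<le> (\<Sum>j<n. cmod (M $$ (i, j) * v j))"
      unfolding app_mat_def by (rule norm_sum)
    also have "\<dots> \<le> (\<Sum>j<n. cmod (M $$ (i, j)) * l2 n v)"
      by (intro sum_mono) (auto simp: norm_mult intro!: mult_left_mono l2_component)
    finally show "cmod (app_mat n M v i) \<le> (\<Sum>j<n. cmod (M $$ (i, j)) * l2 n v)" .
  qed
  finally show ?thesis by (simp add: sum_distrib_right)
qed

lemma op_norm_least: "0 \<le> K ==> (!!v. l2 n (app_mat n M v) \<le> K * l2 n v) ==> op_norm n M \<le> K"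
  unfolding op_norm_def
proof (rule cSUP_least)
  have "l2 n (\<lambda>i. 0) \<le> 1" by (simp add: l2_def L2_set_def)
  then show "{v. l2 n v \<le> 1} \<noteq> {}" by blast
  fix v assume K: "0 \<le> K" "!!v. l2 n (app_mat n M v) \<le> K * l2 n v" and "v \<in> {v. l2 n v \<le> 1}"
  then have "K * l2 n v \<le> K" by (simp add: mult_left_le)
  then show "l2 n (app_mat n M v) \<le> K" using K(2)[of v] by simp
qed

lemma op_norm_bound: "l2 n (app_mat n M v) \<le> op_norm n M * l2 n v"
proof (cases "l2 n v = 0")
  case True
  then show ?thesis using app_mat_entry_bound[of n M v] by simp
next
  case False
  then have p: "l2 n v > 0" by (simp add: less_le)
  let ?c = "of_real (1 / l2 n v) :: complex"
  have "l2 n (app_mat n M (\<lambda>i. ?c * v i)) \<le> op_norm n M"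
    unfolding op_norm_def
  proof (rule cSUP_upper)
    show "(\<lambda>i. ?c * v i) \<in> {v. l2 n v \<le> 1}" unfolding mem_Collect_eq l2_scale norm_of_real using p by simp
    show "bdd_above ((\<lambda>v. l2 n (app_mat n M v)) ` {v. l2 n v \<le> 1})"
    proof (rule bdd_aboveI2)
      fix v assume "v \<in> {v. l2 n v \<le> 1}"
      then have "(\<Sum>i<n. \<Sum>j<n. cmod (M $$ (i, j))) * l2 n v \<le> (\<Sum>i<n. \<Sum>j<n. cmod (M $$ (i, j)))"
        by (intro mult_left_le) (auto simp: sum_nonneg)
      then show "l2 n (app_mat n M v) \<le> (\<Sum>i<n. \<Sum>j<n. cmod (M $$ (i, j)))"
        using app_mat_entry_bound[of n M v] by simp
    qed
  qed
  moreover have "app_mat n M (\<lambda>i. ?c * v i) = (\<lambda>i. ?c * app_mat n M v i)"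
    by (rule ext) (simp only: app_mat_def sum_distrib_left mult.left_commute)
  ultimately have "(1 / l2 n v) * l2 n (app_mat n M v) \<le> op_norm n M"
    using p by (simp only: l2_scale norm_of_real) simp
  then show ?thesis using p by (simp add: field_simps)
qed

lemma op_norm_nonneg: "0 \<le> op_norm n M"
proof -
  have "l2 n (app_mat n M (\<lambda>i. 0)) \<le> op_norm n M"
    unfolding op_norm_def
  proof (rule cSUP_upper)
    show "(\<lambda>i. 0) \<in> {v. l2 n v \<le> 1}" by (simp add: l2_def L2_set_def)
    show "bdd_above ((\<lambda>v. l2 n (app_mat n M v)) ` {v. l2 n v \<le> 1})"
    proof (rule bdd_aboveI2)
      fix v assume "v \<in> {v. l2 n v \<le> 1}"
      then have "(\<Sum>i<n. \<Sum>j<n. cmod (M $$ (i, j))) * l2 n v \<le> (\<Sum>i<n. \<Sum>j<n. cmod (M $$ (i, j)))"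
        by (intro mult_left_le) (auto simp: sum_nonneg)
      then show "l2 n (app_mat n M v) \<le> (\<Sum>i<n. \<Sum>j<n. cmod (M $$ (i, j)))"
        using app_mat_entry_bound[of n M v] by simp
    qed
  qed
  then show ?thesis using l2_nonneg order_trans by blast
qed

lemma op_norm_le_entries: "op_norm n M \<le> (\<Sum>i<n. \<Sum>j<n. cmod (M $$ (i, j)))"
  by (rule op_norm_least) (auto simp: sum_nonneg app_mat_entry_bound)

lemma entry_le_op_norm: "i < n ==> j < n ==> cmod (M $$ (i, j)) \<le> op_norm n M"
proof -
  assume ij: "i < n" "j < n"
  \<comment> \<open>The j-th basis vector: its image is the j-th column.\<close>
  define v where "v k = (if k = j then 1 else 0 :: complex)" for k
  have lv: "l2 n v \<le> 1"
  proof -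
    have "(\<Sum>k<n. (cmod (v k))\<^sup>2) = (\<Sum>k<n. if k = j then 1 else 0)"
      by (rule sum.cong) (auto simp: v_def)
    then show ?thesis using ij by (simp add: l2_def L2_set_def)
  qed
  have "app_mat n M v i = (\<Sum>k<n. if k = j then M $$ (i, j) else 0)"
    unfolding app_mat_def by (rule sum.cong) (auto simp: v_def)
  then have "app_mat n M v i = M $$ (i, j)" using ij by simp
  then have "cmod (M $$ (i, j)) \<le> l2 n (app_mat n M v)" using l2_component[OF ij(1), of "app_mat n M v"] by simp
  also have "\<dots> \<le> op_norm n M * l2 n v" by (rule op_norm_bound)
  also have "\<dots> \<le> op_norm n M" using lv op_norm_nonneg by (intro mult_left_le)
  finally show ?thesis .
qed

lemma app_mat_mult:
  assumes "M \<in> carrier_mat n n" "N \<in> carrier_mat n n" "i < n"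
  shows "app_mat n (M * N) v i = app_mat n M (app_mat n N v) i"
proof -
  have "app_mat n (M * N) v i = (\<Sum>j<n. \<Sum>k<n. M $$ (i, k) * N $$ (k, j) * v j)"
    using assms by (auto simp: app_mat_def scalar_prod_def sum_distrib_right lessThan_atLeast0 intro!: sum.cong)
  also have "\<dots> = app_mat n M (app_mat n N v) i"
    by (subst sum.swap) (simp add: app_mat_def sum_distrib_left mult.assoc)
  finally show ?thesis .
qed

lemma op_norm_mult:
  assumes "M \<in> carrier_mat n n" "N \<in> carrier_mat n n"
  shows "op_norm n (M * N) \<le> op_norm n M * op_norm n N"
proof (rule op_norm_least)
  fix v
  have "l2 n (app_mat n (M * N) v) = l2 n (app_mat n M (app_mat n N v))"
    by (rule l2_cong) (rule app_mat_mult[OF assms])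
  also have "\<dots> \<le> op_norm n M * l2 n (app_mat n N v)" by (rule op_norm_bound)
  also have "\<dots> \<le> op_norm n M * (op_norm n N * l2 n v)" by (intro mult_left_mono op_norm_bound op_norm_nonneg)
  finally show "l2 n (app_mat n (M * N) v) \<le> op_norm n M * op_norm n N * l2 n v" by simp
qed (simp add: op_norm_nonneg)

lemma adjoint_inner:
  assumes "M \<in> carrier_mat n n"
  shows "(\<Sum>i<n. cnj (app_mat n M u i) * w i) = (\<Sum>i<n. cnj (u i) * app_mat n (adj_mat M) w i)"
proof -
  have "(\<Sum>i<n. cnj (app_mat n M u i) * w i) = (\<Sum>i<n. \<Sum>j<n. cnj (M $$ (i, j)) * cnj (u j) * w i)"
    by (simp add: app_mat_def sum_distrib_right)
  also have "\<dots> = (\<Sum>j<n. \<Sum>i<n. cnj (u j) * (adj_mat M $$ (j, i) * w i))"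
    by (subst sum.swap) (use assms in \<open>auto simp: adj_mat_def mult_ac intro!: sum.cong\<close>)
  finally show ?thesis by (simp add: app_mat_def sum_distrib_left)
qed

text \<open>The squared length of M v is the inner product of v with its image under
  \<open>adj_mat M * M\<close>, which Cauchy-Schwarz bounds.\<close>

lemma op_norm_cstar_le:
  assumes M: "M \<in> carrier_mat n n"
  shows "(op_norm n M)\<^sup>2 \<le> op_norm n (adj_mat M * M)"
proof -
  have "op_norm n M \<le> sqrt (op_norm n (adj_mat M * M))"
  proof (rule op_norm_least)
    fix v
    have "of_real ((l2 n (app_mat n M v))\<^sup>2) = (\<Sum>i<n. cnj (v i) * app_mat n (adj_mat M) (app_mat n M v) i)"
      unfolding l2_square by (rule adjoint_inner[OF M])
    also have "\<dots> = (\<Sum>i<n. cnj (v i) * app_mat n (adj_mat M * M) v i)"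
      using M by (auto intro!: sum.cong simp: app_mat_mult[where n = n])
    finally have "(l2 n (app_mat n M v))\<^sup>2 = cmod (\<Sum>i<n. cnj (v i) * app_mat n (adj_mat M * M) v i)"
      by (metis abs_power2 norm_of_real)
    also have "\<dots> \<le> l2 n v * l2 n (app_mat n (adj_mat M * M) v)" by (rule l2_Cauchy_Schwarz)
    also have "\<dots> \<le> l2 n v * (op_norm n (adj_mat M * M) * l2 n v)" by (intro mult_left_mono op_norm_bound) simp
    finally have "l2 n (app_mat n M v) \<le> sqrt (op_norm n (adj_mat M * M) * (l2 n v)\<^sup>2)"
      by (intro real_le_rsqrt) (simp add: power2_eq_square mult_ac)
    then show "l2 n (app_mat n M v) \<le> sqrt (op_norm n (adj_mat M * M)) * l2 n v" by (simp add: real_sqrt_mult)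
  qed (simp add: op_norm_nonneg)
  then have "(op_norm n M)\<^sup>2 \<le> (sqrt (op_norm n (adj_mat M * M)))\<^sup>2"
    by (rule power_mono) (rule op_norm_nonneg)
  then show ?thesis by (simp add: op_norm_nonneg)
qed

lemma adj_adj_mat: "M \<in> carrier_mat n n ==> adj_mat (adj_mat M) = M"
  by (auto intro!: eq_matI simp: adj_mat_def)

lemma op_norm_adj_le: "M \<in> carrier_mat n n ==> op_norm n M \<le> op_norm n (adj_mat M)"
proof -
  assume M: "M \<in> carrier_mat n n"
  have "(op_norm n M)\<^sup>2 \<le> op_norm n (adj_mat M) * op_norm n M"
    using op_norm_cstar_le[OF M] op_norm_mult[of "adj_mat M" n M] M by simp
  then show ?thesis using op_norm_nonneg[of n M] op_norm_nonneg[of n "adj_mat M"]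
    by (cases "op_norm n M = 0") (auto simp: power2_eq_square)
qed

lemma op_norm_cstar:
  assumes M: "M \<in> carrier_mat n n"
  shows "op_norm n (adj_mat M * M) = (op_norm n M)\<^sup>2"
proof (rule antisym)
  have "op_norm n (adj_mat M) = op_norm n M"
    using op_norm_adj_le[OF M] op_norm_adj_le[OF adj_mat_carrier[OF M]] adj_adj_mat[OF M] by simp
  then show "op_norm n (adj_mat M * M) \<le> (op_norm n M)\<^sup>2"
    using op_norm_mult[of "adj_mat M" n M] M by (simp add: power2_eq_square)
qed (rule op_norm_cstar_le[OF M])

lemma op_norm_add:
  assumes "M \<in> carrier_mat n n" "N \<in> carrier_mat n n"
  shows "op_norm n (M + N) \<le> op_norm n M + op_norm n N"
proof (rule op_norm_least)
  fix v
  have "l2 n (app_mat n (M + N) v) = l2 n (\<lambda>i. app_mat n M v i + app_mat n N v i)"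
    by (rule l2_cong) (use assms in \<open>simp add: app_mat_def distrib_right sum.distrib\<close>)
  also have "\<dots> \<le> l2 n (app_mat n M v) + l2 n (app_mat n N v)" by (rule l2_add)
  also have "\<dots> \<le> op_norm n M * l2 n v + op_norm n N * l2 n v" by (intro add_mono op_norm_bound)
  finally show "l2 n (app_mat n (M + N) v) \<le> (op_norm n M + op_norm n N) * l2 n v" by (simp add: algebra_simps)
qed (simp add: op_norm_nonneg add_nonneg_nonneg)

lemma op_norm_smult_le:
  assumes "M \<in> carrier_mat n n"
  shows "op_norm n (c \<cdot>\<^sub>m M) \<le> cmod c * op_norm n M"
proof (rule op_norm_least)
  fix v
  have "l2 n (app_mat n (c \<cdot>\<^sub>m M) v) = l2 n (\<lambda>i. c * app_mat n M v i)"
    by (rule l2_cong) (use assms in \<open>simp add: app_mat_def sum_distrib_left mult.assoc\<close>)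
  also have "\<dots> = cmod c * l2 n (app_mat n M v)" by (rule l2_scale)
  also have "\<dots> \<le> cmod c * (op_norm n M * l2 n v)" by (intro mult_left_mono op_norm_bound) simp
  finally show "l2 n (app_mat n (c \<cdot>\<^sub>m M) v) \<le> cmod c * op_norm n M * l2 n v" by simp
qed (simp add: op_norm_nonneg)

lemma op_norm_smult:
  assumes M: "M \<in> carrier_mat n n"
  shows "op_norm n (c \<cdot>\<^sub>m M) = cmod c * op_norm n M"
proof (cases "c = 0")
  case True
  then show ?thesis using op_norm_smult_le[OF M, of c] op_norm_nonneg[of n "c \<cdot>\<^sub>m M"] by simp
next
  case False
  have "inverse c \<cdot>\<^sub>m (c \<cdot>\<^sub>m M) = M" using M False by (auto intro!: eq_matI)
  then have "op_norm n M \<le> cmod (inverse c) * op_norm n (c \<cdot>\<^sub>m M)"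
    using op_norm_smult_le[of "c \<cdot>\<^sub>m M" n "inverse c"] M by simp
  then have "cmod c * op_norm n M \<le> op_norm n (c \<cdot>\<^sub>m M)"
    using False by (simp add: norm_divide field_simps)
  then show ?thesis using op_norm_smult_le[OF M, of c] by simp
qed

lemma cmatrix_cstar_algebra: "cstar_algebra (cmatrix n) (op_norm n)"
proof -
  interpret ring "cmatrix n" by (rule cmatrix_ring)
  have minus: "M \<ominus>\<^bsub>cmatrix n\<^esub> N = M - N" if "M \<in> carrier_mat n n" "N \<in> carrier_mat n n" for M N
  proof -
    have "\<ominus>\<^bsub>cmatrix n\<^esub> N = - N"
      by (rule minus_equality) (use that in \<open>auto simp: cmatrix_carrier cmatrix_ops cmatrix_consts\<close>)
    then show ?thesis using that by (auto simp: minus_eq cmatrix_ops intro!: eq_matI)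
  qed
  show ?thesis
  proof (unfold_locales; unfold cmatrix_carrier)
    fix M N :: "complex mat" and c d assume M: "M \<in> carrier_mat n n"
    note o = cmatrix_ops[where n = n]
    show "c \<odot>\<^bsub>cmatrix n\<^esub> M \<in> carrier_mat n n" using M by (simp add: o)
    show "(c + d) \<odot>\<^bsub>cmatrix n\<^esub> M = c \<odot>\<^bsub>cmatrix n\<^esub> M \<oplus>\<^bsub>cmatrix n\<^esub> d \<odot>\<^bsub>cmatrix n\<^esub> M"
      using M by (auto simp: o algebra_simps intro!: eq_matI)
    show "c \<odot>\<^bsub>cmatrix n\<^esub> (d \<odot>\<^bsub>cmatrix n\<^esub> M) = (c * d) \<odot>\<^bsub>cmatrix n\<^esub> M"
      using M by (auto simp: o intro!: eq_matI)
    show "1 \<odot>\<^bsub>cmatrix n\<^esub> M = M" using M by (auto simp: o intro!: eq_matI)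
    show "star (cmatrix n) M \<in> carrier_mat n n" using M by (simp add: o)
    show "star (cmatrix n) (c \<odot>\<^bsub>cmatrix n\<^esub> M) = cnj c \<odot>\<^bsub>cmatrix n\<^esub> star (cmatrix n) M"
      using M by (auto simp: o adj_mat_def intro!: eq_matI)
    show "star (cmatrix n) (star (cmatrix n) M) = M" using M by (simp add: o adj_adj_mat)
    show "0 \<le> op_norm n M" by (rule op_norm_nonneg)
    show "M = \<zero>\<^bsub>cmatrix n\<^esub>" if "op_norm n M = 0"
      using M entry_le_op_norm[of _ n _ M] that by (auto simp: cmatrix_consts intro!: eq_matI)
    show "op_norm n (c \<odot>\<^bsub>cmatrix n\<^esub> M) = cmod c * op_norm n M" using M by (simp add: o op_norm_smult)
    show "op_norm n (star (cmatrix n) M \<otimes>\<^bsub>cmatrix n\<^esub> M) = (op_norm n M)\<^sup>2"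
      using M by (simp add: o op_norm_cstar)
    assume N: "N \<in> carrier_mat n n"
    show "c \<odot>\<^bsub>cmatrix n\<^esub> (M \<oplus>\<^bsub>cmatrix n\<^esub> N) = c \<odot>\<^bsub>cmatrix n\<^esub> M \<oplus>\<^bsub>cmatrix n\<^esub> c \<odot>\<^bsub>cmatrix n\<^esub> N"
      using M N by (auto simp: o algebra_simps intro!: eq_matI)
    show "c \<odot>\<^bsub>cmatrix n\<^esub> M \<otimes>\<^bsub>cmatrix n\<^esub> N = c \<odot>\<^bsub>cmatrix n\<^esub> (M \<otimes>\<^bsub>cmatrix n\<^esub> N)"
      "M \<otimes>\<^bsub>cmatrix n\<^esub> (c \<odot>\<^bsub>cmatrix n\<^esub> N) = c \<odot>\<^bsub>cmatrix n\<^esub> (M \<otimes>\<^bsub>cmatrix n\<^esub> N)"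
      using M N by (auto simp: o scalar_prod_def sum_distrib_left mult_ac intro!: eq_matI sum.cong)
    show "star (cmatrix n) (M \<oplus>\<^bsub>cmatrix n\<^esub> N) = star (cmatrix n) M \<oplus>\<^bsub>cmatrix n\<^esub> star (cmatrix n) N"
      using M N by (auto simp: o adj_mat_def intro!: eq_matI)
    show "star (cmatrix n) (M \<otimes>\<^bsub>cmatrix n\<^esub> N) = star (cmatrix n) N \<otimes>\<^bsub>cmatrix n\<^esub> star (cmatrix n) M"
      using M N by (auto simp: o adj_mat_def scalar_prod_def mult.commute intro!: eq_matI sum.cong)
    show "op_norm n (M \<oplus>\<^bsub>cmatrix n\<^esub> N) \<le> op_norm n M + op_norm n N" using M N by (simp add: o op_norm_add)
    show "op_norm n (M \<otimes>\<^bsub>cmatrix n\<^esub> N) \<le> op_norm n M * op_norm n N" using M N by (simp add: o op_norm_mult)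
  next
    fix x :: "nat => complex mat"
    assume x: "!!k. x k \<in> carrier_mat n n"
      and cauchy: "!!e. e > 0 ==> \<exists>M. \<forall>k\<ge>M. \<forall>l\<ge>M. op_norm n (x k \<ominus>\<^bsub>cmatrix n\<^esub> x l) < e"
    \<comment> \<open>The operator norm dominates each entry, so the entries converge; conversely
      the finitely many entries dominate the norm of the difference.\<close>
    have "convergent (\<lambda>k. x k $$ (i, j))" if ij: "i < n" "j < n" for i j
    proof -
      have "Cauchy (\<lambda>k. x k $$ (i, j))"
      proof (rule metric_CauchyI)
        fix e :: real assume "e > 0"
        then obtain M where M: "\<forall>k\<ge>M. \<forall>l\<ge>M. op_norm n (x k \<ominus>\<^bsub>cmatrix n\<^esub> x l) < e" using cauchy by blast
        have "dist (x k $$ (i, j)) (x l $$ (i, j)) < e" if "k \<ge> M" "l \<ge> M" for k l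
        proof -
          have "dist (x k $$ (i, j)) (x l $$ (i, j)) = cmod ((x k - x l) $$ (i, j))"
            using carrier_matD[OF x[of l]] ij by (simp add: dist_norm)
          also have "\<dots> \<le> op_norm n (x k - x l)" by (rule entry_le_op_norm[OF ij])
          finally show ?thesis using M that minus[OF x x, of k l] by (metis le_less_trans)
        qed
        then show "\<exists>M. \<forall>k\<ge>M. \<forall>l\<ge>M. dist (x k $$ (i, j)) (x l $$ (i, j)) < e" by blast
      qed
      then show ?thesis by (simp add: Cauchy_convergent)
    qed
    then have lim: "(\<lambda>k. x k $$ (i, j)) \<longlonglongrightarrow> lim (\<lambda>k. x k $$ (i, j))" if "i < n" "j < n" for i j
      using that by (simp add: convergent_LIMSEQ_iff)
    define a where "a = mat n n (\<lambda>(i, j). lim (\<lambda>k. x k $$ (i, j)))"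
    have a: "a \<in> carrier_mat n n" by (simp add: a_def)
    have "(\<lambda>k. \<Sum>i<n. \<Sum>j<n. cmod (x k $$ (i, j) - a $$ (i, j))) \<longlonglongrightarrow> (\<Sum>i<n. \<Sum>j<n. cmod 0)"
    proof (intro tendsto_sum tendsto_norm)
      fix i j assume ij: "i \<in> {..<n}" "j \<in> {..<n}"
      then have "(\<lambda>k. x k $$ (i, j)) \<longlonglongrightarrow> a $$ (i, j)" using lim[of i j] by (simp add: a_def)
      then show "(\<lambda>k. x k $$ (i, j) - a $$ (i, j)) \<longlonglongrightarrow> 0" by (simp add: LIM_zero)
    qed
    then have s: "(\<lambda>k. \<Sum>i<n. \<Sum>j<n. cmod (x k $$ (i, j) - a $$ (i, j))) \<longlonglongrightarrow> 0" by simp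
    have "(\<lambda>k. op_norm n (x k \<ominus>\<^bsub>cmatrix n\<^esub> a)) \<longlonglongrightarrow> 0"
    proof (rule squeeze_to_0[OF s])
      fix k
      show "op_norm n (x k \<ominus>\<^bsub>cmatrix n\<^esub> a) \<le> (\<Sum>i<n. \<Sum>j<n. cmod (x k $$ (i, j) - a $$ (i, j)))"
        unfolding minus[OF x a] using op_norm_le_entries[of n "x k - a"] carrier_matD[OF x[of k]] a by simp
    qed (rule op_norm_nonneg)
    then show "\<exists>a\<in>carrier_mat n n. (\<lambda>k. op_norm n (x k \<ominus>\<^bsub>cmatrix n\<^esub> a)) \<longlonglongrightarrow> 0" using a by blast
  qed
qed

section \<open>Laurent polynomials on the unit circle\<close>

type_synonym laurent = "int \<Rightarrow>\<^sub>0 complex"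

definition leval :: "laurent => complex => complex" where
  "leval f z = (\<Sum>k\<in>keys f. lookup f k * z powi k)"

text \<open>Complex conjugation on the unit circle, where the conjugate of z is its inverse.\<close>

definition lstar :: "laurent => laurent" where
  "lstar f = (\<Sum>k\<in>keys f. single (- k) (cnj (lookup f k)))"

lemma leval_superset:
  "finite K ==> keys f \<subseteq> K ==> leval f z = (\<Sum>k\<in>K. lookup f k * z powi k)"
  unfolding leval_def by (rule sum.mono_neutral_left) (auto simp: in_keys_iff)

lemma leval_single: "leval (single k c) z = c * z powi k"
  using leval_superset[of "{k}" "single k c" z] by simp

lemma leval_zero [simp]: "leval 0 z = 0"
  by (simp add: leval_def)

lemma leval_add: "leval (f + g) z = leval f z + leval g z"
proof -
  let ?K = "keys f \<union> keys g"
  have "leval (f + g) z = (\<Sum>k\<in>?K. lookup (f + g) k * z powi k)"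
    by (rule leval_superset) (use Poly_Mapping.keys_add[of f g] in auto)
  also have "\<dots> = leval f z + leval g z"
    by (subst (1 2) leval_superset[of ?K]) (auto simp: lookup_add distrib_right sum.distrib)
  finally show ?thesis .
qed

lemma leval_uminus: "leval (- f) z = - leval f z"
  using leval_add[of f "- f" z] by (simp add: eq_neg_iff_add_eq_0 add.commute)

lemma leval_diff: "leval (f - g) z = leval f z - leval g z"
  using leval_add[of f "- g" z] by (simp add: leval_uminus)

lemma leval_mult: "z \<noteq> 0 ==> leval (f * g) z = leval f z * leval g z"
proof (induct f rule: poly_mapping_single_induct)
  case (1 k c)
  then show ?case
    by (induct g rule: poly_mapping_single_induct)
      (auto simp: mult_single leval_single power_int_add distrib_left leval_add)
qed (auto simp: distrib_right leval_add)

lemma lookup_lstar: "lookup (lstar f) k = cnj (lookup f (- k))"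
proof -
  have "lookup (lstar f) k =
    (\<Sum>j\<in>keys f. if j = - k then cnj (lookup f j) else 0)"
    unfolding lstar_def lookup_sum lookup_single when_def by (rule sum.cong) auto
  then show ?thesis by (auto simp: in_keys_iff)
qed

lemma lstar_add: "lstar (f + g) = lstar f + lstar g"
  by (rule poly_mapping_eqI) (simp add: lookup_lstar lookup_add)

lemma lstar_single: "lstar (single k c) = single (- k) (cnj c)"
  by (rule poly_mapping_eqI) (auto simp: lookup_lstar lookup_single when_def)

lemma lstar_lstar [simp]: "lstar (lstar f) = f"
  by (rule poly_mapping_eqI) (simp add: lookup_lstar)

lemma lstar_mult: "lstar (f * g) = lstar f * lstar g"
proof (induct f rule: poly_mapping_single_induct)
  case (1 k c)
  show ?case
    by (induct g rule: poly_mapping_single_induct) (simp_all add: mult_single lstar_single distrib_left lstar_add)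
qed (simp add: distrib_right lstar_add)

lemma lstar_power: "lstar (f ^ n) = lstar f ^ n"
proof (induct n)
  case 0
  have "(1 :: laurent) = single 0 1" by simp
  then show ?case by (metis lstar_single complex_cnj_one power_0 neg_0_equal_iff_equal)
qed (simp add: lstar_mult)

lemma inverse_eq_cnj: "cmod z = 1 ==> inverse z = cnj z"
  by (rule inverse_unique) (simp flip: complex_norm_square)

lemma leval_lstar: "cmod z = 1 ==> leval (lstar f) z = cnj (leval f z)"
proof (induct f rule: poly_mapping_single_induct)
  case (1 k c)
  then have "inverse z = cnj z" by (intro inverse_eq_cnj)
  then show ?case by (simp add: lstar_single leval_single power_int_minus flip: power_int_inverse)
qed (simp add: lstar_add leval_add)

text \<open>The m-th coefficient is the average of z^(-m) f(z) over the M-th roots of unity, once M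
  exceeds every distance from m to an exponent of f. It is a finite version of the Fourier
  integral.\<close>

lemma laurent_coeff_bound:
  assumes B: "!!z. cmod z = 1 ==> cmod (leval f z) \<le> B"
  shows "cmod (lookup f m) \<le> B"
proof -
  obtain d where d: "!!k. k \<in> keys f ==> \<bar>k - m\<bar> \<le> int d"
  proof -
    define D where "D = Max (insert 0 ((\<lambda>k. \<bar>k - m\<bar>) ` keys f))"
    have D0: "D \<ge> 0" by (simp add: D_def)
    have "\<bar>k - m\<bar> \<le> int (nat D)" if "k \<in> keys f" for k
      using that D0 by (auto simp: D_def intro!: Max_ge)
    then show ?thesis by (rule that)
  qed
  define M where "M = Suc d"
  define z where "z k = cis (2 * pi * real k / real M)" for k
  have z: "cmod (z k) = 1" "z k \<noteq> 0" for k by (auto simp: z_def)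
  have "(\<Sum>k<M. z k powi (- m) * leval f (z k)) =
      (\<Sum>k<M. \<Sum>j\<in>keys f. lookup f j * z k powi (j - m))"
    by (auto simp: leval_def sum_distrib_left power_int_diff power_int_minus field_simps z intro!: sum.cong)
  also have "\<dots> = (\<Sum>j\<in>keys f. lookup f j * (\<Sum>k<M. z k powi (j - m)))"
    by (subst sum.swap) (simp add: sum_distrib_left)
  also have "\<dots> = (\<Sum>j\<in>keys f. if j = m then lookup f m * of_nat M else 0)"
  proof (rule sum.cong)
    fix j assume "j \<in> keys f"
    then have "\<bar>j - m\<bar> < int M" using d by (force simp: M_def)
    then have "(\<Sum>k<M. z k powi (j - m)) = (if j - m = 0 then of_nat M else 0)"
      unfolding z_def by (intro sum_roots_of_unity_powi) (simp_all add: M_def)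
    then show "lookup f j * (\<Sum>k<M. z k powi (j - m)) = (if j = m then lookup f m * of_nat M else 0)"
      by simp
  qed auto
  also have "\<dots> = lookup f m * of_nat M" by (auto simp: in_keys_iff)
  finally have eq: "lookup f m * of_nat M = (\<Sum>k<M. z k powi (- m) * leval f (z k))" by simp
  have "real M * cmod (lookup f m) = cmod (\<Sum>k<M. z k powi (- m) * leval f (z k))"
    unfolding eq[symmetric] by (simp add: norm_mult)
  also have "\<dots> \<le> (\<Sum>k<M. cmod (leval f (z k)))"
    by (rule order_trans[OF norm_sum]) (simp add: norm_mult norm_power_int z)
  also have "\<dots> \<le> (\<Sum>k<M. B)" by (intro sum_mono B z)
  finally have "real M * cmod (lookup f m) \<le> real M * B" by simp
  then show ?thesis by (subst (asm) mult_le_cancel_left_pos) (auto simp: M_def)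
qed

lemma keys_power_bound:
  assumes "keys (f :: laurent) \<subseteq> {- int d..int d}"
  shows "keys (f ^ n) \<subseteq> {- int (n * d)..int (n * d)}"
proof (induct n)
  case 0
  then show ?case by simp
next
  case (Suc n)
  have "keys (f ^ Suc n) \<subseteq> {a + b |a b. a \<in> keys f \<and> b \<in> keys (f ^ n)}"
    using keys_mult[of f "f ^ n"] by simp
  also have "\<dots> \<subseteq> {- int (Suc n * d)..int (Suc n * d)}"
  proof safe
    fix a b assume "a \<in> keys f" "b \<in> keys (f ^ n)"
    then have "a \<in> {- int d..int d}" "b \<in> {- int (n * d)..int (n * d)}" using assms Suc by auto
    then show "a + b \<in> {- int (Suc n * d)..int (Suc n * d)}" by simp
  qed
  finally show ?case .
qed

text \<open>
  The spectral radius argument: \<open>p(f)\<^sup>2\<^sup>n \<le> p((f\<^sup>*f)\<^sup>n)\<close> for \<open>n = 2\<^sup>k\<close>, and the right-hand side is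
  at most the number of coefficients of \<open>(f\<^sup>*f)\<^sup>n\<close>, which is linear in \<open>n\<close>, times \<open>\<parallel>f\<parallel>\<^sup>2\<^sup>n\<close>.
\<close>

lemma laurent_sup_bound:
  fixes p :: "laurent => real"
  assumes nonneg: "!!f. 0 \<le> p f" and add: "!!f g. p (f + g) \<le> p f + p g"
    and single: "!!k c. p (single k c) \<le> cmod c"
    and sq: "!!f. (p f)\<^sup>2 \<le> p (lstar f * f)"
    and B: "!!z. cmod z = 1 ==> cmod (leval f z) \<le> B"
  shows "p f \<le> B"
proof (rule dense_ge)
  \<comment> \<open>A number strictly above B is positive, so one can divide by it even if B =
    0.\<close>
  fix b assume bB: "B < b"
  have "0 \<le> B" using order_trans[OF norm_ge_zero B[of 1]] by simp
  then have b0: "b > 0" using bB by simp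
  define h where "h = lstar f * f"
  \<comment> \<open>Since h is self-adjoint, \<open>lstar (h ^ n) * h ^ n\<close> is
    \<open>h ^ (2 * n)\<close>, and \<open>sq\<close> can be iterated along powers of two.\<close>
  have hs: "lstar h = h" by (simp add: h_def lstar_mult mult.commute)
  obtain d where d: "keys h \<subseteq> {- int d..int d}"
  proof -
    define D where "D = Max (insert 0 ((\<lambda>k. \<bar>k\<bar>) ` keys h))"
    have D0: "D \<ge> 0" by (simp add: D_def)
    have "\<bar>k\<bar> \<le> int (nat D)" if "k \<in> keys h" for k
      using that D0 by (auto simp: D_def intro!: Max_ge)
    then have "keys h \<subseteq> {- int (nat D)..int (nat D)}" by fastforce
    then show ?thesis by (rule that)
  qed
  have p0: "p 0 = 0" using single[of 0 0] nonneg[of 0] by simp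
  have psum: "p (sum g I) \<le> (\<Sum>i\<in>I. p (g i))" for g :: "int => laurent" and I
    by (induct I rule: infinite_finite_induct) (auto simp: p0 intro: order_trans[OF add])
  have coeffs: "p g \<le> (\<Sum>k\<in>keys g. cmod (lookup g k))" for g
  proof -
    have "g = (\<Sum>k\<in>keys g. single k (lookup g k))"
      by (rule poly_mapping_eqI) (auto simp: lookup_sum lookup_single when_def in_keys_iff)
    then have "p g \<le> (\<Sum>k\<in>keys g. p (single k (lookup g k)))"
      using psum[of "\<lambda>k. single k (lookup g k)" "keys g"] by simp
    also have "\<dots> \<le> (\<Sum>k\<in>keys g. cmod (lookup g k))" by (intro sum_mono single)
    finally show ?thesis .
  qed
  have powers: "p f ^ (2 * 2 ^ k) \<le> p (h ^ (2 ^ k))" for k :: nat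
  proof (induct k)
    case 0
    show ?case using sq[of f] by (simp add: h_def)
  next
    case (Suc k)
    have "p f ^ (2 * 2 ^ Suc k) = (p f ^ (2 * 2 ^ k))\<^sup>2"
      by (simp add: power_mult[symmetric] mult.commute)
    also have "\<dots> \<le> (p (h ^ (2 ^ k)))\<^sup>2" using Suc nonneg by (intro power_mono) auto
    also have "\<dots> \<le> p (lstar (h ^ 2 ^ k) * h ^ 2 ^ k)" by (rule sq)
    also have "lstar (h ^ 2 ^ k) * h ^ 2 ^ k = h ^ (2 ^ Suc k)"
      by (simp add: lstar_power hs mult_2 flip: power_add)
    finally show ?case .
  qed
  have bound: "p (h ^ n) \<le> real (2 * n * d + 1) * b ^ (2 * n)" for n
  proof -
    have "cmod (leval (h ^ n) z) \<le> b ^ (2 * n)" if z: "cmod z = 1" for z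
    proof -
      have zn: "z \<noteq> 0" using z by auto
      have "cmod (leval h z) = (cmod (leval f z))\<^sup>2"
        using zn z by (simp add: h_def leval_mult leval_lstar norm_mult power2_eq_square)
      also have "\<dots> \<le> b\<^sup>2" using B[OF z] bB by (intro power_mono) auto
      finally have hb: "cmod (leval h z) \<le> b\<^sup>2" .
      have "leval (h ^ n) z = leval h z ^ n"
        by (induct n) (use zn leval_single[of 0 1 z] in \<open>auto simp: leval_mult\<close>)
      then have "cmod (leval (h ^ n) z) = cmod (leval h z) ^ n" by (simp add: norm_power)
      also have "\<dots> \<le> (b\<^sup>2) ^ n" using hb by (intro power_mono) auto
      finally show ?thesis by (simp add: power_mult)
    qed
    then have co: "cmod (lookup (h ^ n) k) \<le> b ^ (2 * n)" for k by (rule laurent_coeff_bound)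
    have "p (h ^ n) \<le> (\<Sum>k\<in>keys (h ^ n). b ^ (2 * n))"
      using order_trans[OF coeffs sum_mono[OF co]] by simp
    also have "\<dots> = real (card (keys (h ^ n))) * b ^ (2 * n)" by simp
    also have "\<dots> \<le> real (2 * n * d + 1) * b ^ (2 * n)"
    proof (rule mult_right_mono)
      have "card (keys (h ^ n)) \<le> card {- int (n * d)..int (n * d)}"
        by (rule card_mono) (use keys_power_bound[OF d] in auto)
      also have "\<dots> = 2 * n * d + 1" by (simp add: nat_eq_iff mult_ac)
      finally show "real (card (keys (h ^ n))) \<le> real (2 * n * d + 1)" by (simp only: of_nat_le_iff)
    qed (use b0 in simp)
    finally show ?thesis .
  qed
  show "p f \<le> b"
  proof (rule ccontr)
    assume "\<not> p f \<le> b"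
    define r where "r = p f / b"
    have r: "r > 1" using \<open>\<not> p f \<le> b\<close> b0 by (simp add: r_def)
    \<comment> \<open>By Bernoulli r^(2 n) grows at least like n^2 (r - 1)^2, against the bound 2 n
      d + 1, which is at most (2 d + 1) n. Beyond n0 the former wins; n is a power of two because
      \<open>powers\<close> speaks only of these.\<close>
    obtain n0 :: nat where n0: "real n0 > real (2 * d + 1) / (r - 1)\<^sup>2" using reals_Archimedean2 by blast
    define n :: nat where "n = 2 ^ n0"
    have n1: "n \<ge> 1" and nn: "real n \<ge> real n0" by (auto simp: n_def)
    have "p f ^ (2 * n) \<le> real (2 * n * d + 1) * b ^ (2 * n)"
      using powers[of n0] bound[of n] by (simp add: n_def)
    then have "r ^ (2 * n) \<le> real (2 * n * d + 1)"
      using b0 by (simp add: r_def power_divide field_simps)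
    moreover have "real n * (r - 1) \<le> r ^ n"
      using Bernoulli_inequality[of "r - 1" n] r by simp
    then have "(real n * (r - 1))\<^sup>2 \<le> r ^ (2 * n)"
      using r by (subst mult.commute) (simp add: power_mult power_mono)
    moreover have "real (2 * n * d + 1) \<le> real (2 * d + 1) * real n" using n1 by (simp add: algebra_simps)
    ultimately have "real n * (real n * (r - 1)\<^sup>2) \<le> real n * real (2 * d + 1)"
      by (simp add: power2_eq_square mult_ac)
    then have "real n * (r - 1)\<^sup>2 \<le> real (2 * d + 1)" using n1 by (subst (asm) mult_le_cancel_left_pos) auto
    moreover have "real (2 * d + 1) < real n0 * (r - 1)\<^sup>2" using n0 r by (simp add: field_simps)
    moreover have "real n0 * (r - 1)\<^sup>2 \<le> real n * (r - 1)\<^sup>2" using nn by (intro mult_right_mono) auto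
    ultimately show False by linarith
  qed
qed

text \<open>On the circle the coordinates are Laurent polynomials: Re z = (z + 1/z) / 2 and Im z =
  (z - 1/z) / (2 \<i>). This explains the coefficients in the linear case.\<close>

lemma leval_real_polynomial:
  assumes "real_polynomial_function q"
  shows "\<exists>h. \<forall>z. cmod z = 1 --> leval h z = of_real (q z)"
  using assms
proof induct
  case (linear f)
  interpret bounded_linear f by fact
  define h :: laurent where "h = single 1 (of_real (f 1) / 2 - \<i> * of_real (f \<i>) / 2)
     + single (-1) (of_real (f 1) / 2 + \<i> * of_real (f \<i>) / 2)"
  have "leval h z = of_real (f z)" if z: "cmod z = 1" for z
  proof -
    have "z = Re z *\<^sub>R 1 + Im z *\<^sub>R \<i>" by (simp add: complex_eq_iff)
    then have "f z = Re z * f 1 + Im z * f \<i>" by (metis add scaleR real_scaleR_def)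
    moreover have "inverse z = cnj z" using z by (rule inverse_eq_cnj)
    ultimately show ?thesis
      by (simp add: h_def leval_add leval_single power_int_minus complex_eq_iff algebra_simps)
  qed
  then show ?case by blast
next
  case (const c)
  show ?case by (rule exI[of _ "single 0 (of_real c)"]) (simp add: leval_single)
next
  case (add f g)
  then obtain h1 h2 where "!!z. cmod z = 1 ==> leval h1 z = of_real (f z)" "!!z. cmod z = 1 ==> leval h2 z = of_real (g z)" by blast
  then show ?case by (intro exI[of _ "h1 + h2"]) (simp add: leval_add)
next
  case (mult f g)
  then obtain h1 h2 where "!!z. cmod z = 1 ==> leval h1 z = of_real (f z)" "!!z. cmod z = 1 ==> leval h2 z = of_real (g z)" by blast
  moreover have "z \<noteq> 0" if "cmod z = 1" for z using that by auto
  ultimately show ?case by (intro exI[of _ "h1 * h2"]) (simp add: leval_mult)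
qed

text \<open>Polynomial approximation in the two real coordinates, applied to the real and the
  imaginary part.\<close>

lemma laurent_dense:
  assumes "continuous_on (sphere 0 1) f" "e > 0"
  shows "\<exists>h. \<forall>z. cmod z = 1 --> cmod (f z - leval h z) < e"
proof -
  obtain g where g: "polynomial_function g" "!!z. z \<in> sphere 0 1 ==> norm (f z - g z) < e"
    using Stone_Weierstrass_polynomial_function[of "sphere 0 1" f e] assms by auto
  have "real_polynomial_function (Re \<circ> g)" "real_polynomial_function (Im \<circ> g)"
    using g(1) bounded_linear_Re bounded_linear_Im by (auto simp: polynomial_function_def)
  then obtain h1 h2 where h: "!!z. cmod z = 1 ==> leval h1 z = of_real (Re (g z))"
     "!!z. cmod z = 1 ==> leval h2 z = of_real (Im (g z))"
    using leval_real_polynomial by (metis comp_apply)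
  have "leval (h1 + single 0 \<i> * h2) z = g z" if "cmod z = 1" for z
  proof -
    have "z \<noteq> 0" using that by auto
    then show ?thesis using h that by (simp add: leval_add leval_mult leval_single complex_eq_iff)
  qed
  then show ?thesis using g(2) by (intro exI[of _ "h1 + single 0 \<i> * h2"]) simp
qed

lemma continuous_on_leval: "continuous_on (sphere 0 1) (leval f)"
proof -
  have "continuous_on (sphere 0 1) (\<lambda>z :: complex. z powi k)" for k
    by (intro continuous_intros) auto
  then show ?thesis unfolding leval_def[abs_def] by (intro continuous_intros) auto
qed

section \<open>States on Laurent polynomials and their extension to continuous functions\<close>

locale laurent_functional =
  fixes \<Lambda> :: "laurent => complex"
  assumes \<Lambda>_add: "\<Lambda> (f + g) = \<Lambda> f + \<Lambda> g"
    and \<Lambda>_scale: "\<Lambda> (single 0 c * f) = c * \<Lambda> f"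
    and \<Lambda>_pos: "\<Lambda> (lstar f * f) \<in> \<real>\<^sub>\<ge>\<^sub>0"
    and \<Lambda>_one: "\<Lambda> 1 = 1"
    and \<Lambda>_lstar: "\<Lambda> (lstar f) = cnj (\<Lambda> f)"
begin

lemma \<Lambda>_uminus: "\<Lambda> (- f) = - \<Lambda> f"
  using \<Lambda>_scale[of "-1" f] by (simp add: single_uminus)

lemma \<Lambda>_diff: "\<Lambda> (f - g) = \<Lambda> f - \<Lambda> g"
  using \<Lambda>_add[of f "- g"] by (simp add: \<Lambda>_uminus)

text \<open>Positivity at f minus the constant \<Lambda> f, that is, a variance is
  nonnegative.\<close>

lemma \<Lambda>_square: "(cmod (\<Lambda> f))\<^sup>2 \<le> Re (\<Lambda> (lstar f * f))"
proof -
  define c where "c = single (0::int) (\<Lambda> f)"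
  have lc: "lstar c = single 0 (cnj (\<Lambda> f))" by (simp add: c_def lstar_single)
  have ld: "lstar (f - c) = lstar f - lstar c"
    using lstar_add[of "f - c" c] by (metis add_diff_cancel_right' diff_add_cancel)
  have "lstar (f - c) * (f - c) = (lstar f * f - c * lstar f) - lstar c * f + lstar c * (c * 1)"
    unfolding ld by (simp add: algebra_simps)
  then have "\<Lambda> (lstar (f - c) * (f - c)) = \<Lambda> (lstar f * f) - \<Lambda> f * cnj (\<Lambda> f) - cnj (\<Lambda> f) * \<Lambda> f + cnj (\<Lambda> f) * (\<Lambda> f * 1)"
    unfolding lc unfolding c_def by (simp only: \<Lambda>_add \<Lambda>_diff \<Lambda>_scale \<Lambda>_lstar \<Lambda>_one)
  then have "Re (\<Lambda> (lstar (f - c) * (f - c))) = Re (\<Lambda> (lstar f * f)) - (cmod (\<Lambda> f))\<^sup>2"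
    by (simp add: cmod_power2) (simp add: power2_eq_square)
  then show ?thesis using \<Lambda>_pos[of "f - c"] by (simp add: complex_nonneg_Reals_iff)
qed

lemma \<Lambda>_monomial: "cmod (\<Lambda> (single k c)) \<le> cmod c"
proof -
  have "lstar (single k 1) * single k (1::complex) = 1"
    by (simp add: lstar_single mult_single)
  then have "(cmod (\<Lambda> (single k 1)))\<^sup>2 \<le> 1"
    using \<Lambda>_square[of "single k 1"] by (simp add: \<Lambda>_one)
  then have "cmod (\<Lambda> (single k 1)) \<le> 1" using abs_square_le_1[of "cmod (\<Lambda> (single k 1))"] by simp
  moreover have "\<Lambda> (single k c) = c * \<Lambda> (single k 1)"
    using \<Lambda>_scale[of c "single k 1"] by (simp add: mult_single)
  ultimately show ?thesis by (simp add: norm_mult mult_left_le)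
qed

text \<open>|\<Lambda>| meets the hypotheses of \<open>laurent_sup_bound\<close>: monomials are
  unitary, and \<open>\<Lambda>_square\<close> plays the part of the C*-identity.\<close>

lemma \<Lambda>_bound:
  assumes "!!z. cmod z = 1 ==> cmod (leval f z) \<le> B"
  shows "cmod (\<Lambda> f) \<le> B"
proof (rule laurent_sup_bound[where p = "\<lambda>f. cmod (\<Lambda> f)", OF _ _ _ _ assms])
  show "(cmod (\<Lambda> f))\<^sup>2 \<le> cmod (\<Lambda> (lstar f * f))" for f
    using \<Lambda>_square[of f] complex_Re_le_cmod order_trans by blast
qed (auto simp: \<Lambda>_add norm_triangle_ineq \<Lambda>_monomial)

definition approx :: "(complex => complex) => nat => laurent" where
  "approx f n = (SOME h. \<forall>z. cmod z = 1 --> cmod (f z - leval h z) < 1 / real (Suc n))"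

text \<open>The trigonometric moment problem of Herglotz, solved by a functional instead of a
  measure. The value is the limit along one chosen sequence of Laurent approximants;
  \<open>\<Lambda>_bound\<close> makes it converge for continuous f.\<close>

definition ext :: "(complex => complex) => complex" where
  "ext f = lim (\<lambda>n. \<Lambda> (approx f n))"

lemma approx: "continuous_on (sphere 0 1) f ==> cmod z = 1 ==> cmod (f z - leval (approx f n) z) < 1 / real (Suc n)"
  using someI_ex[OF laurent_dense[of f "1 / real (Suc n)"]] unfolding approx_def by simp

lemma \<Lambda>_close:
  assumes "!!z. cmod z = 1 ==> cmod (f z - leval g z) \<le> a" "!!z. cmod z = 1 ==> cmod (f z - leval h z) \<le> b"
  shows "cmod (\<Lambda> g - \<Lambda> h) \<le> a + b"
proof -
  have "cmod (leval (g - h) z) \<le> a + b" if "cmod z = 1" for z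
  proof -
    have "leval (g - h) z = (f z - leval h z) - (f z - leval g z)" by (simp add: leval_diff)
    then show ?thesis using assms[OF that] norm_triangle_ineq4[of "f z - leval h z" "f z - leval g z"] by simp
  qed
  from \<Lambda>_bound[OF this] show ?thesis by (simp add: \<Lambda>_diff)
qed

lemma ext_lim: assumes "continuous_on (sphere 0 1) f" shows "(\<lambda>n. \<Lambda> (approx f n)) \<longlonglongrightarrow> ext f"
proof -
  have "Cauchy (\<lambda>n. \<Lambda> (approx f n))"
  proof (rule metric_CauchyI)
    fix e :: real assume e: "e > 0"
    obtain M :: nat where M: "real M > 2 / e" using reals_Archimedean2 by blast
    have "dist (\<Lambda> (approx f m)) (\<Lambda> (approx f n)) < e" if "m \<ge> M" "n \<ge> M" for m n
    proof -
      have s: "1 / real (Suc k) < e / 2" if "k \<ge> M" for k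
      proof -
        have "real (Suc k) > 2 / e" using M that by linarith
        then show ?thesis using e by (simp add: field_simps)
      qed
      have "cmod (\<Lambda> (approx f m) - \<Lambda> (approx f n)) \<le> 1 / real (Suc m) + 1 / real (Suc n)"
        by (rule \<Lambda>_close[of f]) (use approx[OF assms] less_imp_le in blast)+
      then show ?thesis using s[OF that(1)] s[OF that(2)] by (simp add: dist_norm)
    qed
    then show "\<exists>M. \<forall>m\<ge>M. \<forall>n\<ge>M. dist (\<Lambda> (approx f m)) (\<Lambda> (approx f n)) < e" by blast
  qed
  then show ?thesis unfolding ext_def using Cauchy_convergent convergent_LIMSEQ_iff by blast
qed

text \<open>All properties of \<open>ext\<close> come from comparison with the value of \<Lambda> at
  a single nearby Laurent polynomial.\<close>

lemma ext_close:
  assumes f: "continuous_on (sphere 0 1) f" and g: "!!z. cmod z = 1 ==> cmod (f z - leval g z) \<le> e"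
  shows "cmod (ext f - \<Lambda> g) \<le> e"
proof -
  have "(\<lambda>n. cmod (\<Lambda> (approx f n) - \<Lambda> g)) \<longlonglongrightarrow> cmod (ext f - \<Lambda> g)"
    by (intro tendsto_intros ext_lim f)
  moreover have "(\<lambda>n. 1 / real (Suc n) + e) \<longlonglongrightarrow> 0 + e"
    by (intro tendsto_intros LIMSEQ_Suc[OF lim_1_over_n])
  moreover have "cmod (\<Lambda> (approx f n) - \<Lambda> g) \<le> 1 / real (Suc n) + e" for n
    by (rule \<Lambda>_close[of f]) (use approx[OF f] less_imp_le g in blast)+
  ultimately show ?thesis by (intro LIMSEQ_le[of _ "cmod (ext f - \<Lambda> g)" _ e]) auto
qed

lemma ext_leval: "ext (leval g) = \<Lambda> g"
  using ext_close[OF continuous_on_leval, of g g 0] by simp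

text \<open>The choice in \<open>approx\<close> inspects its function only on the circle, so it
  selects the same Laurent polynomials for f and g.\<close>

lemma ext_cong:
  assumes "continuous_on (sphere 0 1) f" "!!z. cmod z = 1 ==> f z = g z"
  shows "ext f = ext g"
proof -
  have "approx f n = approx g n" for n
    unfolding approx_def using assms(2) by (intro arg_cong[of _ _ Eps] ext) auto
  then show ?thesis by (simp add: ext_def)
qed

lemma complex_eq_if_close: "(!!e. e > 0 ==> cmod (a - b) \<le> K * e) ==> a = b"
proof (rule ccontr)
  assume le: "!!e. e > 0 ==> cmod (a - b) \<le> K * e" and "a \<noteq> b"
  then have d: "cmod (a - b) > 0" by simp
  have "cmod (a - b) \<le> K * 1" by (rule le) simp
  then have "K > 0" using d by linarith
  then show False using le[of "cmod (a - b) / (2 * K)"] d by simp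
qed

lemma ext_add:
  assumes f: "continuous_on (sphere 0 1) f" and g: "continuous_on (sphere 0 1) g"
  shows "ext (\<lambda>z. f z + g z) = ext f + ext g"
\<comment> \<open>Error 2 e for the sum and e for each of the two summands.\<close>
proof (rule complex_eq_if_close[where K = 4])
  fix e :: real assume e: "e > 0"
  obtain h1 h2 where h: "!!z. cmod z = 1 ==> cmod (f z - leval h1 z) \<le> e" "!!z. cmod z = 1 ==> cmod (g z - leval h2 z) \<le> e"
    using laurent_dense[OF f e] laurent_dense[OF g e] less_imp_le by metis
  have "cmod (ext (\<lambda>z. f z + g z) - \<Lambda> (h1 + h2)) \<le> e + e"
  proof (rule ext_close)
    show "cmod (f z + g z - leval (h1 + h2) z) \<le> e + e" if "cmod z = 1" for z
      using h(1)[OF that] h(2)[OF that] norm_triangle_ineq[of "f z - leval h1 z" "g z - leval h2 z"]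
      by (simp add: leval_add add_diff_add)
  qed (intro continuous_intros f g)
  moreover have "cmod (ext f - \<Lambda> h1) \<le> e" "cmod (ext g - \<Lambda> h2) \<le> e" using ext_close f g h by blast+
  moreover have e: "ext (\<lambda>z. f z + g z) - (ext f + ext g) =
    (ext (\<lambda>z. f z + g z) - \<Lambda> (h1 + h2)) - (ext f - \<Lambda> h1) - (ext g - \<Lambda> h2)" by (simp add: \<Lambda>_add)
  ultimately show "cmod (ext (\<lambda>z. f z + g z) - (ext f + ext g)) \<le> 4 * e"
    unfolding e using norm_triangle_ineq4[of "(ext (\<lambda>z. f z + g z) - \<Lambda> (h1 + h2)) - (ext f - \<Lambda> h1)" "ext g - \<Lambda> h2"]
      norm_triangle_ineq4[of "ext (\<lambda>z. f z + g z) - \<Lambda> (h1 + h2)" "ext f - \<Lambda> h1"] by simp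
qed

lemma ext_scale:
  assumes f: "continuous_on (sphere 0 1) f"
  shows "ext (\<lambda>z. c * f z) = c * ext f"
proof (rule complex_eq_if_close[where K = "2 * cmod c"])
  fix e :: real assume e: "e > 0"
  obtain h where h: "!!z. cmod z = 1 ==> cmod (f z - leval h z) \<le> e"
    using laurent_dense[OF f e] less_imp_le by metis
  have "cmod (ext (\<lambda>z. c * f z) - \<Lambda> (single 0 c * h)) \<le> cmod c * e"
  proof (rule ext_close)
    show "cmod (c * f z - leval (single 0 c * h) z) \<le> cmod c * e" if "cmod z = 1" for z
    proof -
      have "z \<noteq> 0" using that by auto
      then have "c * f z - leval (single 0 c * h) z = c * (f z - leval h z)"
        by (simp add: leval_mult leval_single algebra_simps)
      then show ?thesis using h[OF that] by (simp add: norm_mult mult_left_mono)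
    qed
  qed (intro continuous_intros f)
  moreover have "cmod (c * (ext f - \<Lambda> h)) \<le> cmod c * e"
    using ext_close[OF f h] by (simp add: norm_mult mult_left_mono)
  moreover have e: "ext (\<lambda>z. c * f z) - c * ext f = (ext (\<lambda>z. c * f z) - \<Lambda> (single 0 c * h)) - c * (ext f - \<Lambda> h)"
    by (simp add: \<Lambda>_scale right_diff_distrib)
  ultimately show "cmod (ext (\<lambda>z. c * f z) - c * ext f) \<le> 2 * cmod c * e"
    unfolding e using norm_triangle_ineq4[of "ext (\<lambda>z. c * f z) - \<Lambda> (single 0 c * h)" "c * (ext f - \<Lambda> h)"] by simp
qed

text \<open>If g approximates f, then \<open>lstar g * g\<close> approximates the squared modulus of
  f with error at most 2 K + 1 times that of g, where K bounds f. The values of \<Lambda> there are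
  nonnegative, and the nonnegative reals are closed.\<close>

lemma ext_pos:
  assumes f: "continuous_on (sphere 0 1) f"
  shows "ext (\<lambda>z. cnj (f z) * f z) \<in> \<real>\<^sub>\<ge>\<^sub>0"
proof -
  have cf: "continuous_on (sphere 0 1) (\<lambda>z. cnj (f z) * f z)" by (intro continuous_intros f)
  obtain K where K: "!!z. cmod z = 1 ==> cmod (f z) \<le> K"
    using compact_imp_bounded[OF compact_continuous_image[OF f compact_sphere]] by (force simp: bounded_iff)
  let ?g = "\<lambda>n. approx f n"
  have "cmod (ext (\<lambda>z. cnj (f z) * f z) - \<Lambda> (lstar (?g n) * ?g n)) \<le> (2 * K + 1) * (1 / real (Suc n))" for n
  proof (rule ext_close[OF cf])
    fix z assume z: "cmod z = 1"
    then have z0: "z \<noteq> 0" by auto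
    let ?d = "f z - leval (?g n) z"
    have d: "cmod ?d \<le> 1 / real (Suc n)" using approx[OF f z, of n] by simp
    have d1: "cmod ?d \<le> 1" by (rule order_trans[OF d]) simp
    have "cnj (f z) * f z - leval (lstar (?g n) * ?g n) z = cnj (f z) * ?d + cnj ?d * (f z - ?d)"
      using z z0 by (simp add: leval_mult leval_lstar algebra_simps)
    then have "cmod (cnj (f z) * f z - leval (lstar (?g n) * ?g n) z) \<le> cmod (f z) * cmod ?d + cmod ?d * cmod (f z - ?d)"
      using norm_triangle_ineq[of "cnj (f z) * ?d" "cnj ?d * (f z - ?d)"] by (simp only: norm_mult complex_mod_cnj)
    also have "\<dots> \<le> K * cmod ?d + cmod ?d * (K + 1)"
    proof (intro add_mono mult_right_mono mult_left_mono)
      show "cmod (f z - ?d) \<le> K + 1" using norm_triangle_ineq4[of "f z" ?d] K[OF z] d1 by linarith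
    qed (use K[OF z] in auto)
    also have "\<dots> = (2 * K + 1) * cmod ?d" by (simp add: algebra_simps)
    also have "\<dots> \<le> (2 * K + 1) * (1 / real (Suc n))"
      using d K[OF z] norm_ge_zero[of "f z"] by (intro mult_left_mono) linarith+
    finally show "cmod (cnj (f z) * f z - leval (lstar (?g n) * ?g n) z) \<le> (2 * K + 1) * (1 / real (Suc n))" .
  qed
  then have ev: "\<forall>\<^sub>F n in sequentially. norm (ext (\<lambda>z. cnj (f z) * f z) - \<Lambda> (lstar (?g n) * ?g n)) \<le> (2 * K + 1) * (1 / real (Suc n))"
    by (intro always_eventually allI)
  have "(\<lambda>n. (2 * K + 1) * (1 / real (Suc n))) \<longlonglongrightarrow> 0"
    by (intro tendsto_mult_right_zero LIMSEQ_Suc[OF lim_1_over_n])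
  from Lim_null_comparison[OF ev this]
  have "(\<lambda>n. ext (\<lambda>z. cnj (f z) * f z) - \<Lambda> (lstar (?g n) * ?g n)) \<longlonglongrightarrow> 0" .
  then have "(\<lambda>n. ext (\<lambda>z. cnj (f z) * f z) - (ext (\<lambda>z. cnj (f z) * f z) - \<Lambda> (lstar (?g n) * ?g n))) \<longlonglongrightarrow> ext (\<lambda>z. cnj (f z) * f z) - 0"
    by (intro tendsto_intros)
  then have "(\<lambda>n. \<Lambda> (lstar (?g n) * ?g n)) \<longlonglongrightarrow> ext (\<lambda>z. cnj (f z) * f z)" by simp
  then show ?thesis
    using closed_sequentially[OF closed_nonneg_Reals_complex, of "\<lambda>n. \<Lambda> (lstar (?g n) * ?g n)"] \<Lambda>_pos by simp
qed

end

section \<open>Functional calculus of unitaries in a corner\<close>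

text \<open>A unitary of the corner p A p, whose unit is p. The case u = p is included and will
  describe sinks.\<close>

locale corner_unitary = cstar_algebra +
  fixes p u
  assumes p [simp]: "p \<in> carrier A" and p_star: "star A p = p" and p_idem: "p \<otimes> p = p"
    and u [simp]: "u \<in> carrier A" and uu: "u \<otimes> star A u = p" "star A u \<otimes> u = p"
    and pu: "p \<otimes> u = u" "u \<otimes> p = u"
begin

lemma pus: "p \<otimes> star A u = star A u" "star A u \<otimes> p = star A u"
  using arg_cong[OF pu(2), of "star A"] arg_cong[OF pu(1), of "star A"] by (simp_all add: star_mult p_star)

text \<open>Powers within the corner: the zeroth power is p, not \<open>\<one>\<close>.\<close>

definition upow :: "int => 'a" where
  "upow k = (if k \<ge> 0 then ((\<lambda>a. u \<otimes> a) ^^ nat k) p else ((\<lambda>a. star A u \<otimes> a) ^^ nat (- k)) p)"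

lemma upow_closed [simp]: "upow k \<in> carrier A"
proof -
  have "((\<lambda>a. v \<otimes> a) ^^ n) p \<in> carrier A" if "v \<in> carrier A" for v n
    using that by (induct n) auto
  then show ?thesis by (simp add: upow_def)
qed

lemma upow_0: "upow 0 = p"
  by (simp add: upow_def)

lemma p_upow: "p \<otimes> upow k = upow k"
proof -
  have "p \<otimes> ((\<lambda>a. v \<otimes> a) ^^ n) p = ((\<lambda>a. v \<otimes> a) ^^ n) p" if v: "v \<in> carrier A" "p \<otimes> v = v" for v n
  proof (cases n)
    case (Suc m)
    have "((\<lambda>a. v \<otimes> a) ^^ m) p \<in> carrier A" using v by (induct m) auto
    then show ?thesis using v by (simp add: Suc m_assoc[symmetric])
  qed (simp add: p_idem)
  then show ?thesis by (simp add: upow_def pu pus)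
qed

lemma upow_Suc: "upow (k + 1) = u \<otimes> upow k"
proof (cases "k \<ge> 0")
  case True
  then have "nat (k + 1) = Suc (nat k)" by simp
  then show ?thesis using True by (simp add: upow_def)
next
  case False
  then have "nat (- k) = Suc (nat (- (k + 1)))" by simp
  then have "upow k = star A u \<otimes> upow (k + 1)" using False by (auto simp: upow_def)
  then show ?thesis using p_upow[of "k + 1"] by (simp add: m_assoc[symmetric] uu)
qed

lemma upow_pred: "upow (k - 1) = star A u \<otimes> upow k"
  using upow_Suc[of "k - 1"] p_upow[of "k - 1"] by (simp add: m_assoc[symmetric] uu)

lemma upow_add: "upow (j + k) = upow j \<otimes> upow k"
proof (induct j rule: int_induct[where k = 0])
  case base
  then show ?case by (simp add: upow_0 p_upow)
next
  case (step1 i)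
  have "upow (i + 1 + k) = u \<otimes> upow (i + k)" using upow_Suc[of "i + k"] by (simp add: add_ac)
  then show ?case using step1 by (simp add: upow_Suc m_assoc)
next
  case (step2 i)
  have "upow (i - 1 + k) = star A u \<otimes> upow (i + k)" using upow_pred[of "i + k"] by (simp add: algebra_simps)
  then show ?case using step2 by (simp add: upow_pred m_assoc)
qed

lemma upow_1: "upow 1 = u" and upow_minus_1: "upow (- 1) = star A u"
  using upow_Suc[of 0] upow_pred[of 0] by (simp_all add: upow_0 pu pus)

lemma star_upow: "star A (upow k) = upow (- k)"
proof (induct k rule: int_induct[where k = 0])
  case base
  then show ?case by (simp add: upow_0 p_star)
next
  case (step1 i)
  have "star A (upow (i + 1)) = upow (- i) \<otimes> upow (- 1)"
    using step1 by (simp add: upow_Suc star_mult upow_minus_1)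
  also have "\<dots> = upow (- i + - 1)" by (rule upow_add[symmetric])
  finally show ?case by simp
next
  case (step2 i)
  have "star A (upow (i - 1)) = upow (- i) \<otimes> upow 1"
    using step2 by (simp add: upow_pred star_mult upow_1)
  also have "\<dots> = upow (- i + 1)" by (rule upow_add[symmetric])
  finally show ?case by simp
qed

definition fcalc :: "laurent => 'a" where
  "fcalc f = finsum A (\<lambda>k. lookup f k \<odot> upow k) (keys f)"

lemma fcalc_superset:
  assumes "finite K" "keys f \<subseteq> K"
  shows "fcalc f = finsum A (\<lambda>k. lookup f k \<odot> upow k) K"
  unfolding fcalc_def
  by (rule add.finprod_mono_neutral_cong_left) (use assms in \<open>auto simp: in_keys_iff\<close>)

lemma fcalc_closed [simp]: "fcalc f \<in> carrier A"
  unfolding fcalc_def by (rule finsum_closed) auto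

lemma fcalc_single: "fcalc (single k c) = c \<odot> upow k"
proof -
  have "fcalc (single k c) = finsum A (\<lambda>j. lookup (single k c) j \<odot> upow j) {k}"
    by (rule fcalc_superset) auto
  then show ?thesis by simp
qed

lemma fcalc_add: "fcalc (f + g) = fcalc f \<oplus> fcalc g"
proof -
  let ?K = "keys f \<union> keys g"
  have "fcalc (f + g) = finsum A (\<lambda>k. lookup (f + g) k \<odot> upow k) ?K"
    by (rule fcalc_superset) (use Poly_Mapping.keys_add[of f g] in auto)
  also have "\<dots> = finsum A (\<lambda>k. lookup f k \<odot> upow k \<oplus> lookup g k \<odot> upow k) ?K"
    by (rule finsum_cong') (auto simp: lookup_add smult_l_distr)
  also have "\<dots> = finsum A (\<lambda>k. lookup f k \<odot> upow k) ?K \<oplus> finsum A (\<lambda>k. lookup g k \<odot> upow k) ?K"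
    by (rule finsum_addf) auto
  also have "\<dots> = fcalc f \<oplus> fcalc g" by (subst (1 2) fcalc_superset[of ?K]) auto
  finally show ?thesis .
qed

lemma fcalc_mult: "fcalc (f * g) = fcalc f \<otimes> fcalc g"
proof (induct f rule: poly_mapping_single_induct)
  case (1 j c)
  show ?case
  proof (induct g rule: poly_mapping_single_induct)
    case (1 k d)
    show ?case
      by (simp add: mult_single fcalc_single upow_add smult_mult_l smult_mult_r smult_smult mult.commute[of c d])
  qed (simp add: distrib_left fcalc_add r_distr)
qed (simp add: distrib_right fcalc_add l_distr)

lemma fcalc_star: "fcalc (lstar f) = star A (fcalc f)"
  by (induct f rule: poly_mapping_single_induct)
    (simp_all add: lstar_single fcalc_single star_smult star_upow lstar_add fcalc_add star_add)

lemma nrm_upow: "nrm (upow k) \<le> 1"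
proof -
  have "(nrm (upow k))\<^sup>2 = nrm p"
    by (simp flip: nrm_cstar) (simp add: star_upow upow_0 flip: upow_add)
  also have "\<dots> \<le> 1" by (rule nrm_projection) (simp_all add: p_star p_idem)
  finally show ?thesis using abs_square_le_1[of "nrm (upow k)"] by simp
qed

text \<open>Powers of a unitary are contractions, so the norm of \<open>fcalc f\<close> satisfies
  the hypotheses of \<open>laurent_sup_bound\<close>. This is the norm estimate of the continuous
  functional calculus.\<close>

lemma nrm_fcalc:
  assumes "!!z. cmod z = 1 ==> cmod (leval f z) \<le> B"
  shows "nrm (fcalc f) \<le> B"
proof (rule laurent_sup_bound[where p = "\<lambda>f. nrm (fcalc f)", OF _ _ _ _ assms])
  show "nrm (fcalc (single k c)) \<le> cmod c" for k c
    using nrm_upow[of k] by (simp add: fcalc_single nrm_smult mult_left_le)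
qed (simp_all add: nrm_nonneg fcalc_add nrm_add fcalc_mult fcalc_star nrm_cstar)

end

section \<open>Graphs in which every vertex leads to a root\<close>

context graph_algebra
begin

text \<open>Expanding the tail projection in \<open>P (tail G e) \<otimes> S e\<close> leaves only
  the term of e itself, since distinct arcs are orthogonal. So S e is a partial isometry, and its
  source projection is \<open>P (head G e)\<close>.\<close>

lemma S_head: "e \<in> arcs G ==> S e \<otimes> P (head G e) = S e"
proof -
  assume e: "e \<in> arcs G"
  have "S e = finsum A (\<lambda>f. S f \<otimes> star A (S f)) {f \<in> arcs G. tail G f = tail G e} \<otimes> S e"
    using P_sum[of "tail G e"] e not_sink[OF e] P_S[OF e] by simp
  also have "\<dots> = finsum A (\<lambda>f. S f \<otimes> star A (S f) \<otimes> S e) {f \<in> arcs G. tail G f = tail G e}"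
    using e by (intro finsum_ldistr) auto
  also have "\<dots> = finsum A (\<lambda>f. if e = f then S f \<otimes> star A (S f) \<otimes> S e else \<zero>) {f \<in> arcs G. tail G f = tail G e}"
    using e by (intro finsum_cong') (auto simp: m_assoc S_orth)
  also have "\<dots> = S e \<otimes> star A (S e) \<otimes> S e"
    using e by (subst finsum_singleton) auto
  finally show ?thesis using e by (simp add: m_assoc S_star_S)
qed

lemma star_S_tail: "e \<in> arcs G ==> star A (S e) \<otimes> P (tail G e) = star A (S e)"
  using arg_cong[OF P_S, of e "star A"] by (simp add: star_mult P_star)

lemma head_star_S: "e \<in> arcs G ==> P (head G e) \<otimes> star A (S e) = star A (S e)"
  using arg_cong[OF S_head, of e "star A"] by (simp add: star_mult P_star)

text \<open>The end vertex is an argument because the empty list of arcs does not determine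
  it.\<close>

definition path_elem :: "'v => 'e list => 'a" where
  "path_elem w \<xi> = foldr (\<lambda>e a. S e \<otimes> a) \<xi> (P w)"

lemma path_elem_simps [simp]:
  "path_elem w [] = P w" "path_elem w (e # \<xi>) = S e \<otimes> path_elem w \<xi>"
  by (simp_all add: path_elem_def)

lemma path_elem_closed [simp]: "awalk v \<xi> w ==> path_elem w \<xi> \<in> carrier A"
  by (induct \<xi> arbitrary: v) (auto simp: awalk_simps)

lemma source_path_elem: "awalk v \<xi> w ==> P v \<otimes> path_elem w \<xi> = path_elem w \<xi>"
proof (cases \<xi>)
  case (Cons e \<nu>)
  assume "awalk v \<xi> w"
  then have "e \<in> arcs G" "v = tail G e" "awalk (head G e) \<nu> w" by (simp_all add: Cons awalk_simps)
  then show ?thesis using path_elem_closed by (simp add: Cons m_assoc[symmetric] P_S)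
qed (auto simp: awalk_simps P_idem)

lemma source_path_elem_orth:
  assumes "awalk v \<xi> w" "v' \<in> verts G" "v' \<noteq> v" shows "P v' \<otimes> path_elem w \<xi> = \<zero>"
proof -
  have v: "v \<in> verts G" using assms(1) by (rule awalk_hd_in_verts)
  have "P v' \<otimes> path_elem w \<xi> = P v' \<otimes> (P v \<otimes> path_elem w \<xi>)" by (simp add: source_path_elem[OF assms(1)])
  also have "\<dots> = (P v' \<otimes> P v) \<otimes> path_elem w \<xi>"
    using assms v path_elem_closed[OF assms(1)] by (intro m_assoc[symmetric]) auto
  finally show ?thesis using assms v path_elem_closed[OF assms(1)] by (simp add: P_orth)
qed

lemma path_elem_range: "awalk v \<xi> w ==> path_elem w \<xi> \<otimes> P w = path_elem w \<xi>"
proof (induct \<xi> arbitrary: v)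
  case (Cons e \<xi>)
  then have e: "e \<in> arcs G" and a: "awalk (head G e) \<xi> w" by (auto simp: awalk_simps)
  show ?case using Cons(1)[OF a] path_elem_closed[OF a] e awalk_last_in_verts[OF a] by (simp add: m_assoc)
qed (auto simp: awalk_simps P_idem)

lemma path_elem_isometry: "awalk v \<xi> w ==> star A (path_elem w \<xi>) \<otimes> path_elem w \<xi> = P w"
proof (induct \<xi> arbitrary: v)
  case Nil
  then show ?case by (auto simp: awalk_simps P_star P_idem)
next
  case (Cons e \<xi>)
  then have e: "e \<in> arcs G" and w: "awalk (head G e) \<xi> w" by (auto simp: awalk_simps)
  note c = path_elem_closed[OF w]
  have "star A (path_elem w (e # \<xi>)) \<otimes> path_elem w (e # \<xi>) =
    star A (path_elem w \<xi>) \<otimes> ((star A (S e) \<otimes> S e) \<otimes> path_elem w \<xi>)"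
    using e c by (simp add: star_mult m_assoc)
  then show ?case using e c Cons(1)[OF w] source_path_elem[OF w] by (simp add: S_star_S)
qed

lemma nrm_path_elem: assumes "awalk v \<xi> w" shows "nrm (path_elem w \<xi>) \<le> 1"
proof -
  have w: "w \<in> verts G" using assms by (rule awalk_last_in_verts)
  have "(nrm (path_elem w \<xi>))\<^sup>2 = nrm (P w)"
    using path_elem_closed[OF assms] by (simp add: nrm_cstar[symmetric] path_elem_isometry[OF assms])
  also have "\<dots> \<le> 1" using w by (intro nrm_projection) (simp_all add: P_star P_idem)
  finally show ?thesis using abs_square_le_1[of "nrm (path_elem w \<xi>)"] by simp
qed

end

text \<open>At the root there is nothing to choose: either no arc leaves it, or a single one does
  and has a single way back. Sinks and circular components are thus treated together.\<close>

locale rooted_digraph = fin_digraph G for G :: "('v, 'e) pre_digraph" +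
  fixes r :: 'v
  assumes root: "r \<in> verts G"
    and reach_root: "v \<in> verts G ==> \<exists>\<xi>. awalk v \<xi> r"
    and finite_paths: "finite {\<xi>. \<exists>v. awalk v \<xi> r \<and> (\<forall>e\<in>set \<xi>. tail G e \<noteq> r)}"
    and loop_cases: "{e \<in> arcs G. tail G e = r} = {} \<or>
      (\<exists>e \<xi>. {e \<in> arcs G. tail G e = r} = {e} \<and>
         {\<xi>. awalk (head G e) \<xi> r \<and> (\<forall>e\<in>set \<xi>. tail G e \<noteq> r)} = {\<xi>})"
begin

text \<open>The index set of the matrix units. A list of arcs suffices for such a path: the empty
  one can only stand at the root, and otherwise the first arc gives the source.\<close>

definition I :: "'e list set" where
  "I = {\<xi>. \<exists>v. awalk v \<xi> r \<and> (\<forall>e\<in>set \<xi>. tail G e \<noteq> r)}"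

definition src :: "'e list => 'v" where
  "src \<xi> = (if \<xi> = [] then r else tail G (hd \<xi>))"

lemma finite_I [simp]: "finite I"
  using finite_paths by (simp add: I_def)

lemma src_simps [simp]: "src [] = r" "src (e # \<xi>) = tail G e"
  by (simp_all add: src_def)

lemma I_iff: "\<xi> \<in> I \<longleftrightarrow> awalk (src \<xi>) \<xi> r \<and> (\<forall>e\<in>set \<xi>. tail G e \<noteq> r)"
  by (cases \<xi>) (auto simp: I_def awalk_simps)

lemma awalk_src: "\<xi> \<in> I ==> awalk (src \<xi>) \<xi> r"
  by (simp add: I_iff)

lemma I_from: "\<xi> \<in> I \<and> src \<xi> = v \<longleftrightarrow> awalk v \<xi> r \<and> (\<forall>e\<in>set \<xi>. tail G e \<noteq> r)"
  by (cases \<xi>) (auto simp: I_iff awalk_simps)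

lemma Nil_I [simp]: "[] \<in> I"
  by (simp add: I_iff awalk_simps root)

lemma Cons_I: "e # \<xi> \<in> I \<longleftrightarrow> e \<in> arcs G \<and> tail G e \<noteq> r \<and> \<xi> \<in> I \<and> src \<xi> = head G e"
  unfolding I_from by (auto simp: I_iff awalk_simps)

lemma src_verts: "\<xi> \<in> I ==> src \<xi> \<in> verts G"
  using awalk_src awalk_hd_in_verts by blast

lemma src_root: "\<xi> \<in> I ==> src \<xi> = r \<longleftrightarrow> \<xi> = []"
  by (cases \<xi>) (auto simp: Cons_I)

lemma I_exists: "v \<in> verts G ==> \<exists>\<xi>\<in>I. src \<xi> = v"
proof -
  have "\<exists>\<xi>\<in>I. src \<xi> = v" if "awalk v \<xi> r" for v \<xi>
    using that
  proof (induct \<xi> arbitrary: v)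
    case Nil
    then show ?case by (auto simp: awalk_simps intro: bexI[of _ "[]"])
  next
    case (Cons e \<xi>)
    then have e: "e \<in> arcs G" "v = tail G e" "awalk (head G e) \<xi> r" by (auto simp: awalk_simps)
    obtain \<nu> where "\<nu> \<in> I" "src \<nu> = head G e" using Cons(1)[OF e(3)] by blast
    then have "v \<noteq> r ==> e # \<nu> \<in> I" using e by (simp add: Cons_I)
    then show ?case using e Nil_I src_simps by metis
  qed
  then show "v \<in> verts G ==> ?thesis" using reach_root by blast
qed

definition has_loop :: bool where
  "has_loop \<longleftrightarrow> {e \<in> arcs G. tail G e = r} \<noteq> {}"

definition loop_arc :: 'e where
  "loop_arc = (THE e. {e \<in> arcs G. tail G e = r} = {e})"

definition loop_rest :: "'e list" where
  "loop_rest = (THE \<xi>. {\<xi> \<in> I. src \<xi> = head G loop_arc} = {\<xi>})"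

lemma loop:
  assumes has_loop
  shows "{e \<in> arcs G. tail G e = r} = {loop_arc}" "{\<xi> \<in> I. src \<xi> = head G loop_arc} = {loop_rest}"
proof -
  obtain e \<xi> where e: "{e \<in> arcs G. tail G e = r} = {e}"
    "{\<xi>. awalk (head G e) \<xi> r \<and> (\<forall>e\<in>set \<xi>. tail G e \<noteq> r)} = {\<xi>}"
    using loop_cases assms unfolding has_loop_def by blast
  have 1: "loop_arc = e" unfolding loop_arc_def e(1) by simp
  show "{e \<in> arcs G. tail G e = r} = {loop_arc}" unfolding 1 by (rule e(1))
  have 2: "{\<xi> \<in> I. src \<xi> = head G loop_arc} = {\<xi>}" unfolding 1 I_from by (rule e(2))
  show "{\<xi> \<in> I. src \<xi> = head G loop_arc} = {loop_rest}" unfolding loop_rest_def 2 by simp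
qed

lemma loop_arc: "has_loop ==> loop_arc \<in> arcs G" "has_loop ==> tail G loop_arc = r"
  and loop_rest: "has_loop ==> loop_rest \<in> I" "has_loop ==> src loop_rest = head G loop_arc"
  using loop by blast+

lemma loop_arc_unique: "e \<in> arcs G ==> tail G e = r ==> has_loop \<and> e = loop_arc"
  using loop(1) by (auto simp: has_loop_def)

lemma loop_rest_unique: "has_loop ==> \<xi> \<in> I ==> src \<xi> = head G loop_arc ==> \<xi> = loop_rest"
  using loop(2) by blast

text \<open>The spectrum of the unitary at the root: the whole circle if there is a loop, and the
  point 1 at a sink, where the unitary is the unit of the corner.\<close>

definition K :: "complex set" where
  "K = (if has_loop then sphere 0 1 else {1})"

lemma K_unit: "z \<in> K ==> cmod z = 1"
  by (auto simp: K_def split: if_splits)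

end

section \<open>Matrix units over the corner at the root\<close>

locale rooted_graph_algebra = rooted_digraph G r + graph_algebra G A nrm P S
  for G :: "('v, 'e) pre_digraph" and r and A :: "'a star_algebra" (structure) and nrm P S
begin

abbreviation V :: "'e list => 'a" where
  "V \<equiv> path_elem r"

lemma V_closed [simp]: "\<xi> \<in> I ==> V \<xi> \<in> carrier A"
  using path_elem_closed[OF awalk_src] by simp

lemma P_V: "v \<in> verts G ==> \<xi> \<in> I ==> P v \<otimes> V \<xi> = (if v = src \<xi> then V \<xi> else \<zero>)"
  using source_path_elem[OF awalk_src] source_path_elem_orth[OF awalk_src] by auto

text \<open>Unfold \<open>P v\<close> over the arcs leaving v until every branch has reached the
  root. The longest remaining path shortens at each step, and a vertex other than the root is no
  sink because it leads there.\<close>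

lemma P_eq_sum_V:
  "(!!\<xi>. \<xi> \<in> I ==> src \<xi> = v ==> length \<xi> \<le> n) ==> v \<in> verts G ==>
    P v = finsum A (\<lambda>\<xi>. V \<xi> \<otimes> star A (V \<xi>)) {\<xi> \<in> I. src \<xi> = v}"
proof (induct n arbitrary: v)
  have rt: "P r = finsum A (\<lambda>\<xi>. V \<xi> \<otimes> star A (V \<xi>)) {\<xi> \<in> I. src \<xi> = r}"
  proof -
    have "{\<xi> \<in> I. src \<xi> = r} = {[]}" using src_root by auto
    then show ?thesis using root by (simp add: P_star P_idem)
  qed
  {
    case 0
    obtain \<xi> where "\<xi> \<in> I" "src \<xi> = v" using I_exists 0(2) by blast
    then have "v = r" using 0(1)[of \<xi>] by simp
    then show ?case using rt by simp
  next
    case (Suc n)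
    show ?case
    proof (cases "v = r")
      case True
      then show ?thesis using rt by simp
    next
      case False
      obtain \<xi> where "\<xi> \<in> I" "src \<xi> = v" using I_exists Suc(3) by blast
      then have ns: "\<not> is_sink G v" using False by (cases \<xi>) (auto simp: Cons_I is_sink_def)
      let ?J = "{e \<in> arcs G. tail G e = v}" and ?B = "\<lambda>e. (#) e ` {\<xi> \<in> I. src \<xi> = head G e}"
      let ?t = "\<lambda>\<xi>. V \<xi> \<otimes> star A (V \<xi>)"
      \<comment> \<open>A path from v, which is not the root, is determined by its first arc and the
        rest.\<close>
      have U: "{\<xi> \<in> I. src \<xi> = v} = (\<Union>e\<in>?J. ?B e)"
      proof (intro equalityI subsetI)
        fix \<xi> assume "\<xi> \<in> {\<xi> \<in> I. src \<xi> = v}"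
        then show "\<xi> \<in> (\<Union>e\<in>?J. ?B e)" using False by (cases \<xi>) (auto simp: Cons_I)
      qed (use False in \<open>auto simp: Cons_I\<close>)
      have SS: "S e \<otimes> star A (S e) = finsum A ?t (?B e)" if e: "e \<in> ?J" for e
      proof -
        have ea: "e \<in> arcs G" using e by simp
        have "P (head G e) = finsum A ?t {\<xi> \<in> I. src \<xi> = head G e}"
        proof (rule Suc(1))
          fix \<xi> assume "\<xi> \<in> I" "src \<xi> = head G e"
          then have "e # \<xi> \<in> I" "src (e # \<xi>) = v" using e False by (auto simp: Cons_I)
          then show "length \<xi> \<le> n" using Suc(2)[of "e # \<xi>"] by simp
        qed (use ea in simp)
        then have "S e \<otimes> star A (S e) = S e \<otimes> finsum A ?t {\<xi> \<in> I. src \<xi> = head G e} \<otimes> star A (S e)"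
          using S_head[OF ea] by simp
        also have "\<dots> = finsum A (\<lambda>\<xi>. S e \<otimes> ?t \<xi>) {\<xi> \<in> I. src \<xi> = head G e} \<otimes> star A (S e)"
          using ea by (subst finsum_rdistr) auto
        also have "\<dots> = finsum A (\<lambda>\<xi>. S e \<otimes> ?t \<xi> \<otimes> star A (S e)) {\<xi> \<in> I. src \<xi> = head G e}"
          using ea by (subst finsum_ldistr) auto
        also have "\<dots> = finsum A (\<lambda>\<xi>. ?t (e # \<xi>)) {\<xi> \<in> I. src \<xi> = head G e}"
          using ea by (intro finsum_cong') (auto simp: m_assoc star_mult)
        also have "\<dots> = finsum A ?t (?B e)"
          using ea by (subst finsum_reindex) (auto simp: inj_on_def)
        finally show ?thesis .
      qed
      have "P v = finsum A (\<lambda>e. S e \<otimes> star A (S e)) ?J" by (rule P_sum[OF Suc(3) ns])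
      also have "\<dots> = finsum A (\<lambda>e. finsum A ?t (?B e)) ?J"
      proof (rule finsum_cong'[OF refl _ SS])
        show "(\<lambda>e. finsum A ?t (?B e)) \<in> ?J \<rightarrow> carrier A"
          by (intro Pi_I, subst SS[symmetric]) auto
      qed
      also have "\<dots> = finsum A ?t (\<Union>e\<in>?J. ?B e)"
        using False by (subst add.finprod_UN_disjoint) (auto simp: pairwise_def disjnt_def Cons_I star_mult)
      finally show ?thesis unfolding U .
    qed
  }
qed

lemma one_eq_sum_V: "\<one> = finsum A (\<lambda>\<xi>. V \<xi> \<otimes> star A (V \<xi>)) I"
proof -
  let ?t = "\<lambda>\<xi>. V \<xi> \<otimes> star A (V \<xi>)"
  define n where "n = Max (length ` I)"
  have len: "length \<xi> \<le> n" if "\<xi> \<in> I" for \<xi> unfolding n_def using that by (intro Max_ge) auto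
  have U: "I = (\<Union>v\<in>verts G. {\<xi> \<in> I. src \<xi> = v})" using src_verts by auto
  have "\<one> = finsum A (\<lambda>v. finsum A ?t {\<xi> \<in> I. src \<xi> = v}) (verts G)"
    unfolding one_sum by (rule finsum_cong') (use P_eq_sum_V[OF len] in \<open>auto intro!: finsum_closed\<close>)
  also have "\<dots> = finsum A ?t (\<Union>v\<in>verts G. {\<xi> \<in> I. src \<xi> = v})"
    by (subst add.finprod_UN_disjoint) (auto simp: pairwise_def disjnt_def)
  finally show ?thesis using U by simp
qed

lemma P_eq_sum: "v \<in> verts G ==> P v = finsum A (\<lambda>\<xi>. V \<xi> \<otimes> star A (V \<xi>)) {\<xi> \<in> I. src \<xi> = v}"
  by (rule P_eq_sum_V[where n = "Max (length ` I)"]) (auto intro: Max_ge)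

definition u :: 'a where
  "u = (if has_loop then S loop_arc \<otimes> V loop_rest else P r)"

text \<open>That u is unitary and not just an isometry rests on uniqueness: only one arc leaves the
  root and only one path returns from its head, so both sums for the projections have a single
  term.\<close>

lemma corner: "corner_unitary A nrm (P r) u"
proof (cases has_loop)
  case False
  then show ?thesis using root by unfold_locales (simp_all add: u_def P_star P_idem)
next
  case True
  note l = loop_arc[OF True] loop_rest[OF True]
  have Vc: "V loop_rest \<in> carrier A" "S loop_arc \<in> carrier A" using l by auto
  have u: "u = S loop_arc \<otimes> V loop_rest" using True by (simp add: u_def)
  have "P (head G loop_arc) = V loop_rest \<otimes> star A (V loop_rest)"
    using P_eq_sum[of "head G loop_arc"] l loop(2)[OF True] by simp
  then have uus: "u \<otimes> star A u = S loop_arc \<otimes> (P (head G loop_arc) \<otimes> star A (S loop_arc))"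
    unfolding u using Vc by (simp add: star_mult m_assoc)
  have "\<not> is_sink G r" using l by (auto simp: is_sink_def)
  then have "P r = S loop_arc \<otimes> star A (S loop_arc)"
    using P_sum[of r] root loop(1)[OF True] Vc by simp
  then have 1: "u \<otimes> star A u = P r" using uus l by (simp add: head_star_S)
  have 2: "star A u \<otimes> u = P r"
    using path_elem_isometry[of r "loop_arc # loop_rest" r] l awalk_src[OF l(3)] by (simp add: u awalk_simps)
  have 3: "P r \<otimes> u = u"
    unfolding u using P_S[OF l(1)] l Vc root by (simp flip: m_assoc)
  have 4: "u \<otimes> P r = u"
    unfolding u using path_elem_range[OF awalk_src[OF l(3)]] Vc root by (simp add: m_assoc)
  have "u \<in> carrier A" using Vc by (simp add: u)
  then show ?thesis using root 1 2 3 4 by unfold_locales (simp_all add: P_star P_idem)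
qed

sublocale corner_unitary A nrm "P r" u
  by (rule corner)

lemma V_P: "\<xi> \<in> I ==> V \<xi> \<otimes> P r = V \<xi>"
  by (rule path_elem_range[OF awalk_src])

text \<open>A letter lengthens or shortens a path, or kills it. An arc that leaves the root closes
  the loop and contributes u; its adjoint at the empty path opens the loop and contributes the
  inverse of u. Hence the span below is invariant under left multiplication.\<close>

lemma letter_V:
  assumes "\<xi> \<in> I"
  shows "v \<in> verts G ==> P v \<otimes> V \<xi> = \<zero> \<or> (\<exists>\<nu>\<in>I. \<exists>j. P v \<otimes> V \<xi> = V \<nu> \<otimes> upow j)"
    and "e \<in> arcs G ==> S e \<otimes> V \<xi> = \<zero> \<or> (\<exists>\<nu>\<in>I. \<exists>j. S e \<otimes> V \<xi> = V \<nu> \<otimes> upow j)"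
    and "e \<in> arcs G ==> star A (S e) \<otimes> V \<xi> = \<zero> \<or> (\<exists>\<nu>\<in>I. \<exists>j. star A (S e) \<otimes> V \<xi> = V \<nu> \<otimes> upow j)"
proof -
  have V0: "V \<nu> = V \<nu> \<otimes> upow 0" if "\<nu> \<in> I" for \<nu> using V_P[OF that] by (simp add: upow_0)
  show "P v \<otimes> V \<xi> = \<zero> \<or> (\<exists>\<nu>\<in>I. \<exists>j. P v \<otimes> V \<xi> = V \<nu> \<otimes> upow j)" if "v \<in> verts G"
    using P_V[OF that assms] V0[OF assms] assms by metis
  show "S e \<otimes> V \<xi> = \<zero> \<or> (\<exists>\<nu>\<in>I. \<exists>j. S e \<otimes> V \<xi> = V \<nu> \<otimes> upow j)" if e: "e \<in> arcs G"
  proof (cases "head G e = src \<xi>")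
    case False
    have "S e \<otimes> V \<xi> = S e \<otimes> (P (head G e) \<otimes> V \<xi>)" using e assms by (simp add: m_assoc[symmetric] S_head)
    also have "\<dots> = \<zero>" using P_V[of "head G e" \<xi>] e assms False by simp
    finally show ?thesis by simp
  next
    case True
    show ?thesis
    proof (cases "tail G e = r")
      case False
      then have "e # \<xi> \<in> I" using e assms True by (simp add: Cons_I)
      then show ?thesis using V0[of "e # \<xi>"] by (intro disjI2 bexI[of _ "e # \<xi>"] exI[of _ 0]) auto
    next
      case tr: True
      then have l: "has_loop" "e = loop_arc" using loop_arc_unique[OF e] by auto
      then have "\<xi> = loop_rest" using loop_rest_unique assms True by simp
      then have "S e \<otimes> V \<xi> = V [] \<otimes> upow 1" using l by (simp add: u_def[symmetric] upow_1 pu) (simp add: u_def)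
      then show ?thesis using Nil_I by blast
    qed
  qed
  show "star A (S e) \<otimes> V \<xi> = \<zero> \<or> (\<exists>\<nu>\<in>I. \<exists>j. star A (S e) \<otimes> V \<xi> = V \<nu> \<otimes> upow j)" if e: "e \<in> arcs G"
  proof (cases \<xi>)
    case Nil
    show ?thesis
    proof (cases "tail G e = r")
      case False
      have "star A (S e) \<otimes> P r = star A (S e) \<otimes> (P (tail G e) \<otimes> P r)"
        using e root by (simp add: m_assoc[symmetric] star_S_tail)
      also have "\<dots> = \<zero>" using e root False by (simp add: P_orth)
      finally show ?thesis by (simp add: Nil)
    next
      case True
      then have l: "has_loop" "e = loop_arc" using loop_arc_unique[OF e] by auto
      note lr = loop_rest[OF l(1)]
      have "V loop_rest \<otimes> star A (V loop_rest) = P (head G e)"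
        using P_eq_sum[of "head G e"] e lr loop(2)[OF l(1)] l by simp
      moreover have "star A u = star A (V loop_rest) \<otimes> star A (S e)"
        using l e lr by (simp add: u_def star_mult)
      then have "V loop_rest \<otimes> upow (- 1) = (V loop_rest \<otimes> star A (V loop_rest)) \<otimes> star A (S e)"
        using e lr by (simp only: upow_minus_1) (simp add: m_assoc)
      ultimately have "V loop_rest \<otimes> upow (- 1) = star A (S e)" using head_star_S[OF e] by simp
      moreover have "star A (S e) \<otimes> V \<xi> = star A (S e)"
        using star_S_tail[OF e] unfolding True by (simp add: Nil)
      ultimately show ?thesis using lr(1) by metis
    qed
  next
    case (Cons f \<nu>)
    then have f: "f \<in> arcs G" "\<nu> \<in> I" "src \<nu> = head G f" using assms by (auto simp: Cons_I)
    have "star A (S e) \<otimes> V \<xi> = (star A (S e) \<otimes> S f) \<otimes> V \<nu>"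
      using e f by (simp add: Cons m_assoc)
    also have "\<dots> = (if e = f then V \<nu> else \<zero>)"
      using e f P_V[of "head G f" \<nu>] by (simp add: S_star_S S_orth)
    finally show ?thesis using V0[OF f(2)] f(2) by metis
  qed
qed

text \<open>The element whose matrix with respect to the paths in \<open>I\<close> has Laurent
  polynomials in u as entries.\<close>

definition span_elem :: "('e list => 'e list => laurent) => 'a" where
  "span_elem F = finsum A (\<lambda>(\<xi>, \<nu>). V \<xi> \<otimes> fcalc (F \<xi> \<nu>) \<otimes> star A (V \<nu>)) (I \<times> I)"

lemma span_elem_closed [simp]: "span_elem F \<in> carrier A"
  unfolding span_elem_def by (rule finsum_closed) auto

lemma span_elem_add: "span_elem F \<oplus> span_elem H = span_elem (\<lambda>\<xi> \<nu>. F \<xi> \<nu> + H \<xi> \<nu>)"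
  unfolding span_elem_def
  by (subst finsum_addf[symmetric]) (auto simp: fcalc_add l_distr r_distr intro!: finsum_cong')

lemma span_elem_smult: "c \<odot> span_elem F = span_elem (\<lambda>\<xi> \<nu>. single 0 c * F \<xi> \<nu>)"
proof -
  have f: "fcalc (single 0 c * f) = c \<odot> fcalc f" for f
    using fcalc_mult[of "single 0 c" f] fcalc_mult[of 1 f] fcalc_single[of 0 1]
    by (simp add: fcalc_single smult_mult_l upow_0)
  show ?thesis unfolding span_elem_def
    by (subst smult_finsum) (auto simp: f smult_mult_l smult_mult_r intro!: finsum_cong')
qed

lemma span_elem_single:
  assumes "\<xi> \<in> I" "\<nu> \<in> I"
  shows "V \<xi> \<otimes> fcalc f \<otimes> star A (V \<nu>) = span_elem (\<lambda>\<alpha> \<beta>. if (\<xi>, \<nu>) = (\<alpha>, \<beta>) then f else 0)"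
proof -
  have z: "fcalc 0 = \<zero>" by (simp add: fcalc_def)
  have "span_elem (\<lambda>\<alpha> \<beta>. if (\<xi>, \<nu>) = (\<alpha>, \<beta>) then f else 0) =
    finsum A (\<lambda>x. if (\<xi>, \<nu>) = x then V (fst x) \<otimes> fcalc f \<otimes> star A (V (snd x)) else \<zero>) (I \<times> I)"
    unfolding span_elem_def by (rule finsum_cong') (auto simp: z split: if_split_asm)
  also have "\<dots> = V \<xi> \<otimes> fcalc f \<otimes> star A (V \<nu>)"
    by (subst finsum_singleton) (use assms in auto)
  finally show ?thesis by simp
qed

lemma span_elem_one: "\<one> = span_elem (\<lambda>\<xi> \<nu>. if \<xi> = \<nu> then 1 else 0)"
proof -
  have z: "fcalc 0 = \<zero>" by (simp add: fcalc_def)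
  have o: "fcalc 1 = P r" using fcalc_single[of 0 1] by (simp add: upow_0)
  let ?D = "(\<lambda>\<xi>. (\<xi>, \<xi>)) ` I"
  have "span_elem (\<lambda>\<xi> \<nu>. if \<xi> = \<nu> then 1 else 0) = finsum A (\<lambda>(\<xi>, \<nu>). V \<xi> \<otimes> P r \<otimes> star A (V \<nu>)) ?D"
    unfolding span_elem_def
    by (rule add.finprod_mono_neutral_cong_right) (auto simp: z o)
  also have "\<dots> = finsum A (\<lambda>\<xi>. V \<xi> \<otimes> star A (V \<xi>)) I"
    by (subst finsum_reindex) (auto simp: inj_on_def V_P intro!: finsum_cong')
  finally show ?thesis using one_eq_sum_V by simp
qed

lemma span_elem_left:
  assumes l: "l \<in> carrier A" and V: "!!\<xi>. \<xi> \<in> I ==> l \<otimes> V \<xi> = \<zero> \<or> (\<exists>\<nu>\<in>I. \<exists>j. l \<otimes> V \<xi> = V \<nu> \<otimes> upow j)"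
  shows "l \<otimes> span_elem F \<in> range span_elem"
proof -
  have zero: "\<zero> \<in> range span_elem"
  proof -
    have "\<zero> = 0 \<odot> span_elem F" by simp
    then show ?thesis unfolding span_elem_smult by blast
  qed
  have sums: "finsum A t J \<in> range span_elem" if "finite J" "!!x. x \<in> J ==> t x \<in> range span_elem" for t and J :: "('e list \<times> 'e list) set"
    using that
  proof (induct J rule: finite_induct)
    case (insert x J)
    have c: "range span_elem \<subseteq> carrier A" by auto
    obtain H where H: "t x = span_elem H" using insert(4)[of x] by blast
    have "finsum A t J \<in> range span_elem" using insert by blast
    then obtain H' where H': "finsum A t J = span_elem H'" by blast
    have "t \<in> J \<rightarrow> carrier A" "t x \<in> carrier A" using insert(4) c by blast+
    then have "finsum A t (insert x J) = t x \<oplus> finsum A t J" using insert by (intro finsum_insert) auto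
    then show ?case unfolding H H' span_elem_add by blast
  qed (use zero in simp)
  have "l \<otimes> span_elem F = finsum A (\<lambda>x. l \<otimes> (case x of (\<xi>, \<nu>) => V \<xi> \<otimes> fcalc (F \<xi> \<nu>) \<otimes> star A (V \<nu>))) (I \<times> I)"
    unfolding span_elem_def using l by (intro finsum_rdistr) auto
  also have "\<dots> \<in> range span_elem"
  proof (rule sums)
    fix x assume "x \<in> I \<times> I"
    then obtain \<xi> \<nu> where x: "x = (\<xi>, \<nu>)" "\<xi> \<in> I" "\<nu> \<in> I" by auto
    have e: "l \<otimes> (V \<xi> \<otimes> fcalc (F \<xi> \<nu>) \<otimes> star A (V \<nu>)) = (l \<otimes> V \<xi>) \<otimes> fcalc (F \<xi> \<nu>) \<otimes> star A (V \<nu>)"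
      using x l by (simp add: m_assoc)
    show "l \<otimes> (case x of (\<xi>, \<nu>) => V \<xi> \<otimes> fcalc (F \<xi> \<nu>) \<otimes> star A (V \<nu>)) \<in> range span_elem"
    proof (cases "l \<otimes> V \<xi> = \<zero>")
      case True
      then show ?thesis using e x zero by simp
    next
      case False
      then obtain \<kappa> j where k: "\<kappa> \<in> I" "l \<otimes> V \<xi> = V \<kappa> \<otimes> upow j" using V[OF x(2)] by blast
      have "fcalc (single j 1 * F \<xi> \<nu>) = upow j \<otimes> fcalc (F \<xi> \<nu>)"
        by (simp add: fcalc_mult fcalc_single)
      then have "l \<otimes> (V \<xi> \<otimes> fcalc (F \<xi> \<nu>) \<otimes> star A (V \<nu>)) = V \<kappa> \<otimes> fcalc (single j 1 * F \<xi> \<nu>) \<otimes> star A (V \<nu>)"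
        unfolding e k(2) using k x by (simp add: m_assoc)
      then show ?thesis using x span_elem_single[OF k(1) x(3)] by auto
    qed
  qed auto
  finally show ?thesis .
qed

lemma span_dense:
  assumes "a \<in> carrier A" shows "\<exists>F. conv (\<lambda>n. span_elem (F n)) a"
proof -
  have "\<exists>x. (\<forall>n. x n \<in> range span_elem) \<and> conv x a"
  proof (rule dense[OF assms])
    show "\<one> \<in> range span_elem" using span_elem_one by blast
    fix x y c v e assume "x \<in> range span_elem"
    then obtain F where F: "x = span_elem F" by blast
    show "c \<odot> x \<in> range span_elem" unfolding F span_elem_smult by blast
    show "P v \<otimes> x \<in> range span_elem" if "v \<in> verts G"
      unfolding F by (rule span_elem_left) (use that letter_V in auto)
    show "S e \<otimes> x \<in> range span_elem" if "e \<in> arcs G"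
      unfolding F by (rule span_elem_left) (use that letter_V in auto)
    show "star A (S e) \<otimes> x \<in> range span_elem" if "e \<in> arcs G"
      unfolding F by (rule span_elem_left) (use that letter_V in auto)
    assume "y \<in> range span_elem"
    then obtain H where H: "y = span_elem H" by blast
    show "x \<oplus> y \<in> range span_elem" unfolding F H span_elem_add by blast
  qed auto
  then obtain x where x: "!!n. x n \<in> range span_elem" "conv x a" by blast
  define F where "F n = (SOME F. x n = span_elem F)" for n
  have "x n = span_elem (F n)" for n
    unfolding F_def by (rule someI_ex[of "\<lambda>F. x n = span_elem F"]) (use x(1)[of n] in blast)
  then have "x = (\<lambda>n. span_elem (F n))" by auto
  then show ?thesis using x(2) by blast
qed

text \<open>At a sink every power of u is \<open>P r\<close>, so \<open>fcalc f\<close> is the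
  multiple of \<open>P r\<close> by the value of f at 1.\<close>

lemma nrm_fcalc_K:
  assumes "!!z. z \<in> K ==> cmod (leval f z) \<le> B"
  shows "nrm (fcalc f) \<le> B"
proof (cases has_loop)
  case True
  then show ?thesis using assms by (intro nrm_fcalc) (auto simp: K_def)
next
  case False
  then have u: "u = P r" by (simp add: u_def)
  have "upow k = P r" for k
  proof -
    have "((\<lambda>a. P r \<otimes> a) ^^ n) (P r) = P r" for n by (induct n) (use p_idem in auto)
    then show ?thesis by (subst upow_def) (simp add: u p_star)
  qed
  then have "fcalc f = leval f 1 \<odot> P r"
    by (induct f rule: poly_mapping_single_induct)
      (simp_all add: fcalc_single leval_single fcalc_add leval_add smult_l_distr)
  then have "nrm (fcalc f) = cmod (leval f 1) * nrm (P r)" by (simp add: nrm_smult)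
  also have "\<dots> \<le> cmod (leval f 1)" using nrm_upow[of 0] by (intro mult_left_le) (auto simp: upow_0)
  also have "\<dots> \<le> B" using assms False by (simp add: K_def)
  finally show ?thesis .
qed

text \<open>The triangle inequality over all entries. A factor that depends only on the size of the
  matrix is good enough, since the bound is used only for convergence and for vanishing.\<close>

lemma nrm_span_elem:
  assumes "!!\<xi> \<nu> z. \<xi> \<in> I ==> \<nu> \<in> I ==> z \<in> K ==> cmod (leval (F \<xi> \<nu>) z) \<le> B"
  shows "nrm (span_elem F) \<le> real (card I * card I) * B"
proof -
  have t: "nrm (V \<xi> \<otimes> fcalc (F \<xi> \<nu>) \<otimes> star A (V \<nu>)) \<le> B" if m: "\<xi> \<in> I" "\<nu> \<in> I" for \<xi> \<nu>
  proof -
    have f: "nrm (fcalc (F \<xi> \<nu>)) \<le> B" using assms[OF m] by (rule nrm_fcalc_K)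
    have "nrm (V \<xi> \<otimes> fcalc (F \<xi> \<nu>) \<otimes> star A (V \<nu>)) \<le> nrm (V \<xi>) * nrm (fcalc (F \<xi> \<nu>)) * nrm (V \<nu>)"
      using m nrm_mult[of "V \<xi> \<otimes> fcalc (F \<xi> \<nu>)" "star A (V \<nu>)"] nrm_mult[of "V \<xi>" "fcalc (F \<xi> \<nu>)"] nrm_nonneg[of "V \<nu>"]
      by (simp add: nrm_star) (meson mult_right_mono order_trans)
    also have "\<dots> \<le> 1 * nrm (fcalc (F \<xi> \<nu>)) * 1"
      using m nrm_path_elem[OF awalk_src] by (intro mult_mono mult_nonneg_nonneg) (auto simp: nrm_nonneg)
    finally show ?thesis using f by simp
  qed
  have "nrm (span_elem F) \<le> (\<Sum>x\<in>I \<times> I. nrm (case x of (\<xi>, \<nu>) => V \<xi> \<otimes> fcalc (F \<xi> \<nu>) \<otimes> star A (V \<nu>)))"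
    unfolding span_elem_def by (rule nrm_finsum) auto
  also have "\<dots> \<le> (\<Sum>x\<in>I \<times> I. B)" by (intro sum_mono) (auto simp: t)
  finally show ?thesis by (simp add: card_cartesian_product)
qed

end

lemma nonneg_Reals_sum: "(!!i. i \<in> J ==> f i \<in> \<real>\<^sub>\<ge>\<^sub>0) ==> sum f J \<in> (\<real>\<^sub>\<ge>\<^sub>0 :: complex set)"
  by (induct J rule: infinite_finite_induct) (auto simp: complex_nonneg_Reals_iff)

lemma cmatrix_unary_ops:
  assumes "M \<in> carrier_mat n n"
  shows "c \<odot>\<^bsub>cmatrix n\<^esub> M = c \<cdot>\<^sub>m M" "star (cmatrix n) M = adj_mat M"
  by (rule cmatrix_ops[OF assms assms])+

section \<open>Representations by evaluation at the points of the spectrum\<close>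

context rooted_digraph
begin

lemma rooted_graph_algebra_cstar:
  "rooted_graph_algebra G r Cstar graph.unorm (P_elem G) (S_elem G)"
proof -
  interpret graph_algebra G "Cstar" graph.unorm "P_elem G" "S_elem G"
    by (rule graph_algebra_graph_cstar)
  show ?thesis by unfold_locales
qed

sublocale alg: rooted_graph_algebra G r "Cstar" graph.unorm "P_elem G" "S_elem G"
  by (rule rooted_graph_algebra_cstar)

abbreviation "n \<equiv> card I"

sublocale M: cstar_algebra "cmatrix n" "op_norm n"
  by (rule cmatrix_cstar_algebra)

sublocale pair: cstar_algebra_pair "Cstar" graph.unorm "cmatrix n" "op_norm n" ..

text \<open>Matrices have numerical indices, so the paths are enumerated in some order;
  \<open>matI\<close> keeps the order out of the calculations.\<close>

definition ix :: "nat => 'e list" where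
  "ix = (SOME b. bij_betw b {..<n} I)"

lemma ix: "bij_betw ix {..<n} I"
  unfolding ix_def by (rule someI_ex[of "\<lambda>b. bij_betw b {..<n} I"]) (use ex_bij_betw_nat_finite[OF finite_I] in \<open>simp add: lessThan_atLeast0\<close>)

lemma ix_I [simp]: "i < n ==> ix i \<in> I"
  using ix by (auto simp: bij_betw_def)

lemma ix_eq [simp]: "i < n ==> j < n ==> ix i = ix j \<longleftrightarrow> i = j"
  using ix by (auto simp: bij_betw_def inj_on_def)

lemma ix_surj: assumes "\<xi> \<in> I" obtains i where "i < n" "\<xi> = ix i"
proof -
  have "\<xi> \<in> ix ` {..<n}" using ix assms by (simp add: bij_betw_def)
  then show ?thesis using that by blast
qed

lemma sum_ix: "(\<Sum>i<n. f (ix i)) = (\<Sum>\<xi>\<in>I. f \<xi>)"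
  by (rule sum.reindex_bij_betw[OF ix])

definition matI :: "('e list => 'e list => complex) => complex mat" where
  "matI F = mat n n (\<lambda>(i, j). F (ix i) (ix j))"

lemma matI_carrier [simp]: "matI F \<in> carrier (cmatrix n)" "matI F \<in> carrier_mat n n"
  by (simp_all add: matI_def cmatrix_carrier)

lemma matI_eqI: "(!!\<xi> \<nu>. \<xi> \<in> I ==> \<nu> \<in> I ==> F \<xi> \<nu> = H \<xi> \<nu>) ==> matI F = matI H"
  by (auto simp: matI_def intro!: eq_matI)

lemma matI_mult: "matI F \<otimes>\<^bsub>cmatrix n\<^esub> matI H = matI (\<lambda>\<xi> \<nu>. \<Sum>\<kappa>\<in>I. F \<xi> \<kappa> * H \<kappa> \<nu>)"
  unfolding cmatrix_ops[OF matI_carrier(2) matI_carrier(2)]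
  by (rule eq_matI) (auto simp: matI_def scalar_prod_def sum_ix[symmetric] lessThan_atLeast0)

lemma matI_add: "matI F \<oplus>\<^bsub>cmatrix n\<^esub> matI H = matI (\<lambda>\<xi> \<nu>. F \<xi> \<nu> + H \<xi> \<nu>)"
  unfolding cmatrix_ops[OF matI_carrier(2) matI_carrier(2)] by (rule eq_matI) (auto simp: matI_def)

lemma matI_smult: "c \<odot>\<^bsub>cmatrix n\<^esub> matI F = matI (\<lambda>\<xi> \<nu>. c * F \<xi> \<nu>)"
  unfolding cmatrix_ops[OF matI_carrier(2) matI_carrier(2)] by (rule eq_matI) (auto simp: matI_def)

lemma matI_star: "star (cmatrix n) (matI F) = matI (\<lambda>\<xi> \<nu>. cnj (F \<nu> \<xi>))"
  unfolding cmatrix_ops[OF matI_carrier(2) matI_carrier(2)] by (rule eq_matI) (auto simp: matI_def adj_mat_def)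

lemma matI_zero: "\<zero>\<^bsub>cmatrix n\<^esub> = matI (\<lambda>\<xi> \<nu>. 0)"
  unfolding cmatrix_consts by (rule eq_matI) (auto simp: matI_def)

lemma matI_finsum: "finite J ==> finsum (cmatrix n) (\<lambda>x. matI (F x)) J = matI (\<lambda>\<xi> \<nu>. \<Sum>x\<in>J. F x \<xi> \<nu>)"
  by (induct J rule: finite_induct) (simp_all add: matI_zero matI_add)

definition unit_mat :: "'e list => 'e list => complex => complex mat" where
  "unit_mat \<xi> \<nu> c = matI (\<lambda>\<alpha> \<beta>. if \<alpha> = \<xi> \<and> \<beta> = \<nu> then c else 0)"

lemma unit_mat_carrier [simp]: "unit_mat \<xi> \<nu> c \<in> carrier (cmatrix n)"
  by (simp add: unit_mat_def)

lemma unit_mat_mult: "\<nu> \<in> I ==> unit_mat \<xi> \<nu> c \<otimes>\<^bsub>cmatrix n\<^esub> unit_mat \<nu> \<kappa> d = unit_mat \<xi> \<kappa> (c * d)"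
proof -
  assume n: "\<nu> \<in> I"
  have "(\<Sum>\<gamma>\<in>I. (if \<alpha> = \<xi> \<and> \<gamma> = \<nu> then c else 0) * (if \<gamma> = \<nu> \<and> \<beta> = \<kappa> then d else 0)) =
    (if \<alpha> = \<xi> \<and> \<beta> = \<kappa> then c * d else 0)" for \<alpha> \<beta>
  proof -
    have "(\<Sum>\<gamma>\<in>I. (if \<alpha> = \<xi> \<and> \<gamma> = \<nu> then c else 0) * (if \<gamma> = \<nu> \<and> \<beta> = \<kappa> then d else 0)) =
      (\<Sum>\<gamma>\<in>I. if \<gamma> = \<nu> then (if \<alpha> = \<xi> \<and> \<beta> = \<kappa> then c * d else 0) else 0)"
      by (rule sum.cong) auto
    then show ?thesis using n by simp
  qed
  then show ?thesis unfolding unit_mat_def matI_mult by simp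
qed

lemma unit_mat_star: "star (cmatrix n) (unit_mat \<xi> \<nu> c) = unit_mat \<nu> \<xi> (cnj c)"
  unfolding unit_mat_def matI_star by (rule matI_eqI) auto

definition vertex_mat :: "'v => 'e list => 'e list => complex" where
  "vertex_mat v \<xi> \<nu> = (if \<xi> = \<nu> \<and> src \<xi> = v then 1 else 0)"

text \<open>An arc acts on the space with basis \<open>I\<close> by prepending itself to the paths
  that start at its head. At the root the result would revisit r, so it is identified with the empty
  path and weighted by z.\<close>

definition edge_mat :: "complex => 'e => 'e list => 'e list => complex" where
  "edge_mat z e \<xi> \<nu> = (if head G e = src \<nu> \<and> \<xi> = (if tail G e = r then [] else e # \<nu>)
     then (if tail G e = r then z else 1) else 0)"

text \<open>Prepending an arc is injective on the paths from its head. For the arc at the root,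
  which sends all of them to the empty path, this is so because there is only one.\<close>

lemma edge_mat_star_mult:
  assumes z: "cmod z = 1" and e: "e \<in> arcs G" and i: "\<xi> \<in> I" "\<nu> \<in> I"
  shows "(\<Sum>\<kappa>\<in>I. cnj (edge_mat z e \<kappa> \<xi>) * edge_mat z e \<kappa> \<nu>) = vertex_mat (head G e) \<xi> \<nu>"
proof (cases "tail G e = r")
  case True
  have l: "has_loop" "e = loop_arc" using loop_arc_unique[OF e True] by auto
  have "(\<Sum>\<kappa>\<in>I. cnj (edge_mat z e \<kappa> \<xi>) * edge_mat z e \<kappa> \<nu>) =
    (\<Sum>\<kappa>\<in>I. if \<kappa> = [] then (if head G e = src \<xi> \<and> head G e = src \<nu> then 1 else 0) else 0)"
    using True z by (intro sum.cong) (auto simp: edge_mat_def mult.commute simp flip: complex_norm_square)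
  also have "\<dots> = (if head G e = src \<xi> \<and> head G e = src \<nu> then 1 else 0)" by simp
  also have "\<dots> = vertex_mat (head G e) \<xi> \<nu>"
  proof -
    have u: "head G e = src \<kappa> \<longleftrightarrow> \<kappa> = loop_rest" "src \<kappa> = head G e \<longleftrightarrow> \<kappa> = loop_rest" if "\<kappa> \<in> I" for \<kappa>
      using loop_rest_unique[OF l(1) that] loop_rest[OF l(1)] l by metis+
    show ?thesis unfolding vertex_mat_def u(1)[OF i(1)] u(1)[OF i(2)] u(2)[OF i(1)] by auto
  qed
  finally show ?thesis .
next
  case False
  have "(\<Sum>\<kappa>\<in>I. cnj (edge_mat z e \<kappa> \<xi>) * edge_mat z e \<kappa> \<nu>) =
    (\<Sum>\<kappa>\<in>I. if \<kappa> = e # \<xi> then vertex_mat (head G e) \<xi> \<nu> else 0)"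
    using False by (intro sum.cong) (auto simp: edge_mat_def vertex_mat_def)
  also have "\<dots> = (if e # \<xi> \<in> I then vertex_mat (head G e) \<xi> \<nu> else 0)" by simp
  also have "\<dots> = vertex_mat (head G e) \<xi> \<nu>" using e i False by (auto simp: vertex_mat_def Cons_I)
  finally show ?thesis .
qed

text \<open>The projection onto the paths beginning with e, or onto the empty path if e leaves the
  root; summed over the arcs at v these exhaust the paths from v.\<close>

lemma edge_mat_mult_star:
  assumes z: "cmod z = 1" and e: "e \<in> arcs G" and i: "\<xi> \<in> I" "\<nu> \<in> I"
  shows "(\<Sum>\<kappa>\<in>I. edge_mat z e \<xi> \<kappa> * cnj (edge_mat z e \<nu> \<kappa>)) =
    (if \<xi> = \<nu> \<and> (if tail G e = r then \<xi> = [] else \<xi> \<noteq> [] \<and> hd \<xi> = e) then 1 else 0)"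
proof (cases "tail G e = r")
  case True
  have l: "has_loop" "e = loop_arc" using loop_arc_unique[OF e True] by auto
  have u: "head G e = src \<kappa> \<longleftrightarrow> \<kappa> = loop_rest" if "\<kappa> \<in> I" for \<kappa>
    using loop_rest_unique[OF l(1) that] loop_rest[OF l(1)] l by metis
  have "(\<Sum>\<kappa>\<in>I. edge_mat z e \<xi> \<kappa> * cnj (edge_mat z e \<nu> \<kappa>)) =
    (\<Sum>\<kappa>\<in>I. if \<kappa> = loop_rest then (if \<xi> = [] \<and> \<nu> = [] then 1 else 0) else 0)"
    using True z by (intro sum.cong) (auto simp: edge_mat_def u simp flip: complex_norm_square)
  then show ?thesis using loop_rest[OF l(1)] True by auto
next
  case False
  have "(\<Sum>\<kappa>\<in>I. edge_mat z e \<xi> \<kappa> * cnj (edge_mat z e \<nu> \<kappa>)) =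
    (\<Sum>\<kappa>\<in>I. if \<kappa> = tl \<xi> then (if \<xi> = \<nu> \<and> \<xi> \<noteq> [] \<and> hd \<xi> = e then 1 else 0) else 0)"
    using False i by (intro sum.cong) (cases \<xi>; auto simp: edge_mat_def Cons_I)+
  also have "\<dots> = (if tl \<xi> \<in> I then (if \<xi> = \<nu> \<and> \<xi> \<noteq> [] \<and> hd \<xi> = e then 1 else 0) else 0)" by simp
  also have "\<dots> = (if \<xi> = \<nu> \<and> \<xi> \<noteq> [] \<and> hd \<xi> = e then 1 else 0)"
    using i by (cases \<xi>) (auto simp: Cons_I)
  finally show ?thesis using False by simp
qed

lemma vertex_mat_sum:
  assumes z: "cmod z = 1" and v: "v \<in> verts G" "\<not> is_sink G v" and i: "\<xi> \<in> I" "\<nu> \<in> I"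
  shows "(\<Sum>e\<in>{e \<in> arcs G. tail G e = v}. \<Sum>\<kappa>\<in>I. edge_mat z e \<xi> \<kappa> * cnj (edge_mat z e \<nu> \<kappa>)) = vertex_mat v \<xi> \<nu>"
proof (cases "v = r")
  case True
  then have l: has_loop using v by (auto simp: has_loop_def is_sink_def)
  have "(\<Sum>e\<in>{e \<in> arcs G. tail G e = v}. \<Sum>\<kappa>\<in>I. edge_mat z e \<xi> \<kappa> * cnj (edge_mat z e \<nu> \<kappa>)) =
    (if \<xi> = \<nu> \<and> \<xi> = [] then 1 else 0)"
    unfolding True loop(1)[OF l] using edge_mat_mult_star[OF z loop_arc(1)[OF l] i] loop_arc(2)[OF l] by simp
  then show ?thesis using src_root[OF i(1)] True by (auto simp: vertex_mat_def)
next
  case False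
  have "(\<Sum>e\<in>{e \<in> arcs G. tail G e = v}. \<Sum>\<kappa>\<in>I. edge_mat z e \<xi> \<kappa> * cnj (edge_mat z e \<nu> \<kappa>)) =
    (\<Sum>e\<in>{e \<in> arcs G. tail G e = v}. if e = hd \<xi> then (if \<xi> = \<nu> \<and> \<xi> \<noteq> [] then 1 else 0) else 0)"
    using False by (intro sum.cong) (auto simp: edge_mat_mult_star[OF z _ i])
  also have "\<dots> = (if hd \<xi> \<in> {e \<in> arcs G. tail G e = v} then (if \<xi> = \<nu> \<and> \<xi> \<noteq> [] then 1 else 0) else 0)" by simp
  also have "\<dots> = vertex_mat v \<xi> \<nu>"
    using i False by (cases \<xi>) (auto simp: vertex_mat_def Cons_I)
  finally show ?thesis .
qed

lemma rep_exists:
  assumes z: "cmod z = 1"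
  shows "\<exists>\<phi>\<in>star_hom Cstar (cmatrix n). (\<forall>v\<in>verts G. \<phi> (P_elem G v) = matI (vertex_mat v)) \<and>
    (\<forall>e\<in>arcs G. \<phi> (S_elem G e) = matI (edge_mat z e))"
proof -
  have SP: "matI (edge_mat z e) \<otimes>\<^bsub>cmatrix n\<^esub> matI (vertex_mat (head G e)) = matI (edge_mat z e)" for e
    unfolding matI_mult
  proof (rule matI_eqI)
    fix \<xi> \<nu> assume i: "\<xi> \<in> I" "\<nu> \<in> I"
    have "(\<Sum>\<kappa>\<in>I. edge_mat z e \<xi> \<kappa> * vertex_mat (head G e) \<kappa> \<nu>) = (\<Sum>\<kappa>\<in>I. if \<kappa> = \<nu> then edge_mat z e \<xi> \<nu> else 0)"
      by (rule sum.cong) (auto simp: vertex_mat_def edge_mat_def)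
    then show "(\<Sum>\<kappa>\<in>I. edge_mat z e \<xi> \<kappa> * vertex_mat (head G e) \<kappa> \<nu>) = edge_mat z e \<xi> \<nu>" using i by simp
  qed
  have PP: "matI (vertex_mat v) \<otimes>\<^bsub>cmatrix n\<^esub> matI (vertex_mat w) = (if v = w then matI (vertex_mat v) else \<zero>\<^bsub>cmatrix n\<^esub>)" for v w
    unfolding matI_mult matI_zero by (auto simp: vertex_mat_def if_distrib[of "\<lambda>x. x * _"] cong: if_cong intro!: matI_eqI sum.neutral)
  show ?thesis
  proof (rule graph_hom_exists[OF cmatrix_cstar_algebra, of "\<lambda>v. matI (vertex_mat v)" n "\<lambda>e. matI (edge_mat z e)"])
    show "star (cmatrix n) (matI (vertex_mat v)) = matI (vertex_mat v)" for v
      unfolding matI_star by (rule matI_eqI) (auto simp: vertex_mat_def)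
    show "star (cmatrix n) (matI (edge_mat z e)) \<otimes>\<^bsub>cmatrix n\<^esub> matI (edge_mat z e) = matI (vertex_mat (head G e))"
      if "e \<in> arcs G" for e
      unfolding matI_star matI_mult by (rule matI_eqI) (rule edge_mat_star_mult[OF z that])
    show "matI (vertex_mat v) = finsum (cmatrix n) (\<lambda>e. matI (edge_mat z e) \<otimes>\<^bsub>cmatrix n\<^esub> star (cmatrix n) (matI (edge_mat z e)))
        {e \<in> arcs G. tail G e = v}" if "v \<in> verts G" "\<not> is_sink G v" for v
      unfolding matI_star matI_mult matI_finsum[OF out_finite] by (rule matI_eqI) (rule vertex_mat_sum[OF z that, symmetric])
  qed (use SP PP in auto)
qed

definition rep :: "complex => ('v, 'e) graph_elem => complex mat" where
  "rep z = (SOME \<phi>. \<phi> \<in> star_hom Cstar (cmatrix n) \<and> (\<forall>v\<in>verts G. \<phi> (P_elem G v) = matI (vertex_mat v)) \<and>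
    (\<forall>e\<in>arcs G. \<phi> (S_elem G e) = matI (edge_mat z e)))"

context
  fixes z assumes z: "z \<in> K"
begin

lemma rep: "rep z \<in> star_hom Cstar (cmatrix n)"
  "v \<in> verts G ==> rep z (P_elem G v) = matI (vertex_mat v)"
  "e \<in> arcs G ==> rep z (S_elem G e) = matI (edge_mat z e)"
proof -
  have "\<exists>\<phi>. \<phi> \<in> star_hom Cstar (cmatrix n) \<and> (\<forall>v\<in>verts G. \<phi> (P_elem G v) = matI (vertex_mat v)) \<and>
    (\<forall>e\<in>arcs G. \<phi> (S_elem G e) = matI (edge_mat z e))"
    using rep_exists[OF K_unit[OF z]] by blast
  from someI_ex[OF this]
  have "rep z \<in> star_hom Cstar (cmatrix n) \<and> (\<forall>v\<in>verts G. rep z (P_elem G v) = matI (vertex_mat v)) \<and>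
    (\<forall>e\<in>arcs G. rep z (S_elem G e) = matI (edge_mat z e))"
    unfolding rep_def .
  then show "rep z \<in> star_hom Cstar (cmatrix n)"
  "v \<in> verts G ==> rep z (P_elem G v) = matI (vertex_mat v)"
  "e \<in> arcs G ==> rep z (S_elem G e) = matI (edge_mat z e)" by blast+
qed

lemmas rep_hom = pair.hom_closed[OF rep(1)] pair.hom_add[OF rep(1)] pair.hom_mult[OF rep(1)]
  pair.hom_smult[OF rep(1)] pair.hom_star[OF rep(1)] pair.hom_diff[OF rep(1)] pair.hom_finsum[OF rep(1)]

lemma rep_P_root: "rep z (P_elem G r) = unit_mat [] [] 1"
  unfolding rep(2)[OF root] unit_mat_def by (rule matI_eqI) (auto simp: vertex_mat_def src_root)

lemma rep_V: "\<xi> \<in> I ==> rep z (alg.V \<xi>) = unit_mat \<xi> [] 1"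
proof (induct \<xi>)
  case Nil
  then show ?case by (simp add: rep_P_root)
next
  case (Cons e \<xi>)
  then have e: "e \<in> arcs G" "tail G e \<noteq> r" "\<xi> \<in> I" "src \<xi> = head G e" by (auto simp: Cons_I)
  have "rep z (alg.V (e # \<xi>)) = matI (edge_mat z e) \<otimes>\<^bsub>cmatrix n\<^esub> unit_mat \<xi> [] 1"
    using e Cons(1) by (simp add: rep_hom rep)
  also have "\<dots> = unit_mat (e # \<xi>) [] 1"
    unfolding unit_mat_def matI_mult
  proof (rule matI_eqI)
    fix \<alpha> \<beta>
    have "(\<Sum>\<kappa>\<in>I. edge_mat z e \<alpha> \<kappa> * (if \<kappa> = \<xi> \<and> \<beta> = [] then 1 else 0)) =
      (\<Sum>\<kappa>\<in>I. if \<kappa> = \<xi> then (if \<beta> = [] then edge_mat z e \<alpha> \<xi> else 0) else 0)"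
      by (rule sum.cong) auto
    then show "(\<Sum>\<kappa>\<in>I. edge_mat z e \<alpha> \<kappa> * (if \<kappa> = \<xi> \<and> \<beta> = [] then 1 else 0)) = (if \<alpha> = e # \<xi> \<and> \<beta> = [] then 1 else 0)"
      using e by (simp add: edge_mat_def)
  qed
  finally show ?case .
qed

lemma rep_u: "rep z alg.u = unit_mat [] [] z"
proof (cases has_loop)
  case True
  note l = loop_arc[OF True] loop_rest[OF True]
  have "rep z alg.u = matI (edge_mat z loop_arc) \<otimes>\<^bsub>cmatrix n\<^esub> unit_mat loop_rest [] 1"
    using l True by (simp add: alg.u_def rep_hom rep rep_V)
  also have "\<dots> = unit_mat [] [] z"
    unfolding unit_mat_def matI_mult
  proof (rule matI_eqI)
    fix \<alpha> \<beta>
    have "(\<Sum>\<kappa>\<in>I. edge_mat z loop_arc \<alpha> \<kappa> * (if \<kappa> = loop_rest \<and> \<beta> = [] then 1 else 0)) =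
      (\<Sum>\<kappa>\<in>I. if \<kappa> = loop_rest then (if \<beta> = [] then edge_mat z loop_arc \<alpha> loop_rest else 0) else 0)"
      by (rule sum.cong) auto
    then show "(\<Sum>\<kappa>\<in>I. edge_mat z loop_arc \<alpha> \<kappa> * (if \<kappa> = loop_rest \<and> \<beta> = [] then 1 else 0)) = (if \<alpha> = [] \<and> \<beta> = [] then z else 0)"
      using l by (simp add: edge_mat_def)
  qed
  finally show ?thesis .
next
  case False
  then show ?thesis using z rep_P_root by (simp add: alg.u_def K_def)
qed

lemma rep_upow: "rep z (alg.upow k) = unit_mat [] [] (z powi k)"
proof -
  have z0: "z \<noteq> 0" and zc: "inverse z = cnj z" using K_unit[OF z] inverse_eq_cnj by auto
  show ?thesis
  proof (induct k rule: int_induct[where k = 0])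
    case base
    then show ?case by (simp add: alg.upow_0 rep_P_root)
  next
    case (step1 i)
    then show ?case using z0 by (simp add: alg.upow_Suc rep_hom rep_u unit_mat_mult power_int_add mult.commute)
  next
    case (step2 i)
    then show ?case using z0
      by (simp add: alg.upow_pred rep_hom rep_u unit_mat_star unit_mat_mult power_int_diff zc[symmetric] field_simps)
  qed
qed

lemma rep_fcalc: "rep z (alg.fcalc f) = unit_mat [] [] (leval f z)"
proof (induct f rule: poly_mapping_single_induct)
  case (1 k c)
  show ?case
    by (simp add: alg.fcalc_single rep_hom rep_upow leval_single) (auto simp: unit_mat_def matI_smult intro!: matI_eqI)
next
  case (2 f h)
  then show ?case
    by (simp add: alg.fcalc_add rep_hom leval_add) (auto simp: unit_mat_def matI_add intro!: matI_eqI)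
qed

text \<open>On the dense span \<open>rep z\<close> is evaluation of the entries at z; every
  statement about \<open>rep\<close> is obtained from here by a limit.\<close>

lemma rep_span: "rep z (alg.span_elem F) = matI (\<lambda>\<xi> \<nu>. leval (F \<xi> \<nu>) z)"
proof -
  let ?t = "\<lambda>x \<alpha> \<beta>. if \<alpha> = fst x \<and> \<beta> = snd x then leval (F (fst x) (snd x)) z else 0"
  have t: "rep z (alg.V \<xi> \<otimes>\<^bsub>Cstar\<^esub> alg.fcalc f \<otimes>\<^bsub>Cstar\<^esub> star Cstar (alg.V \<nu>)) = unit_mat \<xi> \<nu> (leval f z)"
    if "\<xi> \<in> I" "\<nu> \<in> I" for \<xi> \<nu> f
    using that by (simp add: rep_hom rep_V rep_fcalc unit_mat_star unit_mat_mult)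
  have "rep z (alg.span_elem F) = finsum (cmatrix n) (\<lambda>x. rep z (case x of (\<xi>, \<nu>) =>
      alg.V \<xi> \<otimes>\<^bsub>Cstar\<^esub> alg.fcalc (F \<xi> \<nu>) \<otimes>\<^bsub>Cstar\<^esub> star Cstar (alg.V \<nu>))) (I \<times> I)"
    unfolding alg.span_elem_def by (rule rep_hom) auto
  also have "\<dots> = finsum (cmatrix n) (\<lambda>x. matI (?t x)) (I \<times> I)"
    by (rule M.finsum_cong') (auto simp: t unit_mat_def intro!: matI_eqI)
  also have "\<dots> = matI (\<lambda>\<xi> \<nu>. leval (F \<xi> \<nu>) z)"
    unfolding matI_finsum[OF finite_cartesian_product[OF finite_I finite_I]]
  proof (rule matI_eqI)
    fix \<xi> \<nu> assume i: "\<xi> \<in> I" "\<nu> \<in> I"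
    have "(\<Sum>x\<in>I \<times> I. ?t x \<xi> \<nu>) = (\<Sum>x\<in>I \<times> I. if x = (\<xi>, \<nu>) then leval (F \<xi> \<nu>) z else 0)"
      by (rule sum.cong) auto
    then show "(\<Sum>x\<in>I \<times> I. ?t x \<xi> \<nu>) = leval (F \<xi> \<nu>) z" using i by simp
  qed
  finally show ?thesis .
qed

lemma rep_carrier: "a \<in> carrier Cstar ==> rep z a \<in> carrier_mat n n"
  using rep_hom(1) by (simp add: cmatrix_carrier)

lemma rep_dim:
  "a \<in> carrier Cstar ==> dim_row (rep z a) = n"
  "a \<in> carrier Cstar ==> dim_col (rep z a) = n"
  using carrier_matD[OF rep_carrier] by blast+

lemma rep_entry_bound:
  "a \<in> carrier Cstar ==> i < n ==> j < n ==> cmod (rep z a $$ (i, j)) \<le> graph.unorm a"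
  using entry_le_op_norm pair.hom_contractive[OF rep(1)] order_trans by blast

lemma rep_diff_entry:
  assumes "a \<in> carrier Cstar" "b \<in> carrier Cstar" "i < n" "j < n"
  shows "rep z (a \<ominus>\<^bsub>Cstar\<^esub> b) $$ (i, j) = rep z a $$ (i, j) - rep z b $$ (i, j)"
proof -
  have "rep z (a \<ominus>\<^bsub>Cstar\<^esub> b) \<oplus>\<^bsub>cmatrix n\<^esub> rep z b = rep z a"
    using assms(1,2) by (simp flip: rep_hom(2)) (simp add: alg.minus_eq alg.a_assoc alg.l_neg)
  then have "rep z (a \<ominus>\<^bsub>Cstar\<^esub> b) + rep z b = rep z a"
    using assms by (simp add: cmatrix_ops rep_carrier)
  then have "(rep z (a \<ominus>\<^bsub>Cstar\<^esub> b) + rep z b) $$ (i, j) = rep z a $$ (i, j)" by simp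
  then show ?thesis using assms rep_carrier[of b] by (simp add: eq_diff_eq)
qed

lemma rep_conv:
  assumes "alg.conv x a" "i < n" "j < n"
  shows "(\<lambda>k. rep z (x k) $$ (i, j)) \<longlonglongrightarrow> rep z a $$ (i, j)"
proof -
  note c = alg.convD[OF assms(1)]
  have "(\<lambda>k. rep z (x k) $$ (i, j) - rep z a $$ (i, j)) \<longlonglongrightarrow> 0"
  proof (rule Lim_null_comparison[OF _ c(3)])
    show "\<forall>\<^sub>F k in sequentially. norm (rep z (x k) $$ (i, j) - rep z a $$ (i, j)) \<le> graph.unorm (x k \<ominus>\<^bsub>Cstar\<^esub> a)"
      using rep_entry_bound[of "x k \<ominus>\<^bsub>Cstar\<^esub> a" i j for k] c(1,2) assms(2,3)
      by (intro always_eventually allI) (simp add: rep_diff_entry)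
  qed
  then show ?thesis by (simp add: LIM_zero_iff)
qed

end

text \<open>Let span elements tend to a. Since all representations kill a, their entries are bounded
  by the distance to a, and \<open>nrm_span_elem\<close> then forces the span elements themselves to
  tend to 0.\<close>

lemma rep_injective:
  assumes a: "a \<in> carrier Cstar" and 0: "!!z i j. z \<in> K ==> i < n ==> j < n ==> rep z a $$ (i, j) = 0"
  shows "a = \<zero>\<^bsub>Cstar\<^esub>"
proof -
  obtain F where F: "alg.conv (\<lambda>k. alg.span_elem (F k)) a" using alg.span_dense[OF a] by blast
  have le: "graph.unorm (alg.span_elem (F k)) \<le> real (n * n) * graph.unorm (alg.span_elem (F k) \<ominus>\<^bsub>Cstar\<^esub> a)" for k
  proof (rule alg.nrm_span_elem)
    fix \<xi> \<nu> z assume i: "\<xi> \<in> I" "\<nu> \<in> I" and z: "z \<in> K"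
    obtain i j where ij: "i < n" "j < n" "\<xi> = ix i" "\<nu> = ix j"
      using ix_surj[OF i(1)] ix_surj[OF i(2)] by metis
    have "leval (F k \<xi> \<nu>) z = rep z (alg.span_elem (F k) \<ominus>\<^bsub>Cstar\<^esub> a) $$ (i, j)"
      using ij a 0[OF z ij(1,2)] by (simp add: rep_diff_entry[OF z] rep_span[OF z] matI_def)
    then show "cmod (leval (F k \<xi> \<nu>) z) \<le> graph.unorm (alg.span_elem (F k) \<ominus>\<^bsub>Cstar\<^esub> a)"
      using rep_entry_bound[OF z _ ij(1,2)] a by simp
  qed
  have "(\<lambda>k. real (n * n) * graph.unorm (alg.span_elem (F k) \<ominus>\<^bsub>Cstar\<^esub> a)) \<longlonglongrightarrow> 0"
    by (intro tendsto_mult_right_zero alg.convD(3)[OF F])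
  then have "alg.conv (\<lambda>k. alg.span_elem (F k)) \<zero>\<^bsub>Cstar\<^esub>"
    by (rule alg.convI[rotated 3]) (use le in \<open>simp_all add: alg.minus_eq\<close>)
  then show ?thesis using alg.conv_unique F by blast
qed

text \<open>Representations are contractive, so the entries are uniform limits of Laurent
  polynomials.\<close>

lemma rep_continuous:
  assumes a: "a \<in> carrier Cstar" and ij: "i < n" "j < n"
  shows "continuous_on K (\<lambda>z. rep z a $$ (i, j))"
proof -
  obtain F where F: "alg.conv (\<lambda>k. alg.span_elem (F k)) a" using alg.span_dense[OF a] by blast
  have "uniform_limit K (\<lambda>k z. rep z (alg.span_elem (F k)) $$ (i, j)) (\<lambda>z. rep z a $$ (i, j)) sequentially"
  proof (rule uniform_limitI)
    fix e :: real assume "e > 0"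
    then have "\<forall>\<^sub>F k in sequentially. graph.unorm (alg.span_elem (F k) \<ominus>\<^bsub>Cstar\<^esub> a) < e"
      using order_tendstoD(2)[OF alg.convD(3)[OF F]] by simp
    then show "\<forall>\<^sub>F k in sequentially. \<forall>z\<in>K. dist (rep z (alg.span_elem (F k)) $$ (i, j)) (rep z a $$ (i, j)) < e"
    proof (rule eventually_mono)
      fix k assume k: "graph.unorm (alg.span_elem (F k) \<ominus>\<^bsub>Cstar\<^esub> a) < e"
      show "\<forall>z\<in>K. dist (rep z (alg.span_elem (F k)) $$ (i, j)) (rep z a $$ (i, j)) < e"
      proof
        fix z assume z: "z \<in> K"
        show "dist (rep z (alg.span_elem (F k)) $$ (i, j)) (rep z a $$ (i, j)) < e"
          using rep_entry_bound[OF z _ ij, of "alg.span_elem (F k) \<ominus>\<^bsub>Cstar\<^esub> a"] k a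
          by (simp add: dist_norm rep_diff_entry[OF z _ _ ij])
      qed
    qed
  qed
  moreover have "continuous_on K (\<lambda>z. rep z (alg.span_elem (F k)) $$ (i, j))" for k
  proof -
    have "continuous_on K (leval (F k (ix i) (ix j)))"
      by (rule continuous_on_subset[OF continuous_on_leval]) (auto simp: K_def)
    then show ?thesis by (rule continuous_on_eq) (use ij in \<open>simp add: rep_span matI_def\<close>)
  qed
  ultimately show ?thesis by (intro uniform_limit_theorem) auto
qed

text \<open>Approximate the prescribed entries by Laurent polynomials. The corresponding span
  elements form a Cauchy sequence by \<open>nrm_span_elem\<close>, and its limit has the right
  values at each z.\<close>

lemma rep_surjective:
  assumes f: "!!i j. i < n ==> j < n ==> continuous_on (sphere 0 1) (f i j)"
  obtains a where "a \<in> carrier Cstar" "!!z i j. z \<in> K ==> i < n ==> j < n ==> rep z a $$ (i, j) = f i j z"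
proof -
  have "\<exists>h. \<forall>z. cmod z = 1 --> cmod (f i j z - leval h z) < 1 / real (Suc k)" if "i < n" "j < n" for i j k
    using laurent_dense[OF f[OF that], of "1 / real (Suc k)"] by simp
  then obtain h where h: "!!i j k z. i < n ==> j < n ==> cmod z = 1 ==> cmod (f i j z - leval (h i j k) z) < 1 / real (Suc k)"
    by metis
  define jx where "jx = inv_into {..<n} ix"
  have jx: "jx (ix i) = i" if "i < n" for i
    unfolding jx_def using ix that by (intro inv_into_f_f) (auto simp: bij_betw_def)
  define x where "x k = alg.span_elem (\<lambda>\<xi> \<nu>. h (jx \<xi>) (jx \<nu>) k)" for k
  have ent: "rep z (x k) $$ (i, j) = leval (h i j k) z" if "z \<in> K" "i < n" "j < n" for z i j k
    using that by (simp add: x_def rep_span matI_def jx)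
  have xc: "x k \<in> carrier Cstar" for k by (simp add: x_def)
  have diff: "graph.unorm (x k \<ominus>\<^bsub>Cstar\<^esub> x l) \<le> real (n * n) * (1 / real (Suc k) + 1 / real (Suc l))" for k l
  proof -
    let ?D = "\<lambda>\<xi> \<nu>. h (jx \<xi>) (jx \<nu>) k - h (jx \<xi>) (jx \<nu>) l"
    have "alg.span_elem ?D \<oplus>\<^bsub>Cstar\<^esub> x l = x k" by (simp add: x_def alg.span_elem_add)
    then have "x k \<ominus>\<^bsub>Cstar\<^esub> x l = (alg.span_elem ?D \<oplus>\<^bsub>Cstar\<^esub> x l) \<ominus>\<^bsub>Cstar\<^esub> x l" by simp
    also have "\<dots> = alg.span_elem ?D"
      using xc[of l] by (simp add: alg.minus_eq alg.a_assoc alg.r_neg)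
    finally have "x k \<ominus>\<^bsub>Cstar\<^esub> x l = alg.span_elem ?D" .
    moreover have "graph.unorm (alg.span_elem ?D) \<le> real (n * n) * (1 / real (Suc k) + 1 / real (Suc l))"
    proof (rule alg.nrm_span_elem)
      fix \<xi> \<nu> z assume i: "\<xi> \<in> I" "\<nu> \<in> I" and z: "z \<in> K"
      obtain i j where ij: "i < n" "j < n" "\<xi> = ix i" "\<nu> = ix j"
        using ix_surj[OF i(1)] ix_surj[OF i(2)] by metis
      have "leval (?D \<xi> \<nu>) z = (f i j z - leval (h i j l) z) - (f i j z - leval (h i j k) z)"
        using ij by (simp add: jx leval_diff)
      then show "cmod (leval (?D \<xi> \<nu>) z) \<le> 1 / real (Suc k) + 1 / real (Suc l)"
        using norm_triangle_ineq4[of "f i j z - leval (h i j l) z" "f i j z - leval (h i j k) z"]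
          h[OF ij(1,2) K_unit[OF z], of k] h[OF ij(1,2) K_unit[OF z], of l] by simp
    qed
    ultimately show ?thesis by simp
  qed
  have "\<exists>a\<in>carrier Cstar. (\<lambda>k. graph.unorm (x k \<ominus>\<^bsub>Cstar\<^esub> a)) \<longlonglongrightarrow> 0"
  proof (rule alg.complete[OF xc])
    fix e :: real assume e: "e > 0"
    define c where "c = real (n * n) + 1"
    have c: "c > 0" by (simp add: c_def add_nonneg_pos)
    obtain M :: nat where M: "real M > 2 * c / e" using reals_Archimedean2 by blast
    have "graph.unorm (x k \<ominus>\<^bsub>Cstar\<^esub> x l) < e" if "k \<ge> M" "l \<ge> M" for k l
    proof -
      have s: "1 / real (Suc m) < e / (2 * c)" if "m \<ge> M" for m
      proof -
        have "real (Suc m) > 2 * c / e" using M that by linarith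
        then show ?thesis using e c by (simp add: field_simps)
      qed
      have "graph.unorm (x k \<ominus>\<^bsub>Cstar\<^esub> x l) \<le> c * (1 / real (Suc k) + 1 / real (Suc l))"
        by (rule order_trans[OF diff]) (simp add: c_def mult_right_mono)
      also have "\<dots> < c * (e / (2 * c) + e / (2 * c))"
        using s[OF that(1)] s[OF that(2)] c by (intro mult_strict_left_mono add_strict_mono)
      also have "\<dots> = e" using c by (simp add: field_simps)
      finally show ?thesis .
    qed
    then show "\<exists>M. \<forall>k\<ge>M. \<forall>l\<ge>M. graph.unorm (x k \<ominus>\<^bsub>Cstar\<^esub> x l) < e" by blast
  qed
  then obtain a where a: "alg.conv x a" using xc by (auto simp: alg.conv_def)
  have "rep z a $$ (i, j) = f i j z" if zij: "z \<in> K" "i < n" "j < n" for z i j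
  proof -
    have "(\<lambda>k. leval (h i j k) z - f i j z) \<longlonglongrightarrow> 0"
    proof (rule Lim_null_comparison[OF _ LIMSEQ_Suc[OF lim_1_over_n]])
      show "\<forall>\<^sub>F k in sequentially. norm (leval (h i j k) z - f i j z) \<le> 1 / of_nat (Suc k)"
        using h[OF zij(2,3) K_unit[OF zij(1)]] by (intro always_eventually allI) (simp add: norm_minus_commute less_imp_le)
    qed
    then have "(\<lambda>k. rep z (x k) $$ (i, j)) \<longlonglongrightarrow> f i j z" using ent[OF zij] by (simp add: LIM_zero_iff)
    then show ?thesis using rep_conv[OF zij(1) a zij(2,3)] LIMSEQ_unique by blast
  qed
  then show ?thesis using that alg.convD(2)[OF a] by blast
qed

lemma iso_matrix:
  assumes "\<not> has_loop"
  shows "star_isomorphic Cstar (matrix_algebra n complex_algebra)"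
proof -
  have K1: "1 \<in> K" "K = {1}" using assms by (auto simp: K_def)
  have "bij_betw (rep 1) (carrier Cstar) (carrier (cmatrix n))"
    unfolding bij_betw_def
  proof
    show "inj_on (rep 1) (carrier Cstar)"
    proof (rule inj_onI)
      fix a b assume ab: "a \<in> carrier Cstar" "b \<in> carrier Cstar" "rep 1 a = rep 1 b"
      then have "a \<ominus>\<^bsub>Cstar\<^esub> b = \<zero>\<^bsub>Cstar\<^esub>"
        using K1 by (intro rep_injective) (auto simp: rep_diff_entry)
      then show "a = b" using ab by (intro alg.diff_eq_zero) auto
    qed
    show "rep 1 ` carrier Cstar = carrier (cmatrix n)"
    proof (intro equalityI subsetI)
      fix M assume M: "M \<in> carrier (cmatrix n)"
      obtain a where a: "a \<in> carrier Cstar" "!!z i j. z \<in> K ==> i < n ==> j < n ==> rep z a $$ (i, j) = M $$ (i, j)"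
        using rep_surjective[of "\<lambda>i j z. M $$ (i, j)"] by auto
      have "rep 1 a = M"
        using a M rep_carrier[OF K1(1) a(1)] K1 by (intro eq_matI) (auto simp: cmatrix_carrier)
      then show "M \<in> rep 1 ` carrier Cstar" using a by blast
    qed (use rep_hom(1)[OF K1(1)] in auto)
  qed
  then show ?thesis unfolding star_isomorphic_def using rep(1)[OF K1(1)] by blast
qed

end

section \<open>Matrices over the functions on the circle\<close>

lemma circle_algebra_simps:
  "carrier circle_algebra = {f. continuous_on (sphere 0 1) f \<and> f \<in> extensional (sphere 0 1)}"
  "f \<otimes>\<^bsub>circle_algebra\<^esub> g = (\<lambda>z\<in>sphere 0 1. f z * g z)"
  "f \<oplus>\<^bsub>circle_algebra\<^esub> g = (\<lambda>z\<in>sphere 0 1. f z + g z)"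
  "\<zero>\<^bsub>circle_algebra\<^esub> = (\<lambda>z\<in>sphere 0 1. 0)"
  "c \<odot>\<^bsub>circle_algebra\<^esub> f = (\<lambda>z\<in>sphere 0 1. c * f z)"
  "star circle_algebra f = (\<lambda>z\<in>sphere 0 1. cnj (f z))"
  by (simp_all add: circle_algebra_def Let_def)

lemma restrict_carrier_circle: "continuous_on (sphere 0 1) f ==> (\<lambda>z\<in>sphere 0 1. f z) \<in> carrier circle_algebra"
  unfolding circle_algebra_simps by (auto intro: continuous_on_eq)

text \<open>Products in \<open>matrix_algebra\<close> use the sum of the record, which is pointwise
  once the additive structure is known to be a group.\<close>

lemma finsum_circle_algebra:
  assumes "finite J" "!!j. j \<in> J ==> f j \<in> carrier circle_algebra"
  shows "finsum circle_algebra f J = (\<lambda>z\<in>sphere 0 1. \<Sum>j\<in>J. f j z)"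
proof -
  interpret abelian_group circle_algebra
  proof (rule abelian_groupI)
    fix x y assume x: "x \<in> carrier circle_algebra"
    have cx: "continuous_on (sphere 0 1) x" using x by (simp add: circle_algebra_simps)
    show "\<zero>\<^bsub>circle_algebra\<^esub> \<oplus>\<^bsub>circle_algebra\<^esub> x = x"
      using x by (auto simp: circle_algebra_simps fun_eq_iff extensional_def)
    show "\<exists>y\<in>carrier circle_algebra. y \<oplus>\<^bsub>circle_algebra\<^esub> x = \<zero>\<^bsub>circle_algebra\<^esub>"
      using cx by (intro bexI[of _ "\<lambda>z\<in>sphere 0 1. - x z"] restrict_carrier_circle continuous_intros)
        (auto simp: circle_algebra_simps fun_eq_iff)
    assume y: "y \<in> carrier circle_algebra"
    then have cy: "continuous_on (sphere 0 1) y" by (simp add: circle_algebra_simps)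
    show "x \<oplus>\<^bsub>circle_algebra\<^esub> y \<in> carrier circle_algebra"
      unfolding circle_algebra_simps(3) using cx cy by (intro restrict_carrier_circle continuous_intros)
    show "x \<oplus>\<^bsub>circle_algebra\<^esub> y = y \<oplus>\<^bsub>circle_algebra\<^esub> x" by (simp add: circle_algebra_simps add.commute)
    fix w
    show "x \<oplus>\<^bsub>circle_algebra\<^esub> y \<oplus>\<^bsub>circle_algebra\<^esub> w = x \<oplus>\<^bsub>circle_algebra\<^esub> (y \<oplus>\<^bsub>circle_algebra\<^esub> w)"
      by (auto simp: circle_algebra_simps fun_eq_iff add.assoc)
  next
    show "\<zero>\<^bsub>circle_algebra\<^esub> \<in> carrier circle_algebra"
      unfolding circle_algebra_simps(4) by (intro restrict_carrier_circle continuous_intros)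
  qed
  show ?thesis
    using assms
  proof (induct J rule: finite_induct)
    case (insert j J)
    then have "f \<in> J \<rightarrow> carrier circle_algebra" by auto
    then show ?case using insert by (auto simp: circle_algebra_simps(3) fun_eq_iff)
  qed (simp add: circle_algebra_simps)
qed

context rooted_digraph
begin

lemma iso_matrix_circle:
  assumes "has_loop"
  shows "star_isomorphic Cstar (matrix_algebra n circle_algebra)"
proof -
  let ?T = "sphere (0::complex) 1" and ?A = "Cstar" and ?B = "matrix_algebra n circle_algebra"
  have K: "K = ?T" using assms by (simp add: K_def)
  define h where "h a = mat n n (\<lambda>(i, j). \<lambda>z\<in>?T. rep z a $$ (i, j))" for a
  have hd: "dim_row (h a) = n" "dim_col (h a) = n" for a by (simp_all add: h_def)
  have hc: "(\<lambda>z\<in>?T. rep z a $$ (i, j)) \<in> carrier circle_algebra" if "a \<in> carrier ?A" "i < n" "j < n" for a i j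
    using rep_continuous[OF that] K by (intro restrict_carrier_circle) simp
  have B_carrier: "M \<in> carrier ?B \<longleftrightarrow> M \<in> carrier_mat n n \<and> (\<forall>i<n. \<forall>j<n. M $$ (i, j) \<in> carrier circle_algebra)" for M
    by (simp add: matrix_algebra_def)
  have "h \<in> star_hom ?A ?B"
    unfolding star_hom_def
  proof (intro CollectI conjI ballI allI Pi_I)
    fix a c assume a: "a \<in> carrier ?A"
    show "h a \<in> carrier ?B" unfolding B_carrier using hc[OF a] by (simp add: h_def)
    show "h (c \<odot>\<^bsub>?A\<^esub> a) = c \<odot>\<^bsub>?B\<^esub> h a"
    proof (rule eq_matI)
      fix i j assume "i < dim_row (c \<odot>\<^bsub>?B\<^esub> h a)" "j < dim_col (c \<odot>\<^bsub>?B\<^esub> h a)"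
      then have ij: "i < n" "j < n" by (simp_all add: matrix_algebra_def)
      have "rep z (c \<odot>\<^bsub>?A\<^esub> a) $$ (i, j) = c * rep z a $$ (i, j)" if "z \<in> ?T" for z
        using that a K ij rep_carrier[of z a] by (simp add: rep_hom cmatrix_ops(1,2)[where n = n] cmatrix_unary_ops)
      then show "h (c \<odot>\<^bsub>?A\<^esub> a) $$ (i, j) = (c \<odot>\<^bsub>?B\<^esub> h a) $$ (i, j)"
        using ij by (auto simp: h_def matrix_algebra_def circle_algebra_simps fun_eq_iff)
    qed (simp_all add: hd matrix_algebra_def)
    show "h (star ?A a) = star ?B (h a)"
    proof (rule eq_matI)
      fix i j assume "i < dim_row (star ?B (h a))" "j < dim_col (star ?B (h a))"
      then have ij: "i < n" "j < n" by (simp_all add: matrix_algebra_def)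
      have "rep z (star ?A a) $$ (i, j) = cnj (rep z a $$ (j, i))" if "z \<in> ?T" for z
        using that a K ij rep_carrier[of z a] by (simp add: rep_hom cmatrix_ops(1,2)[where n = n] cmatrix_unary_ops adj_mat_def)
      then show "h (star ?A a) $$ (i, j) = star ?B (h a) $$ (i, j)"
        using ij by (auto simp: h_def matrix_algebra_def circle_algebra_simps fun_eq_iff)
    qed (simp_all add: hd matrix_algebra_def)
    fix b assume b: "b \<in> carrier ?A"
    show "h (a \<oplus>\<^bsub>?A\<^esub> b) = h a \<oplus>\<^bsub>?B\<^esub> h b"
    proof (rule eq_matI)
      fix i j assume "i < dim_row (h a \<oplus>\<^bsub>?B\<^esub> h b)" "j < dim_col (h a \<oplus>\<^bsub>?B\<^esub> h b)"
      then have ij: "i < n" "j < n" by (simp_all add: matrix_algebra_def)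
      have "rep z (a \<oplus>\<^bsub>?A\<^esub> b) $$ (i, j) = rep z a $$ (i, j) + rep z b $$ (i, j)" if "z \<in> ?T" for z
        using that a b K ij rep_carrier[of z a] rep_carrier[of z b] by (simp add: rep_hom cmatrix_ops(1,2)[where n = n] cmatrix_unary_ops)
      then show "h (a \<oplus>\<^bsub>?A\<^esub> b) $$ (i, j) = (h a \<oplus>\<^bsub>?B\<^esub> h b) $$ (i, j)"
        using ij by (auto simp: h_def matrix_algebra_def circle_algebra_simps fun_eq_iff)
    qed (simp_all add: hd matrix_algebra_def)
    show "h (a \<otimes>\<^bsub>?A\<^esub> b) = h a \<otimes>\<^bsub>?B\<^esub> h b"
    proof (rule eq_matI)
      fix i j assume "i < dim_row (h a \<otimes>\<^bsub>?B\<^esub> h b)" "j < dim_col (h a \<otimes>\<^bsub>?B\<^esub> h b)"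
      then have ij: "i < n" "j < n" by (simp_all add: matrix_algebra_def)
      have e: "rep z (a \<otimes>\<^bsub>?A\<^esub> b) $$ (i, j) = (\<Sum>k<n. rep z a $$ (i, k) * rep z b $$ (k, j))" if "z \<in> ?T" for z
        using that a b K ij rep_carrier[of z a] rep_carrier[of z b]
        by (simp add: rep_hom cmatrix_ops(1,2)[where n = n] cmatrix_unary_ops scalar_prod_def lessThan_atLeast0)
      have m: "h a $$ (i, k) \<otimes>\<^bsub>circle_algebra\<^esub> h b $$ (k, j) = (\<lambda>z\<in>?T. rep z a $$ (i, k) * rep z b $$ (k, j))" if "k < n" for k
        using ij that by (auto simp: h_def circle_algebra_simps fun_eq_iff)
      have mc: "h a $$ (i, k) \<otimes>\<^bsub>circle_algebra\<^esub> h b $$ (k, j) \<in> carrier circle_algebra" if "k < n" for k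
        unfolding m[OF that] using rep_continuous[OF a ij(1) that] rep_continuous[OF b that ij(2)] K
        by (intro restrict_carrier_circle continuous_intros) auto
      have "(h a \<otimes>\<^bsub>?B\<^esub> h b) $$ (i, j) = finsum circle_algebra (\<lambda>k. h a $$ (i, k) \<otimes>\<^bsub>circle_algebra\<^esub> h b $$ (k, j)) {..<n}"
        using ij by (simp add: matrix_algebra_def)
      also have "\<dots> = (\<lambda>z\<in>?T. \<Sum>k<n. (h a $$ (i, k) \<otimes>\<^bsub>circle_algebra\<^esub> h b $$ (k, j)) z)"
        by (rule finsum_circle_algebra) (use mc in auto)
      also have "\<dots> = (\<lambda>z\<in>?T. \<Sum>k<n. rep z a $$ (i, k) * rep z b $$ (k, j))"
        by (rule restrict_ext) (auto simp: m intro!: sum.cong)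
      also have "\<dots> = h (a \<otimes>\<^bsub>?A\<^esub> b) $$ (i, j)" using ij e by (auto simp: h_def fun_eq_iff)
      finally show "h (a \<otimes>\<^bsub>?A\<^esub> b) $$ (i, j) = (h a \<otimes>\<^bsub>?B\<^esub> h b) $$ (i, j)" by simp
    qed (simp_all add: hd matrix_algebra_def)
  qed
  moreover have "bij_betw h (carrier ?A) (carrier ?B)"
    unfolding bij_betw_def
  proof
    show "inj_on h (carrier ?A)"
    proof (rule inj_onI)
      fix a b assume ab: "a \<in> carrier ?A" "b \<in> carrier ?A" "h a = h b"
      have "rep z a $$ (i, j) = rep z b $$ (i, j)" if "z \<in> K" "i < n" "j < n" for z i j
        using arg_cong[OF ab(3), of "\<lambda>M. (M $$ (i, j)) z"] that K by (simp add: h_def)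
      then have "a \<ominus>\<^bsub>?A\<^esub> b = \<zero>\<^bsub>?A\<^esub>"
        using ab by (intro rep_injective) (auto simp: rep_diff_entry)
      then show "a = b" using ab by (intro alg.diff_eq_zero) auto
    qed
    show "h ` carrier ?A = carrier ?B"
    proof (intro equalityI subsetI)
      fix M assume M: "M \<in> carrier ?B"
      obtain a where a: "a \<in> carrier ?A" "!!z i j. z \<in> K ==> i < n ==> j < n ==> rep z a $$ (i, j) = (M $$ (i, j)) z"
        using rep_surjective[of "\<lambda>i j z. (M $$ (i, j)) z"] M by (auto simp: B_carrier circle_algebra_simps)
      have "h a = M"
      proof (rule eq_matI)
        fix i j assume "i < dim_row M" "j < dim_col M"
        then have ij: "i < n" "j < n" using M by (auto simp: B_carrier)
        then have "M $$ (i, j) \<in> extensional ?T" using M by (auto simp: B_carrier circle_algebra_simps)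
        then show "h a $$ (i, j) = M $$ (i, j)"
          using ij a K by (auto simp: h_def fun_eq_iff extensional_def)
      qed (use M in \<open>auto simp: B_carrier hd\<close>)
      then show "M \<in> h ` carrier ?A" using a by blast
    next
      fix M assume "M \<in> h ` carrier ?A"
      then show "M \<in> carrier ?B" using hc by (auto simp: B_carrier h_def)
    qed
  qed
  ultimately show ?thesis unfolding star_isomorphic_def by blast
qed

text \<open>The normalized matrix trace followed by a state L on the functions on \<open>K\<close>.
  L is constrained only for functions continuous on \<open>K\<close>, hence the hypothesis
  \<open>cong\<close> for rewriting inside it. The matrix of \<open>fcalc f\<close> has its only
  nonzero entry at the empty path, which gives the factor 1 / n.\<close>

lemma trace_from_functional:
  fixes L :: "(complex => complex) => complex"
  assumes cong: "!!f g. continuous_on K f ==> (!!z. z \<in> K ==> f z = g z) ==> L f = L g"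
    and add: "!!f g. continuous_on K f ==> continuous_on K g ==> L (\<lambda>z. f z + g z) = L f + L g"
    and scale: "!!c f. continuous_on K f ==> L (\<lambda>z. c * f z) = c * L f"
    and pos: "!!f. continuous_on K f ==> L (\<lambda>z. cnj (f z) * f z) \<in> \<real>\<^sub>\<ge>\<^sub>0"
    and one: "L (\<lambda>z. 1) = 1"
  defines "\<tau> \<equiv> \<lambda>a. (\<Sum>i<n. L (\<lambda>z. rep z a $$ (i, i))) / of_nat n"
  shows "trace_state Cstar \<tau>" and "\<tau> (alg.fcalc f) = L (leval f) / of_nat n"
proof -
  let ?A = "Cstar"
  note cont = rep_continuous
  have n0: "n > 0" using Nil_I finite_I by (metis card_gt_0_iff empty_iff)
  have zero: "L (\<lambda>z. 0) = 0" using scale[of "\<lambda>z. 0" 0] by simp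
  have Lsum: "L (\<lambda>z. \<Sum>k\<in>J. f k z) = (\<Sum>k\<in>J. L (f k))" if "finite J" "!!k. k \<in> J ==> continuous_on K (f k)"
    for J :: "nat set" and f
    using that by (induct J rule: finite_induct) (simp_all add: zero add continuous_on_sum)
  have ent: "rep z (a \<otimes>\<^bsub>?A\<^esub> b) $$ (i, j) = (\<Sum>k<n. rep z a $$ (i, k) * rep z b $$ (k, j))"
    if "z \<in> K" "a \<in> carrier ?A" "b \<in> carrier ?A" "i < n" "j < n" for z a b i j
    using that rep_carrier[of z a] rep_carrier[of z b]
    by (simp add: rep_hom cmatrix_ops(1,2)[where n = n] cmatrix_unary_ops rep_dim scalar_prod_def lessThan_atLeast0)
  have Lprod: "L (\<lambda>z. rep z (a \<otimes>\<^bsub>?A\<^esub> b) $$ (i, i)) = (\<Sum>k<n. L (\<lambda>z. rep z a $$ (i, k) * rep z b $$ (k, i)))"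
    if a: "a \<in> carrier ?A" and b: "b \<in> carrier ?A" and i: "i < n" for a b i
  proof -
    have "L (\<lambda>z. rep z (a \<otimes>\<^bsub>?A\<^esub> b) $$ (i, i)) = L (\<lambda>z. \<Sum>k<n. rep z a $$ (i, k) * rep z b $$ (k, i))"
    proof (rule cong)
      show "continuous_on K (\<lambda>z. rep z (a \<otimes>\<^bsub>?A\<^esub> b) $$ (i, i))" using a b i by (intro cont) auto
    qed (use that ent in auto)
    also have "\<dots> = (\<Sum>k<n. L (\<lambda>z. rep z a $$ (i, k) * rep z b $$ (k, i)))"
      by (rule Lsum) (use that in \<open>auto intro!: continuous_intros cont\<close>)
    finally show ?thesis .
  qed
  show "trace_state ?A \<tau>"
    unfolding trace_state_def
  proof (intro conjI ballI allI)
    fix a c assume a: "a \<in> carrier ?A"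
    have "L (\<lambda>z. rep z (c \<odot>\<^bsub>?A\<^esub> a) $$ (i, i)) = c * L (\<lambda>z. rep z a $$ (i, i))" if i: "i < n" for i
    proof -
      have "L (\<lambda>z. rep z (c \<odot>\<^bsub>?A\<^esub> a) $$ (i, i)) = L (\<lambda>z. c * rep z a $$ (i, i))"
        using a i rep_carrier by (intro cong cont) (auto simp: rep_hom cmatrix_ops(1,2)[where n = n] cmatrix_unary_ops rep_dim)
      then show ?thesis using scale[OF cont[OF a i i]] by simp
    qed
    then show "\<tau> (c \<odot>\<^bsub>?A\<^esub> a) = c * \<tau> a" by (simp add: \<tau>_def sum_distrib_left[symmetric])
    show "\<tau> (star ?A a \<otimes>\<^bsub>?A\<^esub> a) \<in> \<real>\<^sub>\<ge>\<^sub>0"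
    proof -
      have ii: "L (\<lambda>z. rep z (star ?A a \<otimes>\<^bsub>?A\<^esub> a) $$ (i, i)) \<in> \<real>\<^sub>\<ge>\<^sub>0" if i: "i < n" for i
      proof -
        have kk: "L (\<lambda>z. rep z (star ?A a) $$ (i, k) * rep z a $$ (k, i)) \<in> \<real>\<^sub>\<ge>\<^sub>0" if k: "k < n" for k
        proof -
          have "L (\<lambda>z. rep z (star ?A a) $$ (i, k) * rep z a $$ (k, i)) = L (\<lambda>z. cnj (rep z a $$ (k, i)) * rep z a $$ (k, i))"
            using a i k rep_carrier by (intro cong continuous_intros cont) (auto simp: rep_hom cmatrix_ops(1,2)[where n = n] cmatrix_unary_ops rep_dim adj_mat_def)
          then show ?thesis using pos[OF cont[OF a k i]] by simp
        qed
        show ?thesis unfolding Lprod[OF alg.star_closed[OF a] a i]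
          by (rule nonneg_Reals_sum) (rule kk, simp)
      qed
      have "(\<Sum>i<n. L (\<lambda>z. rep z (star ?A a \<otimes>\<^bsub>?A\<^esub> a) $$ (i, i))) \<in> \<real>\<^sub>\<ge>\<^sub>0"
        by (rule nonneg_Reals_sum) (rule ii, simp)
      then show ?thesis unfolding \<tau>_def by (simp add: complex_nonneg_Reals_iff)
    qed
    fix b assume b: "b \<in> carrier ?A"
    have "L (\<lambda>z. rep z (a \<oplus>\<^bsub>?A\<^esub> b) $$ (i, i)) = L (\<lambda>z. rep z a $$ (i, i)) + L (\<lambda>z. rep z b $$ (i, i))" if i: "i < n" for i
    proof -
      have "L (\<lambda>z. rep z (a \<oplus>\<^bsub>?A\<^esub> b) $$ (i, i)) = L (\<lambda>z. rep z a $$ (i, i) + rep z b $$ (i, i))"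
        using a b i rep_carrier by (intro cong cont) (auto simp: rep_hom cmatrix_ops(1,2)[where n = n] cmatrix_unary_ops rep_dim)
      then show ?thesis using add[OF cont[OF a i i] cont[OF b i i]] by simp
    qed
    then show "\<tau> (a \<oplus>\<^bsub>?A\<^esub> b) = \<tau> a + \<tau> b" by (simp add: \<tau>_def sum.distrib add_divide_distrib)
    show "\<tau> (a \<otimes>\<^bsub>?A\<^esub> b) = \<tau> (b \<otimes>\<^bsub>?A\<^esub> a)"
    proof -
      have "(\<Sum>i<n. L (\<lambda>z. rep z (a \<otimes>\<^bsub>?A\<^esub> b) $$ (i, i))) = (\<Sum>i<n. \<Sum>k<n. L (\<lambda>z. rep z a $$ (i, k) * rep z b $$ (k, i)))"
        using a b by (simp add: Lprod)
      also have "\<dots> = (\<Sum>k<n. \<Sum>i<n. L (\<lambda>z. rep z b $$ (k, i) * rep z a $$ (i, k)))"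
        by (subst sum.swap) (simp add: mult.commute)
      also have "\<dots> = (\<Sum>i<n. L (\<lambda>z. rep z (b \<otimes>\<^bsub>?A\<^esub> a) $$ (i, i)))"
        using a b by (simp add: Lprod)
      finally show ?thesis by (simp add: \<tau>_def)
    qed
  next
    have "L (\<lambda>z. rep z \<one>\<^bsub>?A\<^esub> $$ (i, i)) = 1" if i: "i < n" for i
    proof -
      have "L (\<lambda>z. rep z \<one>\<^bsub>?A\<^esub> $$ (i, i)) = L (\<lambda>z. 1)"
      proof (rule cong)
        fix z assume z: "z \<in> K"
        have "leval 1 z = 1" using leval_single[of 0 1 z] by simp
        then show "rep z \<one>\<^bsub>?A\<^esub> $$ (i, i) = 1"
          unfolding alg.span_elem_one rep_span[OF z] using i by (simp add: matI_def)
      qed (use cont i in auto)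
      then show ?thesis using one by simp
    qed
    moreover have "I \<noteq> {}" using Nil_I by blast
    ultimately show "\<tau> \<one>\<^bsub>?A\<^esub> = 1" by (simp add: \<tau>_def finite_I)
  qed
  obtain i0 where i0: "i0 < n" "ix i0 = []" using ix_surj[OF Nil_I] by metis
  have "L (\<lambda>z. rep z (alg.fcalc f) $$ (i, i)) = (if i = i0 then L (leval f) else 0)" if i: "i < n" for i
  proof -
    have e: "ix i = [] \<longleftrightarrow> i = i0" using i i0 ix_eq by metis
    have "L (\<lambda>z. rep z (alg.fcalc f) $$ (i, i)) = L (\<lambda>z. if i = i0 then leval f z else 0)"
    proof (rule cong)
      show "continuous_on K (\<lambda>z. rep z (alg.fcalc f) $$ (i, i))" using i by (intro cont) simp_all
    qed (use i i0 e in \<open>simp add: rep_fcalc unit_mat_def matI_def\<close>)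
    then show ?thesis using zero by auto
  qed
  then show "\<tau> (alg.fcalc f) = L (leval f) / of_nat n" using i0 by (simp add: \<tau>_def)
qed

end

section \<open>Traces on graph C*-algebras\<close>

context cstar_algebra
begin

text \<open>Without normalization, so that weighted sums can be compared before their weights are
  known to add up to 1.\<close>

definition tracial_functional :: "('a => complex) => bool" where
  "tracial_functional \<tau> \<longleftrightarrow> positive_functional \<tau> \<and> (\<forall>a\<in>carrier A. \<forall>b\<in>carrier A. \<tau> (a \<otimes> b) = \<tau> (b \<otimes> a))"

lemma trace_state_iff: "trace_state A \<tau> \<longleftrightarrow> tracial_functional \<tau> \<and> \<tau> \<one> = 1"
  unfolding trace_state_def tracial_functional_def positive_functional_def by blast

context
  fixes \<tau> assumes \<tau>: "tracial_functional \<tau>"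
begin

lemma tracial_positive: "positive_functional \<tau>"
  and tracial: "a \<in> carrier A ==> b \<in> carrier A ==> \<tau> (a \<otimes> b) = \<tau> (b \<otimes> a)"
  using \<tau> by (simp_all add: tracial_functional_def)

lemmas tf_add = pf_add[OF tracial_positive]
  and tf_smult = pf_smult[OF tracial_positive]
  and tf_zero = pf_zero[OF tracial_positive]

lemma tf_finsum:
  "finite J ==> (!!j. j \<in> J ==> f j \<in> carrier A) ==> \<tau> (finsum A f J) = (\<Sum>j\<in>J. \<tau> (f j))"
proof (induct J rule: finite_induct)
  case (insert j J)
  then have "f \<in> J \<rightarrow> carrier A" "f j \<in> carrier A" by auto
  then show ?case using insert by (simp add: tf_add)
qed (simp add: tf_zero)

lemma tf_conv:
  assumes x: "conv x a" shows "(\<lambda>n. \<tau> (x n)) \<longlonglongrightarrow> \<tau> a"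
proof -
  have b: "norm (\<tau> (x n) - \<tau> a) \<le> Re (\<tau> \<one>) * nrm (x n \<ominus> a)" for n
    using pf_bound[OF tracial_positive, of "x n \<ominus> a"] convD(1,2)[OF x] by (simp add: pf_diff[OF tracial_positive])
  show ?thesis
    by (rule LIM_zero_cancel, rule Lim_null_comparison[OF _ tendsto_mult_right_zero[OF convD(3)[OF x]]],
        rule always_eventually, rule allI, rule b)
qed

end

end

section \<open>Reachability, recurrent and terminal vertices\<close>

context fin_digraph
begin

abbreviation "leads \<equiv> leads_to G"

lemma leads_to_refl [simp]: "v \<in> verts G ==> leads v v"
  unfolding leads_to_def by (rule exI[of _ "[]"]) (simp add: awalk_simps)

lemma leads_to_trans: "leads v w ==> leads w y ==> leads v y"
  unfolding leads_to_def using awalk_appendI by blast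

lemma awalk_leads_to: "awalk v \<xi> w ==> leads v w"
  unfolding leads_to_def by blast

lemma leads_to_verts: "leads v w ==> v \<in> verts G" "leads v w ==> w \<in> verts G"
  unfolding leads_to_def by auto

lemma arc_leads_to: "e \<in> arcs G ==> leads (tail G e) (head G e)"
  unfolding leads_to_def by (rule exI[of _ "[e]"]) (simp add: awalk_simps)

lemma awalk_snoc: "awalk v \<xi> w ==> e \<in> arcs G ==> tail G e = w ==> awalk v (\<xi> @ [e]) (head G e)"
  by (rule awalk_appendI) (simp_all add: awalk_Cons_iff awalk_Nil_iff)

text \<open>Equivalently, v lies on a loop.\<close>

definition recurrent :: "'a => bool" where
  "recurrent v \<longleftrightarrow> (\<exists>e\<in>arcs G. tail G e = v \<and> leads (head G e) v)"

lemma recurrent_mutual: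
  assumes "recurrent v" "leads v w" "leads w v" shows "recurrent w"
proof -
  obtain \<xi> where \<xi>: "awalk w \<xi> v" using assms(3) by (auto simp: leads_to_def)
  show ?thesis
  proof (cases \<xi>)
    case Nil
    then show ?thesis using \<xi> assms(1) by (simp add: awalk_simps)
  next
    case (Cons e \<nu>)
    then have "e \<in> arcs G" "tail G e = w" "leads (head G e) v"
      using \<xi> by (auto simp: awalk_simps leads_to_def)
    then show ?thesis using assms(2) leads_to_trans unfolding recurrent_def by blast
  qed
qed

text \<open>
  The terminal vertices are the sinks in \<open>\<S>(0)\<close> and the vertices of the components in \<open>\<Z>(0)\<close>;
  the last clause says that the component of \<open>r\<close> is circular.
\<close>

definition terminal :: "'a => bool" where
  "terminal r \<longleftrightarrow> r \<in> verts G \<and> (is_sink G r \<or> recurrent r) \<and>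
     (\<forall>v. recurrent v --> leads v r --> leads r v) \<and>
     (\<forall>e\<in>arcs G. \<forall>e'\<in>arcs G. tail G e = tail G e' --> leads r (tail G e) -->
        leads (head G e) r --> leads (head G e') r --> e = e')"

lemma terminal_unique:
  "terminal r ==> e \<in> arcs G ==> e' \<in> arcs G ==> tail G e = tail G e' ==> leads r (tail G e) ==>
    leads (head G e) r ==> leads (head G e') r ==> e = e'"
  unfolding terminal_def by blast

lemma sink_leads_to: "is_sink G v ==> awalk v \<xi> w ==> \<xi> = [] \<and> w = v"
  by (cases \<xi>) (auto simp: is_sink_def awalk_simps)

end

section \<open>Words in a graph algebra\<close>

context graph_algebra
begin

lemma path_elem_append:
  "awalk v \<xi> w ==> awalk w \<nu> y ==> path_elem y (\<xi> @ \<nu>) = path_elem w \<xi> \<otimes> path_elem y \<nu>"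
proof (induct \<xi> arbitrary: v)
  case Nil
  then show ?case by (simp add: source_path_elem)
next
  case (Cons e \<xi>)
  then have e: "e \<in> arcs G" "awalk (head G e) \<xi> w" by (auto simp: awalk_simps)
  then show ?case using Cons(1)[OF e(2) Cons(3)] path_elem_closed[OF e(2)] path_elem_closed[OF Cons(3)]
    by (simp add: m_assoc)
qed

lemma path_elem_snoc:
  "awalk v \<xi> w ==> e \<in> arcs G ==> tail G e = w ==> path_elem (head G e) (\<xi> @ [e]) = path_elem w \<xi> \<otimes> S e"
  using path_elem_append[of v \<xi> w "[e]" "head G e"] by (simp add: awalk_simps S_head)

text \<open>The span of the reduced words: an adjoint standing to the left of a path always cancels
  against it or gives 0.\<close>

inductive_set path_span where
  word: "awalk v \<xi> w ==> awalk v' \<nu> w ==> path_elem w \<xi> \<otimes> star A (path_elem w \<nu>) \<in> path_span"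
| zero: "\<zero> \<in> path_span"
| add: "x \<in> path_span ==> y \<in> path_span ==> x \<oplus> y \<in> path_span"
| smult: "x \<in> path_span ==> c \<odot> x \<in> path_span"

lemma path_span_closed: "x \<in> path_span ==> x \<in> carrier A"
  by (induct rule: path_span.induct) auto

text \<open>The adjoint of an arc cancels the first arc of the left path or annihilates it. If the
  left path is empty, the arc is appended to the right path instead.\<close>

lemma path_span_letter:
  "x \<in> path_span ==> (\<forall>v\<in>verts G. P v \<otimes> x \<in> path_span) \<and>
    (\<forall>e\<in>arcs G. S e \<otimes> x \<in> path_span \<and> star A (S e) \<otimes> x \<in> path_span)"
proof (induct rule: path_span.induct)
  case (word v \<xi> w v' \<nu>)
  let ?a = "path_elem w \<xi>" and ?b = "path_elem w \<nu>"
  note c = path_elem_closed[OF word(1)] path_elem_closed[OF word(2)]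
  have v: "v \<in> verts G" and w: "w \<in> verts G" using word(1) by auto
  have Pv: "P y \<otimes> ?a = (if y = v then ?a else \<zero>)" if "y \<in> verts G" for y
    using source_path_elem[OF word(1)] source_path_elem_orth[OF word(1) that] by auto
  have 1: "P y \<otimes> (?a \<otimes> star A ?b) \<in> path_span" if y: "y \<in> verts G" for y
  proof -
    have "P y \<otimes> (?a \<otimes> star A ?b) = (P y \<otimes> ?a) \<otimes> star A ?b" using y c by (simp add: m_assoc)
    then show ?thesis using Pv[OF y] c path_span.word[OF word] path_span.zero by simp
  qed
  have 2: "S e \<otimes> (?a \<otimes> star A ?b) \<in> path_span" if e: "e \<in> arcs G" for e
  proof -
    have "S e \<otimes> (?a \<otimes> star A ?b) = (S e \<otimes> (P (head G e) \<otimes> ?a)) \<otimes> star A ?b"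
      using e c by (simp add: m_assoc[symmetric] S_head)
    also have "\<dots> = (if head G e = v then path_elem w (e # \<xi>) \<otimes> star A ?b else \<zero>)"
      using Pv[of "head G e"] e c by simp
    finally show ?thesis
      using path_span.word[of "tail G e" "e # \<xi>" w, OF _ word(2)] e word(1) path_span.zero by (auto simp: awalk_simps)
  qed
  have 3: "star A (S e) \<otimes> (?a \<otimes> star A ?b) \<in> path_span" if e: "e \<in> arcs G" for e
  proof (cases \<xi>)
    case Nil
    have "P w \<otimes> star A ?b = star A ?b"
      using arg_cong[OF path_elem_range[OF word(2)], of "star A"] c w by (simp add: star_mult P_star)
    then have q: "star A (S e) \<otimes> (?a \<otimes> star A ?b) = star A (?b \<otimes> S e)" using Nil e c by (simp add: star_mult)
    show ?thesis
    proof (cases "tail G e = w")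
      case True
      have a: "awalk v' (\<nu> @ [e]) (head G e)" by (rule awalk_snoc[OF word(2) e True])
      have h: "awalk (head G e) [] (head G e)" using e by (simp add: awalk_simps)
      have "?b \<otimes> S e = path_elem (head G e) (\<nu> @ [e])" using path_elem_snoc[OF word(2) e True] by simp
      moreover have "P (head G e) \<otimes> star A (path_elem (head G e) (\<nu> @ [e])) = star A (path_elem (head G e) (\<nu> @ [e]))"
        using arg_cong[OF path_elem_range[OF a], of "star A"] path_elem_closed[OF a] e by (simp add: star_mult P_star)
      ultimately show ?thesis using path_span.word[OF h a] unfolding q by simp
    next
      case False
      have "?b \<otimes> S e = (?b \<otimes> P w) \<otimes> (P (tail G e) \<otimes> S e)"
        using path_elem_range[OF word(2)] P_S[OF e] by simp
      also have "\<dots> = ?b \<otimes> ((P w \<otimes> P (tail G e)) \<otimes> S e)" using c w e by (simp add: m_assoc)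
      also have "\<dots> = \<zero>" using P_orth[OF w, of "tail G e"] False e c by simp
      finally show ?thesis unfolding q using path_span.zero by simp
    qed
  next
    case (Cons f \<kappa>)
    then have f: "f \<in> arcs G" "awalk (head G f) \<kappa> w" using word(1) by (auto simp: awalk_simps)
    note k = path_elem_closed[OF f(2)]
    have "star A (S e) \<otimes> (?a \<otimes> star A ?b) = ((star A (S e) \<otimes> S f) \<otimes> path_elem w \<kappa>) \<otimes> star A ?b"
      using Cons e f c k by (simp add: m_assoc)
    also have "\<dots> = (if e = f then path_elem w \<kappa> \<otimes> star A ?b else \<zero>)"
      using e f k c source_path_elem[OF f(2)] by (simp add: S_star_S S_orth)
    finally show ?thesis using path_span.word[OF f(2) word(2)] path_span.zero by simp
  qed
  show ?case using 1 2 3 by blast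
next
  case (add x y)
  then show ?case using path_span_closed by (simp add: r_distr path_span.add)
next
  case (smult x c)
  then show ?case using path_span_closed by (simp add: smult_mult_r path_span.smult)
qed (simp add: path_span.zero)

lemma path_span_dense: assumes a: "a \<in> carrier A" shows "\<exists>x. (\<forall>n. x n \<in> path_span) \<and> conv x a"
proof (rule dense[OF a])
  have fs: "finite J ==> (!!j. j \<in> J ==> f j \<in> path_span) ==> finsum A f J \<in> path_span" for f :: "'v => 'a" and J
  proof (induct J rule: finite_induct)
    case (insert j J)
    then have "f \<in> J \<rightarrow> carrier A" "f j \<in> carrier A" using path_span_closed by auto
    then show ?case using insert by (simp add: path_span.add)
  qed (simp add: path_span.zero)
  have "P v \<in> path_span" if "v \<in> verts G" for v
    using path_span.word[of v "[]" v v "[]"] that by (simp add: awalk_simps P_star P_idem)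
  then show "\<one> \<in> path_span" unfolding one_sum by (intro fs) auto
qed (use path_span_closed path_span_letter path_span.add path_span.smult in auto)

section \<open>Masses of the vertices under a trace\<close>

context
  fixes \<tau> assumes \<tau>: "tracial_functional \<tau>"
begin

definition mass :: "'v => real" where
  "mass v = Re (\<tau> (P v))"

lemma tf_P: "v \<in> verts G ==> \<tau> (P v) = of_real (mass v)" "v \<in> verts G ==> 0 \<le> mass v"
  using pf_pos[OF tracial_positive[OF \<tau>], of "P v"]
  by (auto simp: mass_def P_star P_idem complex_nonneg_Reals_iff complex_eq_iff)

text \<open>The trace property carries each arc around the product. The factor a is kept so that
  agreement of two traces at all heads passes to the tail, not only for the projections.\<close>

lemma tf_P_step:
  assumes v: "v \<in> verts G" "\<not> is_sink G v" and a: "a \<in> carrier A"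
  shows "\<tau> (P v \<otimes> a) = (\<Sum>e | e \<in> arcs G \<and> tail G e = v. \<tau> (P (head G e) \<otimes> (star A (S e) \<otimes> a \<otimes> S e)))"
proof -
  have "\<tau> (P v \<otimes> a) = \<tau> (finsum A (\<lambda>e. S e \<otimes> star A (S e) \<otimes> a) {e \<in> arcs G. tail G e = v})"
    unfolding P_sum[OF v] using a by (subst finsum_ldistr) auto
  also have "\<dots> = (\<Sum>e | e \<in> arcs G \<and> tail G e = v. \<tau> (S e \<otimes> star A (S e) \<otimes> a))"
    using a by (intro tf_finsum[OF \<tau>]) auto
  also have "\<dots> = (\<Sum>e | e \<in> arcs G \<and> tail G e = v. \<tau> (P (head G e) \<otimes> (star A (S e) \<otimes> a \<otimes> S e)))"
  proof (intro sum.cong refl)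
    fix e assume "e \<in> {e \<in> arcs G. tail G e = v}"
    then have e: "e \<in> arcs G" by simp
    have "\<tau> (S e \<otimes> star A (S e) \<otimes> a) = \<tau> (star A (S e) \<otimes> a \<otimes> S e)"
      using tracial[OF \<tau>, of "S e" "star A (S e) \<otimes> a"] e a by (simp add: m_assoc)
    also have "star A (S e) \<otimes> a \<otimes> S e = P (head G e) \<otimes> (star A (S e) \<otimes> a \<otimes> S e)"
      using head_star_S[OF e] e a by (simp add: m_assoc[symmetric])
    finally show "\<tau> (S e \<otimes> star A (S e) \<otimes> a) = \<tau> (P (head G e) \<otimes> (star A (S e) \<otimes> a \<otimes> S e))" .
  qed
  finally show ?thesis .
qed

lemma mass_step:
  assumes v: "v \<in> verts G" "\<not> is_sink G v"
  shows "mass v = (\<Sum>e | e \<in> arcs G \<and> tail G e = v. mass (head G e))"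
proof -
  have "\<tau> (P v) = (\<Sum>e | e \<in> arcs G \<and> tail G e = v. \<tau> (P (head G e)))"
    using tf_P_step[OF v one_closed] v by (auto simp: S_star_S P_idem intro!: sum.cong)
  then show ?thesis by (simp add: mass_def)
qed

lemma mass_two_arcs:
  assumes "e \<in> arcs G" "e' \<in> arcs G" "e \<noteq> e'" "tail G e = tail G e'"
  shows "mass (head G e) + mass (head G e') \<le> mass (tail G e)"
proof -
  have "(\<Sum>f\<in>{e, e'}. mass (head G f)) \<le> (\<Sum>f | f \<in> arcs G \<and> tail G f = tail G e. mass (head G f))"
    by (rule sum_mono2) (use assms tf_P(2) in auto)
  then show ?thesis using assms mass_step[of "tail G e"] not_sink[OF assms(1)] by simp
qed

lemma mass_mono: "leads v w ==> mass w \<le> mass v"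
proof -
  have "awalk v \<xi> w ==> mass w \<le> mass v" for \<xi>
  proof (induct \<xi> arbitrary: v)
    case (Cons e \<xi>)
    then have e: "e \<in> arcs G" "v = tail G e" "mass w \<le> mass (head G e)" by (auto simp: awalk_simps)
    have "(\<Sum>f\<in>{e}. mass (head G f)) \<le> (\<Sum>f | f \<in> arcs G \<and> tail G f = v. mass (head G f))"
      by (rule sum_mono2) (use e tf_P(2) in auto)
    then show ?case using e mass_step[of v] not_sink[OF e(1)] by simp
  qed (simp add: awalk_simps)
  then show "leads v w ==> ?thesis" by (auto simp: leads_to_def)
qed

text \<open>Some other arc f from the same tail returns to it. So the head of f has at least the
  mass of the tail, and the two heads together have at most that mass.\<close>

lemma mass_exit_arc:
  assumes e: "e \<in> arcs G" "recurrent (tail G e)" "\<not> leads (head G e) (tail G e)"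
  shows "mass (head G e) = 0"
proof -
  obtain f where f: "f \<in> arcs G" "tail G f = tail G e" "leads (head G f) (tail G e)"
    using e(2) by (auto simp: recurrent_def)
  then have "mass (head G e) + mass (head G f) \<le> mass (tail G e)" using e by (intro mass_two_arcs) auto
  then show ?thesis using mass_mono[OF f(3)] tf_P(2)[of "head G e"] e(1) by simp
qed

text \<open>Follow the path up to the arc on which it leaves the class of v; the head of that arc
  has mass 0, and mass does not increase along paths.\<close>

lemma mass_exit:
  assumes "recurrent v" "leads v w" "\<not> leads w v" shows "mass w = 0"
proof -
  have "awalk v \<xi> w ==> recurrent v ==> \<not> leads w v ==> mass w = 0" for \<xi>
  proof (induct \<xi> arbitrary: v)
    case Nil
    then show ?case by (auto simp: awalk_simps)
  next
    case (Cons e \<xi>)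
    then have e: "e \<in> arcs G" "v = tail G e" "awalk (head G e) \<xi> w" by (auto simp: awalk_simps)
    note l = arc_leads_to[OF e(1)]
    show ?case
    proof (cases "leads (head G e) v")
      case True
      then have "recurrent (head G e)" using recurrent_mutual[OF Cons(3)] e l by simp
      moreover have "\<not> leads w (head G e)" using True Cons(4) leads_to_trans by blast
      ultimately show ?thesis using Cons(1)[OF e(3)] by simp
    next
      case False
      then have "mass (head G e) = 0" using mass_exit_arc[OF e(1)] Cons(3) e(2) by simp
      then show ?thesis using mass_mono[OF awalk_leads_to[OF e(3)]] tf_P(2)[of w] e(3) by auto
    qed
  qed
  then show ?thesis using assms by (auto simp: leads_to_def)
qed

text \<open>Either v can be reached from a recurrent vertex outside its class, and
  \<open>mass_exit\<close> applies, or some vertex of the class has two arcs returning to v, so that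
  twice the mass of v is at most the mass of v.\<close>

lemma mass_nonterminal:
  assumes v: "v \<in> verts G" "is_sink G v \<or> recurrent v" "\<not> terminal v"
  shows "mass v = 0"
proof (cases "\<exists>w. recurrent w \<and> leads w v \<and> \<not> leads v w")
  case True
  then show ?thesis using mass_exit by blast
next
  case False
  then obtain e e' where e: "e \<in> arcs G" "e' \<in> arcs G" "tail G e = tail G e'" "leads v (tail G e)"
    "leads (head G e) v" "leads (head G e') v" "e \<noteq> e'"
    using v unfolding terminal_def by blast
  have "mass (head G e) + mass (head G e') \<le> mass (tail G e)" using e by (intro mass_two_arcs) auto
  moreover have "mass v \<le> mass (head G e)" "mass v \<le> mass (head G e')" "mass (tail G e) \<le> mass v"
    using e mass_mono by blast+
  ultimately show ?thesis using tf_P(2)[OF v(1)] by simp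
qed

lemma tf_mass_zero:
  assumes w: "w \<in> verts G" "mass w = 0" and a: "a \<in> carrier A"
  shows "\<tau> (P w \<otimes> a) = 0"
  using pf_null(1)[OF tracial_positive[OF \<tau>], of "P w" a] w a tf_P(1)[of w] by (simp add: P_star P_idem)

text \<open>By the trace property the word can be read in the corner at w, where the trace
  vanishes.\<close>

lemma tf_word_mass_zero:
  assumes "awalk v \<xi> w" "awalk v' \<nu> w" "mass w = 0"
  shows "\<tau> (path_elem w \<xi> \<otimes> star A (path_elem w \<nu>)) = 0"
proof -
  have w: "w \<in> verts G" using assms(1) by auto
  note c = path_elem_closed[OF assms(1)] path_elem_closed[OF assms(2)]
  have "P w \<otimes> star A (path_elem w \<nu>) = star A (path_elem w \<nu>)"
    using arg_cong[OF path_elem_range[OF assms(2)], of "star A"] c w by (simp add: star_mult P_star)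
  then have "\<tau> (path_elem w \<xi> \<otimes> star A (path_elem w \<nu>)) = \<tau> (P w \<otimes> (star A (path_elem w \<nu>) \<otimes> path_elem w \<xi>))"
    using tracial[OF \<tau>, of "path_elem w \<xi>" "star A (path_elem w \<nu>)"] c w by (simp add: m_assoc[symmetric])
  then show ?thesis using tf_mass_zero[OF w assms(3)] c by simp
qed

lemma tf_rotate:
  assumes "e \<in> arcs G" "awalk (head G e) \<xi> (tail G e)"
  shows "\<tau> (path_elem (tail G e) (e # \<xi>)) = \<tau> (path_elem (head G e) (\<xi> @ [e]))"
  using tracial[OF \<tau>, of "S e" "path_elem (tail G e) \<xi>"] assms path_elem_snoc[OF assms(2,1)] path_elem_closed[OF assms(2)] by simp

lemma tf_conjugate:
  assumes e: "e \<in> arcs G" and w: "awalk (head G e) \<xi> w" "awalk (head G e) \<nu> w"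
  shows "\<tau> (path_elem w (e # \<xi>) \<otimes> star A (path_elem w (e # \<nu>))) = \<tau> (path_elem w \<xi> \<otimes> star A (path_elem w \<nu>))"
proof -
  note c = path_elem_closed[OF w(1)] path_elem_closed[OF w(2)]
  have "star A (path_elem w \<nu>) \<otimes> P (head G e) = star A (path_elem w \<nu>)"
    using arg_cong[OF source_path_elem[OF w(2)], of "star A"] c e by (simp add: star_mult P_star)
  then have "path_elem w \<xi> \<otimes> star A (path_elem w \<nu>) \<otimes> star A (S e) \<otimes> S e = path_elem w \<xi> \<otimes> star A (path_elem w \<nu>)"
    using c e by (simp add: m_assoc S_star_S)
  moreover have "path_elem w (e # \<xi>) \<otimes> star A (path_elem w (e # \<nu>)) =
      S e \<otimes> (path_elem w \<xi> \<otimes> star A (path_elem w \<nu>) \<otimes> star A (S e))"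
    using c e by (simp add: star_mult m_assoc)
  ultimately show ?thesis
    using tracial[OF \<tau>, of "S e" "path_elem w \<xi> \<otimes> star A (path_elem w \<nu>) \<otimes> star A (S e)"] c e by simp
qed

end

text \<open>R represents the classes of terminal vertices. Agreement on closed walks at R is spread
  over each terminal class, where only one arc per vertex carries mass; the other sinks and
  recurrent vertices have mass 0, and the remaining vertices follow from their heads.\<close>

lemma tracial_functional_eqI:
  assumes t: "tracial_functional \<tau>1" "tracial_functional \<tau>2"
    and R: "!!r. r \<in> R ==> terminal r" "!!v. terminal v ==> \<exists>r\<in>R. leads v r \<and> leads r v"
    and agree: "!!r \<kappa>. r \<in> R ==> awalk r \<kappa> r ==> \<tau>1 (path_elem r \<kappa>) = \<tau>2 (path_elem r \<kappa>)"
    and a: "a \<in> carrier A"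
  shows "\<tau>1 a = \<tau>2 a"
proof -
  \<comment> \<open>Agreement on the whole right ideal of v, not just at \<open>P v\<close>, since
    this is what passes from heads to tails.\<close>
  define Q where "Q v \<longleftrightarrow> (\<forall>a\<in>carrier A. \<tau>1 (P v \<otimes> a) = \<tau>2 (P v \<otimes> a))" for v
  \<comment> \<open>At a vertex of a terminal class only one arc stays in the class. The others are
    exits of a loop, so their heads have mass 0.\<close>
  have other_arc: "mass \<tau> (head G e') = 0"
    if "r \<in> R" "tracial_functional \<tau>" "e \<in> arcs G" "leads (head G e) r" "leads r (tail G e)"
      "e' \<in> arcs G" "tail G e' = tail G e" "e' \<noteq> e" for r \<tau> e e'
  proof -
    have "\<not> leads (head G e') r" using terminal_unique[OF R(1)[OF that(1)], of e e'] that by auto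
    then have "\<not> leads (head G e') (tail G e')"
      using leads_to_trans[OF _ leads_to_trans[OF arc_leads_to[OF that(3)] that(4)]] that(7) by metis
    moreover have "recurrent (tail G e')"
      unfolding recurrent_def that(7) using that(3) leads_to_trans[OF that(4,5)] by blast
    ultimately show ?thesis using mass_exit_arc[OF that(2,6)] by blast
  qed
  have Qnull: "Q v" if "v \<in> verts G" "mass \<tau>1 v = 0" "mass \<tau>2 v = 0" for v
    unfolding Q_def using tf_mass_zero[OF t(1) that(1,2)] tf_mass_zero[OF t(2) that(1,3)] by simp
  have Qstep: "Q v" if v: "v \<in> verts G" "\<not> is_sink G v" and h: "!!e. e \<in> arcs G ==> tail G e = v ==> Q (head G e)" for v
    unfolding Q_def
  proof
    fix a assume a: "a \<in> carrier A"
    show "\<tau>1 (P v \<otimes> a) = \<tau>2 (P v \<otimes> a)"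
      unfolding tf_P_step[OF t(1) v a] tf_P_step[OF t(2) v a]
      by (rule sum.cong) (use h a in \<open>auto simp: Q_def\<close>)
  qed
  \<comment> \<open>A closed walk anywhere in the class is rotated arc by arc along the path
    \<alpha> until it starts at r; it has to follow this path because each vertex has only one
    returning arc.\<close>
  have closed: "awalk w \<alpha> r ==> leads r w ==> awalk w \<kappa> w ==> \<tau>1 (path_elem w \<kappa>) = \<tau>2 (path_elem w \<kappa>)"
    if r: "r \<in> R" for r w \<alpha> \<kappa>
  proof (induct \<alpha> arbitrary: w \<kappa>)
    case Nil
    then show ?case using agree[OF r] by (simp add: awalk_simps)
  next
    case (Cons e \<alpha>)
    then have e: "e \<in> arcs G" "w = tail G e" "awalk (head G e) \<alpha> r" by (auto simp: awalk_simps)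
    have rh: "leads r (head G e)" using leads_to_trans[OF Cons(3)] arc_leads_to[OF e(1)] e(2) by simp
    note IH = Cons(1)[OF e(3) rh]
    have hr: "leads (head G e) r" using awalk_leads_to[OF e(3)] .
    show ?case
    proof (cases \<kappa>)
      \<comment> \<open>The empty walk cannot be rotated; here mass is conserved along e because all
        other arcs have heads of mass 0.\<close>
      case Nil
      have "mass \<tau> w = mass \<tau> (head G e)" if \<tau>: "tracial_functional \<tau>" for \<tau>
      proof -
        have "mass \<tau> w = (\<Sum>f | f \<in> arcs G \<and> tail G f = w. mass \<tau> (head G f))"
          using mass_step[OF \<tau>, of w] e not_sink[OF e(1)] by simp
        also have "\<dots> = (\<Sum>f\<in>{e}. mass \<tau> (head G f))"
          by (rule sum.mono_neutral_right) (use e other_arc[OF r \<tau> e(1) hr] Cons(3) in auto)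
        finally show ?thesis by simp
      qed
      then have m: "mass \<tau>1 w = mass \<tau>1 (head G e)" "mass \<tau>2 w = mass \<tau>2 (head G e)" using t by auto
      have w: "w \<in> verts G" and h: "head G e \<in> verts G" using e by auto
      have "\<tau>1 (P (head G e)) = \<tau>2 (P (head G e))" using IH[of "[]"] h by (simp add: awalk_simps)
      then show ?thesis using m tf_P(1)[OF t(1) w] tf_P(1)[OF t(2) w] tf_P(1)[OF t(1) h] tf_P(1)[OF t(2) h]
        by (simp add: Nil)
    next
      case (Cons e' \<kappa>')
      then have e': "e' \<in> arcs G" "tail G e' = w" "awalk (head G e') \<kappa>' w"
        using \<open>awalk w \<kappa> w\<close> by (auto simp: awalk_simps)
      have wr: "leads w r" using awalk_leads_to[OF \<open>awalk w (e # \<alpha>) r\<close>] .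
      have "leads (head G e') r" using awalk_leads_to[OF e'(3)] wr leads_to_trans by blast
      then have "e' = e" using terminal_unique[OF R(1)[OF r] e'(1) e(1)] e' e hr \<open>leads r w\<close> by simp
      then have k: "\<kappa> = e # \<kappa>'" "awalk (head G e) \<kappa>' (tail G e)" using Cons e' e by auto
      have "awalk (head G e) (\<kappa>' @ [e]) (head G e)" by (rule awalk_snoc[OF k(2) e(1) refl])
      then show ?thesis using IH tf_rotate[OF t(1) e(1) k(2)] tf_rotate[OF t(2) e(1) k(2)] k(1) e(2) by simp
    qed
  qed
  \<comment> \<open>Both paths start with the same returning arc, which the trace property removes.
    When one of them is exhausted, the other is a closed walk.\<close>
  have pair: "awalk v \<xi> w ==> awalk v \<nu> w ==> leads r v ==> leads w r ==>
    \<tau>1 (path_elem w \<xi> \<otimes> star A (path_elem w \<nu>)) = \<tau>2 (path_elem w \<xi> \<otimes> star A (path_elem w \<nu>))"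
    if r: "r \<in> R" for r v w \<xi> \<nu>
  proof (induct \<xi> arbitrary: v \<nu>)
    case Nil
    then have w: "v = w" "w \<in> verts G" by (auto simp: awalk_simps)
    obtain \<alpha> where \<alpha>: "awalk w \<alpha> r" using Nil(4) by (auto simp: leads_to_def)
    have n: "awalk w \<nu> w" using Nil w by simp
    have "\<tau>1 (path_elem w \<nu>) = \<tau>2 (path_elem w \<nu>)" using closed[OF r \<alpha>] Nil(3) n w by simp
    moreover have "P w \<otimes> star A (path_elem w \<nu>) = star A (path_elem w \<nu>)"
      using arg_cong[OF path_elem_range[OF n], of "star A"] path_elem_closed[OF n] w by (simp add: star_mult P_star)
    ultimately show ?case
      using pf_hermitian[OF tracial_positive[OF t(1)] path_elem_closed[OF n]]
        pf_hermitian[OF tracial_positive[OF t(2)] path_elem_closed[OF n]] by simp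
  next
    case (Cons e \<xi>)
    then have e: "e \<in> arcs G" "v = tail G e" "awalk (head G e) \<xi> w" by (auto simp: awalk_simps)
    show ?case
    proof (cases \<nu>)
      case Nil
      then have w: "v = w" "w \<in> verts G" using Cons(3) by (auto simp: awalk_simps)
      obtain \<alpha> where \<alpha>: "awalk w \<alpha> r" using Cons(5) by (auto simp: leads_to_def)
      have n: "awalk w (e # \<xi>) w" using Cons(2) w by simp
      have "\<tau>1 (path_elem w (e # \<xi>)) = \<tau>2 (path_elem w (e # \<xi>))" by (rule closed[OF r \<alpha> _ n]) (use Cons(4) w in simp)
      then show ?thesis using path_elem_range[OF n] w by (simp add: Nil P_star)
    next
      case (Cons f \<nu>')
      then have f: "f \<in> arcs G" "tail G f = tail G e" "awalk (head G f) \<nu>' w"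
        using \<open>awalk v \<nu> w\<close> e by (auto simp: awalk_simps)
      have h: "leads (head G e) r" "leads (head G f) r"
        using awalk_leads_to[OF e(3)] awalk_leads_to[OF f(3)] \<open>leads w r\<close> leads_to_trans by blast+
      then have fe: "f = e" using terminal_unique[OF R(1)[OF r] f(1) e(1) f(2)] f(2) e(2) \<open>leads r v\<close> by simp
      have rh: "leads r (head G e)" using leads_to_trans[OF \<open>leads r v\<close>] arc_leads_to[OF e(1)] e(2) by simp
      have f3: "awalk (head G e) \<nu>' w" using f(3) fe by simp
      show ?thesis using Cons.hyps[OF e(3) f3 rh \<open>leads w r\<close>]
        tf_conjugate[OF t(1) e(1,3) f3] tf_conjugate[OF t(2) e(1,3) f3] unfolding Cons fe by simp
    qed
  qed
  have Qroot: "Q r" if r: "r \<in> R" for r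
  proof -
    have rv: "r \<in> verts G" using R(1)[OF r] by (simp add: terminal_def)
    have span: "x \<in> path_span ==> \<tau>1 (P r \<otimes> x) = \<tau>2 (P r \<otimes> x)" for x
    proof (induct rule: path_span.induct)
      case (word v \<xi> w v' \<nu>)
      let ?a = "path_elem w \<xi>" and ?b = "path_elem w \<nu>"
      note c = path_elem_closed[OF word(1)] path_elem_closed[OF word(2)]
      have w: "w \<in> verts G" "v' \<in> verts G" using word by auto
      have "P r \<otimes> (?a \<otimes> star A ?b) = (P r \<otimes> ?a) \<otimes> star A ?b" using rv c by (simp add: m_assoc)
      then have q: "P r \<otimes> (?a \<otimes> star A ?b) = (if r = v then ?a \<otimes> star A ?b else \<zero>)"
        using source_path_elem[OF word(1)] source_path_elem_orth[OF word(1) rv] c by auto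
      have "\<tau>1 (?a \<otimes> star A ?b) = \<tau>2 (?a \<otimes> star A ?b)" if v: "v = r"
      proof (cases "v' = r")
        \<comment> \<open>The second path starts at another vertex, so the product in the opposite
          order is 0.\<close>
        case False
        have "star A ?b \<otimes> ?a = star A (P v' \<otimes> ?b) \<otimes> (P r \<otimes> ?a)"
          using source_path_elem[OF word(1)] source_path_elem[OF word(2)] v by simp
        also have "\<dots> = star A ?b \<otimes> ((P v' \<otimes> P r) \<otimes> ?a)" using c w rv by (simp add: star_mult P_star m_assoc)
        also have "\<dots> = \<zero>" using P_orth[OF w(2) rv False] c by simp
        finally show ?thesis
          using tracial[OF t(1), of ?a "star A ?b"] tracial[OF t(2), of ?a "star A ?b"] c tf_zero[OF t(1)] tf_zero[OF t(2)] by simp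
      next
        case True
        show ?thesis
        proof (cases "leads w r")
          case True
          then show ?thesis using pair[OF r word(1)] word(2) v \<open>v' = r\<close> rv by simp
        next
          \<comment> \<open>The word ends outside the class of r. Then r is no sink, and the end has
            mass 0 under both traces.\<close>
          case False
          have "recurrent r"
          proof (rule ccontr)
            assume "\<not> recurrent r"
            then have "is_sink G r" using R(1)[OF r] by (simp add: terminal_def)
            then have "w = r" using sink_leads_to[OF _ word(1)] v by simp
            then show False using False leads_to_refl[OF rv] by simp
          qed
          then have "mass \<tau>1 w = 0" "mass \<tau>2 w = 0"
            using mass_exit[OF t(1)] mass_exit[OF t(2)] awalk_leads_to[OF word(1)] v False by auto
          then show ?thesis using tf_word_mass_zero[OF t(1) word] tf_word_mass_zero[OF t(2) word] by simp
        qed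
      qed
      then show ?case unfolding q using tf_zero[OF t(1)] tf_zero[OF t(2)] by simp
    next
      case zero
      then show ?case using rv tf_zero[OF t(1)] tf_zero[OF t(2)] by simp
    next
      case (add x y)
      then show ?case using rv path_span_closed by (simp add: r_distr tf_add[OF t(1)] tf_add[OF t(2)])
    next
      case (smult x c)
      then show ?case using rv path_span_closed by (simp add: smult_mult_r tf_smult[OF t(1)] tf_smult[OF t(2)])
    qed
    show ?thesis unfolding Q_def
    proof
      fix a assume a: "a \<in> carrier A"
      obtain x where x: "!!n. x n \<in> path_span" "conv x a" using path_span_dense[OF a] by blast
      have cv: "conv (\<lambda>n. P r \<otimes> x n) (P r \<otimes> a)" by (rule conv_mult[OF conv_const x(2)]) (use rv in simp)
      have "(\<lambda>n. \<tau>1 (P r \<otimes> x n)) \<longlonglongrightarrow> \<tau>2 (P r \<otimes> a)"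
        unfolding span[OF x(1)] by (rule tf_conv[OF t(2) cv])
      then show "\<tau>1 (P r \<otimes> a) = \<tau>2 (P r \<otimes> a)" using tf_conv[OF t(1) cv] LIMSEQ_unique by blast
    qed
  qed
  have Qclass: "awalk v \<xi> r ==> leads r v ==> Q v" if r: "r \<in> R" for r v \<xi>
  proof (induct \<xi> arbitrary: v)
    case Nil
    then show ?case using Qroot[OF r] by (simp add: awalk_simps)
  next
    case (Cons e \<xi>)
    then have e: "e \<in> arcs G" "v = tail G e" "awalk (head G e) \<xi> r" by (auto simp: awalk_simps)
    have rh: "leads r (head G e)" using leads_to_trans[OF Cons(3)] arc_leads_to[OF e(1)] e(2) by simp
    have hr: "leads (head G e) r" using awalk_leads_to[OF e(3)] .
    show ?case
    proof (rule Qstep)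
      fix e' assume e': "e' \<in> arcs G" "tail G e' = v"
      show "Q (head G e')"
      proof (cases "e' = e")
        case True
        then show ?thesis using Cons(1)[OF e(3) rh] by simp
      next
        case False
        show ?thesis
          by (rule Qnull) (use other_arc[OF r _ e(1) hr _ e'(1)] t False e e' Cons(3) in auto)
      qed
    qed (use e not_sink in auto)
  qed
  \<comment> \<open>Induction on the number of reachable vertices, which drops along every arc from
    a vertex that is not recurrent.\<close>
  have Qall: "Q v" if "v \<in> verts G" for v
    using that
  proof (induct "card {w. leads v w}" arbitrary: v rule: less_induct)
    case less
    show ?case
    proof (cases "is_sink G v \<or> recurrent v")
      case True
      show ?thesis
      proof (cases "terminal v")
        case True
        then obtain r where "r \<in> R" "leads v r" "leads r v" using R(2) by blast
        then show ?thesis using Qclass by (auto simp: leads_to_def)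
      next
        case False
        show ?thesis by (rule Qnull[OF less(2)]; rule mass_nonterminal) (use t less(2) True False in auto)
      qed
    next
      case False
      show ?thesis
      proof (rule Qstep[OF less(2)])
        fix e assume e: "e \<in> arcs G" "tail G e = v"
        have "{w. leads (head G e) w} \<subset> {w. leads v w}"
        proof (rule psubsetI)
          show "{w. leads (head G e) w} \<subseteq> {w. leads v w}"
            using arc_leads_to[OF e(1)] leads_to_trans e(2) by blast
          have "v \<notin> {w. leads (head G e) w}" using False e by (auto simp: recurrent_def)
          moreover have "v \<in> {w. leads v w}" using less(2) by simp
          ultimately show "{w. leads (head G e) w} \<noteq> {w. leads v w}" by metis
        qed
        moreover have "finite {w. leads v w}"
          by (rule finite_subset[of _ "verts G"]) (use leads_to_verts in auto)
        ultimately have "card {w. leads (head G e) w} < card {w. leads v w}" by (intro psubset_card_mono)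
        then show "Q (head G e)" using less(1) e by simp
      qed (use False in simp)
    qed
  qed
  have "a = finsum A (\<lambda>v. P v \<otimes> a) (verts G)"
    using a l_one[OF a] unfolding one_sum by (subst (asm) finsum_ldistr) auto
  then have "\<tau>1 a = \<tau>1 (finsum A (\<lambda>v. P v \<otimes> a) (verts G))" "\<tau>2 a = \<tau>2 (finsum A (\<lambda>v. P v \<otimes> a) (verts G))" by simp_all
  moreover have "\<tau> (finsum A (\<lambda>v. P v \<otimes> a) (verts G)) = (\<Sum>v\<in>verts G. \<tau> (P v \<otimes> a))"
    if "tracial_functional \<tau>" for \<tau>
    using a by (intro tf_finsum[OF that]) auto
  moreover have "(\<Sum>v\<in>verts G. \<tau>1 (P v \<otimes> a)) = (\<Sum>v\<in>verts G. \<tau>2 (P v \<otimes> a))"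
    by (rule sum.cong) (use Qall a in \<open>auto simp: Q_def\<close>)
  ultimately show ?thesis using t by simp
qed

end

section \<open>The quotient onto the graph of a terminal vertex\<close>

context fin_digraph
begin

text \<open>In the class of a terminal vertex each vertex has a unique arc that returns, so a closed
  walk begins like the path \<xi> to the root. Rotating it by one arc shortens \<xi>.\<close>

lemma cycle_through_root:
  assumes r: "terminal r"
  shows "awalk v \<xi> r ==> leads r v ==> awalk v \<kappa> v ==> \<kappa> \<noteq> [] ==> \<exists>e\<in>set \<kappa>. tail G e = r"
proof (induct \<xi> arbitrary: v \<kappa>)
  case Nil
  then show ?case by (cases \<kappa>) (auto simp: awalk_simps)
next
  case (Cons e \<xi>)
  obtain e' \<kappa>' where k: "\<kappa> = e' # \<kappa>'" using Cons(5) by (cases \<kappa>) auto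
  have e: "e \<in> arcs G" "v = tail G e" "awalk (head G e) \<xi> r"
    and e': "e' \<in> arcs G" "tail G e' = tail G e" "awalk (head G e') \<kappa>' v"
    using Cons k by (auto simp: awalk_simps)
  have "leads (head G e') r"
    using leads_to_trans[OF awalk_leads_to[OF e'(3)] awalk_leads_to[OF Cons(2)]] .
  then have ee: "e' = e"
    using terminal_unique[OF r e'(1) e(1) e'(2)] Cons(3) e e'(2) awalk_leads_to[OF e(3)] by simp
  have kv: "awalk (head G e) \<kappa>' v" using e'(3) ee by simp
  have "\<exists>e\<in>set (\<kappa>' @ [e]). tail G e = r"
  proof (rule Cons(1)[OF e(3)])
    show "leads r (head G e)" using leads_to_trans[OF Cons(3)] arc_leads_to[OF e(1)] e(2) by simp
    show "awalk (head G e) (\<kappa>' @ [e]) (head G e)" by (rule awalk_snoc[OF kv e(1)]) (simp add: e(2))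
  qed simp
  then show ?case by (auto simp: k ee)
qed

text \<open>At each vertex before the root both walks must take the only returning arc.\<close>

lemma awalk_avoiding_unique:
  assumes r: "terminal r"
  shows "awalk v \<xi> r ==> \<forall>e\<in>set \<xi>. tail G e \<noteq> r ==> awalk v \<nu> r ==> \<forall>e\<in>set \<nu>. tail G e \<noteq> r ==> leads r v ==> \<xi> = \<nu>"
proof (induct \<xi> arbitrary: v \<nu>)
  case Nil
  then show ?case by (cases \<nu>) (auto simp: awalk_simps)
next
  case (Cons e \<xi>)
  then obtain e' \<nu>' where n: "\<nu> = e' # \<nu>'" by (cases \<nu>) (auto simp: awalk_simps)
  have e: "e \<in> arcs G" "v = tail G e" "awalk (head G e) \<xi> r"
    and e': "e' \<in> arcs G" "tail G e' = tail G e" "awalk (head G e') \<nu>' r"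
    using Cons n by (auto simp: awalk_simps)
  have ee: "e' = e"
    using terminal_unique[OF r e'(1) e(1) e'(2)] Cons(6) e e'(2) awalk_leads_to[OF e(3)] awalk_leads_to[OF e'(3)] by simp
  have "leads r (head G e)" using leads_to_trans[OF Cons(6)] arc_leads_to[OF e(1)] e(2) by simp
  then show ?case using Cons(1)[OF e(3), of \<nu>'] Cons(3,5) e'(3) unfolding n ee by simp
qed

lemma first_visit: "awalk v \<xi> r ==> \<exists>\<nu>. awalk v \<nu> r \<and> (\<forall>e\<in>set \<nu>. tail G e \<noteq> r)"
proof (induct \<xi> arbitrary: v)
  case Nil
  then show ?case by (intro exI[of _ "[]"]) auto
next
  case (Cons e \<xi>)
  then have e: "e \<in> arcs G" "v = tail G e" "awalk (head G e) \<xi> r" by (auto simp: awalk_simps)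
  obtain \<nu> where n: "awalk (head G e) \<nu> r" "\<forall>e\<in>set \<nu>. tail G e \<noteq> r" using Cons(1)[OF e(3)] by blast
  show ?case
  proof (cases "tail G e = r")
    case True
    then show ?thesis using e by (intro exI[of _ "[]"]) (auto simp: awalk_simps)
  next
    case False
    then show ?thesis using e n by (intro exI[of _ "e # \<nu>"]) (auto simp: awalk_simps)
  qed
qed

text \<open>A repeated vertex would be recurrent and lead to r, hence lie in the class of r, and the
  cycle between its two visits would pass through r. The lengths are thereby bounded.\<close>

lemma awalk_avoiding_distinct:
  assumes r: "terminal r"
  shows "awalk v \<xi> r ==> \<forall>e\<in>set \<xi>. tail G e \<noteq> r ==> distinct (map (tail G) \<xi>)"
proof (induct \<xi> arbitrary: v)
  case (Cons e \<xi>)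
  then have e: "e \<in> arcs G" "v = tail G e" "awalk (head G e) \<xi> r" by (auto simp: awalk_simps)
  have "tail G f \<noteq> tail G e" if f: "f \<in> set \<xi>" for f
  proof
    assume fe: "tail G f = tail G e"
    obtain \<xi>1 \<xi>2 where s: "\<xi> = \<xi>1 @ f # \<xi>2" using split_list[OF f] by blast
    then obtain y where y: "awalk (head G e) \<xi>1 y" "awalk y (f # \<xi>2) r"
      using e(3) by (auto simp: awalk_append_iff)
    then have yv: "y = v" using fe e by (auto simp: awalk_simps)
    have c: "awalk v (e # \<xi>1) v" using y(1) e yv by (simp add: awalk_simps)
    have "recurrent v" unfolding recurrent_def using e awalk_leads_to[OF y(1)] yv by auto
    then have "leads r v" using r awalk_leads_to[OF Cons(2)] unfolding terminal_def by blast
    then have "\<exists>e\<in>set (e # \<xi>1). tail G e = r" using cycle_through_root[OF r Cons(2) _ c] by simp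
    then show False using Cons(3) s by auto
  qed
  then have "tail G e \<notin> tail G ` set \<xi>" by (metis imageE)
  then show ?case using Cons(1)[OF e(3)] Cons(3) by simp
qed simp

end

locale terminal_vertex = fin_digraph G for G :: "('v, 'e) pre_digraph" +
  fixes r :: 'v
  assumes r: "terminal r"
begin

abbreviation X :: "'v set" where "X \<equiv> back_closure G {r}"
abbreviation H :: "('v, 'e) pre_digraph" where "H \<equiv> closure_graph G {r}"

lemma r_vert: "r \<in> verts G"
  using r by (simp add: terminal_def)

lemma X_iff: "v \<in> X \<longleftrightarrow> leads v r"
  using leads_to_verts by (auto simp: back_closure_def)

lemma r_X [simp]: "r \<in> X"
  by (simp add: X_iff r_vert)

lemma X_verts: "X \<subseteq> verts G"
  by (auto simp: back_closure_def)

lemma X_pred: "e \<in> arcs G ==> head G e \<in> X ==> tail G e \<in> X"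
  using arc_leads_to leads_to_trans by (simp add: X_iff) blast

text \<open>X is closed under predecessors, so the head alone decides; this is also the condition in
  the definition of the quotient map.\<close>

lemma H_arcs: "e \<in> arcs H \<longleftrightarrow> e \<in> arcs G \<and> head G e \<in> X"
  using X_pred by auto

sublocale H: fin_digraph H
proof -
  interpret H: wf_digraph H by (rule wellformed_induce_subgraph)
  show "fin_digraph H" by unfold_locales (auto intro: finite_subset[OF X_verts])
qed

lemma awalk_H: "w \<in> X ==> H.awalk v \<xi> w \<longleftrightarrow> awalk v \<xi> w"
proof (induct \<xi> arbitrary: v)
  case Nil
  then show ?case using X_verts by (auto simp: awalk_simps H.awalk_simps)
next
  case (Cons e \<xi>)
  have "awalk (head G e) \<xi> w ==> head G e \<in> X"
    using Cons(2) awalk_leads_to leads_to_trans by (simp add: X_iff) blast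
  then show ?case using Cons X_pred by (auto simp: awalk_simps H.awalk_simps)
qed

lemma leads_to_H: "w \<in> X ==> leads_to H v w \<longleftrightarrow> leads v w"
  by (simp add: leads_to_def awalk_H)

text \<open>Passing to H creates no new sinks: each vertex of X keeps a path to r, and a recurrent r
  keeps the arc of its loop.\<close>

lemma sink_H: assumes v: "v \<in> X" shows "is_sink H v \<longleftrightarrow> is_sink G v"
proof
  assume s: "is_sink H v"
  obtain \<xi> where \<xi>: "awalk v \<xi> r" using v by (auto simp: X_iff leads_to_def)
  have "\<xi> = []" using H.sink_leads_to[OF s, of \<xi> r] \<xi> by (simp add: awalk_H)
  then have "v = r" using \<xi> by (simp add: awalk_simps)
  moreover have "\<not> recurrent r"
  proof
    assume "recurrent r"
    then obtain e where e: "e \<in> arcs G" "tail G e = r" "leads (head G e) r" by (auto simp: recurrent_def)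
    then have "e \<in> arcs H" by (simp add: H_arcs X_iff r_vert)
    then show False using s H.not_sink[of e] e \<open>v = r\<close> by simp
  qed
  ultimately show "is_sink G v" using r by (simp add: terminal_def)
qed (use v in \<open>auto simp: is_sink_def\<close>)

lemma recurrent_H: "v \<in> X ==> H.recurrent v \<longleftrightarrow> recurrent v"
  unfolding recurrent_def H.recurrent_def
  using leads_to_H[of v] leads_to_trans[of _ v r] by (auto simp: X_iff H_arcs intro: X_pred)

lemma terminal_H: "H.terminal r"
proof -
  have 1: "\<forall>v. H.recurrent v --> leads_to H v r --> leads_to H r v"
  proof (intro allI impI)
    fix v assume v: "H.recurrent v" "leads_to H v r"
    then have "v \<in> X" by (simp add: leads_to_H[OF r_X] X_iff[symmetric])
    then show "leads_to H r v" using v r recurrent_H leads_to_H r_X unfolding terminal_def by blast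
  qed
  have 2: "e = e'" if "e \<in> arcs H" "e' \<in> arcs H" "tail G e = tail G e'" "leads_to H r (tail G e)"
    "leads_to H (head G e) r" "leads_to H (head G e') r" for e e'
    using that terminal_unique[OF r, of e e'] leads_to_H[of "tail G e" r] leads_to_H[of r] X_pred[of e] by (auto simp: X_iff)
  have 3: "is_sink H r \<or> H.recurrent r" using sink_H recurrent_H r_X r unfolding terminal_def by blast
  show ?thesis
    unfolding H.terminal_def using 1 2 3 by (simp del: induce_subgraph_arcs)
qed

lemma finite_avoiding: "finite {\<xi>. \<exists>v. awalk v \<xi> r \<and> (\<forall>e\<in>set \<xi>. tail G e \<noteq> r)}"
proof (rule finite_subset)
  show "{\<xi>. \<exists>v. awalk v \<xi> r \<and> (\<forall>e\<in>set \<xi>. tail G e \<noteq> r)} \<subseteq> {\<xi>. set \<xi> \<subseteq> arcs G \<and> length \<xi> \<le> card (arcs G)}"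
  proof clarify
    fix \<xi> v assume a: "awalk v \<xi> r" "\<forall>e\<in>set \<xi>. tail G e \<noteq> r"
    have "distinct \<xi>" using awalk_avoiding_distinct[OF r a] by (simp add: distinct_map)
    moreover have s: "set \<xi> \<subseteq> arcs G" using a(1) by (simp add: awalk_def)
    ultimately have "length \<xi> \<le> card (arcs G)" using card_mono[OF finite_arcs s] by (simp add: distinct_card)
    then show "set \<xi> \<subseteq> arcs G \<and> length \<xi> \<le> card (arcs G)" using s by simp
  qed
qed (rule finite_lists_length_le[OF finite_arcs])

text \<open>The arcs from r that survive in H return to r, so there is at most one of them, and the
  way back is unique by \<open>awalk_avoiding_unique\<close>.\<close>

sublocale rooted: rooted_digraph H r
proof
  show "r \<in> verts H" by simp
  show "\<exists>\<xi>. H.awalk v \<xi> r" if "v \<in> verts H" for v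
    using that by (simp add: awalk_H[OF r_X]) (simp add: X_iff leads_to_def)
  show "finite {\<xi>. \<exists>v. H.awalk v \<xi> r \<and> (\<forall>e\<in>set \<xi>. tail H e \<noteq> r)}"
    using finite_avoiding by (simp add: awalk_H)
  show "{e \<in> arcs H. tail H e = r} = {} \<or> (\<exists>e \<xi>. {e \<in> arcs H. tail H e = r} = {e} \<and>
         {\<xi>. H.awalk (head H e) \<xi> r \<and> (\<forall>e\<in>set \<xi>. tail H e \<noteq> r)} = {\<xi>})"
  proof (cases "is_sink G r")
    case True
    then show ?thesis by (auto simp: is_sink_def)
  next
    case False
    then obtain e where e: "e \<in> arcs G" "tail G e = r" "leads (head G e) r"
      using r by (auto simp: terminal_def recurrent_def)
    have rr: "leads r r" using r_vert by simp
    have rh: "leads r (head G e)" using arc_leads_to[OF e(1)] e(2) by simp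
    have 1: "{e \<in> arcs H. tail H e = r} = {e}"
    proof (rule Set.set_eqI, rule iffI)
      fix e'
      assume "e' \<in> {e \<in> arcs H. tail H e = r}"
      then have e': "e' \<in> arcs H" "tail G e' = r" by simp_all
      have a: "e' \<in> arcs G" "leads (head G e') r" using e'(1) unfolding H_arcs X_iff by simp_all
      have "e' = e" by (rule terminal_unique[OF r a(1) e(1)]) (simp_all add: e e' a rr)
      then show "e' \<in> {e}" by simp
    next
      fix e' assume "e' \<in> {e}"
      then have "e' = e" by simp
      moreover have "e \<in> arcs H" by (simp only: H_arcs X_iff) (simp add: e)
      ultimately show "e' \<in> {e \<in> arcs H. tail H e = r}" using e(2) by simp
    qed
    obtain \<alpha> where "awalk (head G e) \<alpha> r" using e(3) by (auto simp: leads_to_def)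
    from first_visit[OF this] obtain \<xi> where \<xi>: "awalk (head G e) \<xi> r" "\<forall>e\<in>set \<xi>. tail G e \<noteq> r"
      by blast
    have "{\<xi>. H.awalk (head H e) \<xi> r \<and> (\<forall>e\<in>set \<xi>. tail H e \<noteq> r)} = {\<xi>}"

    proof (rule Set.set_eqI, rule iffI)
      fix \<nu> assume "\<nu> \<in> {\<xi>. H.awalk (head H e) \<xi> r \<and> (\<forall>e\<in>set \<xi>. tail H e \<noteq> r)}"
      then have "awalk (head G e) \<nu> r" "\<forall>e\<in>set \<nu>. tail G e \<noteq> r" by (simp_all add: awalk_H[OF r_X])
      then show "\<nu> \<in> {\<xi>}" using awalk_avoiding_unique[OF r _ _ \<xi> rh] by simp
    qed (use \<xi> in \<open>simp add: awalk_H[OF r_X]\<close>)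
    show ?thesis by (rule disjI2, intro exI conjI) fact+
  qed
qed

lemma has_loop_iff: "rooted.has_loop \<longleftrightarrow> \<not> is_sink G r"
  using sink_H[OF r_X] by (auto simp: rooted.has_loop_def is_sink_def)

text \<open>\<open>I\<close> holds bare lists of arcs, the counts in the theorem pairs with a
  source; among paths ending at r the list determines the source.\<close>

lemma card_I: "rooted.n = card {(v, \<xi>). awalk v \<xi> r \<and> (\<forall>e\<in>set \<xi>. tail G e \<noteq> r)}" (is "_ = card ?W")
proof -
  have "rooted.I = snd ` ?W"
    unfolding rooted.I_def awalk_H[OF r_X] induce_subgraph_tail image_def by (rule Set.set_eqI) simp
  moreover have "inj_on snd ?W"
  proof (rule inj_onI)
    fix x y assume xy: "x \<in> ?W" "y \<in> ?W" "snd x = snd y"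
    then have "awalk (fst x) (snd x) r" "awalk (fst y) (snd x) r" by auto
    then have "fst x = fst y" by (cases "snd x") (simp_all add: awalk_simps)
    then show "x = y" using xy(3) by (rule prod_eqI)
  qed
  ultimately show ?thesis by (simp add: card_image)
qed

lemma n_eq: "is_sink G r ==> rooted.n = n_sink G r" "rooted.n = n_component G r"
proof -
  show "rooted.n = n_component G r" by (simp add: card_I n_component_def)
  assume s: "is_sink G r"
  have "{(v, \<xi>). awalk v \<xi> r \<and> (\<forall>e\<in>set \<xi>. tail G e \<noteq> r)} = {(v, \<xi>). awalk v \<xi> r}"
    using s by (auto simp: is_sink_def awalk_def)
  then show "rooted.n = n_sink G r" by (simp add: card_I n_sink_def)
qed

sublocale G: graph_algebra G "Cstar" graph.unorm "P_elem G" "S_elem G"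
  by (rule graph_algebra_graph_cstar)

abbreviation "quot \<equiv> pi_hom G {r}"

lemma quot_exists:
  obtains \<phi> where "\<phi> \<in> star_hom Cstar (graph_cstar H)"
    "!!v. v \<in> verts G ==> \<phi> (P_elem G v) = (if v \<in> X then P_elem H v else \<zero>\<^bsub>graph_cstar H\<^esub>)"
    "!!e. e \<in> arcs G ==> \<phi> (S_elem G e) = (if head G e \<in> X then S_elem H e else \<zero>\<^bsub>graph_cstar H\<^esub>)"
proof -
  define p where "p v = (if v \<in> X then P_elem H v else \<zero>\<^bsub>graph_cstar H\<^esub>)" for v
  define t where "t e = (if head G e \<in> X then S_elem H e else \<zero>\<^bsub>graph_cstar H\<^esub>)" for e
  \<comment> \<open>Arcs leading out of X contribute 0 to the sum. A vertex outside X has no arc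
    into X at all, so its sum is 0 as it should be.\<close>
  have pt: "p v = finsum (graph_cstar H) (\<lambda>e. t e \<otimes>\<^bsub>graph_cstar H\<^esub> star (graph_cstar H) (t e)) {e \<in> arcs G. tail G e = v}"
    (is "_ = finsum _ ?s _") if v: "v \<in> verts G" "\<not> is_sink G v" for v
  proof -
  have arcsH: "{e \<in> arcs H. tail H e = v} = {e \<in> {e \<in> arcs G. tail G e = v}. head G e \<in> X}"
    by (auto simp: H_arcs simp del: induce_subgraph_arcs)
  have "finsum (graph_cstar H) ?s {e \<in> arcs G. tail G e = v} = finsum (graph_cstar H) ?s {e \<in> arcs H. tail H e = v}"
    unfolding arcsH by (rule rooted.alg.add.finprod_mono_neutral_cong_right) (auto simp: t_def H_arcs simp del: induce_subgraph_arcs)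
  also have "\<dots> = finsum (graph_cstar H) (\<lambda>e. S_elem H e \<otimes>\<^bsub>graph_cstar H\<^esub> star (graph_cstar H) (S_elem H e)) {e \<in> arcs H. tail H e = v}"
    by (rule rooted.alg.finsum_cong') (auto simp: t_def H_arcs simp del: induce_subgraph_arcs)
  also have "\<dots> = p v"
  proof (cases "v \<in> X")
    case True
    then show ?thesis using rooted.alg.P_sum[of v] sink_H[OF True] v by (simp add: p_def)
  next
    case False
    then have "{e \<in> arcs H. tail H e = v} = {}" by auto
    then show ?thesis using False by (simp only: p_def rooted.alg.finsum_empty if_False)
  qed
  finally show ?thesis by simp
  qed
  have c: "head G e \<in> X ==> e \<in> arcs G ==> e \<in> arcs H" for e by (simp only: H_arcs)
  show ?thesis
  proof (rule graph_hom_exists[where B = "graph_cstar H" and nB = H.graph.unorm and p = p and t = t])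
    show "cstar_algebra (graph_cstar H) H.graph.unorm" by (rule H.graph_cstar_algebra)
    fix \<phi> assume "\<phi> \<in> star_hom Cstar (graph_cstar H)" "!!v. v \<in> verts G ==> \<phi> (P_elem G v) = p v"
      "!!e. e \<in> arcs G ==> \<phi> (S_elem G e) = t e"
    then show ?thesis using that unfolding p_def t_def by blast
  next
    fix e assume e: "e \<in> arcs G"
    show "t e \<in> carrier (graph_cstar H)" using rooted.alg.S_closed[OF c[OF _ e]] by (simp add: t_def)
    show "star (graph_cstar H) (t e) \<otimes>\<^bsub>graph_cstar H\<^esub> t e = p (head G e)"
      using rooted.alg.S_star_S[OF c[OF _ e]] by (simp add: t_def p_def)
    show "t e \<otimes>\<^bsub>graph_cstar H\<^esub> p (head G e) = t e"
      using rooted.alg.S_head[OF c[OF _ e]] by (simp add: t_def p_def)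
  qed (use pt rooted.alg.P_star rooted.alg.P_idem rooted.alg.P_orth in \<open>auto simp: p_def\<close>)
qed

text \<open>\<open>canonical_hom\<close> is a definite description. Existence is the universal
  property, cut down to the carrier to be extensional; uniqueness holds because the generators
  determine a homomorphism.\<close>

lemma quot: "quot \<in> star_hom Cstar (graph_cstar H)"
  and quot_P: "v \<in> verts G ==> quot (P_elem G v) = (if v \<in> X then P_elem H v else \<zero>\<^bsub>graph_cstar H\<^esub>)"
  and quot_S: "e \<in> arcs G ==> quot (S_elem G e) = (if head G e \<in> X then S_elem H e else \<zero>\<^bsub>graph_cstar H\<^esub>)"
proof -
  let ?A = "Cstar" and ?B = "graph_cstar H"
  let ?Q = "\<lambda>\<pi>. \<pi> \<in> star_hom ?A ?B \<inter> extensional (carrier ?A) \<and>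
        (\<forall>v\<in>verts G. \<pi> (P_elem G v) = (if v \<in> X then P_elem H v else \<zero>\<^bsub>?B\<^esub>)) \<and>
        (\<forall>e\<in>arcs G. \<pi> (S_elem G e) = (if head G e \<in> X then S_elem H e else \<zero>\<^bsub>?B\<^esub>))"
  obtain \<phi> where \<phi>: "\<phi> \<in> star_hom ?A ?B"
    "!!v. v \<in> verts G ==> \<phi> (P_elem G v) = (if v \<in> X then P_elem H v else \<zero>\<^bsub>?B\<^esub>)"
    "!!e. e \<in> arcs G ==> \<phi> (S_elem G e) = (if head G e \<in> X then S_elem H e else \<zero>\<^bsub>?B\<^esub>)"
    by (rule quot_exists) blast
  have ex: "?Q (restrict \<phi> (carrier ?A))"
    using \<phi> unfolding star_hom_def by auto
  have un: "\<pi> = \<pi>'" if "?Q \<pi>" "?Q \<pi>'" for \<pi> \<pi>'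
  proof (rule extensionalityI)
    show "\<pi> \<in> extensional (carrier ?A)" "\<pi>' \<in> extensional (carrier ?A)" using that by auto
    fix a assume a: "a \<in> carrier ?A"
    show "\<pi> a = \<pi>' a"
    proof (rule graph.hom_unique[where \<phi> = \<pi> and \<psi> = \<pi>', OF H.graph_cstar_algebra])
      show "\<pi> \<in> star_hom (universal_cstar GX GR) ?B" "\<pi>' \<in> star_hom (universal_cstar GX GR) ?B"
        using that by (auto simp: graph_cstar_def)
      show "a \<in> carrier (universal_cstar GX GR)" using a by (simp add: graph_cstar_def)
      fix h assume "h \<in> GX"
      then consider v where "v \<in> verts G" "h = VertexGen v" | e where "e \<in> arcs G" "h = EdgeGen e"
        by (auto simp: graph_gens_def)
      then show "\<pi> (graph.emb (gen h)) = \<pi>' (graph.emb (gen h))"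
      proof cases
        case 1
        have "\<pi> (P_elem G v) = \<pi>' (P_elem G v)" using that 1(1) by simp
        then show ?thesis unfolding 1(2) elem_emb .
      next
        case 2
        have "\<pi> (S_elem G e) = \<pi>' (S_elem G e)" using that 2(1) by simp
        then show ?thesis unfolding 2(2) elem_emb .
      qed
    qed
  qed
  have "?Q quot" unfolding canonical_hom_def Let_def by (rule theI[of ?Q, OF ex]) (rule un[OF _ ex])
  then show "quot \<in> star_hom ?A ?B"
    "v \<in> verts G ==> quot (P_elem G v) = (if v \<in> X then P_elem H v else \<zero>\<^bsub>?B\<^esub>)"
    "e \<in> arcs G ==> quot (S_elem G e) = (if head G e \<in> X then S_elem H e else \<zero>\<^bsub>?B\<^esub>)" by auto
qed

sublocale pair: cstar_algebra_pair "Cstar" graph.unorm "graph_cstar H" H.graph.unorm ..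

lemmas quot_hom = pair.hom_closed[OF quot] pair.hom_add[OF quot] pair.hom_mult[OF quot]
  pair.hom_smult[OF quot] pair.hom_star[OF quot]

lemma quot_one: "quot \<one>\<^bsub>Cstar\<^esub> = \<one>\<^bsub>graph_cstar H\<^esub>"
proof -
  let ?p = "\<lambda>v. if v \<in> X then P_elem H v else \<zero>\<^bsub>graph_cstar H\<^esub>"
  have "quot \<one>\<^bsub>Cstar\<^esub> = finsum (graph_cstar H) (\<lambda>v. quot (P_elem G v)) (verts G)"
    unfolding G.one_sum by (rule pair.hom_finsum[OF quot]) auto
  also have "\<dots> = finsum (graph_cstar H) ?p (verts G)"
    by (rule rooted.alg.finsum_cong') (auto simp: quot_P)
  also have "\<dots> = finsum (graph_cstar H) (P_elem H) (verts H)"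
    by (rule rooted.alg.add.finprod_mono_neutral_cong_right) (use X_verts in auto)
  finally show ?thesis by (simp add: rooted.alg.one_sum)
qed

lemma quot_path: "awalk v \<kappa> w ==>
  quot (G.path_elem w \<kappa>) = (if w \<in> X then rooted.alg.path_elem w \<kappa> else \<zero>\<^bsub>graph_cstar H\<^esub>)"
proof (induct \<kappa> arbitrary: v)
  case Nil
  then show ?case by (auto simp: awalk_simps quot_P)
next
  case (Cons e \<kappa>)
  then have e: "e \<in> arcs G" "awalk (head G e) \<kappa> w" by (auto simp: awalk_simps)
  have h: "w \<in> X ==> head G e \<in> X" using awalk_leads_to[OF e(2)] leads_to_trans unfolding X_iff by blast
  have "S_elem H e \<in> carrier (graph_cstar H)" if "head G e \<in> X" using e(1) that X_pred by simp
  then show ?case using Cons(1)[OF e(2)] e(1) G.path_elem_closed[OF e(2)] h by (simp add: quot_hom quot_S)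
qed

lemma trace_pullback:
  assumes \<sigma>: "trace_state (graph_cstar H) \<sigma>"
  shows "G.tracial_functional (\<lambda>a. \<sigma> (quot a))"
proof -
  have t: "rooted.alg.tracial_functional \<sigma>" using \<sigma> by (simp add: rooted.alg.trace_state_iff)
  note p = rooted.alg.tracial_positive[OF t]
  show ?thesis
    unfolding G.tracial_functional_def G.positive_functional_def
    using rooted.alg.pf_add[OF p] rooted.alg.pf_smult[OF p] rooted.alg.pf_pos[OF p] rooted.alg.tracial[OF t]
    by (simp add: quot_hom)
qed

text \<open>The unit is the sum of the n range projections of the paths in \<open>I\<close>, and the
  trace property gives each of them the value at \<open>P_elem H r\<close>.\<close>

lemma trace_root:
  assumes \<sigma>: "trace_state (graph_cstar H) \<sigma>"
  shows "\<sigma> (P_elem H r) = 1 / of_nat rooted.n"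
proof -
  have t: "rooted.alg.tracial_functional \<sigma>" "\<sigma> \<one>\<^bsub>graph_cstar H\<^esub> = 1"
    using \<sigma> by (simp_all add: rooted.alg.trace_state_iff)
  have "\<sigma> \<one>\<^bsub>graph_cstar H\<^esub> =
      (\<Sum>\<xi>\<in>rooted.I. \<sigma> (rooted.alg.V \<xi> \<otimes>\<^bsub>graph_cstar H\<^esub> star (graph_cstar H) (rooted.alg.V \<xi>)))"
    unfolding rooted.alg.one_eq_sum_V by (rule rooted.alg.tf_finsum[OF t(1)]) auto
  also have "\<dots> = (\<Sum>\<xi>\<in>rooted.I. \<sigma> (P_elem H r))"
  proof (intro sum.cong refl)
    fix \<xi> assume \<xi>: "\<xi> \<in> rooted.I"
    show "\<sigma> (rooted.alg.V \<xi> \<otimes>\<^bsub>graph_cstar H\<^esub> star (graph_cstar H) (rooted.alg.V \<xi>)) = \<sigma> (P_elem H r)"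
      using rooted.alg.tracial[OF t(1) rooted.alg.V_closed[OF \<xi>] rooted.alg.star_closed[OF rooted.alg.V_closed[OF \<xi>]]]
      by (simp only: rooted.alg.path_elem_isometry[OF rooted.awalk_src[OF \<xi>]])
  qed
  finally have "1 = of_nat rooted.n * \<sigma> (P_elem H r)" by (simp add: t)
  then show ?thesis by (metis mult_zero_left nonzero_mult_div_cancel_left zero_neq_one)
qed

text \<open>All vertices of H lead to r, so r alone represents the terminal vertices of H.\<close>

lemma trace_eqI:
  assumes "trace_state (graph_cstar H) \<sigma>1" "trace_state (graph_cstar H) \<sigma>2"
    and "!!\<kappa>. awalk r \<kappa> r ==> \<sigma>1 (rooted.alg.path_elem r \<kappa>) = \<sigma>2 (rooted.alg.path_elem r \<kappa>)"
    and "a \<in> carrier (graph_cstar H)"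
  shows "\<sigma>1 a = \<sigma>2 a"
proof (rule rooted.alg.tracial_functional_eqI[where R = "{r}"])
  show "rooted.alg.tracial_functional \<sigma>1" "rooted.alg.tracial_functional \<sigma>2"
    using assms(1,2) by (simp_all add: rooted.alg.trace_state_iff)
  show "H.terminal s" if "s \<in> {r}" for s using that terminal_H by simp
  show "\<exists>s\<in>{r}. leads_to H v s \<and> leads_to H s v" if v: "H.terminal v" for v
  proof -
    have vX: "v \<in> X" using v by (simp add: H.terminal_def)
    then obtain \<xi> where \<xi>: "H.awalk v \<xi> r" unfolding awalk_H[OF r_X] by (auto simp: X_iff leads_to_def)
    show ?thesis
    proof (cases "H.recurrent v")
      case True
      then show ?thesis using terminal_H H.awalk_leads_to[OF \<xi>] unfolding H.terminal_def by blast
    next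
      case False
      then have "r = v" using H.sink_leads_to[OF _ \<xi>] v by (simp add: H.terminal_def)
      then show ?thesis using H.leads_to_refl[of v] vX by simp
    qed
  qed
qed (use assms awalk_H in auto)

end

section \<open>Moments of a trace at a terminal vertex\<close>

context cstar_algebra
begin

definition isometry_pow :: "'a => 'a => nat => 'a" where
  "isometry_pow p s k = ((\<lambda>a. s \<otimes> a) ^^ k) p"

text \<open>Only nonnegative powers of an isometry are formed; the moments of negative order are
  those of the adjoints, that is, conjugates. Division by \<open>\<tau> p\<close> normalizes the
  moment of order 0.\<close>

definition moment :: "('a => complex) => 'a => 'a => int => complex" where
  "moment \<tau> p s k = (if 0 \<le> k then \<tau> (isometry_pow p s (nat k)) else cnj (\<tau> (isometry_pow p s (nat (- k))))) / \<tau> p"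

definition moment_functional :: "('a => complex) => 'a => 'a => laurent => complex" where
  "moment_functional \<tau> p s f = (\<Sum>k\<in>keys f. lookup f k * moment \<tau> p s k)"

lemma moment_functional_superset:
  assumes "finite J" "keys f \<subseteq> J"
  shows "moment_functional \<tau> p s f = (\<Sum>k\<in>J. lookup f k * moment \<tau> p s k)"
  unfolding moment_functional_def using assms by (intro sum.mono_neutral_left) (auto simp: in_keys_iff)

lemma moment_functional_single: "moment_functional \<tau> p s (single k c) = c * moment \<tau> p s k"
  using moment_functional_superset[of "{k}" "single k c" \<tau> p s] by simp

lemma moment_functional_add:
  "moment_functional \<tau> p s (f + g) = moment_functional \<tau> p s f + moment_functional \<tau> p s g"
proof -
  let ?J = "keys f \<union> keys g"
  have "keys (f + g) \<subseteq> ?J" by (rule keys_add)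
  then show ?thesis
    using moment_functional_superset[of ?J "f + g"] moment_functional_superset[of ?J f] moment_functional_superset[of ?J g]
    by (simp add: lookup_add distrib_right sum.distrib)
qed

lemma moment_functional_sum:
  "finite J ==> moment_functional \<tau> p s (sum f J) = (\<Sum>j\<in>J. moment_functional \<tau> p s (f j))"
  by (induct J rule: finite_induct) (simp_all add: moment_functional_add moment_functional_def[of _ _ _ 0])

context
  fixes \<tau> p s
  assumes \<tau>: "tracial_functional \<tau>" and p [simp]: "p \<in> carrier A" and s [simp]: "s \<in> carrier A"
    and p_star: "star A p = p" and p_idem: "p \<otimes> p = p" and ss: "star A s \<otimes> s = p"
    and ps: "p \<otimes> s = s" and nz: "\<tau> p \<noteq> 0"
begin

lemma isometry_pow_simps [simp]:
  "isometry_pow p s 0 = p" "isometry_pow p s (Suc k) = s \<otimes> isometry_pow p s k"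
  by (simp_all add: isometry_pow_def)

lemma isometry_pow_closed [simp]: "isometry_pow p s k \<in> carrier A"
  by (induct k) auto

lemma p_isometry_pow: "p \<otimes> isometry_pow p s k = isometry_pow p s k"
  by (cases k) (simp_all add: p_idem m_assoc[symmetric] ps)

lemma star_isometry_pow: "star A (isometry_pow p s j) \<otimes> isometry_pow p s (j + k) = isometry_pow p s k"
proof (induct j)
  case (Suc j)
  let ?a = "isometry_pow p s j" and ?b = "isometry_pow p s (j + k)"
  have "star A (s \<otimes> ?a) \<otimes> (s \<otimes> ?b) = star A ?a \<otimes> ((star A s \<otimes> s) \<otimes> ?b)" by (simp add: star_mult m_assoc)
  then show ?case using Suc by (simp add: ss p_isometry_pow)
qed (simp add: p_star p_isometry_pow)

text \<open>Common powers of the isometry cancel, so the Gram matrix of its powers depends only on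
  the difference of the exponents: it is a Toeplitz matrix.\<close>

lemma moment_inner:
  "\<tau> (star A (isometry_pow p s i) \<otimes> isometry_pow p s j) = \<tau> p * moment \<tau> p s (int j - int i)"
proof (cases "i \<le> j")
  case True
  then obtain k where "j = i + k" by (auto simp: le_iff_add)
  then show ?thesis using nz by (simp add: star_isometry_pow moment_def)
next
  case False
  then obtain k where k: "i = j + k" "k > 0" by (metis less_imp_add_positive not_le)
  have "star A (isometry_pow p s i) \<otimes> isometry_pow p s j = star A (star A (isometry_pow p s j) \<otimes> isometry_pow p s i)"
    by (simp add: star_mult)
  also have "\<dots> = star A (isometry_pow p s k)" using k star_isometry_pow by simp
  finally show ?thesis using nz k by (simp add: moment_def pf_hermitian[OF tracial_positive[OF \<tau>]])
qed

lemma tf_p: "\<tau> p \<in> \<real>\<^sub>\<ge>\<^sub>0"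
  using pf_pos[OF tracial_positive[OF \<tau>], of p] by (simp add: p_star p_idem)

lemma laurent_functional_moments: "laurent_functional (moment_functional \<tau> p s)"
proof
  let ?\<Lambda> = "moment_functional \<tau> p s"
  have pc: "cnj (\<tau> p) = \<tau> p" using tf_p by (simp add: complex_nonneg_Reals_iff complex_eq_iff)
  have m0: "moment \<tau> p s 0 = 1" using nz by (simp add: moment_def)
  have mc: "moment \<tau> p s (- k) = cnj (moment \<tau> p s k)" for k
    using m0 pc by (cases "k = 0") (auto simp: moment_def)
  fix f g c
  show "?\<Lambda> (f + g) = ?\<Lambda> f + ?\<Lambda> g" by (rule moment_functional_add)
  show "?\<Lambda> (single 0 c * f) = c * ?\<Lambda> f"
    by (induct f rule: poly_mapping_single_induct)
      (simp_all add: mult_single moment_functional_single moment_functional_add distrib_left)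
  show "?\<Lambda> (lstar f) = cnj (?\<Lambda> f)"
    by (induct f rule: poly_mapping_single_induct)
      (simp_all add: lstar_single moment_functional_single moment_functional_add lstar_add mc)
  show "?\<Lambda> 1 = 1" using moment_functional_single[of \<tau> p s 0 1] by (simp add: m0)
  show "?\<Lambda> (lstar f * f) \<in> \<real>\<^sub>\<ge>\<^sub>0"
  proof -
    define F where "F = keys f"
    define c where "c k = lookup f k" for k
    \<comment> \<open>Shifting all exponents by N makes them nonnegative and leaves their
      differences alone. So the value at \<open>lstar f * f\<close> is, up to the factor
      \<open>\<tau> p\<close>, the trace of the square of Q, an honest element of the
      algebra.\<close>
    define N where "N = Max (insert 0 ((\<lambda>k. nat (- k)) ` F))"
    have fin: "finite F" by (simp add: F_def)
    have N: "int (nat (k + int N)) = k + int N" if "k \<in> F" for k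
    proof -
      have "nat (- k) \<le> N" unfolding N_def using that fin by (intro Max_ge) auto
      then show ?thesis by simp
    qed
    let ?w = "\<lambda>k. isometry_pow p s (nat (k + int N))"
    define Q where "Q = finsum A (\<lambda>k. c k \<odot> ?w k) F"
    have Qc [simp]: "Q \<in> carrier A" unfolding Q_def by (rule finsum_closed) auto
    have f: "f = (\<Sum>k\<in>F. single k (c k))"
      by (rule poly_mapping_eqI) (auto simp: F_def c_def lookup_sum lookup_single when_def in_keys_iff)
    have lf: "lstar f = (\<Sum>k\<in>F. single (- k) (cnj (c k)))"
      by (simp add: lstar_def F_def c_def)
    have "?\<Lambda> (lstar f * f) = ?\<Lambda> ((\<Sum>j\<in>F. single (- j) (cnj (c j))) * (\<Sum>k\<in>F. single k (c k)))"
      using f lf by simp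
    also have "\<dots> = (\<Sum>j\<in>F. \<Sum>k\<in>F. cnj (c j) * c k * moment \<tau> p s (k - j))"
      using fin by (simp add: sum_product moment_functional_sum mult_single moment_functional_single)
    finally have 1: "?\<Lambda> (lstar f * f) = (\<Sum>j\<in>F. \<Sum>k\<in>F. cnj (c j) * c k * moment \<tau> p s (k - j))" .
    have "star A Q = finsum A (\<lambda>j. cnj (c j) \<odot> star A (?w j)) F"
      unfolding Q_def using fin by (subst star_finsum) (auto simp: star_smult intro!: finsum_cong')
    then have "star A Q \<otimes> Q = finsum A (\<lambda>j. cnj (c j) \<odot> star A (?w j) \<otimes> Q) F"
      using fin by (simp only:) (rule finsum_ldistr, auto)
    moreover have "cnj (c j) \<odot> star A (?w j) \<otimes> Q = finsum A (\<lambda>k. (cnj (c j) * c k) \<odot> (star A (?w j) \<otimes> ?w k)) F" for j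
      unfolding Q_def using fin
      by (subst finsum_rdistr) (auto simp: smult_mult_l smult_mult_r smult_smult mult.commute intro!: finsum_cong')
    ultimately have "star A Q \<otimes> Q = finsum A (\<lambda>j. finsum A (\<lambda>k. (cnj (c j) * c k) \<odot> (star A (?w j) \<otimes> ?w k)) F) F"
      by simp
    then have "\<tau> (star A Q \<otimes> Q) = \<tau> (finsum A (\<lambda>j. finsum A (\<lambda>k. (cnj (c j) * c k) \<odot> (star A (?w j) \<otimes> ?w k)) F) F)" by simp
    also have "\<dots> = (\<Sum>j\<in>F. \<tau> (finsum A (\<lambda>k. (cnj (c j) * c k) \<odot> (star A (?w j) \<otimes> ?w k)) F))"
      by (rule tf_finsum[OF \<tau> fin], rule finsum_closed) auto
    also have "\<dots> = (\<Sum>j\<in>F. \<Sum>k\<in>F. cnj (c j) * c k * (\<tau> p * moment \<tau> p s (k - j)))"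
    proof (rule sum.cong[OF refl])
      fix j assume j: "j \<in> F"
      have "\<tau> (finsum A (\<lambda>k. (cnj (c j) * c k) \<odot> (star A (?w j) \<otimes> ?w k)) F) =
          (\<Sum>k\<in>F. \<tau> ((cnj (c j) * c k) \<odot> (star A (?w j) \<otimes> ?w k)))"
        by (rule tf_finsum[OF \<tau> fin]) auto
      also have "\<dots> = (\<Sum>k\<in>F. cnj (c j) * c k * (\<tau> p * moment \<tau> p s (k - j)))"
        by (rule sum.cong[OF refl]) (use N j in \<open>simp add: tf_smult[OF \<tau>] moment_inner\<close>)
      finally show "\<tau> (finsum A (\<lambda>k. (cnj (c j) * c k) \<odot> (star A (?w j) \<otimes> ?w k)) F) = \<dots>" .
    qed
    also have "\<dots> = \<tau> p * ?\<Lambda> (lstar f * f)" unfolding 1 by (simp add: sum_distrib_left mult_ac)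
    finally have "?\<Lambda> (lstar f * f) = \<tau> (star A Q \<otimes> Q) / \<tau> p" using nz by simp
    moreover have "\<tau> (star A Q \<otimes> Q) \<in> \<real>\<^sub>\<ge>\<^sub>0" by (rule pf_pos[OF tracial_positive[OF \<tau>]]) simp
    ultimately show ?thesis using tf_p nonneg_Reals_divide_I by metis
  qed
qed

end

lemma tracial_functional_sum:
  assumes "finite R" "!!r. r \<in> R ==> 0 \<le> \<alpha> r" "!!r. r \<in> R ==> tracial_functional (\<tau> r)"
  shows "tracial_functional (\<lambda>a. \<Sum>r\<in>R. of_real (\<alpha> r) * \<tau> r a)"
  unfolding tracial_functional_def positive_functional_def
proof (intro conjI ballI allI)
  fix a c assume a: "a \<in> carrier A"
  show "(\<Sum>r\<in>R. of_real (\<alpha> r) * \<tau> r (c \<odot> a)) = c * (\<Sum>r\<in>R. of_real (\<alpha> r) * \<tau> r a)"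
    using assms(3) a by (simp add: tf_smult sum_distrib_left mult_ac)
  show "(\<Sum>r\<in>R. of_real (\<alpha> r) * \<tau> r (star A a \<otimes> a)) \<in> \<real>\<^sub>\<ge>\<^sub>0"
    by (rule nonneg_Reals_sum, rule nonneg_Reals_mult_I)
      (use assms(2) pf_pos[OF tracial_positive[OF assms(3)] a] in auto)
  fix b assume b: "b \<in> carrier A"
  show "(\<Sum>r\<in>R. of_real (\<alpha> r) * \<tau> r (a \<oplus> b)) = (\<Sum>r\<in>R. of_real (\<alpha> r) * \<tau> r a) + (\<Sum>r\<in>R. of_real (\<alpha> r) * \<tau> r b)"
    using assms(3) a b by (simp add: tf_add sum.distrib distrib_left)
  show "(\<Sum>r\<in>R. of_real (\<alpha> r) * \<tau> r (a \<otimes> b)) = (\<Sum>r\<in>R. of_real (\<alpha> r) * \<tau> r (b \<otimes> a))"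
    using tracial[OF assms(3) a b] by simp
qed

end

section \<open>Closed walks at the root\<close>

context rooted_digraph
begin

lemma split_first_visit:
  "awalk v \<xi> r ==> \<exists>\<nu> \<kappa>. \<xi> = \<nu> @ \<kappa> \<and> \<nu> \<in> I \<and> src \<nu> = v \<and> awalk r \<kappa> r"
proof (induct \<xi> arbitrary: v)
  case Nil
  then show ?case by (auto simp: awalk_simps)
next
  case (Cons e \<xi>)
  then have e: "e \<in> arcs G" "v = tail G e" "awalk (head G e) \<xi> r" by (auto simp: awalk_simps)
  show ?case
  proof (cases "v = r")
    case True
    then show ?thesis using Cons(2) by (intro exI[of _ "[]"] exI[of _ "e # \<xi>"]) simp
  next
    case False
    obtain \<nu> \<kappa> where n: "\<xi> = \<nu> @ \<kappa>" "\<nu> \<in> I" "src \<nu> = head G e" "awalk r \<kappa> r" using Cons(1)[OF e(3)] by blast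
    then show ?thesis using e False by (intro exI[of _ "e # \<nu>"] exI[of _ \<kappa>]) (simp add: Cons_I)
  qed
qed

text \<open>The part up to the first return to the root is forced to be the loop; cut it off and
  repeat.\<close>

lemma closed_walk_power:
  "awalk r \<kappa> r ==> (\<exists>k. \<kappa> = concat (replicate k (loop_arc # loop_rest))) \<and> (\<kappa> \<noteq> [] --> has_loop)"
proof (induct "length \<kappa>" arbitrary: \<kappa> rule: less_induct)
  case less
  show ?case
  proof (cases \<kappa>)
    case Nil
    then show ?thesis by (intro conjI exI[of _ 0]) auto
  next
    case (Cons e \<kappa>')
    then have e: "e \<in> arcs G" "tail G e = r" "awalk (head G e) \<kappa>' r" using less(2) by (auto simp: awalk_simps)
    have l: "has_loop" "e = loop_arc" using loop_arc_unique[OF e(1,2)] by auto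
    obtain \<nu> \<kappa>'' where n: "\<kappa>' = \<nu> @ \<kappa>''" "\<nu> \<in> I" "src \<nu> = head G e" "awalk r \<kappa>'' r"
      using split_first_visit[OF e(3)] by blast
    have "\<nu> = loop_rest" using loop_rest_unique[OF l(1) n(2)] n(3) l(2) by simp
    moreover obtain k where "\<kappa>'' = concat (replicate k (loop_arc # loop_rest))"
      using less(1)[OF _ n(4)] Cons n(1) by auto
    ultimately have "\<kappa> = concat (replicate (Suc k) (loop_arc # loop_rest))" using Cons n(1) l(2) by simp
    then show ?thesis using l(1) by blast
  qed
qed

lemma loop_awalk: "has_loop ==> awalk r (loop_arc # loop_rest) r"
  using loop_arc loop_rest awalk_src[of loop_rest] by (simp add: awalk_simps)

end

context graph_algebra
begin

lemma path_elem_power: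
  assumes l: "awalk r \<xi> r"
  shows "awalk r (concat (replicate k \<xi>)) r \<and> path_elem r (concat (replicate k \<xi>)) = isometry_pow (P r) (path_elem r \<xi>) k"
proof (induct k)
  case 0
  then show ?case using l by (auto simp: awalk_simps isometry_pow_def)
next
  case (Suc k)
  have "awalk r (\<xi> @ concat (replicate k \<xi>)) r" by (rule awalk_appendI[OF l]) (use Suc in simp)
  moreover have "path_elem r (\<xi> @ concat (replicate k \<xi>)) = path_elem r \<xi> \<otimes> path_elem r (concat (replicate k \<xi>))"
    by (rule path_elem_append[OF l]) (use Suc in simp)
  ultimately show ?case using Suc by (simp add: isometry_pow_def)
qed

end

section \<open>Trace states with prescribed moments\<close>

context terminal_vertex
begin

lemma one_K: "1 \<in> rooted.K"
  by (simp add: rooted.K_def)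

lemma n_pos: "rooted.n > 0"
  using rooted.Nil_I rooted.finite_I by (metis card_gt_0_iff empty_iff)

lemma quot_closed_walk: "awalk r \<kappa> r ==> quot (G.path_elem r \<kappa>) = rooted.alg.path_elem r \<kappa>"
  by (simp add: quot_path)

text \<open>If the root has mass 0, both sides vanish for any \<sigma>; if it is a sink, only the
  empty walk is to be matched. Otherwise the closed walks are powers of one isometry, and its
  moments prescribe \<sigma>.\<close>

lemma trace_with_moments:
  assumes \<omega>: "G.tracial_functional \<omega>"
  shows "\<exists>\<sigma>. trace_state (graph_cstar H) \<sigma> \<and> (\<forall>\<kappa>. awalk r \<kappa> r -->
    \<omega> (G.path_elem r \<kappa>) = \<omega> (P_elem G r) * of_nat rooted.n * \<sigma> (quot (G.path_elem r \<kappa>)))"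
proof (cases "rooted.has_loop \<and> \<omega> (P_elem G r) \<noteq> 0")
  case False
  \<comment> \<open>Some trace state is needed, and evaluation at 1 provides one because 1 belongs
    to the spectrum with or without a loop.\<close>
  define L :: "(complex => complex) => complex" where "L f = f 1" for f
  let ?\<sigma> = "\<lambda>a. (\<Sum>i<rooted.n. L (\<lambda>z. rooted.rep z a $$ (i, i))) / of_nat rooted.n"
  have \<sigma>: "trace_state (graph_cstar H) ?\<sigma>"
  proof (rule rooted.trace_from_functional(1))
    fix f :: "complex => complex"
    have "cnj (f 1) * f 1 = of_real ((cmod (f 1))\<^sup>2)" by (simp only: complex_norm_square mult.commute)
    then show "L (\<lambda>z. cnj (f z) * f z) \<in> \<real>\<^sub>\<ge>\<^sub>0" by (simp add: L_def)
  qed (simp_all add: L_def one_K)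
  have "\<omega> (G.path_elem r \<kappa>) = \<omega> (P_elem G r) * of_nat rooted.n * ?\<sigma> (quot (G.path_elem r \<kappa>))" if \<kappa>: "awalk r \<kappa> r" for \<kappa>
  proof (cases "\<omega> (P_elem G r) = 0")
    case True
    then have "G.mass \<omega> r = 0" by (simp add: G.mass_def[OF \<omega>])
    then have "\<omega> (P_elem G r \<otimes>\<^bsub>Cstar\<^esub> G.path_elem r \<kappa>) = 0"
      by (rule G.tf_mass_zero[OF \<omega> r_vert _ G.path_elem_closed[OF \<kappa>]])
    then show ?thesis using True by (simp add: G.source_path_elem[OF \<kappa>])
  next
    case nz: False
    then have "\<kappa> = []" using False rooted.closed_walk_power[of \<kappa>] \<kappa> awalk_H[OF r_X] by auto
    moreover have "rooted.I \<noteq> {}" using rooted.Nil_I by blast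
    ultimately show ?thesis using trace_root[OF \<sigma>] quot_P[OF r_vert] by simp
  qed
  then show ?thesis using \<sigma> by blast
next
  case True
  let ?l = "rooted.loop_arc # rooted.loop_rest"
  let ?s = "G.path_elem r ?l" and ?p = "P_elem G r"
  have l: "awalk r ?l r" "H.awalk r ?l r" using rooted.loop_awalk True awalk_H[OF r_X] by auto
  \<comment> \<open>The moments are taken in the algebra of G, where the loop may have exits and its
    path element is an isometry; in the quotient it becomes the unitary u.\<close>
  interpret laurent_functional "G.moment_functional \<omega> ?p ?s"
  proof (rule G.laurent_functional_moments[OF \<omega>])
    show "?s \<in> carrier Cstar" by (rule G.path_elem_closed[OF l(1)])
    show "star Cstar ?s \<otimes>\<^bsub>Cstar\<^esub> ?s = ?p" by (rule G.path_elem_isometry[OF l(1)])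
    show "?p \<otimes>\<^bsub>Cstar\<^esub> ?s = ?s" by (rule G.source_path_elem[OF l(1)])
  qed (use True r_vert in \<open>auto simp: G.P_star G.P_idem\<close>)
  have K: "rooted.K = sphere 0 1" using True by (simp add: rooted.K_def)
  have ce: "ext f = ext g" if "continuous_on rooted.K f" "!!z. z \<in> rooted.K ==> f z = g z" for f g
    by (rule ext_cong) (use that K in auto)
  have l1: "leval 1 = (\<lambda>z. 1)" using leval_single[of 0 1] by (intro HOL.ext) simp
  note T = rooted.trace_from_functional[where L = ext, OF ce ext_add ext_scale ext_pos, unfolded K]
  let ?\<sigma> = "\<lambda>a. (\<Sum>i<rooted.n. ext (\<lambda>z. rooted.rep z a $$ (i, i))) / of_nat rooted.n"
  have one: "ext (\<lambda>z. 1) = 1" using ext_leval[of 1] l1 \<Lambda>_one by simp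
  have \<sigma>: "trace_state (graph_cstar H) ?\<sigma>" by (rule T(1)) (use one in auto)
  have fc: "?\<sigma> (rooted.alg.fcalc f) = ext (leval f) / of_nat rooted.n" for f by (rule T(2)) (use one in auto)
  have "\<omega> (G.path_elem r \<kappa>) = \<omega> ?p * of_nat rooted.n * ?\<sigma> (quot (G.path_elem r \<kappa>))" if \<kappa>: "awalk r \<kappa> r" for \<kappa>
  proof -
    obtain k where k: "\<kappa> = concat (replicate k ?l)"
      using rooted.closed_walk_power[of \<kappa>] \<kappa> awalk_H[OF r_X] by blast
    have u: "rooted.alg.path_elem r ?l = rooted.alg.u" using True by (simp add: rooted.alg.u_def)
    have "rooted.alg.isometry_pow (P_elem H r) rooted.alg.u j = rooted.alg.upow (int j)" for j
    proof (induct j)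
      case (Suc j)
      then show ?case using rooted.alg.upow_Suc[of "int j"] by (simp add: rooted.alg.isometry_pow_def add.commute)
    qed (simp add: rooted.alg.isometry_pow_def rooted.alg.upow_0)
    then have "quot (G.path_elem r \<kappa>) = rooted.alg.upow (int k)"
      using rooted.alg.path_elem_power[OF l(2), of k] quot_closed_walk[OF \<kappa>] by (simp only: u k)
    also have "\<dots> = rooted.alg.fcalc (single (int k) 1)" by (simp add: rooted.alg.fcalc_single)
    finally have q: "quot (G.path_elem r \<kappa>) = rooted.alg.fcalc (single (int k) 1)" .
    have "\<omega> ?p * G.moment \<omega> ?p ?s (int k) = \<omega> (G.path_elem r \<kappa>)"
      using True G.path_elem_power[OF l(1), of k] by (simp only: G.moment_def k) simp
    moreover have "rooted.I \<noteq> {}" using rooted.Nil_I by blast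
    ultimately show ?thesis unfolding q fc ext_leval G.moment_functional_single by simp
  qed
  then show ?thesis using \<sigma> by blast
qed

end

context fin_digraph
begin

section \<open>Components and terminal vertices\<close>

lemma component_class:
  assumes "C \<in> verts G // mutual_rel G" "v \<in> C"
  shows "C = {w. leads v w \<and> leads w v}" and "v \<in> verts G"
proof -
  obtain x where x: "C = {w. leads x w \<and> leads w x}"
    using assms(1) by (auto simp: quotient_def mutual_rel_def)
  have v: "leads x v" "leads v x" using assms(2) x by auto
  then show "v \<in> verts G" using leads_to_verts by blast
  show "C = {w. leads v w \<and> leads w v}"
    unfolding x using v leads_to_trans by blast
qed

lemma component_recurrent: assumes C: "is_component G C" and v: "v \<in> C" shows "recurrent v"
proof -
  obtain e where e: "e \<in> arcs G" "tail G e \<in> C" "head G e \<in> C" using C by (auto simp: is_component_def)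
  have q: "C \<in> verts G // mutual_rel G" using C by (simp add: is_component_def)
  have "leads (head G e) (tail G e)" using component_class(1)[OF q e(2)] e(3) by blast
  then have "recurrent (tail G e)" using e(1) by (auto simp: recurrent_def)
  moreover have "leads (tail G e) v" "leads v (tail G e)" using component_class(1)[OF q e(2)] v by blast+
  ultimately show ?thesis by (rule recurrent_mutual)
qed

lemma recurrent_component:
  assumes v: "recurrent v"
  shows "is_component G {w. leads v w \<and> leads w v}" "v \<in> verts G"
proof -
  obtain e where e: "e \<in> arcs G" "tail G e = v" "leads (head G e) v" using v by (auto simp: recurrent_def)
  show vv: "v \<in> verts G" using e by auto
  have "{w. leads v w \<and> leads w v} = mutual_rel G `` {v}" by (auto simp: mutual_rel_def)
  then have "{w. leads v w \<and> leads w v} \<in> verts G // mutual_rel G" using vv by (simp add: quotientI)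
  moreover have "tail G e \<in> {w. leads v w \<and> leads w v}" "head G e \<in> {w. leads v w \<and> leads w v}"
    using e vv arc_leads_to[OF e(1)] by auto
  ultimately show "is_component G {w. leads v w \<and> leads w v}" using e(1) unfolding is_component_def by blast
qed

text \<open>Components and classes of recurrent vertices are the same thing. A component in the
  closure of X but outside X is such a class that leads to r without being reachable from
  it.\<close>

lemma no_component_above:
  assumes X: "!!v. v \<in> X ==> leads r v \<and> leads v r" "r \<in> X"
    and full: "!!v. recurrent v ==> leads r v ==> leads v r ==> v \<in> X"
  shows "(\<exists>D. is_component G D \<and> D \<subseteq> back_closure G X - X) \<longleftrightarrow>
    \<not> (\<forall>v. recurrent v --> leads v r --> leads r v)" (is "?L = (\<not> ?R)")
proof
  assume ?L
  then obtain D where D: "is_component G D" "D \<subseteq> back_closure G X - X" by blast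
  then obtain e where "tail G e \<in> D" by (auto simp: is_component_def)
  then obtain v where v: "v \<in> D" by blast
  then have "recurrent v" "v \<notin> X" "leads v r"
    using component_recurrent[OF D(1)] D(2) X(1) leads_to_trans unfolding back_closure_def by blast+
  then show "\<not> ?R" using full by blast
next
  assume "\<not> ?R"
  then obtain v where v: "recurrent v" "leads v r" "\<not> leads r v" by blast
  let ?D = "{w. leads v w \<and> leads w v}"
  have "?D \<subseteq> back_closure G X - X"
  proof
    fix w assume w: "w \<in> ?D"
    then have "leads w r" using v leads_to_trans by blast
    moreover have "\<not> leads r w" using w v leads_to_trans by blast
    ultimately show "w \<in> back_closure G X - X" using X leads_to_verts unfolding back_closure_def by blast
  qed
  then show ?L using recurrent_component[OF v(1)] by blast
qed

text \<open>From a sink nothing else is reachable and no arc leaves, so the circularity clause of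
  \<open>terminal\<close> is vacuous.\<close>

lemma S0_iff: "s \<in> S0 G \<longleftrightarrow> is_sink G s \<and> terminal s"
proof (cases "is_sink G s")
  case True
  have s: "s \<in> verts G" using True by (simp add: is_sink_def)
  have only: "v = s" if "leads s v" for v using that sink_leads_to[OF True] by (auto simp: leads_to_def)
  have "(\<exists>D. is_component G D \<and> D \<subseteq> back_closure G {s} - {s}) \<longleftrightarrow>
      \<not> (\<forall>v. recurrent v --> leads v s --> leads s v)"
    by (rule no_component_above) (use s only in auto)
  moreover have "tail G e \<noteq> s" if "e \<in> arcs G" for e using True that by (auto simp: is_sink_def)
  ultimately show ?thesis using True s only unfolding S0_def terminal_def by blast
qed (simp add: S0_def)

lemma closed_walk_in_class:
  assumes "awalk v \<xi> w" "e \<in> set \<xi>"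
  shows "leads v (tail G e)" "leads (tail G e) w"
proof -
  obtain \<xi>1 \<xi>2 where "\<xi> = \<xi>1 @ e # \<xi>2" using split_list[OF assms(2)] by blast
  then obtain y where y: "awalk v \<xi>1 y" "awalk y (e # \<xi>2) w" using assms(1) by (auto simp: awalk_append_iff)
  then have "y = tail G e" by (simp add: awalk_simps)
  then show "leads v (tail G e)" "leads (tail G e) w" using y awalk_leads_to by blast+
qed

text \<open>For a returning arc f at t, the first return to t gives a loop that visits t once. It is
  a rotation of a power of the generating loop, so counting visits shows that the power is 1 and
  that the generating loop has a single arc at t, namely f.\<close>

lemma circular_unique:
  assumes C: "C = {w. leads v w \<and> leads w v}" and circ: "circular G C"
    and e: "e \<in> arcs G" "e' \<in> arcs G" "tail G e = tail G e'" "leads v (tail G e)"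
      "leads (head G e) v" "leads (head G e') v"
  shows "e = e'"
proof -
  let ?t = "tail G e" and ?P = "\<lambda>f. tail G f = tail G e"
  obtain m0 where m: "!!\<nu>. \<nu> \<in> loops_in G C ==> \<exists>k m. \<nu> = rotate k (concat (replicate m m0))"
    using circ by (auto simp: circular_def)
  have "length (filter ?P m0) = 1 \<and> f \<in> set (filter ?P m0)"
    if f: "f \<in> arcs G" "tail G f = ?t" "leads (head G f) v" for f
  proof -
    have "leads (head G f) ?t" using f(3) e(4) leads_to_trans by blast
    then obtain \<alpha> where "awalk (head G f) \<alpha> ?t" by (auto simp: leads_to_def)
    from first_visit[OF this] obtain \<xi> where \<xi>: "awalk (head G f) \<xi> ?t" "\<forall>g\<in>set \<xi>. tail G g \<noteq> ?t" by blast
    have w: "awalk ?t (f # \<xi>) ?t" using \<xi>(1) f by (simp add: awalk_simps)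
    have tv: "leads ?t v" using leads_to_trans[OF arc_leads_to[OF f(1)] f(3)] f(2) by simp
    have "tail G g \<in> C" if "g \<in> set (f # \<xi>)" for g
      unfolding C using closed_walk_in_class[OF w that] tv e(4) leads_to_trans by blast
    then have "f # \<xi> \<in> loops_in G C" using w by (auto simp: loops_in_def)
    then obtain k j where kj: "f # \<xi> = rotate k (concat (replicate j m0))" using m by blast
    have "length (filter ?P (rotate k xs)) = length (filter ?P xs)" for k and xs :: "'b list"
      unfolding rotate_drop_take by (metis add.commute append_take_drop_id filter_append length_append)
    moreover have "length (filter ?P (concat (replicate j xs))) = j * length (filter ?P xs)" for j and xs :: "'b list"
      by (induct j) auto
    moreover have "length (filter ?P (f # \<xi>)) = 1"
      using \<xi>(2) f(2) by (simp add: filter_empty_conv)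
    ultimately have "j * length (filter ?P m0) = 1" using kj by metis
    then have j: "j = 1" "length (filter ?P m0) = 1" by auto
    then have "set (f # \<xi>) = set m0" using kj by simp
    then show ?thesis using j f(2) by auto
  qed
  then have "length (filter ?P m0) = 1" "e \<in> set (filter ?P m0)" "e' \<in> set (filter ?P m0)" using e by auto
  then show ?thesis by (metis One_nat_def length_0_conv length_Suc_conv set_ConsD empty_iff set_empty)
qed

lemma Z0_terminal:
  assumes C: "C \<in> Z0 G" and v: "v \<in> C"
  shows "C = {w. leads v w \<and> leads w v}" "recurrent v" "terminal v"
proof -
  have c: "is_component G C" "circular G C" using C by (auto simp: Z0_def)
  show Cv: "C = {w. leads v w \<and> leads w v}"
    using component_class[OF _ v] c(1) by (simp add: is_component_def)
  show rv: "recurrent v" by (rule component_recurrent[OF c(1) v])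
  have "(\<exists>D. is_component G D \<and> D \<subseteq> back_closure G C - C) \<longleftrightarrow>
      \<not> (\<forall>w. recurrent w --> leads w v --> leads v w)"
    by (rule no_component_above) (use Cv v in auto)
  then have "\<forall>w. recurrent w --> leads w v --> leads v w" using C unfolding Z0_def by blast
  moreover note circular_unique[OF Cv c(2)]
  ultimately show "terminal v" using recurrent_component(2)[OF rv] rv unfolding terminal_def by blast
qed

text \<open>Every loop in the class passes through v. Rotated so as to start there, it is a closed
  walk at the root and hence a power of the simple loop.\<close>

lemma terminal_Z0:
  assumes v: "terminal v" "recurrent v"
  shows "{w. leads v w \<and> leads w v} \<in> Z0 G" (is "?C \<in> _")
proof -
  interpret T: terminal_vertex G v by unfold_locales (rule v(1))
  have vC: "v \<in> ?C" using recurrent_component(2)[OF v(2)] by simp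
  have nd: "\<not> (\<exists>D. is_component G D \<and> D \<subseteq> back_closure G ?C - ?C)"
    by (subst no_component_above[where r = v]) (use v vC in \<open>auto simp: terminal_def\<close>)
  have "\<not> is_sink G v" using v(2) by (auto simp: recurrent_def is_sink_def)
  then have "T.rooted.has_loop" by (simp add: T.has_loop_iff)
  then have l: "awalk v (T.rooted.loop_arc # T.rooted.loop_rest) v" (is "awalk v ?l v")
    using T.rooted.loop_awalk T.awalk_H[OF T.r_X] by simp
  have "?l \<in> loops_in G ?C"
    using l closed_walk_in_class[OF l] unfolding loops_in_def by blast
  moreover have "\<exists>k m. \<nu> = rotate k (concat (replicate m ?l))" if \<nu>: "\<nu> \<in> loops_in G ?C" for \<nu>
  proof -
    obtain x where x: "\<nu> \<noteq> []" "awalk x \<nu> x" "tail G ` set \<nu> \<subseteq> ?C" using \<nu> by (auto simp: loops_in_def)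
    have "x = tail G (hd \<nu>)" using x(1,2) by (cases \<nu>) (auto simp: awalk_simps)
    moreover have "hd \<nu> \<in> set \<nu>" using x(1) by simp
    ultimately have xC: "x \<in> ?C" using x(3) by blast
    then obtain \<alpha> where "awalk x \<alpha> v" by (auto simp: leads_to_def)
    then have "\<exists>e\<in>set \<nu>. tail G e = v" using cycle_through_root[OF v(1) _ _ x(2,1)] xC by blast
    then obtain e where e: "e \<in> set \<nu>" "tail G e = v" by blast
    obtain \<nu>1 \<nu>2 where s: "\<nu> = \<nu>1 @ e # \<nu>2" using split_list[OF e(1)] by blast
    then obtain y where y: "awalk x \<nu>1 y" "awalk y (e # \<nu>2) x" using x(2) by (auto simp: awalk_append_iff)
    have "y = v" using y(2) e(2) by (simp add: awalk_simps)
    then have "awalk v ((e # \<nu>2) @ \<nu>1) v" using awalk_appendI[OF y(2,1)] by simp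
    then obtain k where "(e # \<nu>2) @ \<nu>1 = concat (replicate k ?l)"
      using T.rooted.closed_walk_power T.awalk_H[OF T.r_X] by blast
    then have "\<nu> = rotate (length (e # \<nu>2)) (concat (replicate k ?l))"
      unfolding s using rotate_append[of "e # \<nu>2" \<nu>1] by simp
    then show ?thesis by blast
  qed
  ultimately have "circular G ?C" unfolding circular_def by blast
  then show ?thesis using recurrent_component(1)[OF v(2)] nd by (simp add: Z0_def)
qed

section \<open>Decomposition over the terminal vertices\<close>

text \<open>One vertex per terminal class as index in place of the two families \<open>S0\<close>
  and \<open>Z0\<close>, so that existence and uniqueness are proved once.\<close>

definition trace_sum :: "'a set => (('a, 'b) graph_elem => complex) => ('a => real) =>
    ('a => ('a, 'b) graph_elem => complex) => bool" where
  "trace_sum R \<omega> \<alpha> \<sigma> \<longleftrightarrow>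
     (\<forall>r\<in>R. \<alpha> r \<in> {0..1} \<and> trace_state (graph_cstar (closure_graph G {r})) (\<sigma> r)) \<and> (\<Sum>r\<in>R. \<alpha> r) = 1 \<and>
     (\<forall>a\<in>carrier Cstar. \<omega> a = (\<Sum>r\<in>R. of_real (\<alpha> r) * \<sigma> r (pi_hom G {r} a)))"

lemma trace_sum_exists_unique:
  assumes R: "!!r. r \<in> R ==> terminal r" "!!v. terminal v ==> \<exists>r\<in>R. leads v r \<and> leads r v"
    "!!r r'. r \<in> R ==> r' \<in> R ==> leads r r' ==> r = r'"
    and \<omega>: "trace_state Cstar \<omega>"
  shows "\<exists>\<alpha> \<sigma>. trace_sum R \<omega> \<alpha> \<sigma> \<and> (\<forall>\<alpha>' \<sigma>'. trace_sum R \<omega> \<alpha>' \<sigma>' -->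
    (\<forall>r\<in>R. \<alpha>' r = \<alpha> r \<and> (\<alpha> r \<noteq> 0 --> (\<forall>a\<in>carrier (graph_cstar (closure_graph G {r})). \<sigma>' r a = \<sigma> r a))))"
proof -
  interpret C: graph_algebra G "Cstar" graph.unorm "P_elem G" "S_elem G"
    by (rule graph_algebra_graph_cstar)
  have tv: "terminal_vertex G r" if "r \<in> R" for r by unfold_locales (rule R(1)[OF that])
  have finR: "finite R" by (rule finite_subset[of _ "verts G"]) (use R(1) in \<open>auto simp: terminal_def\<close>)
  have t: "C.tracial_functional \<omega>" "\<omega> \<one>\<^bsub>Cstar\<^esub> = 1" using \<omega> by (simp_all add: C.trace_state_iff)
  define n where "n r = card (rooted_digraph.I (closure_graph G {r}) r)" for r
  have n: "n r > 0" if "r \<in> R" for r unfolding n_def by (rule terminal_vertex.n_pos[OF tv[OF that]])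
  have rv: "r \<in> verts G" if "r \<in> R" for r using R(1)[OF that] by (simp add: terminal_def)
  define \<alpha> where "\<alpha> r = real (n r) * C.mass \<omega> r" for r
  have \<alpha>0: "0 \<le> \<alpha> r" if "r \<in> R" for r using C.tf_P(2)[OF t(1) rv[OF that]] by (simp add: \<alpha>_def)
  have "\<forall>r\<in>R. \<exists>\<sigma>. trace_state (graph_cstar (closure_graph G {r})) \<sigma> \<and> (\<forall>\<kappa>. awalk r \<kappa> r -->
      \<omega> (C.path_elem r \<kappa>) = \<omega> (P_elem G r) * of_nat (n r) * \<sigma> (pi_hom G {r} (C.path_elem r \<kappa>)))"
    unfolding n_def using terminal_vertex.trace_with_moments[OF tv t(1)] by blast
  from bchoice[OF this] obtain \<sigma> where \<sigma>: "!!r. r \<in> R ==> trace_state (graph_cstar (closure_graph G {r})) (\<sigma> r)"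
    "!!r \<kappa>. r \<in> R ==> awalk r \<kappa> r ==>
      \<omega> (C.path_elem r \<kappa>) = \<omega> (P_elem G r) * of_nat (n r) * \<sigma> r (pi_hom G {r} (C.path_elem r \<kappa>))"
    by blast
  \<comment> \<open>For q other than r the vertex r does not lead to q, so the quotient belonging to
    q kills every path ending at r.\<close>
  have pick: "(\<Sum>q\<in>R. of_real (\<beta> q) * \<rho> q (pi_hom G {q} (C.path_elem r \<kappa>))) =
      of_real (\<beta> r) * \<rho> r (pi_hom G {r} (C.path_elem r \<kappa>))"
    if r: "r \<in> R" and \<kappa>: "awalk r \<kappa> r" and \<rho>: "!!q. q \<in> R ==> trace_state (graph_cstar (closure_graph G {q})) (\<rho> q)"
    for r \<kappa> and \<beta> :: "'a => real" and \<rho>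
  proof -
    have "\<rho> q (pi_hom G {q} (C.path_elem r \<kappa>)) = 0" if q: "q \<in> R" "q \<noteq> r" for q
    proof -
      interpret T: terminal_vertex G q by (rule tv[OF q(1)])
      have "r \<notin> T.X" using R(3)[OF r q(1)] q(2) T.X_iff by auto
      then have "pi_hom G {q} (C.path_elem r \<kappa>) = \<zero>\<^bsub>graph_cstar T.H\<^esub>" using T.quot_path[OF \<kappa>] by simp
      then show ?thesis
        using T.rooted.alg.pf_zero[OF T.rooted.alg.tracial_positive] \<rho>[OF q(1)] by (simp add: T.rooted.alg.trace_state_iff)
    qed
    then show ?thesis using finR r by (subst sum.remove[OF finR r]) simp
  qed
  let ?\<tau> = "\<lambda>a. \<Sum>r\<in>R. of_real (\<alpha> r) * \<sigma> r (pi_hom G {r} a)"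
  have t\<tau>: "C.tracial_functional ?\<tau>"
    by (rule C.tracial_functional_sum[OF finR \<alpha>0 terminal_vertex.trace_pullback[OF tv \<sigma>(1)]])
  have dec: "\<omega> a = ?\<tau> a" if a: "a \<in> carrier Cstar" for a
  proof (rule C.tracial_functional_eqI[OF t(1) t\<tau> R(1,2) _ a])
    fix r \<kappa> assume r: "r \<in> R" and \<kappa>: "awalk r \<kappa> r"
    show "\<omega> (C.path_elem r \<kappa>) = ?\<tau> (C.path_elem r \<kappa>)"
      by (rule trans[OF _ pick[OF r \<kappa> \<sigma>(1), symmetric]])
        (use \<sigma>(2)[OF r \<kappa>] C.tf_P(1)[OF t(1) rv[OF r]] in \<open>simp_all add: \<alpha>_def mult_ac\<close>)
  qed
  have "?\<tau> \<one>\<^bsub>Cstar\<^esub> = (\<Sum>r\<in>R. of_real (\<alpha> r))"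
    using \<sigma>(1) by (intro sum.cong) (auto simp: terminal_vertex.quot_one[OF tv] trace_state_def)
  then have "of_real (\<Sum>r\<in>R. \<alpha> r) = (1 :: complex)" using dec[OF C.one_closed] t(2) by simp
  then have \<alpha>1: "(\<Sum>r\<in>R. \<alpha> r) = 1" by (simp only: of_real_eq_1_iff)
  have "\<alpha> r \<le> 1" if "r \<in> R" for r
    using member_le_sum[OF that _ finR, of \<alpha>] \<alpha>0 \<alpha>1 by auto
  then have "trace_sum R \<omega> \<alpha> \<sigma>" unfolding trace_sum_def using \<alpha>0 \<alpha>1 \<sigma>(1) dec by auto
  \<comment> \<open>The value at the vertex projection of r gives the weight, as every trace state
    takes the value 1 / n there. The closed walks at r then give the trace state, provided the
    weight can be cancelled.\<close>
  moreover have "\<alpha>' r = \<alpha> r \<and> (\<alpha> r \<noteq> 0 --> (\<forall>a\<in>carrier (graph_cstar (closure_graph G {r})). \<sigma>' r a = \<sigma> r a))"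
    if d: "trace_sum R \<omega> \<alpha>' \<sigma>'" and r: "r \<in> R" for \<alpha>' \<sigma>' r
  proof -
    interpret T: terminal_vertex G r by (rule tv[OF r])
    have \<sigma>': "trace_state (graph_cstar (closure_graph G {q})) (\<sigma>' q)" if "q \<in> R" for q
      using d that by (simp add: trace_sum_def)
    have k: "\<omega> (C.path_elem r \<kappa>) = of_real (\<alpha>' r) * \<sigma>' r (T.quot (C.path_elem r \<kappa>))" if \<kappa>: "awalk r \<kappa> r" for \<kappa>
      using d C.path_elem_closed[OF \<kappa>] pick[OF r \<kappa> \<sigma>', of \<alpha>'] by (simp add: trace_sum_def)
    have "\<omega> (P_elem G r) = of_real (\<alpha>' r) / of_nat (n r)"
      using k[of "[]"] rv[OF r] T.trace_root[OF \<sigma>'[OF r]] T.quot_P[OF rv[OF r]] by (simp add: awalk_simps n_def)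
    then have "(of_real (C.mass \<omega> r * real (n r)) :: complex) = of_real (\<alpha>' r)"
      using C.tf_P(1)[OF t(1) rv[OF r]] n[OF r] by (simp add: field_simps)
    then have \<alpha>': "\<alpha>' r = \<alpha> r" unfolding of_real_eq_iff by (simp add: \<alpha>_def mult.commute)
    moreover have "\<sigma>' r a = \<sigma> r a" if "\<alpha> r \<noteq> 0" "a \<in> carrier (graph_cstar (closure_graph G {r}))" for a
    proof (rule T.trace_eqI[OF \<sigma>'[OF r] \<sigma>(1)[OF r] _ that(2)])
      fix \<kappa> assume \<kappa>: "awalk r \<kappa> r"
      have "of_real (\<alpha> r) * \<sigma>' r (T.quot (C.path_elem r \<kappa>)) = of_real (\<alpha> r) * \<sigma> r (T.quot (C.path_elem r \<kappa>))"
        using k[OF \<kappa>] dec[OF C.path_elem_closed[OF \<kappa>]] pick[OF r \<kappa> \<sigma>(1), of \<alpha>] \<alpha>' by auto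
      then show "\<sigma>' r (T.rooted.alg.path_elem r \<kappa>) = \<sigma> r (T.rooted.alg.path_elem r \<kappa>)"
        using that(1) T.quot_closed_walk[OF \<kappa>] by simp
    qed
    ultimately show ?thesis by blast
  qed
  ultimately show ?thesis by blast
qed

end

text \<open>A trace state with weight 0 does not influence \<omega>; uniqueness of the trace states
  is therefore stated for nonzero weights, and that of the weights without restriction.\<close>

theorem theorem5p3:
  fixes G :: "('v, 'e) pre_digraph"
  assumes "fin_digraph G"
  shows "(\<forall>s\<in>S0 G.
            star_isomorphic (graph_cstar (closure_graph G {s}))
              (matrix_algebra (n_sink G s) complex_algebra)) \<and>
         (\<forall>C\<in>Z0 G. \<forall>vC\<in>C.
            star_isomorphic (graph_cstar (closure_graph G C))
              (matrix_algebra (n_component G vC) circle_algebra)) \<and>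
         (\<forall>\<omega>. trace_state (graph_cstar G) \<omega> \<longrightarrow>
            (\<exists>\<alpha>S \<alpha>C \<omega>S \<omega>C. trace_decomposition G \<omega> \<alpha>S \<alpha>C \<omega>S \<omega>C \<and>
               (\<forall>\<alpha>S' \<alpha>C' \<omega>S' \<omega>C'. trace_decomposition G \<omega> \<alpha>S' \<alpha>C' \<omega>S' \<omega>C' \<longrightarrow>
                  (\<forall>s\<in>S0 G. \<alpha>S' s = \<alpha>S s \<and>
                     (\<alpha>S s \<noteq> 0 \<longrightarrow>
                        (\<forall>a\<in>carrier (graph_cstar (closure_graph G {s})). \<omega>S' s a = \<omega>S s a))) \<and>
                  (\<forall>C\<in>Z0 G. \<alpha>C' C = \<alpha>C C \<and>
                     (\<alpha>C C \<noteq> 0 \<longrightarrow>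
                        (\<forall>a\<in>carrier (graph_cstar (closure_graph G C)). \<omega>C' C a = \<omega>C C a))))))"
proof -
  interpret fin_digraph G by (rule assms)
  have sinkZ: "\<not> is_sink G v" if "C \<in> Z0 G" "v \<in> C" for C v
    using Z0_terminal(2)[OF that] by (auto simp: recurrent_def is_sink_def)
  \<comment> \<open>All of C leads to v, so the closure may be formed from any vertex of the
    component.\<close>
  have bc: "back_closure G C = back_closure G {v}" if C: "C \<in> Z0 G" "v \<in> C" for C v
  proof -
    have "leads w v" if "w \<in> C" for w using Z0_terminal(1)[OF C] that by blast
    then show ?thesis using C(2) leads_to_trans unfolding back_closure_def by blast
  qed
  have 1: "star_isomorphic (graph_cstar (closure_graph G {s})) (matrix_algebra (n_sink G s) complex_algebra)"
    if s: "s \<in> S0 G" for s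
  proof -
    interpret T: terminal_vertex G s by unfold_locales (use s S0_iff in blast)
    have "is_sink G s" using s S0_iff by blast
    then show ?thesis using T.rooted.iso_matrix T.has_loop_iff T.n_eq(1) by simp
  qed
  have 2: "star_isomorphic (graph_cstar (closure_graph G C)) (matrix_algebra (n_component G v) circle_algebra)"
    if C: "C \<in> Z0 G" "v \<in> C" for C v
  proof -
    interpret T: terminal_vertex G v by unfold_locales (rule Z0_terminal(3)[OF C])
    show ?thesis using T.rooted.iso_matrix_circle T.has_loop_iff T.n_eq(2) sinkZ[OF C] bc[OF C] by simp
  qed
  define rep where "rep C = (SOME v. v \<in> C)" for C :: "'v set"
  define cls where "cls v = {w. leads v w \<and> leads w v}" for v
  have rep: "rep C \<in> C" if "C \<in> Z0 G" for C
    unfolding rep_def by (rule someI_ex[of "\<lambda>v. v \<in> C"]) (use that in \<open>auto simp: Z0_def is_component_def\<close>)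
  have cls: "cls v = C" if "C \<in> Z0 G" "v \<in> C" for C v
    using Z0_terminal(1)[OF that] by (simp add: cls_def)
  have repS: "rep C \<notin> S0 G" if "C \<in> Z0 G" for C using sinkZ[OF that rep[OF that]] S0_iff by blast
  define R where "R = S0 G \<union> rep ` Z0 G"
  have R1: "terminal r" if "r \<in> R" for r
    using that S0_iff Z0_terminal(3)[OF _ rep] by (auto simp: R_def)
  have R2: "\<exists>r\<in>R. leads v r \<and> leads r v" if v: "terminal v" for v
  proof (cases "is_sink G v")
    case True
    then have "v \<in> R" using v S0_iff by (simp add: R_def)
    moreover have "v \<in> verts G" using v by (simp add: terminal_def)
    ultimately show ?thesis using leads_to_refl by blast
  next
    case False
    then have "cls v \<in> Z0 G" using terminal_Z0[OF v] v by (simp add: cls_def terminal_def)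
    then have "rep (cls v) \<in> R" "rep (cls v) \<in> cls v" using rep by (auto simp: R_def)
    then show ?thesis by (auto simp: cls_def)
  qed
  \<comment> \<open>Terminal vertices that lead to each other share a class, and each class
    contributes one vertex. From a sink only the sink itself is reachable.\<close>
  have R3: "r = r'" if r: "r \<in> R" "r' \<in> R" "leads r r'" for r r'
  proof (cases "r \<in> S0 G")
    case True
    then show ?thesis using sink_leads_to[of r _ r'] r(3) S0_iff by (auto simp: leads_to_def)
  next
    case False
    then obtain C where C: "C \<in> Z0 G" "r = rep C" using r(1) by (auto simp: R_def)
    have "recurrent r" using Z0_terminal(2)[OF C(1) rep[OF C(1)]] C(2) by simp
    then have r'r: "leads r' r" using R1[OF r(2)] r(3) unfolding terminal_def by blast
    have "r' \<in> C" using cls[OF C(1) rep[OF C(1)]] r(3) r'r C(2) by (auto simp: cls_def)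
    then have "r' \<notin> S0 G" using sinkZ[OF C(1)] S0_iff by blast
    then obtain C' where C': "C' \<in> Z0 G" "r' = rep C'" using r(2) by (auto simp: R_def)
    have "C' = C" using cls[OF C(1) \<open>r' \<in> C\<close>] cls[OF C'(1) rep[OF C'(1)]] C'(2) by simp
    then show ?thesis using C(2) C'(2) by simp
  qed
  have finR: "finite R" by (rule finite_subset[of _ "verts G"]) (use R1 in \<open>auto simp: terminal_def\<close>)
  have inj: "inj_on rep (Z0 G)" by (rule inj_onI) (metis cls rep)
  have sumR: "(\<Sum>r\<in>R. f r) = (\<Sum>s\<in>S0 G. f s) + (\<Sum>C\<in>Z0 G. f (rep C))" for f :: "'v => 'x::comm_monoid_add"
    unfolding R_def using finR repS
    by (subst sum.union_disjoint) (auto simp: R_def sum.reindex[OF inj])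
  \<comment> \<open>Both kinds of decomposition carry the same data: the summand at
    \<open>rep C\<close> stands for C because the two closures coincide.\<close>
  have conv: "trace_decomposition G \<omega> \<alpha>S \<alpha>C \<omega>S \<omega>C \<longleftrightarrow> trace_sum R \<omega> \<alpha> \<sigma>"
    if S: "!!s. s \<in> S0 G ==> \<alpha> s = \<alpha>S s" "!!s. s \<in> S0 G ==> \<sigma> s = \<omega>S s"
      and C: "!!C. C \<in> Z0 G ==> \<alpha> (rep C) = \<alpha>C C" "!!C. C \<in> Z0 G ==> \<sigma> (rep C) = \<omega>C C"
    for \<omega> \<alpha>S \<alpha>C \<omega>S \<omega>C \<alpha> \<sigma>
  proof -
    have b: "back_closure G {rep C} = back_closure G C" if "C \<in> Z0 G" for C using bc[OF that rep[OF that]] by simp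
    have all: "(\<forall>r\<in>R. Q r) \<longleftrightarrow> (\<forall>s\<in>S0 G. Q s) \<and> (\<forall>C\<in>Z0 G. Q (rep C))" for Q by (auto simp: R_def)
    show ?thesis unfolding trace_decomposition_def trace_sum_def sumR all
      using S C b by (simp cong: sum.cong)
  qed
  have 3: "\<exists>\<alpha>S \<alpha>C \<omega>S \<omega>C. trace_decomposition G \<omega> \<alpha>S \<alpha>C \<omega>S \<omega>C \<and>
      (\<forall>\<alpha>S' \<alpha>C' \<omega>S' \<omega>C'. trace_decomposition G \<omega> \<alpha>S' \<alpha>C' \<omega>S' \<omega>C' -->
        (\<forall>s\<in>S0 G. \<alpha>S' s = \<alpha>S s \<and>
           (\<alpha>S s \<noteq> 0 --> (\<forall>a\<in>carrier (graph_cstar (closure_graph G {s})). \<omega>S' s a = \<omega>S s a))) \<and>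
        (\<forall>C\<in>Z0 G. \<alpha>C' C = \<alpha>C C \<and>
           (\<alpha>C C \<noteq> 0 --> (\<forall>a\<in>carrier (graph_cstar (closure_graph G C)). \<omega>C' C a = \<omega>C C a))))"
    if \<omega>: "trace_state (graph_cstar G) \<omega>" for \<omega>
  proof -
    from trace_sum_exists_unique[OF R1 R2 R3 \<omega>] obtain \<alpha> \<sigma> where d: "trace_sum R \<omega> \<alpha> \<sigma>"
      and u: "!!\<alpha>' \<sigma>' r. trace_sum R \<omega> \<alpha>' \<sigma>' ==> r \<in> R ==> \<alpha>' r = \<alpha> r \<and>
        (\<alpha> r \<noteq> 0 --> (\<forall>a\<in>carrier (graph_cstar (closure_graph G {r})). \<sigma>' r a = \<sigma> r a))"
      by blast
    show ?thesis
    proof (rule exI[of _ \<alpha>], rule exI[of _ "\<lambda>C. \<alpha> (rep C)"], rule exI[of _ \<sigma>], rule exI[of _ "\<lambda>C. \<sigma> (rep C)"],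
        intro conjI allI impI)
      show "trace_decomposition G \<omega> \<alpha> (\<lambda>C. \<alpha> (rep C)) \<sigma> (\<lambda>C. \<sigma> (rep C))"
        by (rule conv[THEN iffD2, OF _ _ _ _ d]) simp_all
      fix \<alpha>S' \<alpha>C' \<omega>S' \<omega>C' assume d': "trace_decomposition G \<omega> \<alpha>S' \<alpha>C' \<omega>S' \<omega>C'"
      \<comment> \<open>No vertex of a component in \<open>Z0\<close> is a sink, so the two families
        do not collide, and \<open>cls\<close> recovers the component from its
        representative.\<close>
      define \<alpha>' \<sigma>' where "\<alpha>' v = (if v \<in> S0 G then \<alpha>S' v else \<alpha>C' (cls v))"
        and "\<sigma>' v = (if v \<in> S0 G then \<omega>S' v else \<omega>C' (cls v))" for v
      have e: "\<alpha>' (rep C) = \<alpha>C' C" "\<sigma>' (rep C) = \<omega>C' C" if "C \<in> Z0 G" for C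
        using repS[OF that] cls[OF that rep[OF that]] by (simp_all add: \<alpha>'_def \<sigma>'_def)
      have "trace_sum R \<omega> \<alpha>' \<sigma>'"
        by (rule conv[THEN iffD1, OF _ _ _ _ d']) (simp_all add: e, simp_all add: \<alpha>'_def \<sigma>'_def)
      note u' = u[OF this]
      show "\<forall>s\<in>S0 G. \<alpha>S' s = \<alpha> s \<and>
          (\<alpha> s \<noteq> 0 --> (\<forall>a\<in>carrier (graph_cstar (closure_graph G {s})). \<omega>S' s a = \<sigma> s a))"
      proof
        fix s assume "s \<in> S0 G"
        then show "\<alpha>S' s = \<alpha> s \<and>
          (\<alpha> s \<noteq> 0 --> (\<forall>a\<in>carrier (graph_cstar (closure_graph G {s})). \<omega>S' s a = \<sigma> s a))"
          using u'[of s] by (simp add: \<alpha>'_def \<sigma>'_def R_def)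
      qed
      show "\<forall>C\<in>Z0 G. \<alpha>C' C = \<alpha> (rep C) \<and>
          (\<alpha> (rep C) \<noteq> 0 --> (\<forall>a\<in>carrier (graph_cstar (closure_graph G C)). \<omega>C' C a = \<sigma> (rep C) a))"
      proof
        fix C assume C: "C \<in> Z0 G"
        then show "\<alpha>C' C = \<alpha> (rep C) \<and>
          (\<alpha> (rep C) \<noteq> 0 --> (\<forall>a\<in>carrier (graph_cstar (closure_graph G C)). \<omega>C' C a = \<sigma> (rep C) a))"
          using u'[of "rep C"] e[OF C] bc[OF C rep[OF C]] by (simp add: R_def)
      qed
    qed
  qed
  show ?thesis using 1 2 3 by blast
qed

end
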